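(* Let $n\ge1$, $0<q\le\infty$, $s\in\mathbb{R}$, and let $\Phi\in L^1_{loc}(\mathbb{R}^n\setminus\{0\})$. If $0<p<1$, then for each of the spaces $X=F^{p,q}_s$, $X=B^{p,q}_s$, $X=M^{p,q}_s$ on $\mathbb{R}^n$, $$H_\Phi \text{ is bounded on } X \iff H_\Phi=0.$$
   Context: Functions are complex-valued. $L^1_{loc}(\mathbb{R}^n\setminus\{0\})$ is the set of measurable functions integrable on every compact subset of $\mathbb{R}^n\setminus\{0\}$. The Hausdorff operator is $$H_\Phi f(x)=\int_{\mathbb{R}^n}\Phi(y)\,f\!\left(\frac{x}{|y|}\right)dy ;$$ for $f\in C_c^\infty(\mathbb{R}^n\setminus\{0\})$ (smooth, with compact support not containing the origin) the integral converges absolutely for every $x$ and defines a measurable function. "$H_\Phi$ is bounded on $X$" means: there is a constant $C$ such that for every $f\in C_c^\infty(\mathbb{R}^n\setminus\{0\})$, $H_\Phi f$ is a locally integrable function on $\mathbb{R}^n$ defining a tempered distribution that belongs to $X$, and $\|H_\Phi f\|_X\le C\|f\|_X$. "$H_\Phi=0$" means $H_\Phi f=0$ for every $f\in C_c^\infty(\mathbb{R}^n\setminus\{0\})$. Fourier transform: $\mathscr{F}f(\xi)=\int f(x)e^{-2\pi i x\cdot\xi}dx$, extended to the tempered distributions $\mathscr{S}'$. Besov and Triebel–Lizorkin spaces: let $\varphi$ be a smooth bump function supported in $\{|\xi|<3/2\}$ and equal to $1$ on $\{|\xi|\le 4/3\}$, $\phi(\xi)=\varphi(\xi)-\varphi(2\xi)$,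 $\phi_j(\xi)=\phi(2^{-j}\xi)$ for $j\ge1$, $\phi_0=\varphi$, and $\Delta_j=\mathscr{F}^{-1}\phi_j\mathscr{F}$. Then $B^{p,q}_s$ and $F^{p,q}_s$ consist of all $f\in\mathscr{S}'$ with, respectively, $$\|f\|_{B^{p,q}_s}=\Big(\sum_{j\ge0}2^{jsq}\|\Delta_jf\|_{L^p}^q\Big)^{1/q}<\infty,\qquad \|f\|_{F^{p,q}_s}=\Big\|\Big(\sum_{j\ge0}2^{jsq}|\Delta_jf|^q\Big)^{1/q}\Big\|_{L^p}<\infty,$$ with the usual modifications if $q=\infty$. Modulation spaces: let $\eta:\mathbb{R}^n\to[0,1]$ be smooth with $\eta(\xi)=1$ for $|\xi|_\infty\le 1/2$ and $\eta(\xi)=0$ for $|\xi|_\infty\ge 3/4$, where $|\xi|_\infty=\max_i|\xi_i|$; let $\sigma_k(\xi)=\eta(\xi-k)\big(\sum_{l\in\mathbb{Z}^n}\eta(\xi-l)\big)^{-1}$ and $\Box_k=\mathscr{F}^{-1}\sigma_k\mathscr{F}$ for $k\in\mathbb{Z}^n$. With $\langle k\rangle=(1+|k|^2)^{1/2}$, $M^{p,q}_s$ consists of all $f\in\mathscr{S}'$ with $$\|f\|_{M^{p,q}_s}=\Big(\sum_{k\in\mathbb{Z}^n}\langle k\rangle^{sq}\|\Box_kf\|_{L^p}^q\Big)^{1/q}<\infty$$ (usual modification if $q=\infty$). Different choices of the cutoff functions give equivalent quasi-norms. *)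

theory Defs
  imports "HOL-Analysis.Analysis"
begin

section \<open>Smooth functions, test functions and Schwartz functions\<close>

(* iter_deriv [v1, ..., vm] f is the iterated directional derivative along v1, ..., vm;
   with the v's ranging over Basis these are exactly the partial derivatives of f. *)
primrec iter_deriv ::
    "'a list \<Rightarrow> ('a::euclidean_space \<Rightarrow> 'b::real_normed_vector) \<Rightarrow> 'a \<Rightarrow> 'b" where
  "iter_deriv [] f = f"
| "iter_deriv (v # vs) f = (\<lambda>x. frechet_derivative (iter_deriv vs f) (at x) v)"

(* Total differentiability of every iterated partial derivative gives their continuity, so this is
   the usual C-infinity condition.  It also ensures that frechet_derivative above is never applied
   at a point of non-differentiability. *)
definition smooth :: "('a::euclidean_space \<Rightarrow> 'b::real_normed_vector) \<Rightarrow> bool" where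
  "smooth f \<longleftrightarrow>
     (\<forall>vs. set vs \<subseteq> Basis \<longrightarrow> (\<forall>x. iter_deriv vs f differentiable (at x)))"

definition test_function :: "'a set \<Rightarrow> ('a::euclidean_space \<Rightarrow> complex) \<Rightarrow> bool" where
  "test_function S f \<longleftrightarrow>
     smooth f \<and> compact (closure {x. f x \<noteq> 0}) \<and> closure {x. f x \<noteq> 0} \<subseteq> S"

definition schwartz :: "('a::euclidean_space \<Rightarrow> complex) \<Rightarrow> bool" where
  "schwartz \<psi> \<longleftrightarrow> smooth \<psi> \<and>
     (\<forall>N::nat. \<forall>vs. set vs \<subseteq> Basis \<longrightarrow>
        bounded (range (\<lambda>x. (1 + norm x) ^ N *\<^sub>R iter_deriv vs \<psi> x)))"

definition schwartz_null_sequence :: "(nat \<Rightarrow> 'a::euclidean_space \<Rightarrow> complex) \<Rightarrow> bool" where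
  "schwartz_null_sequence \<psi> \<longleftrightarrow> (\<forall>m. schwartz (\<psi> m)) \<and>
     (\<forall>N::nat. \<forall>vs. set vs \<subseteq> Basis \<longrightarrow>
        uniform_limit UNIV (\<lambda>m x. (1 + norm x) ^ N *\<^sub>R iter_deriv vs (\<psi> m) x) (\<lambda>_. 0)
          sequentially)"

section \<open>Tempered distributions\<close>

(* Distributions are functionals on all functions, of which only the values at Schwartz functions
   matter.  The Schwartz space is metrizable, so sequential continuity at 0 is continuity. *)
type_synonym 'a functional = "('a \<Rightarrow> complex) \<Rightarrow> complex"

definition tempered_distribution :: "'a::euclidean_space functional \<Rightarrow> bool" where
  "tempered_distribution T \<longleftrightarrow>
     (\<forall>\<psi> \<psi>'. schwartz \<psi> \<longrightarrow> schwartz \<psi>' \<longrightarrow> T (\<lambda>x. \<psi> x + \<psi>' x) = T \<psi> + T \<psi>') \<and>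
     (\<forall>c \<psi>. schwartz \<psi> \<longrightarrow> T (\<lambda>x. c * \<psi> x) = c * T \<psi>) \<and>
     (\<forall>\<psi>. schwartz_null_sequence \<psi> \<longrightarrow> (\<lambda>m. T (\<psi> m)) \<longlonglongrightarrow> 0)"

definition locally_integrable ::
    "'a set \<Rightarrow> ('a::euclidean_space \<Rightarrow> complex) \<Rightarrow> bool" where
  "locally_integrable S f \<longleftrightarrow> f \<in> borel_measurable (lebesgue_on S) \<and>
     (\<forall>K. compact K \<longrightarrow> K \<subseteq> S \<longrightarrow> f absolutely_integrable_on K)"

definition distribution_of :: "('a::euclidean_space \<Rightarrow> complex) \<Rightarrow> 'a functional" where
  "distribution_of g = (\<lambda>\<psi>. LINT x|lebesgue. g x * \<psi> x)"

(* The pairing is only tested on compactly supported functions: for a locally integrable g that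
   defines a tempered distribution, the integral of g times a Schwartz function need not converge
   absolutely.  Test functions being dense in the Schwartz space, a tempered T is determined on
   Schwartz functions by g, and g is determined almost everywhere by T. *)
definition represents ::
    "('a::euclidean_space \<Rightarrow> complex) \<Rightarrow> 'a functional \<Rightarrow> bool" where
  "represents g T \<longleftrightarrow> locally_integrable UNIV g \<and>
     (\<forall>\<psi>. test_function UNIV \<psi> \<longrightarrow> T \<psi> = distribution_of g \<psi>)"

(* The pointwise modulus of a distribution given by a function (unique up to a null set); by
   convention it is infinite for distributions that are not functions, so that the L^p quasi-norm
   of such a distribution is infinite. *)
definition distribution_modulus :: "'a::euclidean_space functional \<Rightarrow> 'a \<Rightarrow> ennreal" where
  "distribution_modulus T x =
     (if \<exists>g. represents g T then ennreal (cmod ((SOME g. represents g T) x)) else \<infinity>)"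

section \<open>Fourier transform and Fourier multipliers\<close>

definition fourier :: "('a::euclidean_space \<Rightarrow> complex) \<Rightarrow> 'a \<Rightarrow> complex" where
  "fourier f \<xi> = (LINT x|lebesgue. f x * exp (- 2 * pi * \<i> * of_real (x \<bullet> \<xi>)))"

definition inv_fourier :: "('a::euclidean_space \<Rightarrow> complex) \<Rightarrow> 'a \<Rightarrow> complex" where
  "inv_fourier f x = (LINT \<xi>|lebesgue. f \<xi> * exp (2 * pi * \<i> * of_real (x \<bullet> \<xi>)))"

definition fourier_dist :: "'a::euclidean_space functional \<Rightarrow> 'a functional" where
  "fourier_dist T = (\<lambda>\<psi>. T (fourier \<psi>))"

definition inv_fourier_dist :: "'a::euclidean_space functional \<Rightarrow> 'a functional" where
  "inv_fourier_dist T = (\<lambda>\<psi>. T (inv_fourier \<psi>))"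

definition mult_dist :: "('a \<Rightarrow> complex) \<Rightarrow> 'a functional \<Rightarrow> 'a functional" where
  "mult_dist m T = (\<lambda>\<psi>. T (\<lambda>\<xi>. m \<xi> * \<psi> \<xi>))"

definition fourier_multiplier ::
    "('a::euclidean_space \<Rightarrow> complex) \<Rightarrow> 'a functional \<Rightarrow> 'a functional" where
  "fourier_multiplier m T = inv_fourier_dist (mult_dist m (fourier_dist T))"

section \<open>Quasi-norms\<close>

(* Only used for exponents r > 0. *)
definition enn_powr :: "ennreal \<Rightarrow> real \<Rightarrow> ennreal" where
  "enn_powr x r = (if x = \<infinity> then \<infinity> else ennreal (enn2real x powr r))"

definition Lp_norm :: "real \<Rightarrow> ('a::euclidean_space \<Rightarrow> ennreal) \<Rightarrow> ennreal" where
  "Lp_norm p h = enn_powr (\<integral>\<^sup>+ x. enn_powr (h x) p \<partial>lebesgue) (1 / p)"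

definition lq_norm :: "ennreal \<Rightarrow> ('i \<Rightarrow> ennreal) \<Rightarrow> ennreal" where
  "lq_norm q a =
     (if q = \<infinity> then (SUP i. a i)
      else enn_powr (\<integral>\<^sup>+ i. enn_powr (a i) (enn2real q) \<partial>count_space UNIV) (1 / enn2real q))"

definition qspace :: "('a::euclidean_space functional \<Rightarrow> ennreal) \<Rightarrow> 'a functional set" where
  "qspace N = {T. tempered_distribution T \<and> N T < \<infinity>}"

subsection \<open>Besov and Triebel--Lizorkin spaces\<close>

definition dyadic_bump :: "('a::euclidean_space \<Rightarrow> complex) \<Rightarrow> bool" where
  "dyadic_bump \<phi> \<longleftrightarrow> smooth \<phi> \<and> closure {\<xi>. \<phi> \<xi> \<noteq> 0} \<subseteq> {\<xi>. norm \<xi> < 3/2} \<and>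
     (\<forall>\<xi>. norm \<xi> \<le> 4/3 \<longrightarrow> \<phi> \<xi> = 1)"

definition dyadic_symbol :: "('a::euclidean_space \<Rightarrow> complex) \<Rightarrow> nat \<Rightarrow> 'a \<Rightarrow> complex" where
  "dyadic_symbol \<phi> j \<xi> =
     (if j = 0 then \<phi> \<xi>
      else \<phi> (2 powr (- real j) *\<^sub>R \<xi>) - \<phi> (2 *\<^sub>R (2 powr (- real j) *\<^sub>R \<xi>)))"

definition dyadic_block ::
    "('a::euclidean_space \<Rightarrow> complex) \<Rightarrow> nat \<Rightarrow> 'a functional \<Rightarrow> 'a functional" where
  "dyadic_block \<phi> j = fourier_multiplier (dyadic_symbol \<phi> j)"

(* The weight is inside the l^q quasi-norm, (2^(js) a_j)^q = 2^(jsq) a_j^q, which covers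
   q = \<infinity> as well. *)
definition besov_norm ::
    "('a::euclidean_space \<Rightarrow> complex) \<Rightarrow> real \<Rightarrow> ennreal \<Rightarrow> real \<Rightarrow> 'a functional \<Rightarrow> ennreal"
  where "besov_norm \<phi> p q s T =
     lq_norm q (\<lambda>j. ennreal (2 powr (real j * s)) *
       Lp_norm p (distribution_modulus (dyadic_block \<phi> j T)))"

definition triebel_lizorkin_norm ::
    "('a::euclidean_space \<Rightarrow> complex) \<Rightarrow> real \<Rightarrow> ennreal \<Rightarrow> real \<Rightarrow> 'a functional \<Rightarrow> ennreal"
  where "triebel_lizorkin_norm \<phi> p q s T =
     Lp_norm p (\<lambda>x. lq_norm q (\<lambda>j. ennreal (2 powr (real j * s)) *
       distribution_modulus (dyadic_block \<phi> j T) x))"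

subsection \<open>Modulation spaces\<close>

definition lattice_point :: "int ^ 'n \<Rightarrow> real ^ 'n" where
  "lattice_point k = (\<chi> i. of_int (k $ i))"

definition uniform_bump :: "(real ^ 'n \<Rightarrow> real) \<Rightarrow> bool" where
  "uniform_bump \<eta> \<longleftrightarrow> smooth \<eta> \<and> (\<forall>\<xi>. 0 \<le> \<eta> \<xi> \<and> \<eta> \<xi> \<le> 1) \<and>
     (\<forall>\<xi>. infnorm \<xi> \<le> 1/2 \<longrightarrow> \<eta> \<xi> = 1) \<and> (\<forall>\<xi>. infnorm \<xi> \<ge> 3/4 \<longrightarrow> \<eta> \<xi> = 0)"

definition uniform_symbol :: "(real ^ 'n \<Rightarrow> real) \<Rightarrow> int ^ 'n \<Rightarrow> real ^ 'n \<Rightarrow> complex" where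
  "uniform_symbol \<eta> k \<xi> =
     of_real (\<eta> (\<xi> - lattice_point k) / (\<Sum>\<^sub>\<infinity>l. \<eta> (\<xi> - lattice_point l)))"

definition uniform_block ::
    "(real ^ 'n \<Rightarrow> real) \<Rightarrow> int ^ 'n \<Rightarrow> (real ^ 'n) functional \<Rightarrow> (real ^ 'n) functional" where
  "uniform_block \<eta> k = fourier_multiplier (uniform_symbol \<eta> k)"

definition modulation_norm ::
    "(real ^ 'n \<Rightarrow> real) \<Rightarrow> real \<Rightarrow> ennreal \<Rightarrow> real \<Rightarrow> (real ^ 'n) functional \<Rightarrow> ennreal"
  where "modulation_norm \<eta> p q s T =
     lq_norm q (\<lambda>k. ennreal (sqrt (1 + (norm (lattice_point k))\<^sup>2) powr s) *
       Lp_norm p (distribution_modulus (uniform_block \<eta> k T)))"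

section \<open>Hausdorff operators\<close>

(* At y = 0 the integrand is \<Phi> 0 * f 0, which is irrelevant as the origin is a null set. *)
definition hausdorff_op ::
    "('a::euclidean_space \<Rightarrow> complex) \<Rightarrow> ('a \<Rightarrow> complex) \<Rightarrow> 'a \<Rightarrow> complex" where
  "hausdorff_op \<Phi> f x = (LINT y|lebesgue. \<Phi> y * f (x /\<^sub>R norm y))"

definition hausdorff_bounded ::
    "('a::euclidean_space \<Rightarrow> complex) \<Rightarrow> ('a functional \<Rightarrow> ennreal) \<Rightarrow> bool" where
  "hausdorff_bounded \<Phi> N \<longleftrightarrow>
     (\<exists>C::real. \<forall>f. test_function (- {0}) f \<longrightarrow>
        (\<exists>T. represents (hausdorff_op \<Phi> f) T \<and> T \<in> qspace N \<and>
             N T \<le> ennreal C * N (distribution_of f)))"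

definition hausdorff_zero :: "('a::euclidean_space \<Rightarrow> complex) \<Rightarrow> bool" where
  "hausdorff_zero \<Phi> \<longleftrightarrow> (\<forall>f. test_function (- {0}) f \<longrightarrow> (\<forall>x. hausdorff_op \<Phi> f x = 0))"

end

theory Submission
  imports Defs
begin

text \<open>For \<open>p < 1\<close> a bump of width \<open>\<epsilon>\<close> at a point \<open>e \<noteq> 0\<close> has \<open>L\<^sup>p\<close>-mass of order \<open>\<epsilon>\<^sup>n\<close>, while
  \<open>H\<^sub>\<Phi>\<close> spreads it over a tube along \<open>\<real>e\<close>, where it is uniformly small but keeps an
  \<open>L\<^sup>1\<close>-mass of order \<open>\<epsilon>\<^sup>n\<close>; since \<open>|h| = |h|\<^sup>p |h|\<^bsup>1-p\<^esup>\<close>, an \<open>L\<^sup>p\<close> bound by \<open>\<epsilon>\<^sup>n\<close> forces that mass to be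
  of lower order, and so the averages of \<open>\<Phi>\<close> over almost all spheres vanish.

  The \<open>L\<^sup>p\<close> bound comes out of all three scales in the same way, because \<open>H\<^sub>\<Phi>\<close> commutes with dilations.
  Dilating by a large factor pushes all frequencies to the origin: the quasi-norm of a widely dilated
  bump is at most of the order of its \<open>L\<^sup>p\<close> quasi-norm, and the quasi-norm of its image dominates the
  \<open>L\<^sup>p\<close> quasi-norm of the lowest frequency block.  After rescaling, this block is an approximate
  identity applied to one fixed tempered distribution.  It converges almost everywhere to a nonzero multiple
  of the image, and Fatou's lemma applies.\<close>

section \<open>Calculus of iterated directional derivatives\<close>

text \<open>A representing function is tied to its tempered distribution \<open>T\<close> on test
  functions only: its integral against the Schwartz kernel of a block may diverge, and the image is
  known neither to be continuous at the origin nor to have bounded growth. So convergence is local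
  and is measured by pairings: near a point of continuity the function is integrated, and the rest
  of \<open>T\<close> is estimated by one seminorm of finite order. The errors are multiples of the
  L1 norm of the test function, which the fundamental lemma turns into bounds almost everywhere.

  Dilating a bump of width \<open>\<epsilon>\<close> by \<open>l\<close> gives width
  \<open>l * \<epsilon>\<close>, hence a quasi-norm of order
  \<open>(l * \<epsilon>) powr (n / p)\<close>. Rescaling the image removes the power of
  \<open>l\<close>, and \<open>\<epsilon> ^ n\<close> remains in the integral of the
  \<open>p\<close>-th power.

  What results is that a pairing of \<open>\<Phi>\<close> with functions on one ray vanishes.
  Composing an arbitrary test function with the inversion in a sphere makes this pairing the value
  of the Hausdorff operator at a point.\<close>

lemma iter_deriv_append: "iter_deriv (us @ vs) f = iter_deriv us (iter_deriv vs f)"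
  by (induction us) auto

lemma smooth_differentiable: "smooth f \<Longrightarrow> f differentiable (at x)"
  unfolding smooth_def by (metis empty_set empty_subsetI iter_deriv.simps(1))

lemma smooth_continuous: "smooth f \<Longrightarrow> continuous_on S f"
  by (meson continuous_at_imp_continuous_on differentiable_imp_continuous_within smooth_differentiable)

lemma smooth_iter_deriv: "smooth f \<Longrightarrow> set vs \<subseteq> Basis \<Longrightarrow> smooth (iter_deriv vs f)"
  unfolding smooth_def by (simp flip: iter_deriv_append)

text \<open>A class of differentiable functions that is stable under partial derivatives contains
  all iterated derivatives of its members. Choosing a suitable class replaces explicit formulas for
  higher derivatives.\<close>

lemma smooth_coinduct:
  assumes "P f"
    and step: "\<And>f. P f \<Longrightarrow> (\<forall>x. f differentiable (at x)) \<and> (\<forall>b\<in>Basis. P (iter_deriv [b] f))"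
  shows "smooth f"
proof -
  have "P (iter_deriv vs f)" if "set vs \<subseteq> Basis" for vs
    using that
  proof (induction vs)
    case (Cons v vs)
    then show ?case using step[of "iter_deriv vs f"] by simp
  qed (simp add: assms)
  then show ?thesis
    unfolding smooth_def using step by blast
qed

lemma frechet_derivative_eqI:
  "(f has_derivative f') (at x) \<Longrightarrow> frechet_derivative f (at x) = f'"
  using frechet_derivative_at by fastforce

lemma has_frechet_derivative: "f differentiable (at x) \<Longrightarrow> (f has_derivative frechet_derivative f (at x)) (at x)"
  using frechet_derivative_works by blast

lemma smooth_const: "smooth (\<lambda>_. c)"
proof (rule smooth_coinduct[where P = "\<lambda>f. \<exists>c. f = (\<lambda>_. c)"])
  show "(\<forall>x. f differentiable (at x)) \<and> (\<forall>b\<in>Basis. \<exists>c. iter_deriv [b] f = (\<lambda>_. c))"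
    if "\<exists>c. f = (\<lambda>_. c)" for f :: "'a \<Rightarrow> 'b"
    using that by auto
qed auto

text \<open>Differentiation maps the closure of the smooth functions under the field operations into itself,
  so this closure consists of smooth functions, and no iterated product or quotient rule is needed.\<close>

inductive smooth_alg :: "('a::euclidean_space \<Rightarrow> 'b::real_normed_field) \<Rightarrow> bool" where
  base: "smooth f \<Longrightarrow> smooth_alg f"
| add: "smooth_alg f \<Longrightarrow> smooth_alg g \<Longrightarrow> smooth_alg (\<lambda>x. f x + g x)"
| mult: "smooth_alg f \<Longrightarrow> smooth_alg g \<Longrightarrow> smooth_alg (\<lambda>x. f x * g x)"
| inv: "smooth_alg f \<Longrightarrow> (\<And>x. f x \<noteq> 0) \<Longrightarrow> smooth_alg (\<lambda>x. inverse (f x))"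

lemma smooth_alg_step:
  "smooth_alg f \<Longrightarrow> (\<forall>x. f differentiable (at x)) \<and> (\<forall>b\<in>Basis. smooth_alg (iter_deriv [b] f))"
proof (induction rule: smooth_alg.induct)
  case (base f)
  then show ?case
    using smooth_differentiable[OF base] smooth_iter_deriv[OF base] smooth_alg.base
    by (metis empty_set empty_subsetI insert_subset list.simps(15))
next
  case (add f g)
  have "frechet_derivative (\<lambda>x. f x + g x) (at x) =
     (\<lambda>h. frechet_derivative f (at x) h + frechet_derivative g (at x) h)" for x
    using add by (intro frechet_derivative_eqI has_derivative_add has_frechet_derivative) auto
  then have "iter_deriv [b] (\<lambda>x. f x + g x) = (\<lambda>x. iter_deriv [b] f x + iter_deriv [b] g x)" for b
    by auto
  then show ?case using add by (auto intro: smooth_alg.add)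
next
  case (mult f g)
  have "frechet_derivative (\<lambda>x. f x * g x) (at x) =
     (\<lambda>h. f x * frechet_derivative g (at x) h + frechet_derivative f (at x) h * g x)" for x
    using mult by (intro frechet_derivative_eqI has_derivative_mult has_frechet_derivative) auto
  then have "iter_deriv [b] (\<lambda>x. f x * g x) = (\<lambda>x. f x * iter_deriv [b] g x + iter_deriv [b] f x * g x)" for b
    by auto
  moreover have "smooth_alg (\<lambda>x. f x * iter_deriv [b] g x + iter_deriv [b] f x * g x)" if "b \<in> Basis" for b
    using mult that by (intro smooth_alg.add smooth_alg.mult) auto
  ultimately show ?case using mult by auto
next
  case (inv f)
  have "((\<lambda>x. inverse (f x)) has_derivative
     (\<lambda>h. - (inverse (f x) * frechet_derivative f (at x) h * inverse (f x)))) (at x)" for x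
    using inv by (intro Deriv.has_derivative_inverse has_frechet_derivative) auto
  then have *: "(\<lambda>x. inverse (f x)) differentiable (at x)"
     "frechet_derivative (\<lambda>x. inverse (f x)) (at x) =
     (\<lambda>h. - (inverse (f x) * frechet_derivative f (at x) h * inverse (f x)))" for x
    by (auto simp: differentiable_def intro: frechet_derivative_eqI)
  then have "iter_deriv [b] (\<lambda>x. inverse (f x)) =
     (\<lambda>x. (-1) * (inverse (f x) * iter_deriv [b] f x * inverse (f x)))" for b
    by auto
  moreover have "smooth_alg (\<lambda>x. (-1) * (inverse (f x) * iter_deriv [b] f x * inverse (f x)))"
    if "b \<in> Basis" for b
    using inv that by (intro smooth_alg.mult smooth_alg.inv smooth_alg.base[OF smooth_const]) auto
  ultimately show ?case using * by auto
qed

lemma smooth_alg_smooth: "smooth_alg f \<Longrightarrow> smooth f"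
  by (rule smooth_coinduct[where P = smooth_alg]) (use smooth_alg_step in auto)

lemma smooth_add:
  fixes f g :: "'a::euclidean_space \<Rightarrow> 'b::real_normed_field"
  shows "smooth f \<Longrightarrow> smooth g \<Longrightarrow> smooth (\<lambda>x. f x + g x)"
  by (rule smooth_alg_smooth[OF smooth_alg.add[OF smooth_alg.base smooth_alg.base]])

lemma smooth_mult:
  fixes f g :: "'a::euclidean_space \<Rightarrow> 'b::real_normed_field"
  shows "smooth f \<Longrightarrow> smooth g \<Longrightarrow> smooth (\<lambda>x. f x * g x)"
  by (rule smooth_alg_smooth[OF smooth_alg.mult[OF smooth_alg.base smooth_alg.base]])

lemma smooth_inverse:
  fixes f :: "'a::euclidean_space \<Rightarrow> 'b::real_normed_field"
  shows "smooth f \<Longrightarrow> (\<And>x. f x \<noteq> 0) \<Longrightarrow> smooth (\<lambda>x. inverse (f x))"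
  by (rule smooth_alg_smooth[OF smooth_alg.inv[OF smooth_alg.base]])

lemma smooth_diff:
  fixes f g :: "'a::euclidean_space \<Rightarrow> 'b::real_normed_field"
  assumes "smooth f" "smooth g" shows "smooth (\<lambda>x. f x - g x)"
  using smooth_add[OF assms(1) smooth_mult[OF smooth_const[of "-1"] assms(2)]] by simp

lemma smooth_sum:
  fixes f :: "'i \<Rightarrow> 'a::euclidean_space \<Rightarrow> 'b::real_normed_field"
  shows "(\<And>i. i \<in> I \<Longrightarrow> smooth (f i)) \<Longrightarrow> smooth (\<lambda>x. \<Sum>i\<in>I. f i x)"
  by (induction I rule: infinite_finite_induct) (auto simp: smooth_const intro: smooth_add)

lemma smooth_bounded_linear_comp:
  assumes L: "bounded_linear L" and f: "smooth f" shows "smooth (\<lambda>x. L (f x))"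
proof (rule smooth_coinduct[where P = "\<lambda>g. \<exists>f. smooth f \<and> g = (\<lambda>x. L (f x))"])
  fix g assume "\<exists>f. smooth f \<and> g = (\<lambda>x. L (f x))"
  then obtain f where f: "smooth f" and g: "g = (\<lambda>x. L (f x))" by blast
  have d: "(g has_derivative (\<lambda>h. L (frechet_derivative f (at x) h))) (at x)" for x
    unfolding g using f by (intro bounded_linear.has_derivative[OF L] has_frechet_derivative smooth_differentiable)
  then have "iter_deriv [b] g = (\<lambda>x. L (iter_deriv [b] f x))" for b
    using frechet_derivative_eqI[OF d] by auto
  then show "(\<forall>x. g differentiable (at x)) \<and> (\<forall>b\<in>Basis. \<exists>f. smooth f \<and> iter_deriv [b] g = (\<lambda>x. L (f x)))"
    using d smooth_iter_deriv[OF f, of "[_]"] by (fastforce simp: differentiable_def)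
qed (use f in blast)

lemma smooth_bounded_linear: "bounded_linear L \<Longrightarrow> smooth L"
proof (rule smooth_coinduct[where P = "\<lambda>g. bounded_linear g \<or> (\<exists>c. g = (\<lambda>_. c))"])
  fix g :: "'a \<Rightarrow> 'b"
  assume g: "bounded_linear g \<or> (\<exists>c. g = (\<lambda>_. c))"
  show "(\<forall>x. g differentiable (at x)) \<and>
      (\<forall>b\<in>Basis. bounded_linear (iter_deriv [b] g) \<or> (\<exists>c. iter_deriv [b] g = (\<lambda>_. c)))"
  proof (cases "bounded_linear g")
    case True
    then have d: "(g has_derivative g) (at x)" for x by (rule bounded_linear_imp_has_derivative)
    then show ?thesis using frechet_derivative_eqI[OF d] by (auto simp: differentiable_def)
  next
    case False
    then show ?thesis using g by auto
  qed
qed simp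

section \<open>Iterated derivatives of sums, affine substitutions and products\<close>

lemma iter_deriv_add:
  fixes f g :: "'a::euclidean_space \<Rightarrow> 'b::real_normed_vector"
  assumes "smooth f" "smooth g" "set vs \<subseteq> Basis"
  shows "iter_deriv vs (\<lambda>x. f x + g x) = (\<lambda>x. iter_deriv vs f x + iter_deriv vs g x)"
  using assms(3)
proof (induction vs)
  case (Cons v vs)
  have "frechet_derivative (\<lambda>x. iter_deriv vs f x + iter_deriv vs g x) (at x) =
     (\<lambda>h. frechet_derivative (iter_deriv vs f) (at x) h + frechet_derivative (iter_deriv vs g) (at x) h)" for x
    using Cons assms by (intro frechet_derivative_eqI has_derivative_add has_frechet_derivative smooth_differentiable smooth_iter_deriv) auto
  then show ?case using Cons by auto
qed simp

lemma iter_deriv_bounded_linear_comp: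
  assumes L: "bounded_linear L" and f: "smooth f" "set vs \<subseteq> Basis"
  shows "iter_deriv vs (\<lambda>x. L (f x)) = (\<lambda>x. L (iter_deriv vs f x))"
  using f(2)
proof (induction vs)
  case (Cons v vs)
  have "frechet_derivative (\<lambda>x. L (iter_deriv vs f x)) (at x) =
     (\<lambda>h. L (frechet_derivative (iter_deriv vs f) (at x) h))" for x
    using Cons f by (intro frechet_derivative_eqI bounded_linear.has_derivative[OF L] has_frechet_derivative smooth_differentiable smooth_iter_deriv) auto
  then show ?case using Cons by auto
qed simp

lemma iter_deriv_cmult:
  fixes f :: "'a::euclidean_space \<Rightarrow> 'b::real_normed_algebra"
  assumes "smooth f" "set vs \<subseteq> Basis"
  shows "iter_deriv vs (\<lambda>x. c * f x) = (\<lambda>x. c * iter_deriv vs f x)"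
  by (rule iter_deriv_bounded_linear_comp[OF bounded_linear_mult_right assms])

lemma has_derivative_affine_comp:
  fixes f :: "'a::real_normed_vector \<Rightarrow> 'b::real_normed_vector"
  assumes "f differentiable (at (c *\<^sub>R x + z))"
  shows "((\<lambda>x. f (c *\<^sub>R x + z)) has_derivative (\<lambda>h. c *\<^sub>R frechet_derivative f (at (c *\<^sub>R x + z)) h)) (at x)"
proof -
  have 1: "((\<lambda>x. c *\<^sub>R x + z) has_derivative (\<lambda>h. c *\<^sub>R h)) (at x)"
    by (auto intro!: derivative_eq_intros)
  have 2: "linear (frechet_derivative f (at (c *\<^sub>R x + z)))"
    using assms linear_frechet_derivative by blast
  have "((\<lambda>x. f (c *\<^sub>R x + z)) has_derivative (\<lambda>h. frechet_derivative f (at (c *\<^sub>R x + z)) (c *\<^sub>R h))) (at x)"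
    using has_derivative_compose[OF 1 has_frechet_derivative[OF assms]] by simp
  then show ?thesis by (simp add: linear_cmul[OF 2])
qed

lemma iter_deriv_affine_comp:
  fixes f :: "'a::euclidean_space \<Rightarrow> 'b::real_normed_vector"
  assumes "smooth f" "set vs \<subseteq> Basis"
  shows "iter_deriv vs (\<lambda>x. f (c *\<^sub>R x + z)) = (\<lambda>x. c ^ length vs *\<^sub>R iter_deriv vs f (c *\<^sub>R x + z))"
  using assms(2)
proof (induction vs)
  case (Cons v vs)
  have "((\<lambda>x. iter_deriv vs f (c *\<^sub>R x + z)) has_derivative (\<lambda>h. c *\<^sub>R frechet_derivative (iter_deriv vs f) (at (c *\<^sub>R x + z)) h)) (at x)" for x
    using Cons.prems assms(1) by (intro has_derivative_affine_comp smooth_differentiable smooth_iter_deriv) auto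
  then have "frechet_derivative (\<lambda>x. c ^ length vs *\<^sub>R iter_deriv vs f (c *\<^sub>R x + z)) (at x) =
     (\<lambda>h. c ^ length vs *\<^sub>R c *\<^sub>R frechet_derivative (iter_deriv vs f) (at (c *\<^sub>R x + z)) h)" for x
    by (intro frechet_derivative_eqI has_derivative_scaleR_right) auto
  then show ?case using Cons by (auto simp: mult.commute)
qed simp

lemma smooth_affine_comp:
  fixes f :: "'a::euclidean_space \<Rightarrow> 'b::real_normed_vector"
  assumes f: "smooth f" shows "smooth (\<lambda>x. f (c *\<^sub>R x + z))"
proof -
  have "(\<lambda>x. iter_deriv vs f (c *\<^sub>R x + z)) differentiable (at x)" if "set vs \<subseteq> Basis" for vs x
    using has_derivative_affine_comp[of "iter_deriv vs f" c x z] smooth_differentiable[OF smooth_iter_deriv[OF f that]]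
    unfolding differentiable_def[of "\<lambda>x. iter_deriv vs f (c *\<^sub>R x + z)"] by blast
  then show ?thesis
    unfolding smooth_def using f by (simp add: iter_deriv_affine_comp)
qed

text \<open>\<open>frechet_derivative\<close> is chosen among all derivatives at a point, and
  functions that agree near the point have the same ones, so the equality survives each
  differentiation. The main use is that a product vanishes with all its derivatives on an open set
  where one factor is zero.\<close>

lemma iter_deriv_cong_open:
  assumes "open U" "\<And>y. y \<in> U \<Longrightarrow> f y = g y" "x \<in> U"
  shows "iter_deriv vs f x = iter_deriv vs g x"
  using assms(3)
proof (induction vs arbitrary: x)
  case (Cons v vs)
  have "(iter_deriv vs f has_derivative D) (at x) \<longleftrightarrow> (iter_deriv vs g has_derivative D) (at x)" for D
    using has_derivative_transform_within_open[OF _ assms(1) Cons.prems] Cons.IH by metis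
  then have "frechet_derivative (iter_deriv vs f) (at x) = frechet_derivative (iter_deriv vs g) (at x)"
    unfolding frechet_derivative_def by simp
  then show ?case by simp
qed (use assms in auto)

lemma iter_deriv_const_0: "iter_deriv vs (\<lambda>_. 0) = (\<lambda>_. 0)"
  by (induction vs) auto

lemma iter_deriv_eq_0:
  assumes "x \<notin> closure {x. f x \<noteq> 0}"
  shows "iter_deriv vs f x = 0"
proof -
  have U: "open (- closure {x. f x \<noteq> 0})" "x \<in> - closure {x. f x \<noteq> 0}"
    using assms by auto
  have f0: "f y = (\<lambda>_. 0) y" if "y \<in> - closure {x. f x \<noteq> 0}" for y
    using that closure_subset[of "{x. f x \<noteq> 0}"] by auto
  show ?thesis
    using iter_deriv_cong_open[OF U(1) f0 U(2), where vs = vs] by (simp add: iter_deriv_const_0)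
qed

text \<open>A Leibniz rule without binomial coefficients: each differentiation splits a product into
  two, which leads to at most \<open>2 ^ n\<close> products bounded by \<open>A * B\<close>. The
  induction peels off the last list entry, the innermost derivative, since this leaves a sum of
  products to which the induction hypothesis applies. The bounds concern one point \<open>x\<close>,
  so \<open>A\<close> and \<open>B\<close> may contain a weight depending on
  \<open>x\<close>.\<close>

lemma iter_deriv_mult_bound:
  fixes w v :: "'a::euclidean_space \<Rightarrow> complex"
  assumes "smooth w" "smooth v" "set vs \<subseteq> Basis" "length vs \<le> n"
    and "\<And>us. set us \<subseteq> Basis \<Longrightarrow> length us \<le> n \<Longrightarrow> norm (iter_deriv us w x) \<le> A"
    and "\<And>us. set us \<subseteq> Basis \<Longrightarrow> length us \<le> n \<Longrightarrow> norm (iter_deriv us v x) \<le> B"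
  shows "norm (iter_deriv vs (\<lambda>x. w x * v x) x) \<le> 2 ^ n * (A * B)"
proof -
  have A0: "0 \<le> A" and B0: "0 \<le> B"
    by (rule order_trans[OF norm_ge_zero assms(5)[of "[]"]]; simp) (rule order_trans[OF norm_ge_zero assms(6)[of "[]"]]; simp)
  have "norm (iter_deriv vs (\<lambda>x. w x * v x) x) \<le> 2 ^ length vs * (A * B)"
    using assms
  proof (induction vs arbitrary: w v n rule: rev_induct)
    case Nil
    then show ?case using Nil(5)[of "[]"] Nil(6)[of "[]"] A0 B0 by (auto simp: norm_mult intro!: mult_mono)
  next
    case (snoc b vs)
    obtain k where k: "n = Suc k" "length vs \<le> k" using snoc.prems(4) by (cases n) auto
    have b: "b \<in> Basis" "set vs \<subseteq> Basis" using snoc.prems by auto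
    have sm: "smooth (iter_deriv [b] w)" "smooth (iter_deriv [b] v)"
      using smooth_iter_deriv[OF snoc.prems(1), of "[b]"] smooth_iter_deriv[OF snoc.prems(2), of "[b]"] b by auto
    have "frechet_derivative (\<lambda>x. w x * v x) (at x) =
       (\<lambda>h. w x * frechet_derivative v (at x) h + frechet_derivative w (at x) h * v x)" for x
      by (intro frechet_derivative_eqI has_derivative_mult has_frechet_derivative smooth_differentiable snoc.prems(1,2))
    then have "iter_deriv [b] (\<lambda>x. w x * v x) = (\<lambda>x. w x * iter_deriv [b] v x + iter_deriv [b] w x * v x)"
      by auto
    then have eq: "iter_deriv (vs @ [b]) (\<lambda>x. w x * v x) =
       (\<lambda>x. iter_deriv vs (\<lambda>x. w x * iter_deriv [b] v x) x + iter_deriv vs (\<lambda>x. iter_deriv [b] w x * v x) x)"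
      unfolding iter_deriv_append using sm b snoc.prems by (simp only: iter_deriv_add smooth_mult)
    have 1: "norm (iter_deriv vs (\<lambda>x. w x * iter_deriv [b] v x) x) \<le> 2 ^ length vs * (A * B)"
    proof (rule snoc.IH[of _ _ k])
      show "norm (iter_deriv us (iter_deriv [b] v) x) \<le> B" if "set us \<subseteq> Basis" "length us \<le> k" for us
        using snoc.prems(6)[of "us @ [b]"] that b k unfolding iter_deriv_append by simp
      show "norm (iter_deriv us w x) \<le> A" if "set us \<subseteq> Basis" "length us \<le> k" for us
        using snoc.prems(5)[of us] that k by simp
    qed (use snoc.prems sm b k in auto)
    have 2: "norm (iter_deriv vs (\<lambda>x. iter_deriv [b] w x * v x) x) \<le> 2 ^ length vs * (A * B)"
    proof (rule snoc.IH[of _ _ k])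
      show "norm (iter_deriv us (iter_deriv [b] w) x) \<le> A" if "set us \<subseteq> Basis" "length us \<le> k" for us
        using snoc.prems(5)[of "us @ [b]"] that b k unfolding iter_deriv_append by simp
      show "norm (iter_deriv us v x) \<le> B" if "set us \<subseteq> Basis" "length us \<le> k" for us
        using snoc.prems(6)[of us] that k by simp
    qed (use snoc.prems sm b k in auto)
    show ?case unfolding eq using norm_triangle_le[OF add_mono[OF 1 2]] by (simp add: mult_ac)
  qed
  also have "\<dots> \<le> 2 ^ n * (A * B)"
    using A0 B0 assms(4) by (intro mult_right_mono power_increasing) auto
  finally show ?thesis .
qed

section \<open>Schwartz functions\<close>

lemma schwartzD:
  assumes "schwartz u" "set vs \<subseteq> Basis"
  obtains C where "0 \<le> C" "\<And>x. (1 + norm x) ^ N * norm (iter_deriv vs u x) \<le> C"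
proof -
  from assms have "bounded (range (\<lambda>x. (1 + norm x) ^ N *\<^sub>R iter_deriv vs u x))"
    unfolding schwartz_def by blast
  then obtain C where "\<And>x. norm ((1 + norm x) ^ N *\<^sub>R iter_deriv vs u x) \<le> C"
    unfolding bounded_iff by auto
  then have *: "(1 + norm x) ^ N * norm (iter_deriv vs u x) \<le> C" for x by (simp add: abs_of_nonneg)
  then show ?thesis using that[of C] *[of 0] order_trans[OF norm_ge_zero, of "iter_deriv vs u 0" C] by simp
qed

lemma schwartzI:
  assumes "smooth u"
    and "\<And>N vs. set vs \<subseteq> Basis \<Longrightarrow> \<exists>C. \<forall>x. (1 + norm x) ^ N * norm (iter_deriv vs u x) \<le> C"
  shows "schwartz u"
  unfolding schwartz_def bounded_iff using assms by (auto simp: abs_of_nonneg)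

lemma schwartz_smooth: "schwartz u \<Longrightarrow> smooth u"
  by (simp add: schwartz_def)

lemma test_function_smooth: "test_function S f \<Longrightarrow> smooth f"
  by (simp add: test_function_def)

lemma test_function_mono: "test_function S f \<Longrightarrow> S \<subseteq> T \<Longrightarrow> test_function T f"
  by (auto simp: test_function_def)

lemma test_function_schwartz:
  assumes "test_function S f" shows "schwartz f"
proof (rule schwartzI)
  show sm: "smooth f" using assms test_function_smooth by auto
  fix N and vs :: "'a list" assume vs: "set vs \<subseteq> Basis"
  let ?K = "closure {x. f x \<noteq> 0}"
  have "continuous_on ?K (\<lambda>x. (1 + norm x) ^ N *\<^sub>R iter_deriv vs f x)"
    by (intro continuous_intros smooth_continuous smooth_iter_deriv sm vs)
  then have "bounded ((\<lambda>x. (1 + norm x) ^ N *\<^sub>R iter_deriv vs f x) ` ?K)"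
    using assms by (intro compact_imp_bounded compact_continuous_image) (auto simp: test_function_def)
  then obtain C where C: "\<And>x. x \<in> ?K \<Longrightarrow> norm ((1 + norm x) ^ N *\<^sub>R iter_deriv vs f x) \<le> C"
    unfolding bounded_iff by auto
  have "(1 + norm x) ^ N * norm (iter_deriv vs f x) \<le> max C 0" for x
    using C[of x] iter_deriv_eq_0[of x f vs] by (cases "x \<in> ?K") (auto simp: abs_of_nonneg)
  then show "\<exists>C. \<forall>x. (1 + norm x) ^ N * norm (iter_deriv vs f x) \<le> C" by blast
qed

lemma test_functionI:
  assumes "smooth f" "closed K" "bounded K" "K \<subseteq> S" "\<And>x. x \<notin> K \<Longrightarrow> f x = 0"
  shows "test_function S f"
proof -
  have "closure {x. f x \<noteq> 0} \<subseteq> K" using assms by (intro closure_minimal) auto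
  then show ?thesis unfolding test_function_def using assms
    by (meson bounded_subset closed_closure compact_eq_bounded_closed subset_trans)
qed

lemma test_functionD:
  assumes "test_function S f"
  obtains K where "compact K" "K \<subseteq> S" "\<And>x. x \<notin> K \<Longrightarrow> f x = 0"
  using assms that[of "closure {x. f x \<noteq> 0}"] closure_subset[of "{x. f x \<noteq> 0}"]
  unfolding test_function_def by blast

lemma test_function_bounded_support:
  assumes "test_function S f"
  obtains R where "0 < R" "\<And>x. R \<le> norm x \<Longrightarrow> f x = 0"
proof -
  obtain K where K: "compact K" "K \<subseteq> S" "\<And>x. x \<notin> K \<Longrightarrow> f x = 0" using test_functionD[OF assms] by metis
  obtain B where B: "B > 0" "\<And>x. x \<in> K \<Longrightarrow> norm x \<le> B" using compact_imp_bounded[OF K(1)] bounded_pos by metis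
  show ?thesis by (rule that[of "B+1"]) (use B K in force)+
qed

lemma test_function_mult:
  assumes "test_function S f" "smooth g"
  shows "test_function S (\<lambda>x. g x * f x)" "test_function S (\<lambda>x. f x * g x)"
proof -
  obtain K where K: "compact K" "K \<subseteq> S" "\<And>x. x \<notin> K \<Longrightarrow> f x = 0" using test_functionD[OF assms(1)] by metis
  show "test_function S (\<lambda>x. g x * f x)" "test_function S (\<lambda>x. f x * g x)"
    using K test_function_smooth[OF assms(1)] assms(2)
    by (auto intro!: test_functionI[of _ K] smooth_mult simp: compact_imp_bounded compact_imp_closed)
qed

lemma test_function_iter_deriv:
  assumes "test_function S f" "set vs \<subseteq> Basis" shows "test_function S (iter_deriv vs f)"
proof (rule test_functionI)
  show "smooth (iter_deriv vs f)"
    using assms test_function_smooth smooth_iter_deriv by blast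
  show "bounded (closure {x. f x \<noteq> 0})" "closure {x. f x \<noteq> 0} \<subseteq> S"
    using assms(1) compact_imp_bounded unfolding test_function_def by auto
qed (auto intro: iter_deriv_eq_0)

section \<open>Lebesgue integration on Euclidean spaces\<close>

lemma sigma_finite_lebesgue: "sigma_finite_measure (lebesgue :: 'a::euclidean_space measure)"
proof
  let ?A = "range (\<lambda>n::nat. cball (0::'a) (real n))"
  have "\<Union> ?A = UNIV"
    by (auto simp: real_arch_simple)
  moreover have "emeasure lebesgue (cball (0::'a) (real n)) \<noteq> \<infinity>" for n :: nat
    using emeasure_bounded_finite[of "cball (0::'a) n"] by (auto simp: less_top)
  ultimately show "\<exists>A::'a set set. countable A \<and> A \<subseteq> sets lebesgue \<and> \<Union> A = space lebesgue \<and> (\<forall>a\<in>A. emeasure lebesgue a \<noteq> \<infinity>)"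
    by (intro exI[of _ ?A]) auto
qed

interpretation lebesgue: sigma_finite_measure lebesgue
  by (rule sigma_finite_lebesgue)

interpretation lebesgue_pair: pair_sigma_finite lebesgue lebesgue ..

lemma lebesgue_scaling:
  fixes t :: "'a::euclidean_space"
  assumes "c \<noteq> 0"
  shows "lebesgue = density (distr lebesgue lebesgue (\<lambda>x. t + c *\<^sub>R x)) (\<lambda>_. ennreal (\<bar>c\<bar> ^ DIM('a)))"
    and "(\<lambda>x. t + c *\<^sub>R x) \<in> lebesgue \<rightarrow>\<^sub>M lebesgue"
proof -
  have "(\<Sum>j\<in>Basis. (c * (x \<bullet> j)) *\<^sub>R j) = c *\<^sub>R x" for x :: 'a
    by (simp flip: scaleR_scaleR scaleR_sum_right add: euclidean_representation)
  then show "lebesgue = density (distr lebesgue lebesgue (\<lambda>x. t + c *\<^sub>R x)) (\<lambda>_. ennreal (\<bar>c\<bar> ^ DIM('a)))"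
     "(\<lambda>x. t + c *\<^sub>R x) \<in> lebesgue \<rightarrow>\<^sub>M lebesgue"
    using lebesgue_affine_euclidean[of "\<lambda>_. c" t] lebesgue_affine_measurable[of "\<lambda>_. c" t] assms by auto
qed

lemma nn_integral_scaling:
  fixes t :: "'a::euclidean_space"
  assumes "c \<noteq> 0" and [measurable]: "f \<in> borel_measurable lebesgue"
  shows "(\<integral>\<^sup>+x. f x \<partial>lebesgue) = ennreal (\<bar>c\<bar> ^ DIM('a)) * (\<integral>\<^sup>+x. f (t + c *\<^sub>R x) \<partial>lebesgue)"
  using lebesgue_scaling(2)[OF assms(1), of t]
  by (subst lebesgue_scaling(1)[OF assms(1), of t])
    (simp add: nn_integral_density nn_integral_distr nn_integral_cmult)

lemma integral_scaling:
  fixes t :: "'a::euclidean_space" and f :: "'a \<Rightarrow> 'b::euclidean_space"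
  assumes c: "c \<noteq> 0"
  shows "integrable lebesgue (\<lambda>x. f (t + c *\<^sub>R x)) \<longleftrightarrow> integrable lebesgue f"
    and "integral\<^sup>L lebesgue f = \<bar>c\<bar> ^ DIM('a) *\<^sub>R (LINT x|lebesgue. f (t + c *\<^sub>R x))"
proof -
  have 1: "integrable lebesgue (\<lambda>x. g (u + d *\<^sub>R x))" if "integrable lebesgue g" "d \<noteq> 0"
    for g :: "'a \<Rightarrow> 'b" and u d
  proof -
    have "integrable (density (distr lebesgue lebesgue (\<lambda>x. u + d *\<^sub>R x)) (\<lambda>_. ennreal (\<bar>d\<bar> ^ DIM('a)))) g"
      using that lebesgue_scaling(1)[of d u] by simp
    then have "integrable lebesgue (\<lambda>x. \<bar>d\<bar> ^ DIM('a) *\<^sub>R g (u + d *\<^sub>R x))"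
      using lebesgue_scaling(2)[OF that(2), of u] that
      by (subst (asm) integrable_density) (auto simp: integrable_distr_eq)
    from integrable_scaleR_right[OF this, of "1 / \<bar>d\<bar> ^ DIM('a)"] that(2) show ?thesis by simp
  qed
  \<comment> \<open>The reverse direction is the same implication for the inverse affine
    map.\<close>
  show iff: "integrable lebesgue (\<lambda>x. f (t + c *\<^sub>R x)) \<longleftrightarrow> integrable lebesgue f"
    using 1[of f c t] 1[of "\<lambda>x. f (t + c *\<^sub>R x)" "1/c" "- (1/c) *\<^sub>R t"] c
    by (auto simp: algebra_simps)
  show "integral\<^sup>L lebesgue f = \<bar>c\<bar> ^ DIM('a) *\<^sub>R (LINT x|lebesgue. f (t + c *\<^sub>R x))"
  proof (cases "integrable lebesgue f")
    case True
    then show ?thesis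
      using lebesgue_scaling(2)[OF c, of t]
      by (subst lebesgue_scaling(1)[OF c, of t]) (auto simp: integral_density integral_distr)
  next
    case False
    then show ?thesis using iff by (simp add: not_integrable_integral_eq)
  qed
qed

lemma borel_measurable_lebesgue: "f \<in> borel_measurable borel \<Longrightarrow> f \<in> borel_measurable lebesgue"
  by (simp add: measurable_completion)

lemma continuous_borel_measurable_lebesgue:
  "continuous_on UNIV f \<Longrightarrow> f \<in> borel_measurable lebesgue"
  by (intro borel_measurable_lebesgue borel_measurable_continuous_onI)

text \<open>The product of two Lebesgue sigma-algebras contains the Borel sets of the product space,
  so Borel kernels can enter Fubini's theorem for the completed measures.\<close>

lemma measurable_lebesgue_pair:
  fixes f :: "'a::euclidean_space \<times> 'b::euclidean_space \<Rightarrow> 'c::topological_space"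
  assumes "f \<in> borel_measurable borel"
  shows "f \<in> borel_measurable (lebesgue \<Otimes>\<^sub>M lebesgue)"
proof -
  have "(\<lambda>p. (fst p, snd p)) \<in> lebesgue \<Otimes>\<^sub>M lebesgue \<rightarrow>\<^sub>M (borel :: 'a measure) \<Otimes>\<^sub>M (borel :: 'b measure)"
    by (intro measurable_Pair measurable_compose[OF measurable_fst] measurable_compose[OF measurable_snd])
       (use borel_measurable_lebesgue[of "\<lambda>x::'a. x"] borel_measurable_lebesgue[of "\<lambda>x::'b. x"] in simp_all)
  from measurable_compose[OF this, of f borel] assms show ?thesis
    by (simp add: borel_prod)
qed

text \<open>The dominating function is \<open>norm (A x) * norm (B y) * M\<close>. The interchanges
  of Lebesgue integrals below have this shape: two integrable factors in separate variables, coupled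
  by a bounded Borel kernel such as a character, a translated kernel or a dilated bump.\<close>

lemma fubini_bounded:
  fixes A :: "'a::euclidean_space \<Rightarrow> complex" and B :: "'b::euclidean_space \<Rightarrow> complex"
  assumes A: "integrable lebesgue A" and B: "integrable lebesgue B"
    and c: "(\<lambda>p. c (fst p) (snd p)) \<in> borel_measurable borel" and M: "\<And>x y. norm (c x y) \<le> M"
  shows "(LINT x|lebesgue. LINT y|lebesgue. A x * B y * c x y) =
         (LINT y|lebesgue. LINT x|lebesgue. A x * B y * c x y)"
    and "integrable lebesgue (\<lambda>x. LINT y|lebesgue. A x * B y * c x y)"
proof -
  have [measurable]: "A \<in> borel_measurable lebesgue" "B \<in> borel_measurable lebesgue"
    using A B by auto
  have [measurable]: "(\<lambda>p. c (fst p) (snd p)) \<in> borel_measurable (lebesgue \<Otimes>\<^sub>M lebesgue)"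
    by (rule measurable_lebesgue_pair[OF c])
  have cm[measurable]: "c x \<in> borel_measurable lebesgue" for x
  proof -
    have "(\<lambda>y. (x, y)) \<in> borel \<rightarrow>\<^sub>M borel" by (intro borel_measurable_continuous_onI continuous_intros)
    from measurable_compose[OF this c] show ?thesis by (simp add: borel_measurable_lebesgue)
  qed
  have int1: "integrable lebesgue (\<lambda>y. norm (A x * B y * c x y))" for x
  proof (rule Bochner_Integration.integrable_bound)
    show "integrable lebesgue (\<lambda>y. norm (A x) * norm (B y) * M)" using B by simp
    show "AE y in lebesgue. norm (norm (A x * B y * c x y)) \<le> norm (norm (A x) * norm (B y) * M)"
      using M order_trans[OF norm_ge_zero M] by (auto simp: norm_mult abs_mult intro!: mult_left_mono)
  qed measurable
  have m: "(\<lambda>x. LINT y|lebesgue. norm (A x * B y * c x y)) \<in> borel_measurable lebesgue"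
    using lebesgue.borel_measurable_lebesgue_integral[of "\<lambda>x y. norm (A x * B y * c x y)" lebesgue] by simp
  have int: "integrable (lebesgue \<Otimes>\<^sub>M lebesgue) (\<lambda>(x, y). A x * B y * c x y)"
  proof (rule lebesgue_pair.Fubini_integrable)
    show "integrable lebesgue (\<lambda>x. LINT y|lebesgue. norm (case (x, y) of (x, y) \<Rightarrow> A x * B y * c x y))"
    proof (rule Bochner_Integration.integrable_bound)
      show "integrable lebesgue (\<lambda>x. norm (A x) * (LINT y|lebesgue. norm (B y) * M))" using A by simp
      show "AE x in lebesgue. norm (LINT y|lebesgue. norm (case (x, y) of (x, y) \<Rightarrow> A x * B y * c x y))
          \<le> norm (norm (A x) * (LINT y|lebesgue. norm (B y) * M))"
      proof (rule AE_I2)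
        fix x
        have "(LINT y|lebesgue. norm (A x * B y * c x y)) \<le> (LINT y|lebesgue. norm (A x) * (norm (B y) * M))"
          using int1[of x] B M by (intro integral_mono) (auto simp: norm_mult mult.assoc intro!: mult_left_mono)
        also have "\<dots> = norm (A x) * (LINT y|lebesgue. norm (B y) * M)" by simp
        finally show "norm (LINT y|lebesgue. norm (case (x, y) of (x, y) \<Rightarrow> A x * B y * c x y))
          \<le> norm (norm (A x) * (LINT y|lebesgue. norm (B y) * M))" by simp
      qed
    qed (use m in simp)
    show "AE x in lebesgue. integrable lebesgue (\<lambda>y. case (x, y) of (x, y) \<Rightarrow> A x * B y * c x y)"
    proof (rule AE_I2)
      show "integrable lebesgue (\<lambda>y. case (x, y) of (x, y) \<Rightarrow> A x * B y * c x y)" for x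
        using int1[of x] by (subst (asm) integrable_norm_iff) auto
    qed
  qed measurable
  from lebesgue_pair.Fubini_integral[OF int] show "(LINT x|lebesgue. LINT y|lebesgue. A x * B y * c x y) =
         (LINT y|lebesgue. LINT x|lebesgue. A x * B y * c x y)" by simp
  from lebesgue_pair.integrable_fst[OF int] show "integrable lebesgue (\<lambda>x. LINT y|lebesgue. A x * B y * c x y)" by simp
qed

text \<open>Dyadic balls replace polar coordinates: for the least \<open>j\<close> with
  \<open>norm x \<le> 2 ^ j\<close> the weight is at most \<open>c j\<close>, and the ball of radius
  \<open>2 ^ j\<close> has volume proportional to \<open>2 ^ j\<close> to the power of the
  dimension, so a geometric series with ratio \<open>1 / 2\<close> remains. The numerator of
  \<open>c j\<close> pays for the gap between \<open>norm x\<close> and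
  \<open>2 ^ j\<close>.\<close>

lemma nn_integral_decay_finite:
  "(\<integral>\<^sup>+x. ennreal (1 / (1 + norm (x::'a::euclidean_space)) ^ (DIM('a) + 1)) \<partial>lebesgue) < \<infinity>"
proof -
  let ?n = "DIM('a)"
  define v where "v = unit_ball_vol (real ?n)"
  have v0: "0 \<le> v" by (simp add: v_def)
  define c where "c j = 2 ^ (?n + 1) / (2::real) ^ (j * (?n + 1))" for j :: nat
  have c0: "0 \<le> c j" for j by (simp add: c_def)
  have le: "ennreal (1 / (1 + norm x) ^ (?n + 1)) \<le> (\<Sum>j. ennreal (c j) * indicator (cball 0 (2 ^ j)) x)" for x :: 'a
  proof -
    obtain j0 where j0: "norm x < 2 ^ j0" using real_arch_pow[of 2 "norm x"] by auto
    define j where "j = (LEAST j. norm x \<le> 2 ^ j)"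
    have j: "norm x \<le> 2 ^ j" unfolding j_def by (rule LeastI[of _ j0]) (use j0 in simp)
    have "1 / (1 + norm x) ^ (?n + 1) \<le> c j"
    proof (cases j)
      case 0
      have "1 \<le> (1 + norm x) ^ (?n + 1)" by (intro one_le_power) auto
      then have "1 / (1 + norm x) ^ (?n + 1) \<le> 1" using order_less_le_trans[OF zero_less_one] by (simp only: divide_le_eq_1) blast
      moreover have "(1::real) \<le> 2 ^ (?n + 1)" by (rule one_le_power) simp
      ultimately show ?thesis unfolding 0 c_def by simp
    next
      case (Suc i)
      then have "\<not> norm x \<le> 2 ^ i" using not_less_Least[of i "\<lambda>j. norm x \<le> 2 ^ j"] unfolding j_def by auto
      then have "(2 ^ i) ^ (?n + 1) \<le> (1 + norm x) ^ (?n + 1)" by (intro power_mono) auto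
      then have "1 / (1 + norm x) ^ (?n + 1) \<le> 1 / (2 ^ i) ^ (?n + 1)"
        by (intro divide_left_mono mult_pos_pos zero_less_power) (simp_all add: add_pos_nonneg)
      also have "\<dots> = c j" unfolding Suc c_def by (simp add: power_mult[symmetric] power_add)
      finally show ?thesis .
    qed
    then have "ennreal (1 / (1 + norm x) ^ (?n + 1)) \<le> ennreal (c j) * indicator (cball 0 (2 ^ j)) x"
      using j by (simp add: ennreal_leI)
    also have "\<dots> \<le> (\<Sum>j. ennreal (c j) * indicator (cball 0 (2 ^ j)) x)"
      using sum_le_suminf[of "\<lambda>j. ennreal (c j) * indicator (cball 0 (2 ^ j)) x" "{j}"]
      by (simp only: sum.insert sum.empty finite.intros empty_iff not_False_eq_True add_0_right summableI zero_le ball_simps simp_thms)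
    finally show ?thesis .
  qed
  have "(\<integral>\<^sup>+x. ennreal (1 / (1 + norm (x::'a)) ^ (?n + 1)) \<partial>lebesgue)
     \<le> (\<integral>\<^sup>+x. (\<Sum>j. ennreal (c j) * indicator (cball (0::'a) (2 ^ j)) x) \<partial>lebesgue)"
    by (intro nn_integral_mono le)
  also have "\<dots> = (\<Sum>j. \<integral>\<^sup>+x. ennreal (c j) * indicator (cball (0::'a) (2 ^ j)) x \<partial>lebesgue)"
    by (intro nn_integral_suminf borel_measurable_times_ennreal borel_measurable_indicator) auto
  also have "\<dots> = (\<Sum>j. ennreal (c j * (v * (2 ^ j) ^ ?n)))"
    using c0 v0 by (intro suminf_cong) (simp add: nn_integral_cmult_indicator emeasure_cball v_def ennreal_mult)
  also have "\<dots> = (\<Sum>j. ennreal (2 ^ (?n + 1) * v * (1 / 2) ^ j))"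
    by (intro suminf_cong arg_cong[of _ _ ennreal]) (simp add: c_def power_mult[symmetric] power_add[symmetric] field_simps)
  also have "\<dots> = ennreal (\<Sum>j. 2 ^ (?n + 1) * v * (1 / 2) ^ j)"
    using v0 by (intro suminf_ennreal2) (auto intro!: summable_mult simp: summable_geometric)
  also have "\<dots> < \<infinity>" by simp
  finally show ?thesis .
qed

section \<open>Integrability from polynomial decay, compact support and local integrability\<close>

lemma integrable_decay_weight:
  "integrable lebesgue (\<lambda>x::'a::euclidean_space. 1 / (1 + norm x) ^ (DIM('a) + 1))"
proof (rule integrableI_bounded)
  have "norm (1 / (1 + norm x) ^ (DIM('a) + 1)) = 1 / (1 + norm x) ^ (DIM('a) + 1)" for x :: 'a
    by (simp add: add_nonneg_nonneg)
  then show "(\<integral>\<^sup>+x. ennreal (norm (1 / (1 + norm (x::'a)) ^ (DIM('a) + 1))) \<partial>lebesgue) < \<infinity>"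
    using nn_integral_decay_finite[where 'a='a] by simp
  have "1 + norm x \<noteq> 0" for x :: 'a
    using norm_ge_zero[of x] by linarith
  then have "continuous_on UNIV (\<lambda>x::'a. 1 / (1 + norm x) ^ (DIM('a) + 1))"
    by (intro continuous_intros) auto
  then show "(\<lambda>x::'a. 1 / (1 + norm x) ^ (DIM('a) + 1)) \<in> borel_measurable lebesgue"
    by (rule continuous_borel_measurable_lebesgue)
qed

lemma integrable_decay:
  fixes f :: "'a::euclidean_space \<Rightarrow> 'b::euclidean_space"
  assumes "f \<in> borel_measurable lebesgue" "\<And>x. (1 + norm x) ^ (DIM('a) + 1) * norm (f x) \<le> C"
  shows "integrable lebesgue f"
    and "(LINT x|lebesgue. norm (f x)) \<le> C * (LINT x|lebesgue. 1 / (1 + norm (x::'a)) ^ (DIM('a) + 1))"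
proof -
  let ?w = "\<lambda>x::'a. 1 / (1 + norm x) ^ (DIM('a) + 1)"
  have p: "0 < (1 + norm x) ^ (DIM('a) + 1)" for x :: 'a
    by (intro zero_less_power) (simp add: add_pos_nonneg)
  have b: "norm (f x) \<le> C * ?w x" for x
    using assms(2)[of x] p[of x] by (simp add: field_simps)
  show i: "integrable lebesgue f"
    by (rule Bochner_Integration.integrable_bound[OF integrable_mult_right[OF integrable_decay_weight, of C] assms(1)])
       (rule AE_I2, unfold real_norm_def, rule order_trans[OF b abs_ge_self])
  have "(LINT x|lebesgue. norm (f x)) \<le> (LINT x|lebesgue. C * ?w x)"
    by (rule integral_mono[OF integrable_norm[OF i] integrable_mult_right[OF integrable_decay_weight] b])
  then show "(LINT x|lebesgue. norm (f x)) \<le> C * (LINT x|lebesgue. ?w x)"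
    by (simp only: integral_mult_right_zero)
qed

lemma integrable_compact_support:
  fixes f :: "'a::euclidean_space \<Rightarrow> 'b::euclidean_space"
  assumes "continuous_on UNIV f" "compact K" "\<And>x. x \<notin> K \<Longrightarrow> f x = 0"
  shows "integrable lebesgue f"
proof -
  have "integrable lborel (\<lambda>x. indicator K x *\<^sub>R f x)"
    by (rule borel_integrable_compact[OF assms(2) continuous_on_subset[OF assms(1)]]) auto
  moreover have "(\<lambda>x. indicator K x *\<^sub>R f x) = f" using assms(3) by (auto simp: indicator_def)
  ultimately show ?thesis by (simp add: integrable_completion)
qed

lemma locally_integrable_UNIV:
  assumes "locally_integrable UNIV g"
  shows "g \<in> borel_measurable lebesgue"
    and "compact K \<Longrightarrow> integrable lebesgue (\<lambda>x. indicator K x *\<^sub>R g x)"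
  using assms unfolding locally_integrable_def set_integrable_def by (auto simp: lebesgue_on_UNIV_eq)

lemma locally_integrable_mult:
  assumes "locally_integrable UNIV g" and [measurable]: "\<psi> \<in> borel_measurable lebesgue"
    and "compact K" "\<And>x. x \<notin> K \<Longrightarrow> \<psi> x = 0" "\<And>x. norm (\<psi> x) \<le> M"
  shows "integrable lebesgue (\<lambda>x. g x * \<psi> x)"
proof (rule Bochner_Integration.integrable_bound)
  show "integrable lebesgue (\<lambda>x. (indicator K x *\<^sub>R g x) * of_real M)"
    using locally_integrable_UNIV(2)[OF assms(1,3)] by (intro integrable_mult_left)
  have [measurable]: "g \<in> borel_measurable lebesgue" using locally_integrable_UNIV(1)[OF assms(1)] .
  show "(\<lambda>x. g x * \<psi> x) \<in> borel_measurable lebesgue" by measurable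
  show "AE x in lebesgue. norm (g x * \<psi> x) \<le> norm ((indicator K x *\<^sub>R g x) * of_real M)"
  proof (rule AE_I2)
    fix x
    show "norm (g x * \<psi> x) \<le> norm ((indicator K x *\<^sub>R g x) * of_real M)"
    proof (cases "x \<in> K")
      case True
      have "norm (\<psi> x) \<le> \<bar>M\<bar>" using assms(5)[of x] by linarith
      then show ?thesis using True by (auto simp: norm_mult intro!: mult_left_mono)
    qed (use assms(4) in auto)
  qed
qed

lemma test_function_bounded:
  assumes "test_function S \<psi>" obtains M where "0 \<le> M" "\<And>x. norm (\<psi> x) \<le> M"
  using schwartzD[OF test_function_schwartz[OF assms], of "[]" 0] by auto

lemma test_function_measurable: "test_function S \<psi> \<Longrightarrow> \<psi> \<in> borel_measurable lebesgue"
  by (intro continuous_borel_measurable_lebesgue smooth_continuous test_function_smooth)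

lemma test_function_integrable:
  assumes "test_function S \<psi>" shows "integrable lebesgue \<psi>"
proof -
  obtain K where "compact K" "K \<subseteq> S" "\<And>x. x \<notin> K \<Longrightarrow> \<psi> x = 0" using test_functionD[OF assms] by metis
  then show ?thesis
    by (intro integrable_compact_support[of \<psi> K] smooth_continuous test_function_smooth[OF assms]) auto
qed

lemma locally_integrable_mult_test:
  assumes g: "locally_integrable UNIV g" and t: "test_function S \<psi>"
  shows "integrable lebesgue (\<lambda>x. g x * \<psi> x)"
proof -
  obtain K where K: "compact K" "K \<subseteq> S" "\<And>x. x \<notin> K \<Longrightarrow> \<psi> x = 0" using test_functionD[OF t] by metis
  obtain M where M: "\<And>x. norm (\<psi> x) \<le> M" using test_function_bounded[OF t] by metis
  show ?thesis
    by (rule locally_integrable_mult[OF g test_function_measurable[OF t] K(1) K(3) M])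
qed

lemma integrable_locally_integrable:
  assumes "integrable lebesgue g" shows "locally_integrable UNIV g"
  unfolding locally_integrable_def using assms
  by (auto simp: lebesgue_on_UNIV_eq set_integrable_def compact_imp_closed intro!: integrable_mult_indicator)

lemma schwartz_integrable:
  assumes "schwartz u" shows "integrable lebesgue u"
proof -
  obtain C where "\<And>x. (1 + norm x) ^ (DIM('a) + 1) * norm (iter_deriv [] u x) \<le> C"
    using schwartzD[OF assms, of "[]" "DIM('a) + 1"] by auto
  then show ?thesis
    by (intro integrable_decay(1) continuous_borel_measurable_lebesgue smooth_continuous schwartz_smooth[OF assms]) auto
qed

section \<open>Differentiation under the integral sign and convolutions\<close>

lemma frechet_derivative_Basis:
  fixes f :: "'a::euclidean_space \<Rightarrow> 'b::real_normed_vector"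
  assumes "f differentiable (at x)"
  shows "frechet_derivative f (at x) h = (\<Sum>b\<in>Basis. (h \<bullet> b) *\<^sub>R iter_deriv [b] f x)"
proof -
  interpret linear "frechet_derivative f (at x)" using assms linear_frechet_derivative by blast
  have "frechet_derivative f (at x) h = frechet_derivative f (at x) (\<Sum>b\<in>Basis. (h \<bullet> b) *\<^sub>R b)"
    by (simp add: euclidean_representation)
  then show ?thesis by (simp add: sum scale)
qed

lemma lipschitz_of_partials:
  fixes f :: "'a::euclidean_space \<Rightarrow> 'b::real_normed_vector"
  assumes d: "\<And>x. f differentiable (at x)"
    and B: "\<And>b x. b \<in> Basis \<Longrightarrow> norm (iter_deriv [b] f x) \<le> B"
  shows "norm (f x - f y) \<le> real DIM('a) * B * norm (x - y)"
proof (rule differentiable_bound[of UNIV f "\<lambda>x. frechet_derivative f (at x)"])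
  show "onorm (frechet_derivative f (at x)) \<le> real DIM('a) * B" for x
  proof (rule onorm_le)
    fix h
    have "norm (\<Sum>b\<in>Basis. (h \<bullet> b) *\<^sub>R iter_deriv [b] f x) \<le> real (card (Basis::'a set)) * (norm h * B)"
    proof (rule sum_norm_bound)
      fix b :: 'a assume b: "b \<in> Basis"
      show "norm ((h \<bullet> b) *\<^sub>R iter_deriv [b] f x) \<le> norm h * B"
        unfolding norm_scaleR by (rule mult_mono[OF Basis_le_norm[OF b] B[OF b]]) auto
    qed
    then show "norm (frechet_derivative f (at x) h) \<le> real DIM('a) * B * norm h"
      unfolding frechet_derivative_Basis[OF d] by (simp only: mult.assoc mult.commute[of B "norm h"])
  qed
qed (use d has_frechet_derivative in auto)

text \<open>The mean value inequality is applied to \<open>k\<close> minus its differential at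
  \<open>x\<close>; on the segment the derivative of this difference is of order
  \<open>norm h\<close> by the Lipschitz bound for the partial derivatives. The point is that the
  constant is uniform in \<open>x\<close>.\<close>

lemma quadratic_remainder:
  fixes k :: "'a::euclidean_space \<Rightarrow> 'b::real_normed_vector"
  assumes k: "smooth k" and B: "\<And>b c x. b \<in> Basis \<Longrightarrow> c \<in> Basis \<Longrightarrow> norm (iter_deriv [c, b] k x) \<le> B"
  shows "norm (k (x + h) - k x - frechet_derivative k (at x) h) \<le> (real DIM('a))\<^sup>2 * B * (norm h)\<^sup>2"
proof -
  have d: "k differentiable (at z)" for z by (rule smooth_differentiable[OF k])
  define D where "D = frechet_derivative k (at x)"
  have linD: "linear D" unfolding D_def using d linear_frechet_derivative by blast
  have sk: "smooth (iter_deriv [b] k)" if "b \<in> Basis" for b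
    by (rule smooth_iter_deriv[OF k]) (use that in simp)
  have diffb: "norm (iter_deriv [b] k z - iter_deriv [b] k x) \<le> real DIM('a) * B * norm (z - x)" if "b \<in> Basis" for b z
    by (rule lipschitz_of_partials) (use smooth_differentiable[OF sk[OF that]] B[OF that] in auto)
  have B0: "0 \<le> B"
  proof -
    obtain b :: 'a where "b \<in> Basis" using nonempty_Basis by blast
    then show ?thesis using order_trans[OF norm_ge_zero B[of b b 0]] by simp
  qed
  have der: "((\<lambda>z. k z - D z) has_derivative (\<lambda>h. frechet_derivative k (at z) h - D h)) (at z within S)" for z S
    by (intro has_derivative_diff has_derivative_at_withinI[OF has_frechet_derivative[OF d]]
        has_derivative_at_withinI[OF linear_imp_has_derivative[OF linD]])
  have "norm ((k (x + h) - D (x + h)) - (k x - D x)) \<le> ((real DIM('a))\<^sup>2 * B * norm h) * norm (x + h - x)"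
  proof (rule differentiable_bound[of "closed_segment x (x + h)" "\<lambda>z. k z - D z", OF _ der])
    fix z assume z: "z \<in> closed_segment x (x + h)"
    then have zx: "norm (z - x) \<le> norm h"
      using segment_bound(1)[OF z] by (simp add: norm_minus_commute)
    show "onorm (\<lambda>h. frechet_derivative k (at z) h - D h) \<le> (real DIM('a))\<^sup>2 * B * norm h"
    proof (rule onorm_le)
      fix v
      have "frechet_derivative k (at z) v - D v = (\<Sum>b\<in>Basis. (v \<bullet> b) *\<^sub>R (iter_deriv [b] k z - iter_deriv [b] k x))"
        unfolding D_def by (simp only: frechet_derivative_Basis[OF d, of _ v] scaleR_diff_right sum_subtractf)
      moreover have "norm (\<Sum>b\<in>Basis. (v \<bullet> b) *\<^sub>R (iter_deriv [b] k z - iter_deriv [b] k x))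
         \<le> real (card (Basis::'a set)) * (norm v * (real DIM('a) * B * norm h))"
      proof (rule sum_norm_bound)
        fix b :: 'a assume b: "b \<in> Basis"
        have "norm (iter_deriv [b] k z - iter_deriv [b] k x) \<le> real DIM('a) * B * norm h"
          by (rule order_trans[OF diffb[OF b]]) (use zx B0 in \<open>auto intro!: mult_left_mono\<close>)
        then show "norm ((v \<bullet> b) *\<^sub>R (iter_deriv [b] k z - iter_deriv [b] k x)) \<le> norm v * (real DIM('a) * B * norm h)"
          unfolding norm_scaleR by (rule mult_mono[OF Basis_le_norm[OF b]]) auto
      qed
      ultimately have "norm (frechet_derivative k (at z) v - D v) \<le> real DIM('a) * (norm v * (real DIM('a) * B * norm h))"
        by (simp only:)
      also have "\<dots> = (real DIM('a))\<^sup>2 * B * norm h * norm v" by (simp add: power2_eq_square)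
      finally show "norm (frechet_derivative k (at z) v - D v) \<le> (real DIM('a))\<^sup>2 * B * norm h * norm v" .
    qed
  qed auto
  moreover have "D (x + h) = D x + D h" using linD by (simp add: linear_add)
  ultimately show ?thesis unfolding D_def[symmetric] by (simp add: power2_eq_square algebra_simps)
qed

text \<open>A remainder that is quadratic in \<open>h\<close> with an integrable constant can simply
  be integrated. This serves convolutions, through \<open>quadratic_remainder\<close>, and Fourier
  integrals, through the Taylor expansion of the character.\<close>

lemma has_derivative_integral_quadratic:
  fixes f :: "'a::euclidean_space \<Rightarrow> 'b \<Rightarrow> 'c::euclidean_space"
  assumes f: "\<And>x. integrable M (f x)" and f': "\<And>h. integrable M (\<lambda>y. f' y h)"
    and lin: "\<And>y. linear (f' y)" and C: "integrable M C"
    and q: "\<And>h y. norm (f (x + h) y - f x y - f' y h) \<le> C y * (norm h)\<^sup>2"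
  shows "((\<lambda>x. \<integral>y. f x y \<partial>M) has_derivative (\<lambda>h. \<integral>y. f' y h \<partial>M)) (at x)"
  unfolding has_derivative_at
proof
  show "bounded_linear (\<lambda>h. \<integral>y. f' y h \<partial>M)"
    unfolding linear_conv_bounded_linear[symmetric]
    using f' by (intro linearI) (simp_all add: linear_add[OF lin] linear_cmul[OF lin])
  define I where "I = (\<integral>y. C y \<partial>M)"
  have bound: "norm ((\<integral>y. f (x + h) y \<partial>M) - (\<integral>y. f x y \<partial>M) - (\<integral>y. f' y h \<partial>M)) / norm h \<le> I * norm h" for h
  proof -
    have "norm ((\<integral>y. f (x + h) y \<partial>M) - (\<integral>y. f x y \<partial>M) - (\<integral>y. f' y h \<partial>M))
       = norm (\<integral>y. f (x + h) y - f x y - f' y h \<partial>M)" using f f' by simp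
    also have "\<dots> \<le> (\<integral>y. norm (f (x + h) y - f x y - f' y h) \<partial>M)"
      by (rule integral_norm_bound)
    also have "\<dots> \<le> (\<integral>y. C y * (norm h)\<^sup>2 \<partial>M)"
      by (rule integral_mono[OF integrable_norm[OF Bochner_Integration.integrable_diff[OF
          Bochner_Integration.integrable_diff[OF f f] f']] integrable_mult_left[OF C] q])
    also have "\<dots> = I * (norm h)\<^sup>2" by (simp add: I_def)
    finally show ?thesis by (simp add: divide_simps power2_eq_square mult_ac)
  qed
  have lim: "(\<lambda>h::'a. I * norm h) \<midarrow>0\<rightarrow> 0"
    by (intro tendsto_mult_right_zero tendsto_norm_zero tendsto_ident_at)
  show "(\<lambda>h. norm ((\<integral>y. f (x + h) y \<partial>M) - (\<integral>y. f x y \<partial>M) - (\<integral>y. f' y h \<partial>M)) / norm h) \<midarrow>0\<rightarrow> 0"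
    by (rule Lim_null_comparison[OF always_eventually lim]) (use bound in simp)
qed

section \<open>Convolution of integrable functions with smooth kernels\<close>

definition conv :: "('a::euclidean_space \<Rightarrow> complex) \<Rightarrow> ('a \<Rightarrow> complex) \<Rightarrow> 'a \<Rightarrow> complex" where
  "conv k w x = (LINT y|lebesgue. w y * k (x - y))"

text \<open>Besides the Schwartz functions this class contains the constants, hence the complements
  \<open>1 - \<theta>\<close> of cut-off functions, and its members multiply Schwartz functions into
  Schwartz functions.\<close>

definition smooth_bounded :: "('a::euclidean_space \<Rightarrow> complex) \<Rightarrow> bool" where
  "smooth_bounded k \<longleftrightarrow> smooth k \<and> (\<forall>vs. set vs \<subseteq> Basis \<longrightarrow> (\<exists>B. \<forall>x. norm (iter_deriv vs k x) \<le> B))"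

lemma schwartz_smooth_bounded: "schwartz k \<Longrightarrow> smooth_bounded k"
proof -
  assume k: "schwartz k"
  have "\<exists>B. \<forall>x. norm (iter_deriv vs k x) \<le> B" if "set vs \<subseteq> Basis" for vs
    using schwartzD[OF k that, of 0] by (metis mult_1 power_0)
  then show ?thesis using schwartz_smooth[OF k] unfolding smooth_bounded_def by blast
qed

lemma smooth_bounded_iter_deriv:
  "smooth_bounded k \<Longrightarrow> set vs \<subseteq> Basis \<Longrightarrow> smooth_bounded (iter_deriv vs k)"
  unfolding smooth_bounded_def using smooth_iter_deriv[of k vs] by (simp flip: iter_deriv_append)

lemma integrable_mult_bounded_continuous:
  fixes w k :: "'a::euclidean_space \<Rightarrow> complex"
  assumes "integrable lebesgue w" "continuous_on UNIV k" "\<And>x. norm (k x) \<le> B"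
  shows "integrable lebesgue (\<lambda>y. w y * k y)"
proof (rule Bochner_Integration.integrable_bound)
  show "integrable lebesgue (\<lambda>y. w y * of_real B)" using assms(1) by simp
  have [measurable]: "k \<in> borel_measurable lebesgue" "w \<in> borel_measurable lebesgue"
    using continuous_borel_measurable_lebesgue[OF assms(2)] assms(1) by auto
  show "(\<lambda>y. w y * k y) \<in> borel_measurable lebesgue" by measurable
  show "AE x in lebesgue. norm (w x * k x) \<le> norm (w x * of_real B)"
    using assms(3) by (auto simp: norm_mult intro!: mult_left_mono order_trans[OF _ abs_ge_self])
qed

lemma conv_integrable:
  assumes "smooth_bounded k" "integrable lebesgue w"
  shows "integrable lebesgue (\<lambda>y. w y * k (x - y))"
proof -
  obtain B where B: "\<And>x. norm (iter_deriv [] k x) \<le> B"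
    using assms(1) unfolding smooth_bounded_def by (metis empty_set empty_subsetI)
  have "continuous_on UNIV (\<lambda>y. k (x - y))"
    using smooth_continuous[of k UNIV] assms(1) unfolding smooth_bounded_def
    by (intro continuous_on_compose2[of UNIV k UNIV "\<lambda>y. x - y"] continuous_intros) auto
  then show ?thesis using B by (intro integrable_mult_bounded_continuous[OF assms(2)]) auto
qed

lemma conv_has_derivative:
  assumes k: "smooth_bounded k" and w: "integrable lebesgue w"
  shows "(conv k w has_derivative (\<lambda>h. LINT y|lebesgue. w y * frechet_derivative k (at (x - y)) h)) (at x)"
proof -
  have sk: "smooth k" using k by (simp add: smooth_bounded_def)
  have "\<exists>B. \<forall>x. norm (iter_deriv [c, b] k x) \<le> B" if "b \<in> Basis" "c \<in> Basis" for b c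
    using k that unfolding smooth_bounded_def by (metis empty_subsetI insert_subset list.set(1) list.set(2))
  then obtain B' where B': "\<And>b c x. b \<in> Basis \<Longrightarrow> c \<in> Basis \<Longrightarrow> norm (iter_deriv [c, b] k x) \<le> B' b c"
    by metis
  define B where "B = (\<Sum>b\<in>Basis. \<Sum>c\<in>Basis. B' b c)"
  have B'0: "0 \<le> B' b c" if "b \<in> Basis" "c \<in> Basis" for b c
    using order_trans[OF norm_ge_zero B'[OF that, of 0]] .
  have B: "norm (iter_deriv [c, b] k x) \<le> B" if "b \<in> Basis" "c \<in> Basis" for b c x
  proof -
    have "B' b c \<le> (\<Sum>c\<in>Basis. B' b c)" using that B'0 by (intro member_le_sum) auto
    also have "\<dots> \<le> B" unfolding B_def using that B'0
      by (intro member_le_sum[of b Basis "\<lambda>b. \<Sum>c\<in>Basis. B' b c"] sum_nonneg) auto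
    finally show ?thesis using B'[OF that, of x] by linarith
  qed
  have lin: "linear (frechet_derivative k (at z))" for z
    using smooth_differentiable[OF sk] linear_frechet_derivative by blast
  have "((\<lambda>x. LINT y|lebesgue. w y * k (x - y)) has_derivative
      (\<lambda>h. LINT y|lebesgue. w y * frechet_derivative k (at (x - y)) h)) (at x)"
  proof (rule has_derivative_integral_quadratic[where C = "\<lambda>y. norm (w y) * ((real DIM('a))\<^sup>2 * B)"])
    show "integrable lebesgue (\<lambda>y. w y * k (x - y))" for x by (rule conv_integrable[OF k w])
    show "integrable lebesgue (\<lambda>y. w y * frechet_derivative k (at (x - y)) h)" for h
    proof -
      have "integrable lebesgue (\<lambda>y. \<Sum>b\<in>Basis. (h \<bullet> b) *\<^sub>R (w y * iter_deriv [b] k (x - y)))"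
        using conv_integrable[OF smooth_bounded_iter_deriv[OF k] w, of "[_]"]
        by (intro Bochner_Integration.integrable_sum integrable_scaleR_right) auto
      then show ?thesis
        by (simp only: frechet_derivative_Basis[OF smooth_differentiable[OF sk], of _ h] sum_distrib_left mult_scaleR_right)
    qed
    show "linear (\<lambda>h. w y * frechet_derivative k (at (x - y)) h)" for y
      using lin[of "x - y"] by (intro linearI) (simp_all add: linear_add linear_cmul distrib_left)
    show "integrable lebesgue (\<lambda>y. norm (w y) * ((real DIM('a))\<^sup>2 * B))" using w by simp
    fix h y
    have "x + h - y = (x - y) + h" by simp
    then have "norm (w y * k (x + h - y) - w y * k (x - y) - w y * frechet_derivative k (at (x - y)) h)
       = norm (w y) * norm (k ((x - y) + h) - k (x - y) - frechet_derivative k (at (x - y)) h)"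
      by (simp add: norm_mult[symmetric] algebra_simps)
    also have "\<dots> \<le> norm (w y) * ((real DIM('a))\<^sup>2 * B * (norm h)\<^sup>2)"
      by (intro mult_left_mono quadratic_remainder[OF sk B]) auto
    finally show "norm (w y * k (x + h - y) - w y * k (x - y) - w y * frechet_derivative k (at (x - y)) h)
       \<le> norm (w y) * ((real DIM('a))\<^sup>2 * B) * (norm h)\<^sup>2" by (simp add: mult_ac)
  qed
  then show ?thesis unfolding conv_def[abs_def] .
qed

lemma iter_deriv_conv:
  assumes k: "smooth_bounded k" and w: "integrable lebesgue w" and vs: "set vs \<subseteq> Basis"
  shows "iter_deriv vs (conv k w) = conv (iter_deriv vs k) w"
  using vs
proof (induction vs)
  case (Cons v vs)
  then have vs: "set vs \<subseteq> Basis" by simp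
  have "iter_deriv (v # vs) (conv k w) x = conv (iter_deriv (v # vs) k) w x" for x
    unfolding iter_deriv.simps Cons.IH[OF vs]
    using frechet_derivative_eqI[OF conv_has_derivative[OF smooth_bounded_iter_deriv[OF k vs] w, of x]]
    by (simp add: conv_def)
  then show ?case by blast
qed simp

lemma smooth_conv:
  assumes k: "smooth_bounded k" and w: "integrable lebesgue w"
  shows "smooth (conv k w)"
  unfolding smooth_def
  using conv_has_derivative[OF smooth_bounded_iter_deriv[OF k] w]
  by (auto simp: iter_deriv_conv[OF k w] differentiable_def)

section \<open>The Fourier transform\<close>

definition character :: "real \<Rightarrow> complex" where
  "character t = exp (2 * pi * \<i> * of_real t)"

lemma character_cis: "character t = cis (2 * pi * t)"
  by (simp add: character_def cis_conv_exp mult_ac)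

lemma norm_character [simp]: "norm (character t) = 1"
  by (simp add: character_cis)

lemma character_add: "character (s + t) = character s * character t"
  by (simp add: character_def distrib_left flip: exp_add)

lemma character_0 [simp]: "character 0 = 1"
  by (simp add: character_def)

lemma character_minus_mult [simp]: "character (- t) * character t = 1"
  using character_add[of "-t" t] by simp

lemma cnj_character: "cnj (character t) = character (- t)"
  by (simp add: character_cis cis_cnj)

lemma continuous_character [continuous_intros]:
  "continuous_on S f \<Longrightarrow> continuous_on S (\<lambda>x. character (f x))"
  unfolding character_def by (intro continuous_intros)

lemma character_remainder:
  "norm (character (t + s) - character t - character t * (2 * pi * \<i> * of_real s)) \<le> (2 * pi)\<^sup>2 * s\<^sup>2"
proof -
  define z where "z = 2 * pi * \<i> * of_real s"
  have "norm (exp z - (\<Sum>i\<le>1. z ^ i / fact i)) \<le> exp \<bar>Re z\<bar> * (norm z) ^ Suc 1 / fact 1"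
    by (rule Taylor_exp)
  moreover have "Re z = 0" "norm z = 2 * pi * \<bar>s\<bar>" by (auto simp: z_def norm_mult)
  ultimately have "norm (exp z - 1 - z) \<le> (2 * pi)\<^sup>2 * s\<^sup>2"
    by (simp add: power_mult_distrib power2_eq_square algebra_simps)
  moreover have "character (t + s) - character t - character t * (2 * pi * \<i> * of_real s)
      = character t * (exp z - 1 - z)"
    unfolding character_add by (simp add: z_def algebra_simps character_def)
  ultimately show ?thesis by (simp only: norm_mult norm_character mult_1)
qed

lemma inv_fourier_character: "inv_fourier f x = (LINT y|lebesgue. f y * character (x \<bullet> y))"
  by (simp add: inv_fourier_def character_def)

lemma fourier_inv_fourier: "fourier f x = inv_fourier f (- x)"
  by (simp add: fourier_def inv_fourier_def inner_commute)

lemma integrable_mult_character: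
  fixes f :: "'a::euclidean_space \<Rightarrow> complex"
  assumes "integrable lebesgue f" shows "integrable lebesgue (\<lambda>y. f y * character (x \<bullet> y))"
  by (rule integrable_mult_bounded_continuous[OF assms, of _ 1]) (auto intro!: continuous_intros)

lemma norm_inv_fourier_le: "norm (inv_fourier f x) \<le> (LINT y|lebesgue. norm (f y))"
proof -
  have "norm (inv_fourier f x) \<le> (LINT y|lebesgue. norm (f y * character (x \<bullet> y)))"
    unfolding inv_fourier_character by (rule integral_norm_bound)
  then show ?thesis by (simp add: norm_mult)
qed

text \<open>The two characters merge into \<open>character ((x - y) \<bullet> \<xi>)\<close>, and
  integrating in \<open>\<xi>\<close> first leaves a convolution. Only Fubini is involved, not the
  inversion theorem.\<close>

lemma inv_fourier_mult_fourier:
  assumes m: "integrable lebesgue m" and w: "integrable lebesgue w"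
  shows "inv_fourier (\<lambda>\<xi>. m \<xi> * fourier w \<xi>) x = conv (inv_fourier m) w x"
proof -
  let ?c = "\<lambda>\<xi> y. character ((x - y) \<bullet> \<xi>)"
  have "inv_fourier (\<lambda>\<xi>. m \<xi> * fourier w \<xi>) x =
      (LINT \<xi>|lebesgue. LINT y|lebesgue. m \<xi> * w y * ?c \<xi> y)"
    unfolding inv_fourier_character fourier_inv_fourier
    by (intro Bochner_Integration.integral_cong refl, subst integral_mult_right_zero[symmetric], subst integral_mult_left_zero[symmetric])
       (simp add: inner_diff_left inner_diff_right mult_ac inner_commute flip: character_add)
  also have "\<dots> = (LINT y|lebesgue. LINT \<xi>|lebesgue. m \<xi> * w y * ?c \<xi> y)"
    by (rule fubini_bounded(1)[OF m w, of _ 1]) (auto intro!: borel_measurable_continuous_onI continuous_intros)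
  also have "\<dots> = conv (inv_fourier m) w x"
    unfolding conv_def inv_fourier_character
    by (intro Bochner_Integration.integral_cong refl, subst integral_mult_right_zero[symmetric]) (simp add: mult_ac)
  finally show ?thesis .
qed

lemma inv_fourier_reflect: "inv_fourier f (- x) = inv_fourier (\<lambda>y. f (- y)) x"
  using integral_scaling(2)[of "-1" "\<lambda>y. f y * character (- x \<bullet> y)" 0]
  by (simp add: inv_fourier_character)

lemma fourier_mult_inv_fourier:
  assumes m: "integrable lebesgue m" and w: "integrable lebesgue w"
  shows "fourier (\<lambda>\<xi>. m \<xi> * inv_fourier w \<xi>) x = conv (fourier m) w x"
proof -
  have m': "integrable lebesgue (\<lambda>y. m (- y))"
    using integral_scaling(1)[of "-1" m 0] m by simp
  have "fourier (\<lambda>\<xi>. m \<xi> * inv_fourier w \<xi>) x = inv_fourier (\<lambda>\<xi>. m (- \<xi>) * fourier w \<xi>) x"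
    unfolding fourier_inv_fourier inv_fourier_reflect[of "\<lambda>\<xi>. m \<xi> * inv_fourier w \<xi>"] by simp
  also have "\<dots> = conv (inv_fourier (\<lambda>y. m (- y))) w x"
    by (rule inv_fourier_mult_fourier[OF m' w])
  also have "inv_fourier (\<lambda>y. m (- y)) = fourier m"
    by (rule ext) (simp only: fourier_inv_fourier inv_fourier_reflect)
  finally show ?thesis .
qed

lemma fourier_duality:
  fixes a b :: "'a::euclidean_space \<Rightarrow> complex"
  assumes a: "integrable lebesgue a" and b: "integrable lebesgue b"
  shows "(LINT x|lebesgue. a x * inv_fourier b x) = (LINT y|lebesgue. inv_fourier a y * b y)"
proof -
  have "(LINT x|lebesgue. a x * inv_fourier b x) =
      (LINT x|lebesgue. LINT y|lebesgue. a x * b y * character (x \<bullet> y))"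
    unfolding inv_fourier_character
    by (intro Bochner_Integration.integral_cong refl, subst integral_mult_right_zero[symmetric]) (simp add: mult_ac)
  also have "\<dots> = (LINT y|lebesgue. LINT x|lebesgue. a x * b y * character (x \<bullet> y))"
    by (rule fubini_bounded(1)[OF a b, of _ 1]) (auto intro!: borel_measurable_continuous_onI continuous_intros)
  also have "\<dots> = (LINT y|lebesgue. inv_fourier a y * b y)"
    unfolding inv_fourier_character
    by (intro Bochner_Integration.integral_cong refl, subst integral_mult_left_zero[symmetric])
       (simp add: mult_ac inner_commute)
  finally show ?thesis .
qed

lemma inv_fourier_affine:
  fixes g :: "'a::euclidean_space \<Rightarrow> complex"
  assumes "c \<noteq> 0"
  shows "inv_fourier (\<lambda>x. g (z + c *\<^sub>R x)) \<xi> =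
    of_real (1 / \<bar>c\<bar> ^ DIM('a)) * character (- (z \<bullet> \<xi>) / c) * inv_fourier g ((1 / c) *\<^sub>R \<xi>)"
proof -
  have "inv_fourier g ((1 / c) *\<^sub>R \<xi>) =
      \<bar>c\<bar> ^ DIM('a) *\<^sub>R (LINT x|lebesgue. g (z + c *\<^sub>R x) * character (((1 / c) *\<^sub>R \<xi>) \<bullet> (z + c *\<^sub>R x)))"
    unfolding inv_fourier_character by (rule integral_scaling(2)[OF assms])
  also have "(LINT x|lebesgue. g (z + c *\<^sub>R x) * character (((1 / c) *\<^sub>R \<xi>) \<bullet> (z + c *\<^sub>R x))) =
      (LINT x|lebesgue. character ((z \<bullet> \<xi>) / c) * (g (z + c *\<^sub>R x) * character (\<xi> \<bullet> x)))"
    using assms by (intro Bochner_Integration.integral_cong refl)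
      (simp add: inner_add_right add_divide_distrib character_add inner_commute mult_ac)
  also have "\<dots> = character ((z \<bullet> \<xi>) / c) * inv_fourier (\<lambda>x. g (z + c *\<^sub>R x)) \<xi>"
    by (simp add: inv_fourier_character)
  finally have "character (- ((z \<bullet> \<xi>) / c)) * inv_fourier g ((1 / c) *\<^sub>R \<xi>) = \<bar>c\<bar> ^ DIM('a) *\<^sub>R inv_fourier (\<lambda>x. g (z + c *\<^sub>R x)) \<xi>"
    by (simp add: scaleR_conv_of_real mult.assoc[symmetric] mult.commute[of _ "of_real _"])
  then show ?thesis using assms by (simp add: scaleR_conv_of_real field_simps)
qed

section \<open>Derivatives and rapid decay of Fourier integrals of test functions\<close>

lemma test_function_mult_linear:
  fixes a :: "'a::euclidean_space \<Rightarrow> complex"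
  assumes "test_function UNIV a"
  shows "test_function UNIV (\<lambda>y. a y * of_real (b \<bullet> y) * (2 * pi * \<i>))"
proof -
  have "bounded_linear (\<lambda>y. complex_of_real (b \<bullet> y))"
    using bounded_linear_compose[OF bounded_linear_of_real bounded_linear_inner_right] .
  from test_function_mult(2)[OF test_function_mult(2)[OF assms smooth_bounded_linear[OF this]] smooth_const]
  show ?thesis .
qed

text \<open>On the support of \<open>a\<close> one has \<open>norm y < R\<close>, which turns the
  second-order remainder of the character, quadratic in \<open>h \<bullet> y\<close>, into an
  integrable constant times the square of \<open>norm h\<close>.\<close>

lemma inv_fourier_has_derivative:
  fixes a :: "'a::euclidean_space \<Rightarrow> complex"
  assumes a: "test_function UNIV a"
  shows "(inv_fourier a has_derivative (\<lambda>h. inv_fourier (\<lambda>y. a y * of_real (h \<bullet> y) * (2 * pi * \<i>)) x)) (at x)"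
proof -
  obtain R where R: "0 < R" "\<And>y. R \<le> norm y \<Longrightarrow> a y = 0" using test_function_bounded_support[OF a] by metis
  have ai: "integrable lebesgue a" by (rule test_function_integrable[OF a])
  have "((\<lambda>x. LINT y|lebesgue. a y * character (x \<bullet> y)) has_derivative
      (\<lambda>h. LINT y|lebesgue. (a y * of_real (h \<bullet> y) * (2 * pi * \<i>)) * character (x \<bullet> y))) (at x)"
  proof (rule has_derivative_integral_quadratic[where C = "\<lambda>y. norm (a y) * ((2 * pi)\<^sup>2 * R\<^sup>2)"])
    show "integrable lebesgue (\<lambda>y. a y * character (x \<bullet> y))" for x
      by (rule integrable_mult_character[OF ai])
    show "integrable lebesgue (\<lambda>y. (a y * of_real (h \<bullet> y) * (2 * pi * \<i>)) * character (x \<bullet> y))" for h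
      by (rule integrable_mult_character[OF test_function_integrable[OF test_function_mult_linear[OF a]]])
    show "linear (\<lambda>h. a y * of_real (h \<bullet> y) * (2 * pi * \<i>) * character (x \<bullet> y))" for y
      by (intro linearI) (simp_all add: inner_add_left distrib_left distrib_right scaleR_conv_of_real)
    show "integrable lebesgue (\<lambda>y. norm (a y) * ((2 * pi)\<^sup>2 * R\<^sup>2))" using ai by simp
    fix h y
    have "norm (a y * character ((x + h) \<bullet> y) - a y * character (x \<bullet> y) - a y * of_real (h \<bullet> y) * (2 * pi * \<i>) * character (x \<bullet> y))
      = norm (a y * (character (x \<bullet> y + h \<bullet> y) - character (x \<bullet> y) - character (x \<bullet> y) * (2 * pi * \<i> * of_real (h \<bullet> y))))"
      by (simp add: inner_add_left algebra_simps)
    also have "\<dots> \<le> norm (a y) * ((2 * pi)\<^sup>2 * (h \<bullet> y)\<^sup>2)"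
      unfolding norm_mult[of "a y"] by (intro mult_left_mono character_remainder) auto
    also have "\<dots> \<le> norm (a y) * ((2 * pi)\<^sup>2 * R\<^sup>2) * (norm h)\<^sup>2"
    proof (cases "R \<le> norm y")
      case False
      have "\<bar>h \<bullet> y\<bar> \<le> norm h * R"
        using Cauchy_Schwarz_ineq2[of h y] False mult_left_mono[of "norm y" R "norm h"] by simp
      then have "(h \<bullet> y)\<^sup>2 \<le> (norm h * R)\<^sup>2" using R(1) by (intro abs_le_square_iff[THEN iffD1]) (simp add: abs_mult)
      then have "norm (a y) * ((2 * pi)\<^sup>2 * (h \<bullet> y)\<^sup>2) \<le> norm (a y) * ((2 * pi)\<^sup>2 * (norm h * R)\<^sup>2)"
        by (intro mult_left_mono) auto
      then show ?thesis by (simp add: power_mult_distrib mult_ac)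
    qed (use R(2) in auto)
    finally show "norm (a y * character ((x + h) \<bullet> y) - a y * character (x \<bullet> y) - a y * of_real (h \<bullet> y) * (2 * pi * \<i>) * character (x \<bullet> y))
      \<le> norm (a y) * ((2 * pi)\<^sup>2 * R\<^sup>2) * (norm h)\<^sup>2" .
  qed
  then show ?thesis unfolding inv_fourier_character[abs_def] .
qed

lemma inv_fourier_partial:
  assumes a: "test_function UNIV a"
  shows "iter_deriv [b] (inv_fourier a) = inv_fourier (\<lambda>y. a y * of_real (b \<bullet> y) * (2 * pi * \<i>))"
  using frechet_derivative_eqI[OF inv_fourier_has_derivative[OF a]] by auto

lemma iter_deriv_inv_fourier:
  assumes "test_function UNIV a"
  shows "\<exists>a'. test_function UNIV a' \<and> iter_deriv vs (inv_fourier a) = inv_fourier a'"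
proof (induction vs)
  case (Cons v vs)
  then obtain a' where a': "test_function UNIV a'" "iter_deriv vs (inv_fourier a) = inv_fourier a'" by blast
  have "iter_deriv (v # vs) (inv_fourier a) = iter_deriv [v] (inv_fourier a')" using a' by simp
  then show ?case using inv_fourier_partial[OF a'(1)] test_function_mult_linear[OF a'(1)] by metis
qed (use assms in auto)

lemma smooth_inv_fourier:
  assumes a: "test_function UNIV a" shows "smooth (inv_fourier a)"
proof (rule smooth_coinduct[where P = "\<lambda>f. \<exists>a. test_function UNIV a \<and> f = inv_fourier a"])
  fix f :: "'a \<Rightarrow> complex" assume "\<exists>a. test_function UNIV a \<and> f = inv_fourier a"
  then obtain a where a: "test_function UNIV a" and f: "f = inv_fourier a" by blast
  show "(\<forall>x. f differentiable (at x)) \<and> (\<forall>b\<in>Basis. \<exists>a. test_function UNIV a \<and> iter_deriv [b] f = inv_fourier a)"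
    using inv_fourier_has_derivative[OF a] inv_fourier_partial[OF a] test_function_mult_linear[OF a]
    unfolding f differentiable_def by blast
qed (use a in blast)

text \<open>Comparing a function with its translate replaces integration by parts, and Fubini along
  coordinate lines, by the translation invariance of the Lebesgue integral.\<close>

lemma inv_fourier_of_partial:
  fixes a :: "'a::euclidean_space \<Rightarrow> complex"
  assumes a: "test_function UNIV a" and b: "b \<in> Basis"
  shows "inv_fourier (iter_deriv [b] a) x = - (2 * pi * \<i> * of_real (x \<bullet> b)) * inv_fourier a x"
proof -
  have sa: "smooth a" and ai: "integrable lebesgue a"
    using a test_function_smooth test_function_integrable by auto
  have ab: "test_function UNIV (iter_deriv [b] a)"
    using a b by (intro test_function_iter_deriv) auto
  have bi: "integrable lebesgue (iter_deriv [b] a)" by (rule test_function_integrable[OF ab])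
  obtain R where R: "0 < R" "\<And>y. R \<le> norm y \<Longrightarrow> a y = 0" using test_function_bounded_support[OF a] by metis
  have sba: "smooth_bounded a" by (rule schwartz_smooth_bounded[OF test_function_schwartz[OF a]])
  have "\<exists>B. \<forall>x. norm (iter_deriv [c, d] a x) \<le> B" if "c \<in> Basis" "d \<in> Basis" for c d
    using sba that unfolding smooth_bounded_def by (metis empty_subsetI insert_subset list.set(1) list.set(2))
  then obtain B' where B': "\<And>c d x. c \<in> Basis \<Longrightarrow> d \<in> Basis \<Longrightarrow> norm (iter_deriv [c, d] a x) \<le> B' c d"
    by metis
  define B where "B = (\<Sum>p\<in>Basis \<times> Basis. \<bar>B' (fst p) (snd p)\<bar>)"
  have B: "norm (iter_deriv [c, d] a x) \<le> B" if "d \<in> Basis" "c \<in> Basis" for c d x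
  proof -
    have "\<bar>B' c d\<bar> \<le> B" unfolding B_def
      using that member_le_sum[of "(c, d)" "Basis \<times> Basis" "\<lambda>p. \<bar>B' (fst p) (snd p)\<bar>"] by auto
    then show ?thesis using B'[OF that(2,1), of x] by linarith
  qed
  have supp: "a y = 0" "iter_deriv [b] a y = 0" if "R + 1 \<le> norm y" for y
  proof -
    show "a y = 0" using R that by simp
    have "iter_deriv [b] a y = iter_deriv [b] (\<lambda>_. 0) y"
      by (rule iter_deriv_cong_open[of "- cball 0 R"]) (use that R in auto)
    then show "iter_deriv [b] a y = 0" by (simp add: iter_deriv_const_0)
  qed
  define C where "C = (real DIM('a))\<^sup>2 * B"
  \<comment> \<open>The radius \<open>R + 2\<close> leaves room for the translation by
    \<open>t\<close> times \<open>b\<close> with \<open>\<bar>t\<bar> < 1\<close>: outside this ball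
    \<open>a\<close> vanishes at both points of the difference quotient, and so does its
    derivative.\<close>
  define V where "V = (LINT y|lebesgue. indicator (cball (0::'a) (R + 2)) y * C)"
  have Vi: "integrable lebesgue (\<lambda>y. indicator (cball (0::'a) (R + 2)) y * C)"
    by (intro integrable_mult_left integrable_real_indicator) (simp_all add: emeasure_lborel_cball_finite[simplified])
  have key: "norm (((character (- (t * (x \<bullet> b))) - 1) / of_real t) * inv_fourier a x - inv_fourier (iter_deriv [b] a) x) \<le> V * \<bar>t\<bar>"
    if t: "t \<noteq> 0" "\<bar>t\<bar> < 1" for t
  proof -
    let ?q = "\<lambda>y. (a (y + t *\<^sub>R b) - a y) / of_real t - iter_deriv [b] a y"
    have ati: "integrable lebesgue (\<lambda>y. a (y + t *\<^sub>R b))"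
      using integral_scaling(1)[of 1 a "t *\<^sub>R b"] ai by (simp add: add.commute)
    have qi: "integrable lebesgue ?q" using ati ai bi by simp
    have "inv_fourier (\<lambda>y. a (y + t *\<^sub>R b)) x = character (- (t * (x \<bullet> b))) * inv_fourier a x"
      using inv_fourier_affine[of 1 a "t *\<^sub>R b" x] by (simp add: add.commute inner_commute)
    then have "((character (- (t * (x \<bullet> b))) - 1) / of_real t) * inv_fourier a x - inv_fourier (iter_deriv [b] a) x
      = (inv_fourier (\<lambda>y. a (y + t *\<^sub>R b)) x - inv_fourier a x) / of_real t - inv_fourier (iter_deriv [b] a) x"
      by (simp add: algebra_simps diff_divide_distrib)
    also have "\<dots> = inv_fourier ?q x"
      unfolding inv_fourier_character
      using integrable_mult_character[OF ati, of x] integrable_mult_character[OF ai, of x] integrable_mult_character[OF bi, of x]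
      by (simp add: left_diff_distrib diff_divide_distrib)
    also have "norm \<dots> \<le> (LINT y|lebesgue. norm (?q y))" by (rule norm_inv_fourier_le)
    also have "\<dots> \<le> (LINT y|lebesgue. (indicator (cball (0::'a) (R + 2)) y * C) * \<bar>t\<bar>)"
    proof (rule integral_mono[OF integrable_norm[OF qi] integrable_mult_left[OF Vi]])
      fix y
      show "norm (?q y) \<le> (indicator (cball (0::'a) (R + 2)) y * C) * \<bar>t\<bar>"
      proof (cases "norm y \<le> R + 2")
        case True
        have "iter_deriv [b] a y * of_real t = frechet_derivative a (at y) (t *\<^sub>R b)"
          using linear_cmul[OF linear_frechet_derivative[OF smooth_differentiable[OF sa]], of y t b]
          by (simp add: scaleR_conv_of_real)
        then have "?q y = (a (y + t *\<^sub>R b) - a y - frechet_derivative a (at y) (t *\<^sub>R b)) / of_real t"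
          using t by (simp add: field_simps)
        then have "norm (?q y) = norm (a (y + t *\<^sub>R b) - a y - frechet_derivative a (at y) (t *\<^sub>R b)) / \<bar>t\<bar>"
          by (simp add: norm_divide)
        also have "\<dots> \<le> (C * (norm (t *\<^sub>R b))\<^sup>2) / \<bar>t\<bar>"
          unfolding C_def by (intro divide_right_mono quadratic_remainder[OF sa B]) auto
        also have "\<dots> = C * \<bar>t\<bar>" using b t by (cases "0 < t") (auto simp: power2_eq_square)
        finally show ?thesis using True by simp
      next
        case False
        have "norm y \<le> norm (y + t *\<^sub>R b) + norm (t *\<^sub>R b)"
          using norm_triangle_ineq4[of "y + t *\<^sub>R b" "t *\<^sub>R b"] by simp
        then have "R + 1 \<le> norm (y + t *\<^sub>R b)" using False t b by simp
        then show ?thesis using supp[of y] supp(1)[of "y + t *\<^sub>R b"] False by simp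
      qed
    qed
    also have "\<dots> = V * \<bar>t\<bar>" by (simp add: V_def)
    finally show ?thesis .
  qed
  have lim0: "((\<lambda>t. V * \<bar>t\<bar>) \<longlongrightarrow> 0) (at 0)"
    by (intro tendsto_mult_right_zero tendsto_rabs_zero tendsto_ident_at)
  have ev: "\<forall>\<^sub>F t::real in at 0. t \<noteq> 0 \<and> \<bar>t\<bar> < 1"
    unfolding eventually_at by (intro exI[of _ 1]) (auto simp: dist_real_def)
  have 1: "((\<lambda>t. ((character (- (t * (x \<bullet> b))) - 1) / of_real t) * inv_fourier a x) \<longlongrightarrow> inv_fourier (iter_deriv [b] a) x) (at 0)"
    by (rule LIM_zero_cancel, rule Lim_null_comparison[OF _ lim0]) (use ev key in \<open>auto elim!: eventually_mono\<close>)
  \<comment> \<open>The scalar factor in front of \<open>inv_fourier a x\<close> converges on its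
    own by Taylor expansion of the character; uniqueness of limits then gives the formula.\<close>
  have "((\<lambda>t. (character (- (t * (x \<bullet> b))) - 1) / of_real t) \<longlongrightarrow> - (2 * pi * \<i> * of_real (x \<bullet> b))) (at 0)"
  proof (rule LIM_zero_cancel, rule Lim_null_comparison[where g = "\<lambda>t. ((2 * pi)\<^sup>2 * (x \<bullet> b)\<^sup>2) * \<bar>t\<bar>"])
    have "norm ((character (- (t * (x \<bullet> b))) - 1) / of_real t - - (2 * pi * \<i> * of_real (x \<bullet> b))) \<le> ((2 * pi)\<^sup>2 * (x \<bullet> b)\<^sup>2) * \<bar>t\<bar>"
      if t: "t \<noteq> 0" for t :: real
    proof -
      have "norm ((character (- (t * (x \<bullet> b))) - 1) / of_real t - - (2 * pi * \<i> * of_real (x \<bullet> b)))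
        = norm ((character (0 + - (t * (x \<bullet> b))) - character 0 - character 0 * (2 * pi * \<i> * of_real (- (t * (x \<bullet> b))))) / of_real t)"
        using t by (intro arg_cong[of _ _ norm]) (simp add: field_simps)
      also have "\<dots> \<le> ((2 * pi)\<^sup>2 * (- (t * (x \<bullet> b)))\<^sup>2) / \<bar>t\<bar>"
        unfolding norm_divide norm_of_real by (intro divide_right_mono character_remainder) auto
      also have "\<dots> = ((2 * pi)\<^sup>2 * (x \<bullet> b)\<^sup>2) * \<bar>t\<bar>"
        using t by (simp add: power_mult_distrib power2_eq_square[of t] divide_simps)
      finally show ?thesis .
    qed
    then show "\<forall>\<^sub>F t in at 0. norm ((character (- (t * (x \<bullet> b))) - 1) / of_real t - - (2 * pi * \<i> * of_real (x \<bullet> b))) \<le> ((2 * pi)\<^sup>2 * (x \<bullet> b)\<^sup>2) * \<bar>t\<bar>"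
      using ev by (auto elim!: eventually_mono)
    show "((\<lambda>t. ((2 * pi)\<^sup>2 * (x \<bullet> b)\<^sup>2) * \<bar>t\<bar>) \<longlongrightarrow> 0) (at 0)"
      by (intro tendsto_mult_right_zero tendsto_rabs_zero tendsto_ident_at)
  qed
  from tendsto_unique[OF _ 1 tendsto_mult_right[OF this, of "inv_fourier a x"]] show ?thesis by simp
qed

text \<open>Each power of \<open>norm x\<close> is traded for one partial derivative of
  \<open>a\<close>: \<open>norm x\<close> is at most the sum of the moduli of the coordinates, and
  \<open>x \<bullet> b\<close> times \<open>inv_fourier a x\<close> is, up to a constant of modulus
  at most 1, the transform of a derivative, which is again a test function.\<close>

lemma inv_fourier_decay:
  fixes a :: "'a::euclidean_space \<Rightarrow> complex"
  assumes "test_function UNIV a"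
  shows "\<exists>C. \<forall>x. (1 + norm x) ^ N * norm (inv_fourier a x) \<le> C"
  using assms
proof (induction N arbitrary: a)
  case 0
  then show ?case using norm_inv_fourier_le[of a] by auto
next
  case (Suc N)
  obtain C where C: "\<And>x. (1 + norm x) ^ N * norm (inv_fourier a x) \<le> C" using Suc by metis
  have "\<exists>D. \<forall>x. (1 + norm x) ^ N * norm (inv_fourier (iter_deriv [b] a) x) \<le> D" if "b \<in> Basis" for b
    by (rule Suc.IH, rule test_function_iter_deriv[OF Suc.prems]) (use that in simp)
  then obtain D where D: "\<And>b x. b \<in> Basis \<Longrightarrow> (1 + norm x) ^ N * norm (inv_fourier (iter_deriv [b] a) x) \<le> D b"
    by metis
  have "(1 + norm x) ^ Suc N * norm (inv_fourier a x) \<le> C + (\<Sum>b\<in>Basis. D b)" for x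
  proof -
    have p: "0 \<le> (1 + norm x) ^ N * norm (inv_fourier a x)" by simp
    have "norm x * ((1 + norm x) ^ N * norm (inv_fourier a x)) \<le> (\<Sum>b\<in>Basis. \<bar>x \<bullet> b\<bar>) * ((1 + norm x) ^ N * norm (inv_fourier a x))"
      by (intro mult_right_mono norm_le_l1 p)
    also have "\<dots> \<le> (\<Sum>b\<in>Basis. D b)"
      unfolding sum_distrib_right
    proof (rule sum_mono)
      fix b :: 'a assume b: "b \<in> Basis"
      have "norm (inv_fourier (iter_deriv [b] a) x) = (2 * pi) * \<bar>x \<bullet> b\<bar> * norm (inv_fourier a x)"
        unfolding inv_fourier_of_partial[OF Suc.prems b] by (simp add: norm_mult)
      moreover have "1 * (\<bar>x \<bullet> b\<bar> * norm (inv_fourier a x)) \<le> (2 * pi) * (\<bar>x \<bullet> b\<bar> * norm (inv_fourier a x))"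
        using pi_gt3 by (intro mult_right_mono) auto
      ultimately have "\<bar>x \<bullet> b\<bar> * norm (inv_fourier a x) \<le> norm (inv_fourier (iter_deriv [b] a) x)" by (simp only: mult_1 mult.assoc)
      then have "(1 + norm x) ^ N * (\<bar>x \<bullet> b\<bar> * norm (inv_fourier a x)) \<le> (1 + norm x) ^ N * norm (inv_fourier (iter_deriv [b] a) x)"
        by (intro mult_left_mono) auto
      then show "\<bar>x \<bullet> b\<bar> * ((1 + norm x) ^ N * norm (inv_fourier a x)) \<le> D b"
        using D[OF b, of x] by (simp only: mult.left_commute)
    qed
    finally show ?thesis using C[of x] by (simp add: distrib_right mult.assoc)
  qed
  then show ?case by blast
qed

lemma schwartz_inv_fourier:
  assumes a: "test_function UNIV a" shows "schwartz (inv_fourier a)"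
proof (rule schwartzI[OF smooth_inv_fourier[OF a]])
  fix N and vs :: "'a list"
  obtain a' where "test_function UNIV a'" "iter_deriv vs (inv_fourier a) = inv_fourier a'"
    using iter_deriv_inv_fourier[OF a] by metis
  then show "\<exists>C. \<forall>x. (1 + norm x) ^ N * norm (iter_deriv vs (inv_fourier a) x) \<le> C"
    using inv_fourier_decay[of a' N] by simp
qed

lemma test_function_affine:
  fixes f :: "'a::euclidean_space \<Rightarrow> complex"
  assumes f: "test_function UNIV f" and c: "c \<noteq> 0"
  shows "test_function UNIV (\<lambda>x. f (c *\<^sub>R x + z))"
proof -
  obtain R where R: "0 < R" "\<And>y. R \<le> norm y \<Longrightarrow> f y = 0" using test_function_bounded_support[OF f] by metis
  show ?thesis
  proof (rule test_functionI[of _ "cball (0::'a) ((R + norm z) / \<bar>c\<bar>)"])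
    show "smooth (\<lambda>x. f (c *\<^sub>R x + z))" by (rule smooth_affine_comp[OF test_function_smooth[OF f]])
    fix x :: 'a assume "x \<notin> cball 0 ((R + norm z) / \<bar>c\<bar>)"
    then have "R + norm z < \<bar>c\<bar> * norm x" using c by (simp add: field_simps)
    moreover have "norm (c *\<^sub>R x) \<le> norm (c *\<^sub>R x + z) + norm z"
      using norm_triangle_ineq4[of "c *\<^sub>R x + z" z] by simp
    ultimately show "f (c *\<^sub>R x + z) = 0" by (intro R(2)) simp
  qed auto
qed

lemma fourier_eq_inv_fourier: "fourier a = inv_fourier (\<lambda>y. a (- y))"
  by (rule ext) (simp only: fourier_inv_fourier inv_fourier_reflect)

lemma schwartz_fourier:
  fixes a :: "'a::euclidean_space \<Rightarrow> complex"
  assumes "test_function UNIV a" shows "schwartz (fourier a)"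
  unfolding fourier_eq_inv_fourier using test_function_affine[OF assms, of "-1" 0]
  by (intro schwartz_inv_fourier) simp

section \<open>Tempered distributions\<close>

lemma tempered_cmult: "tempered_distribution T \<Longrightarrow> schwartz u \<Longrightarrow> T (\<lambda>x. c * u x) = c * T u"
  by (simp add: tempered_distribution_def)

lemma tempered_add:
  "tempered_distribution T \<Longrightarrow> schwartz u \<Longrightarrow> schwartz v \<Longrightarrow> T (\<lambda>x. u x + v x) = T u + T v"
  by (simp add: tempered_distribution_def)

lemma finite_Basis_lists: "finite {us::'a::euclidean_space list. set us \<subseteq> Basis \<and> length us \<le> N}"
  by (rule finite_lists_length_le) simp

lemma smooth_bounded_uniform:
  fixes k :: "'a::euclidean_space \<Rightarrow> complex"
  assumes "smooth_bounded k"
  obtains A where "0 \<le> A" "\<And>us x. set us \<subseteq> Basis \<Longrightarrow> length us \<le> N \<Longrightarrow> norm (iter_deriv us k x) \<le> A"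
proof -
  have "\<exists>B. \<forall>us. set us \<subseteq> Basis \<longrightarrow> (\<forall>x. norm (iter_deriv us k x) \<le> B us)"
    using assms unfolding smooth_bounded_def by metis
  then obtain B where B: "\<And>us x. set us \<subseteq> Basis \<Longrightarrow> norm (iter_deriv us k x) \<le> B us" by blast
  let ?L = "{us::'a list. set us \<subseteq> Basis \<and> length us \<le> N}"
  show ?thesis
  proof (rule that[of "\<Sum>us\<in>?L. \<bar>B us\<bar>"])
    fix us :: "'a list" and x assume us: "set us \<subseteq> Basis" "length us \<le> N"
    have "norm (iter_deriv us k x) \<le> \<bar>B us\<bar>" using B[OF us(1), of x] by linarith
    also have "\<dots> \<le> (\<Sum>us\<in>?L. \<bar>B us\<bar>)" using us finite_Basis_lists[of N] by (intro member_le_sum) auto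
    finally show "norm (iter_deriv us k x) \<le> (\<Sum>us\<in>?L. \<bar>B us\<bar>)" .
  qed (auto intro: sum_nonneg)
qed

lemma schwartz_uniform:
  fixes u :: "'a::euclidean_space \<Rightarrow> complex"
  assumes "schwartz u"
  obtains A where "0 \<le> A"
    "\<And>us x. set us \<subseteq> Basis \<Longrightarrow> length us \<le> N \<Longrightarrow> (1 + norm x) ^ M * norm (iter_deriv us u x) \<le> A"
proof -
  have "\<exists>B. \<forall>us. set us \<subseteq> Basis \<longrightarrow> (\<forall>x. (1 + norm x) ^ M * norm (iter_deriv us u x) \<le> B us)"
  proof -
    have "\<exists>C. \<forall>x. (1 + norm x) ^ M * norm (iter_deriv us u x) \<le> C" if "set us \<subseteq> Basis" for us
      by (rule schwartzD[OF assms that, of M]) blast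
    then show ?thesis by metis
  qed
  then obtain B where B: "\<And>us x. set us \<subseteq> Basis \<Longrightarrow> (1 + norm x) ^ M * norm (iter_deriv us u x) \<le> B us" by blast
  let ?L = "{us::'a list. set us \<subseteq> Basis \<and> length us \<le> N}"
  show ?thesis
  proof (rule that[of "\<Sum>us\<in>?L. \<bar>B us\<bar>"])
    fix us :: "'a list" and x assume us: "set us \<subseteq> Basis" "length us \<le> N"
    have "(1 + norm x) ^ M * norm (iter_deriv us u x) \<le> \<bar>B us\<bar>" using B[OF us(1), of x] by linarith
    also have "\<dots> \<le> (\<Sum>us\<in>?L. \<bar>B us\<bar>)" using us finite_Basis_lists[of N] by (intro member_le_sum) auto
    finally show "(1 + norm x) ^ M * norm (iter_deriv us u x) \<le> (\<Sum>us\<in>?L. \<bar>B us\<bar>)" .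
  qed (auto intro: sum_nonneg)
qed

lemma smooth_bounded_const: "smooth_bounded (\<lambda>_. c)"
proof -
  have "iter_deriv vs (\<lambda>_::'a. c) = (\<lambda>_. if vs = [] then c else 0)" for vs
    by (induction vs) auto
  then show ?thesis unfolding smooth_bounded_def by (auto simp: smooth_const)
qed

lemma smooth_bounded_diff:
  assumes "smooth_bounded f" "smooth_bounded g"
  shows "smooth_bounded (\<lambda>x. f x - g x)"
  unfolding smooth_bounded_def
proof (intro conjI allI impI)
  have s: "smooth f" "smooth g" using assms by (auto simp: smooth_bounded_def)
  show "smooth (\<lambda>x. f x - g x)" by (rule smooth_diff[OF s])
  fix vs :: "'a list" assume vs: "set vs \<subseteq> Basis"
  obtain A where A: "\<And>x. norm (iter_deriv vs f x) \<le> A" using assms(1) vs unfolding smooth_bounded_def by metis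
  obtain B where B: "\<And>x. norm (iter_deriv vs g x) \<le> B" using assms(2) vs unfolding smooth_bounded_def by metis
  have "iter_deriv vs (\<lambda>x. f x + (-1) * g x) = (\<lambda>x. iter_deriv vs f x + (-1) * iter_deriv vs g x)"
    unfolding iter_deriv_add[OF s(1) smooth_mult[OF smooth_const s(2)] vs] iter_deriv_cmult[OF s(2) vs] ..
  then have "norm (iter_deriv vs (\<lambda>x. f x - g x) x) \<le> A + B" for x
    using norm_triangle_ineq4[of "iter_deriv vs f x" "iter_deriv vs g x"] A[of x] B[of x] by simp
  then show "\<exists>B. \<forall>x. norm (iter_deriv vs (\<lambda>x. f x - g x) x) \<le> B" by blast
qed

lemma schwartz_mult:
  assumes w: "smooth_bounded w" and u: "schwartz u" shows "schwartz (\<lambda>x. w x * u x)"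
proof (rule schwartzI)
  have s: "smooth w" "smooth u" using w u by (auto simp: smooth_bounded_def schwartz_def)
  show "smooth (\<lambda>x. w x * u x)" by (rule smooth_mult[OF s])
  fix M and vs :: "'a list" assume vs: "set vs \<subseteq> Basis"
  obtain A where A: "0 \<le> A" "\<And>us x. set us \<subseteq> Basis \<Longrightarrow> length us \<le> length vs \<Longrightarrow> norm (iter_deriv us w x) \<le> A"
    using smooth_bounded_uniform[OF w] by metis
  obtain B where B: "0 \<le> B" "\<And>us x. set us \<subseteq> Basis \<Longrightarrow> length us \<le> length vs \<Longrightarrow> (1 + norm x) ^ M * norm (iter_deriv us u x) \<le> B"
    using schwartz_uniform[OF u] by metis
  have "(1 + norm x) ^ M * norm (iter_deriv vs (\<lambda>x. w x * u x) x) \<le> 2 ^ length vs * (A * B)" for x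
  proof -
    have p: "0 < (1 + norm x) ^ M" by (intro zero_less_power) (simp add: add_pos_nonneg)
    have "norm (iter_deriv vs (\<lambda>x. w x * u x) x) \<le> 2 ^ length vs * (A * (B / (1 + norm x) ^ M))"
    proof (rule iter_deriv_mult_bound[OF s vs order_refl A(2)])
      fix us :: "'a list" assume us: "set us \<subseteq> Basis" "length us \<le> length vs"
      show "norm (iter_deriv us u x) \<le> B / (1 + norm x) ^ M"
        using B(2)[OF us, of x] p by (simp add: field_simps)
    qed
    then show ?thesis using p by (simp add: field_simps)
  qed
  then show "\<exists>C. \<forall>x. (1 + norm x) ^ M * norm (iter_deriv vs (\<lambda>x. w x * u x) x) \<le> C" by blast
qed

lemma schwartz_cmult: "schwartz u \<Longrightarrow> schwartz (\<lambda>x. c * u x)"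
  by (rule schwartz_mult[OF smooth_bounded_const])

text \<open>The index \<open>N\<close> limits the order of differentiation and is also the power of
  the weight. For fixed \<open>B\<close> the condition becomes stronger as \<open>N\<close> grows,
  and together the indices control every Schwartz seminorm. A bound \<open>B\<close> in place of a
  supremum avoids questions of finiteness.\<close>

definition schwartz_bound :: "nat \<Rightarrow> ('a::euclidean_space \<Rightarrow> complex) \<Rightarrow> real \<Rightarrow> bool" where
  "schwartz_bound N u B \<longleftrightarrow>
     (\<forall>vs x. set vs \<subseteq> Basis \<longrightarrow> length vs \<le> N \<longrightarrow> (1 + norm x) ^ N * norm (iter_deriv vs u x) \<le> B)"

text \<open>If every order failed, there would be functions \<open>u N\<close> with
  \<open>norm (T (u N))\<close> above \<open>N\<close> times their bound of order \<open>N\<close>;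
  divided by \<open>norm (T (u N))\<close> they form a null sequence on which \<open>T\<close> has
  modulus 1. The finite order obtained here controls \<open>T\<close> wherever its representing
  function cannot be integrated.\<close>

lemma tempered_seminorm_bound:
  fixes T :: "'a::euclidean_space functional"
  assumes T: "tempered_distribution T"
  obtains N C where "0 \<le> C" "\<And>u B. schwartz u \<Longrightarrow> schwartz_bound N u B \<Longrightarrow> norm (T u) \<le> C * B"
proof (rule ccontr)
  assume neg: "\<not> thesis"
  have "\<exists>u B. schwartz u \<and> schwartz_bound N u B \<and> real N * B < norm (T u)" for N
    using neg that[of "real N" N] not_le of_nat_0_le_iff by blast
  then obtain u B where u: "\<And>N. schwartz (u N)"
    and B: "\<And>N vs x. set vs \<subseteq> Basis \<Longrightarrow> length vs \<le> N \<Longrightarrow> (1 + norm x) ^ N * norm (iter_deriv vs (u N) x) \<le> B N"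
    and TB: "\<And>N. real N * B N < norm (T (u N))" unfolding schwartz_bound_def by metis
  have B0: "0 \<le> B N" for N by (rule order_trans[OF _ B[of "[]" N 0]]) auto
  have t0: "0 < norm (T (u N))" for N using TB[of N] B0[of N] by (meson mult_nonneg_nonneg of_nat_0_le_iff order_le_less_trans)
  define v where "v N x = inverse (of_real (norm (T (u N)))) * u N x" for N x
  have v: "schwartz (v N)" for N unfolding v_def[abs_def] by (rule schwartz_cmult[OF u])
  have "schwartz_null_sequence v"
    unfolding schwartz_null_sequence_def
  proof (intro conjI allI impI v)
    fix M :: nat and vs :: "'a list" assume vs: "set vs \<subseteq> Basis"
    show "uniform_limit UNIV (\<lambda>m x. (1 + norm x) ^ M *\<^sub>R iter_deriv vs (v m) x) (\<lambda>_. 0) sequentially"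
      unfolding uniform_limit_iff
    proof (intro allI impI)
      fix e :: real assume e: "0 < e"
      obtain n0 :: nat where n0: "1 / e < real n0" using reals_Archimedean2 by blast
      \<comment> \<open>For \<open>N\<close> beyond \<open>M\<close> and \<open>length vs\<close>,
        the seminorm of order \<open>N\<close> dominates the one in question, and after
        normalisation it is below \<open>1 / N\<close>.\<close>
      have "dist ((1 + norm x) ^ M *\<^sub>R iter_deriv vs (v N) x) 0 < e" if N: "N \<ge> max (max M (length vs)) (max n0 1)" for N x
      proof -
        have "norm ((1 + norm x) ^ M *\<^sub>R iter_deriv vs (v N) x) =
          ((1 + norm x) ^ M * norm (iter_deriv vs (u N) x)) / norm (T (u N))"
          unfolding v_def[abs_def] iter_deriv_cmult[OF schwartz_smooth[OF u] vs]
          by (simp add: norm_mult norm_inverse divide_inverse mult_ac abs_of_nonneg)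
        also have "\<dots> \<le> ((1 + norm x) ^ N * norm (iter_deriv vs (u N) x)) / norm (T (u N))"
          using N by (intro divide_right_mono mult_right_mono power_increasing) auto
        also have "\<dots> \<le> B N / norm (T (u N))"
          using N by (intro divide_right_mono B vs) auto
        also have "\<dots> < 1 / real N" using TB[of N] t0[of N] N by (simp add: field_simps)
        also have "\<dots> < e"
        proof -
          have "1 / e < real N" using n0 N by simp
          then show ?thesis using e N by (simp add: field_simps)
        qed
        finally show ?thesis by simp
      qed
      then show "\<forall>\<^sub>F m in sequentially. \<forall>x\<in>UNIV. dist ((1 + norm x) ^ M *\<^sub>R iter_deriv vs (v m) x) 0 < e"
        unfolding eventually_sequentially by blast
    qed
  qed
  then have "(\<lambda>m. T (v m)) \<longlonglongrightarrow> 0" using T unfolding tempered_distribution_def by blast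
  then have "(\<lambda>m. norm (T (v m))) \<longlonglongrightarrow> 0" by (rule tendsto_norm_zero)
  moreover have "norm (T (v m)) = 1" for m
    unfolding v_def[abs_def] tempered_cmult[OF T u] using t0[of m] by (simp add: norm_mult norm_inverse)
  ultimately have "(\<lambda>_::nat. 1::real) \<longlonglongrightarrow> 0" by simp
  then show False by (simp add: LIMSEQ_const_iff)
qed

text \<open>For \<open>l \<ge> 1\<close> the weight at \<open>x\<close> is at most the weight at
  \<open>l x\<close>, so the weighted derivative along \<open>vs\<close> grows at most by the factor
  \<open>l ^ length vs\<close>. If \<open>T\<close> is given by a function \<open>h\<close> and
  \<open>c\<close> is \<open>l\<close> to the power of the dimension, the result is the distribution
  of \<open>h (x / l)\<close>.\<close>

lemma tempered_scaling:
  fixes T :: "'a::euclidean_space functional"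
  assumes T: "tempered_distribution T" and l: "1 \<le> l"
  shows "tempered_distribution (\<lambda>u. c * T (\<lambda>x. u (l *\<^sub>R x)))"
proof -
  have it: "iter_deriv vs (\<lambda>x. u (l *\<^sub>R x)) = (\<lambda>x. l ^ length vs *\<^sub>R iter_deriv vs u (l *\<^sub>R x))"
    if "schwartz u" "set vs \<subseteq> Basis" for u :: "'a \<Rightarrow> complex" and vs
    using iter_deriv_affine_comp[OF schwartz_smooth[OF that(1)] that(2), of l 0] by simp
  have le: "norm ((1 + norm x) ^ N *\<^sub>R iter_deriv vs (\<lambda>x. u (l *\<^sub>R x)) x) \<le>
      l ^ length vs * norm ((1 + norm (l *\<^sub>R x)) ^ N *\<^sub>R iter_deriv vs u (l *\<^sub>R x))"
    if "schwartz u" "set vs \<subseteq> Basis" for u :: "'a \<Rightarrow> complex" and vs N x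
  proof -
    have "1 * norm x \<le> l * norm x" using l by (intro mult_right_mono) auto
    then have "(1 + norm x) ^ N \<le> (1 + norm (l *\<^sub>R x)) ^ N" using l by (intro power_mono) auto
    then have "(1 + norm x) ^ N * (l ^ length vs * norm (iter_deriv vs u (l *\<^sub>R x)))
       \<le> (1 + norm (l *\<^sub>R x)) ^ N * (l ^ length vs * norm (iter_deriv vs u (l *\<^sub>R x)))"
      using l by (intro mult_right_mono) auto
    then show ?thesis unfolding it[OF that] using l by (simp add: abs_of_nonneg mult_ac)
  qed
  have S: "schwartz (\<lambda>x. u (l *\<^sub>R x))" if u: "schwartz u" for u :: "'a \<Rightarrow> complex"
  proof (rule schwartzI)
    show "smooth (\<lambda>x. u (l *\<^sub>R x))" using smooth_affine_comp[OF schwartz_smooth[OF u], of l 0] by simp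
    fix N and vs :: "'a list" assume vs: "set vs \<subseteq> Basis"
    obtain C where C: "\<And>x. (1 + norm x) ^ N * norm (iter_deriv vs u x) \<le> C" using schwartzD[OF u vs] by metis
    have "(1 + norm x) ^ N * norm (iter_deriv vs (\<lambda>x. u (l *\<^sub>R x)) x) \<le> l ^ length vs * C" for x
    proof -
      have "l ^ length vs * ((1 + norm (l *\<^sub>R x)) ^ N * norm (iter_deriv vs u (l *\<^sub>R x))) \<le> l ^ length vs * C"
        using l by (intro mult_left_mono C) auto
      then show ?thesis using le[OF u vs, of x N] by (simp add: abs_of_nonneg)
    qed
    then show "\<exists>C. \<forall>x. (1 + norm x) ^ N * norm (iter_deriv vs (\<lambda>x. u (l *\<^sub>R x)) x) \<le> C" by blast
  qed
  have null: "schwartz_null_sequence (\<lambda>m x. u m (l *\<^sub>R x))" if u: "schwartz_null_sequence u" for u :: "nat \<Rightarrow> 'a \<Rightarrow> complex"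
    unfolding schwartz_null_sequence_def
  proof (intro conjI allI impI)
    have us: "schwartz (u m)" for m using u by (simp add: schwartz_null_sequence_def)
    show "schwartz (\<lambda>x. u m (l *\<^sub>R x))" for m by (rule S[OF us])
    fix N :: nat and vs :: "'a list" assume vs: "set vs \<subseteq> Basis"
    have ul: "uniform_limit UNIV (\<lambda>m x. (1 + norm x) ^ N *\<^sub>R iter_deriv vs (u m) x) (\<lambda>_. 0) sequentially"
      using u vs by (simp add: schwartz_null_sequence_def)
    show "uniform_limit UNIV (\<lambda>m x. (1 + norm x) ^ N *\<^sub>R iter_deriv vs (\<lambda>x. u m (l *\<^sub>R x)) x) (\<lambda>_. 0) sequentially"
      unfolding uniform_limit_iff
    proof (intro allI impI)
      fix e :: real assume e: "0 < e"
      have p: "0 < l ^ length vs" using l by simp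
      have "\<forall>\<^sub>F m in sequentially. \<forall>x\<in>UNIV. dist ((1 + norm x) ^ N *\<^sub>R iter_deriv vs (u m) x) 0 < e / l ^ length vs"
        using ul e p unfolding uniform_limit_iff by simp
      then show "\<forall>\<^sub>F m in sequentially. \<forall>x\<in>UNIV. dist ((1 + norm x) ^ N *\<^sub>R iter_deriv vs (\<lambda>x. u m (l *\<^sub>R x)) x) 0 < e"
      proof (rule eventually_mono, intro ballI)
        fix m x assume m: "\<forall>x\<in>UNIV. dist ((1 + norm x) ^ N *\<^sub>R iter_deriv vs (u m) x) 0 < e / l ^ length vs"
        then have "norm ((1 + norm (l *\<^sub>R x)) ^ N *\<^sub>R iter_deriv vs (u m) (l *\<^sub>R x)) < e / l ^ length vs"
          by (metis UNIV_I dist_0_norm dist_commute)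
        then have "l ^ length vs * norm ((1 + norm (l *\<^sub>R x)) ^ N *\<^sub>R iter_deriv vs (u m) (l *\<^sub>R x)) < e"
          using p by (simp only: less_divide_eq mult.commute if_True)
        then show "dist ((1 + norm x) ^ N *\<^sub>R iter_deriv vs (\<lambda>x. u m (l *\<^sub>R x)) x) 0 < e"
          using le[OF us vs, of x N m] by (simp only: dist_0_norm dist_commute)
      qed
    qed
  qed
  show ?thesis
    unfolding tempered_distribution_def
  proof (intro conjI allI impI)
    show "c * T (\<lambda>x. u (l *\<^sub>R x) + v (l *\<^sub>R x)) = c * T (\<lambda>x. u (l *\<^sub>R x)) + c * T (\<lambda>x. v (l *\<^sub>R x))"
      if "schwartz u" "schwartz v" for u v
      using tempered_add[OF T S[OF that(1)] S[OF that(2)]] by (simp add: distrib_left)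
    show "c * T (\<lambda>x. d * u (l *\<^sub>R x)) = d * (c * T (\<lambda>x. u (l *\<^sub>R x)))" if "schwartz u" for u d
      using tempered_cmult[OF T S[OF that]] by simp
    show "(\<lambda>m. c * T (\<lambda>x. u m (l *\<^sub>R x))) \<longlonglongrightarrow> 0" if "schwartz_null_sequence u" for u
      using null[OF that] T unfolding tempered_distribution_def by (intro tendsto_mult_right_zero) blast
  qed
qed

section \<open>Cut-off functions and the fundamental lemma of the calculus of variations\<close>

text \<open>A bump function is a parameter because the theorem supplies one: the bump
  \<open>\<eta>\<close> of the modulation space, dilated by 2. Its real values are embedded in the
  complex numbers since test functions are complex-valued.\<close>

locale cutoff =
  fixes \<rho> :: "'a::euclidean_space \<Rightarrow> complex" and R :: real
  assumes smooth: "smooth \<rho>"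
    and real: "\<rho> x = of_real (Re (\<rho> x))"
    and nonneg: "0 \<le> Re (\<rho> x)"
    and le_1: "Re (\<rho> x) \<le> 1"
    and eq_1: "norm x \<le> 1 \<Longrightarrow> \<rho> x = 1"
    and eq_0: "R \<le> norm x \<Longrightarrow> \<rho> x = 0"
begin

lemma test_function: "test_function UNIV \<rho>"
  by (rule test_functionI[OF smooth, of "cball 0 R"]) (auto intro: eq_0)

lemma R_gt_1: "1 < R"
proof -
  obtain b :: 'a where b: "b \<in> Basis" using nonempty_Basis by blast
  show ?thesis
  proof (rule ccontr)
    assume "\<not> 1 < R"
    then have "\<rho> b = 0" using b by (intro eq_0) auto
    then show False using eq_1[of b] b by simp
  qed
qed

lemma norm_le_1: "norm (\<rho> x) \<le> 1"
  by (subst real) (use nonneg[of x] le_1[of x] in simp)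

lemma integrable: "integrable lebesgue \<rho>"
  by (rule test_function_integrable[OF test_function])

definition mass :: real where "mass = (LINT x|lebesgue. Re (\<rho> x))"

lemma integral_eq_mass: "(LINT x|lebesgue. \<rho> x) = of_real mass"
proof -
  have "(LINT x|lebesgue. \<rho> x) = (LINT x|lebesgue. of_real (Re (\<rho> x)))"
    using real by (intro Bochner_Integration.integral_cong refl)
  then show ?thesis by (simp only: mass_def integral_complex_of_real)
qed

lemma mass_pos: "0 < mass"
proof -
  have "measure lebesgue (cball (0::'a) 1) \<le> mass"
  proof -
    have "(LINT x|lebesgue. indicator (cball (0::'a) 1) x) \<le> mass"
      unfolding mass_def
    proof (rule integral_mono)
      show "integrable lebesgue (indicat_real (cball (0::'a) 1))"
        by (intro integrable_real_indicator) (simp_all add: emeasure_lborel_cball_finite[simplified])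
      show "integrable lebesgue (\<lambda>x. Re (\<rho> x))" using integrable by simp
      show "indicator (cball (0::'a) 1) x \<le> Re (\<rho> x)" for x
        using eq_1[of x] nonneg[of x] by (auto simp: indicator_def)
    qed
    then show ?thesis by simp
  qed
  moreover have "0 < measure lebesgue (cball (0::'a) 1)"
    using content_cball_pos[of 1 "0::'a"] by simp
  ultimately show ?thesis by (rule order_less_le_trans[rotated])
qed

text \<open>The indicator of the \<open>e\<close>-neighbourhood \<open>V\<close> of \<open>E\<close>
  is mollified by a nonnegative kernel of integral 1 that vanishes beyond distance \<open>e\<close>:
  from a point of \<open>E\<close> the kernel sees only the value 1, and beyond distance
  \<open>2 * e\<close> only 0.\<close>

lemma smooth_urysohn:
  assumes E: "compact E" "E \<noteq> {}" and e: "0 < e" and S: "{x. infdist x E \<le> 2 * e} \<subseteq> S"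
  obtains \<psi> :: "'a \<Rightarrow> complex" where "test_function S \<psi>" "\<And>x. x \<in> E \<Longrightarrow> \<psi> x = 1" "\<And>x. norm (\<psi> x) \<le> 1"
    "\<And>x. 2 * e \<le> infdist x E \<Longrightarrow> \<psi> x = 0"
proof -
  define V where "V = {y. infdist y E < e}"
  have oV: "open V" unfolding V_def by (intro open_Collect_less continuous_intros)
  have comp: "compact {x. infdist x E \<le> 2 * e}" using compact_infdist_le[OF E(2,1)] e by simp
  have "V \<subseteq> {x. infdist x E \<le> 2 * e}" using e by (auto simp: V_def)
  then have bV: "bounded V" using bounded_subset[OF compact_imp_bounded[OF comp]] by blast
  define w :: "'a \<Rightarrow> complex" where "w x = of_real (indicat_real V x)" for x
  have wi: "integrable lebesgue w"
    unfolding w_def[abs_def] using oV bV emeasure_bounded_finite[of V]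
    by (intro integrable_of_real integrable_real_indicator) (auto simp: less_top)
  \<comment> \<open>Scaling by \<open>R / e\<close> shrinks the support of \<open>\<rho>\<close>
    from radius \<open>R\<close> to radius \<open>e\<close>, and the factor in front makes the
    integral 1.\<close>
  define k where "k z = of_real ((R / e) ^ DIM('a) / mass) * \<rho> ((R / e) *\<^sub>R z)" for z
  have Re: "0 < R / e" using R_gt_1 e by simp
  have tk: "test_function UNIV k"
    unfolding k_def[abs_def]
    using test_function_affine[OF test_function less_imp_neq[OF Re, symmetric], of 0]
    by (intro test_function_mult smooth_const) (simp only: add_0_right)
  have ki: "integrable lebesgue k" by (rule test_function_integrable[OF tk])
  have k0: "k z = 0" if "e \<le> norm z" for z
    using that Re e unfolding k_def by (simp add: eq_0 field_simps)
  have kr: "k z = of_real (Re (k z))" "0 \<le> Re (k z)" for z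
  proof -
    show "k z = of_real (Re (k z))" unfolding k_def by (subst real, subst (2) real) simp
    show "0 \<le> Re (k z)" unfolding k_def using Re mass_pos nonneg by simp
  qed
  have nk: "norm (k z) = Re (k z)" for z using kr[of z] by (metis abs_of_nonneg norm_of_real)
  have Ik: "(LINT z|lebesgue. k z) = 1"
  proof -
    define J where "J = (LINT x|lebesgue. \<rho> ((R / e) *\<^sub>R x))"
    have "of_real ((R / e) ^ DIM('a)) * J = of_real mass"
      using integral_scaling(2)[OF less_imp_neq[OF Re, symmetric], of \<rho> 0] Re
      unfolding J_def integral_eq_mass by (simp only: add_0_left scaleR_conv_of_real abs_of_pos)
    moreover have "(LINT z|lebesgue. k z) = (of_real ((R / e) ^ DIM('a)) * J) / of_real mass"
      unfolding k_def J_def by simp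
    ultimately show ?thesis using mass_pos by simp
  qed
  have Ikx: "(LINT y|lebesgue. k (x - y)) = 1" "integrable lebesgue (\<lambda>y. k (x - y))" for x
    using integral_scaling[of "-1" k x] ki Ik by simp_all
  have sbk: "smooth_bounded k" by (rule schwartz_smooth_bounded[OF test_function_schwartz[OF tk]])
  show ?thesis
  proof (rule that[of "conv k w"])
    have z: "conv k w x = 0" if "2 * e \<le> infdist x E" for x
    proof -
      have "w y * k (x - y) = 0" for y
      proof (cases "y \<in> V")
        case True
        have "infdist x E \<le> infdist y E + dist x y" by (rule infdist_triangle)
        then have "e \<le> norm (x - y)" using True that by (simp add: V_def dist_norm)
        then show ?thesis using k0 by simp
      qed (simp add: w_def)
      then show ?thesis unfolding conv_def by (simp only: Bochner_Integration.integral_zero)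
    qed
    then show "\<And>x. 2 * e \<le> infdist x E \<Longrightarrow> conv k w x = 0" .
    show "test_function S (conv k w)"
      by (rule test_functionI[OF smooth_conv[OF sbk wi] compact_imp_closed[OF comp] compact_imp_bounded[OF comp] S])
         (use z in auto)
    show "conv k w x = 1" if x: "x \<in> E" for x
    proof -
      have "w y * k (x - y) = k (x - y)" for y
      proof (cases "y \<in> V")
        case False
        have "infdist y E \<le> dist y x" by (rule infdist_le[OF x])
        then have "e \<le> norm (x - y)" using False by (simp add: V_def dist_norm norm_minus_commute)
        then show ?thesis using k0 by simp
      qed (simp add: w_def)
      then show ?thesis using Ikx(1) unfolding conv_def by (simp only:)
    qed
    show "norm (conv k w x) \<le> 1" for x
    proof -
      have "norm (conv k w x) \<le> (LINT y|lebesgue. norm (w y * k (x - y)))"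
        unfolding conv_def by (rule integral_norm_bound)
      also have "\<dots> \<le> (LINT y|lebesgue. norm (k (x - y)))"
        using conv_integrable[OF sbk wi, of x] Ikx(2)[of x]
        by (intro integral_mono integrable_norm) (auto simp: norm_mult w_def indicator_def)
      also have "\<dots> = Re (LINT y|lebesgue. k (x - y))" unfolding nk using Ikx(2)[of x] by simp
      finally show ?thesis using Ikx(1) by simp
    qed
  qed
qed

text \<open>Dominated convergence along Urysohn functions that are 1 on \<open>E\<close> and
  supported in neighbourhoods shrinking to \<open>E\<close>: both sides of the assumed estimate
  converge to their values at the indicator of \<open>E\<close>.\<close>

lemma integral_compact_bound:
  fixes u :: "'a \<Rightarrow> complex"
  assumes u: "locally_integrable UNIV u" and S: "open S"
    and bd: "\<And>\<psi>. test_function S \<psi> \<Longrightarrow> norm (LINT x|lebesgue. u x * \<psi> x) \<le> d * (LINT x|lebesgue. norm (\<psi> x))"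
    and E: "compact E" "E \<subseteq> S"
  shows "norm (LINT x|lebesgue. u x * indicator E x) \<le> d * measure lebesgue E"
proof (cases "E = {}")
  case False
  obtain e0 where e0: "0 < e0" "{x. infdist x E \<le> e0} \<subseteq> S" using compact_in_open_separated[OF False E(1) S E(2)] by metis
  define e where "e k = e0 / (2 * real (Suc k))" for k
  have e: "0 < e k" "2 * e k \<le> e0" for k using e0(1) by (auto simp: e_def field_simps)
  have "\<exists>\<psi>. test_function S \<psi> \<and> (\<forall>x\<in>E. \<psi> x = 1) \<and> (\<forall>x. norm (\<psi> x) \<le> 1) \<and> (\<forall>x. 2 * e k \<le> infdist x E \<longrightarrow> \<psi> x = 0)" for k
  proof -
    have "{x. infdist x E \<le> 2 * e k} \<subseteq> S" using e0(2) e(2)[of k] by force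
    from smooth_urysohn[OF E(1) False e(1) this] show ?thesis by metis
  qed
  then obtain \<psi> where \<psi>: "\<And>k. test_function S (\<psi> k)" "\<And>k x. x \<in> E \<Longrightarrow> \<psi> k x = 1" "\<And>k x. norm (\<psi> k x) \<le> 1"
    "\<And>k x. 2 * e k \<le> infdist x E \<Longrightarrow> \<psi> k x = 0" by metis
  let ?K = "{x. infdist x E \<le> e0}"
  have K: "compact ?K" using compact_infdist_le[OF False E(1) e0(1)] .
  have \<psi>0: "\<psi> k x = 0" if "x \<notin> ?K" for k x using that e(2)[of k] by (intro \<psi>(4)) simp
  have lim: "(\<lambda>k. \<psi> k x) \<longlonglongrightarrow> indicator E x" for x
  proof (cases "x \<in> E")
    case False
    then have "0 < infdist x E" using E(1) \<open>E \<noteq> {}\<close> by (simp add: compact_imp_closed infdist_pos_not_in_closed)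
    then obtain m where m: "e0 / infdist x E < real m" using reals_Archimedean2 by blast
    have "\<psi> k x = 0" if "k \<ge> m" for k
    proof (rule \<psi>(4))
      have "e0 / infdist x E < real (Suc k)" using m that by simp
      then show "2 * e k \<le> infdist x E" using \<open>0 < infdist x E\<close> by (simp add: e_def field_simps)
    qed
    then have "\<forall>\<^sub>F k in sequentially. \<psi> k x = 0" by (auto simp: eventually_sequentially)
    then show ?thesis using False by (simp add: tendsto_eventually)
  qed (simp add: \<psi>(2))
  have [measurable]: "u \<in> borel_measurable lebesgue" "\<And>k. \<psi> k \<in> borel_measurable lebesgue" "E \<in> sets lebesgue"
    using locally_integrable_UNIV(1)[OF u] test_function_measurable[OF \<psi>(1)] compact_imp_closed[OF E(1)] by auto
  have 1: "(\<lambda>k. LINT x|lebesgue. u x * \<psi> k x) \<longlonglongrightarrow> (LINT x|lebesgue. u x * indicator E x)"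
  proof (rule integral_dominated_convergence[where w = "\<lambda>x. norm (indicator ?K x *\<^sub>R u x)"])
    show "integrable lebesgue (\<lambda>x. norm (indicator ?K x *\<^sub>R u x))"
      by (rule integrable_norm[OF locally_integrable_UNIV(2)[OF u K]])
    show "AE x in lebesgue. (\<lambda>k. u x * \<psi> k x) \<longlonglongrightarrow> u x * indicator E x"
      using lim by (intro AE_I2 tendsto_mult tendsto_const)
    show "AE x in lebesgue. norm (u x * \<psi> k x) \<le> norm (indicator ?K x *\<^sub>R u x)" for k
    proof (rule AE_I2)
      show "norm (u x * \<psi> k x) \<le> norm (indicator ?K x *\<^sub>R u x)" for x
        using \<psi>(3)[of k x] \<psi>0[of x k] by (cases "x \<in> ?K") (auto simp: norm_mult mult_left_le)
    qed
  qed measurable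
  have 2: "(\<lambda>k. LINT x|lebesgue. norm (\<psi> k x)) \<longlonglongrightarrow> (LINT x|lebesgue. indicator E x)"
  proof (rule integral_dominated_convergence[where w = "indicator ?K"])
    show "integrable lebesgue (indicat_real ?K)"
      using K emeasure_bounded_finite[OF compact_imp_bounded[OF K]] by (intro integrable_real_indicator) (auto simp: compact_imp_closed)
    show "AE x in lebesgue. (\<lambda>k. norm (\<psi> k x)) \<longlonglongrightarrow> indicat_real E x"
    proof (rule AE_I2)
      show "(\<lambda>k. norm (\<psi> k x)) \<longlonglongrightarrow> indicat_real E x" for x
        using tendsto_norm[OF lim[of x]] by (cases "x \<in> E") simp_all
    qed
    show "AE x in lebesgue. norm (norm (\<psi> k x)) \<le> indicat_real ?K x" for k
    proof (rule AE_I2)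
      show "norm (norm (\<psi> k x)) \<le> indicat_real ?K x" for x
        using \<psi>(3)[of k x] \<psi>0[of x k] by (cases "x \<in> ?K") auto
    qed
  qed measurable
  have "norm (LINT x|lebesgue. u x * indicator E x) \<le> d * (LINT x|lebesgue. indicator E x)"
    by (rule LIMSEQ_le[OF tendsto_norm[OF 1] tendsto_mult_left[OF 2]]) (use bd[OF \<psi>(1)] in blast)
  then show ?thesis by simp
qed simp

text \<open>The bound \<open>d\<close> makes this quantitative: an estimate of pairings by a
  multiple of the L1 norm becomes a pointwise one, and \<open>d = 0\<close> gives uniqueness of
  representing functions. Where the conclusion fails, some \<open>c\<close> from a countable dense
  set satisfies \<open>d * norm c < Re (c * u x)\<close>. If the set \<open>A c N\<close> of such
  points had positive measure, integrating over a compact part of it would contradict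
  \<open>integral_compact_bound\<close>.\<close>

lemma fundamental_lemma:
  fixes u :: "'a \<Rightarrow> complex"
  assumes u: "locally_integrable UNIV u" and S: "open S" and d: "0 \<le> d"
    and bd: "\<And>\<psi>. test_function S \<psi> \<Longrightarrow> norm (LINT x|lebesgue. u x * \<psi> x) \<le> d * (LINT x|lebesgue. norm (\<psi> x))"
  shows "AE x in lebesgue. x \<in> S \<longrightarrow> norm (u x) \<le> d"
proof -
  have um[measurable]: "u \<in> borel_measurable lebesgue" using locally_integrable_UNIV(1)[OF u] .
  have Sm[measurable]: "S \<in> sets lebesgue" using S by simp
  obtain D :: "complex set" where D: "countable D" "\<And>X. open X \<Longrightarrow> X \<noteq> {} \<Longrightarrow> \<exists>d\<in>D. d \<in> X"
    using countable_dense_setE by blast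
  define A where "A c N = {x \<in> space lebesgue. x \<in> S \<and> norm x \<le> real N \<and> d * norm c < Re (c * u x)}" for c and N :: nat
  have A_S: "A c N \<subseteq> S" and A_cball: "A c N \<subseteq> cball 0 (real N)"
    and A_less: "x \<in> A c N \<Longrightarrow> d * norm c < Re (c * u x)" for c N x
    unfolding A_def cball_def dist_0_norm by blast+
  have A_I: "x \<in> A c N" if "x \<in> S" "norm x \<le> real N" "d * norm c < Re (c * u x)" for c N x
    unfolding A_def using that by (simp only: mem_Collect_eq simp_thms) simp
  have Am[measurable]: "A c N \<in> sets lebesgue" for c N
  proof -
    have [measurable]: "(\<lambda>x. Re (c * u x)) \<in> borel_measurable lebesgue"
      using measurable_compose[OF um, of "\<lambda>z. Re (c * z)" borel]
      by (simp add: borel_measurable_continuous_onI continuous_intros)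
    have [measurable]: "(norm :: 'a \<Rightarrow> real) \<in> borel_measurable lebesgue"
      by (intro continuous_borel_measurable_lebesgue continuous_intros)
    have "{x \<in> space lebesgue. x \<in> S \<and> norm x \<le> real N \<and> d * norm c < Re (c * u x)} \<in> sets lebesgue"
      by measurable
    then show ?thesis unfolding A_def .
  qed
  have null: "A c N \<in> null_sets lebesgue" for c N
  proof (rule ccontr)
    assume nn: "A c N \<notin> null_sets lebesgue"
    have fin: "emeasure lebesgue (A c N) < \<infinity>"
      using bounded_set_imp_lmeasurable[OF bounded_subset[OF bounded_cball A_cball] Am]
      unfolding fmeasurable_def by blast
    define m where "m = measure lebesgue (A c N)"
    have em: "emeasure lebesgue (A c N) = ennreal m" using fin by (simp add: m_def emeasure_eq_ennreal_measure less_top)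
    have m: "0 < m" using nn em Am by (metis ennreal_0 m_def measure_nonneg not_less null_setsI order_antisym)
    \<comment> \<open>Inner approximation with the whole measure \<open>m\<close> as tolerance is
      enough: for a null set \<open>E\<close> the difference would have measure exactly
      \<open>m\<close>.\<close>
    obtain E where E: "closed E" "E \<subseteq> A c N" "A c N - E \<in> lmeasurable" "emeasure lebesgue (A c N - E) < ennreal m"
      using sets_lebesgue_inner_closed[OF Am m] by metis
    have Em[measurable]: "E \<in> sets lebesgue" using E(1) by simp
    have cE: "compact E" unfolding compact_eq_bounded_closed using E(1) bounded_subset[OF bounded_cball subset_trans[OF E(2) A_cball]] by blast
    have ES: "E \<subseteq> S" using E(2) A_S by blast
    have iE: "integrable lebesgue (indicat_real E)"
      using lmeasurable_compact[OF cE] unfolding fmeasurable_def by (intro integrable_real_indicator) auto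
    have iu: "integrable lebesgue (\<lambda>x. u x * indicator E x)"
    proof -
      have "(\<lambda>x. u x * indicator E x) = (\<lambda>x. indicator E x *\<^sub>R u x)" by (auto simp: indicator_def)
      then show ?thesis using locally_integrable_UNIV(2)[OF u cE] by simp
    qed
    define f where "f x = Re (c * (u x * indicator E x)) - d * norm c * indicator E x" for x
    have fi: "integrable lebesgue f" unfolding f_def using iu iE by (intro Bochner_Integration.integrable_diff integrable_Re integrable_mult_right)
    have fpos: "0 < f x" if "x \<in> E" for x using A_less[of x c N] E(2) that by (auto simp: f_def simp del: times_complex.sel)
    have f0: "0 \<le> f x" for x using fpos[of x] by (cases "x \<in> E") (auto simp: f_def)
    have "(LINT x|lebesgue. f x) = Re (c * (LINT x|lebesgue. u x * indicator E x)) - d * norm c * measure lebesgue E"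
    proof -
      have cu: "integrable lebesgue (\<lambda>x. c * (u x * indicator E x))" using iu by (rule integrable_mult_right)
      have "(LINT x|lebesgue. f x) = (LINT x|lebesgue. Re (c * (u x * indicator E x))) - (LINT x|lebesgue. d * norm c * indicator E x)"
        unfolding f_def by (rule Bochner_Integration.integral_diff[OF integrable_Re[OF cu] integrable_mult_right[OF iE]])
      also have "(LINT x|lebesgue. Re (c * (u x * indicator E x))) = Re (c * (LINT x|lebesgue. u x * indicator E x))"
        unfolding integral_Re[OF cu] by (simp only: integral_mult_right_zero)
      finally show ?thesis by simp
    qed
    also have "\<dots> \<le> norm c * (d * measure lebesgue E) - d * norm c * measure lebesgue E"
    proof -
      have "Re (c * (LINT x|lebesgue. u x * indicator E x)) \<le> norm c * norm (LINT x|lebesgue. u x * indicator E x)"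
        unfolding norm_mult[symmetric] by (rule complex_Re_le_cmod)
      also have "\<dots> \<le> norm c * (d * measure lebesgue E)"
        by (intro mult_left_mono integral_compact_bound[OF u S bd cE ES]) auto
      finally show ?thesis by (rule diff_right_mono)
    qed
    also have "\<dots> = 0" by simp
    finally have "(LINT x|lebesgue. f x) = 0" using f0 by (simp add: antisym integral_nonneg_AE)
    then have "AE x in lebesgue. f x = 0" using integral_nonneg_eq_0_iff_AE[OF fi] f0 by simp
    then have "AE x in lebesgue. x \<notin> E" by (rule AE_mp) (use fpos in force)
    then have "E \<in> null_sets lebesgue" using AE_iff_null_sets[OF Em] by simp
    then have "emeasure lebesgue (A c N - E) = ennreal m" unfolding em[symmetric] by (rule emeasure_Diff_null_set) (rule Am)
    then show False using E(4) by simp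
  qed
  have "(\<Union>c\<in>D. \<Union>N. A c N) \<in> null_sets lebesgue"
    by (intro null_sets_UN' D(1) null) auto
  then show ?thesis
  proof (rule AE_I')
    show "{x \<in> space lebesgue. \<not> (x \<in> S \<longrightarrow> norm (u x) \<le> d)} \<subseteq> (\<Union>c\<in>D. \<Union>N. A c N)"
    proof
      fix x assume "x \<in> {x \<in> space lebesgue. \<not> (x \<in> S \<longrightarrow> norm (u x) \<le> d)}"
      then have x: "x \<in> S" "d < norm (u x)" by auto
      let ?X = "{c. d * norm c < Re (c * u x)}"
      have "open ?X" by (intro open_Collect_less continuous_intros)
      \<comment> \<open>The optimal choice \<open>cnj (u x)\<close> satisfies the strict inequality,
        and by openness so does some element of the dense set.\<close>
      moreover have "cnj (u x) \<in> ?X"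
      proof -
        have "Re (cnj (u x) * u x) = (norm (u x))\<^sup>2"
          by (metis Re_complex_of_real complex_norm_square mult.commute of_real_power)
        moreover have "d * norm (u x) < norm (u x) * norm (u x)" using x d by (intro mult_strict_right_mono) auto
        ultimately show ?thesis by (simp add: power2_eq_square)
      qed
      ultimately obtain c where c: "c \<in> D" "c \<in> ?X" using D(2)[of ?X] by blast
      obtain N :: nat where "norm x \<le> real N" using real_arch_simple by blast
      then show "x \<in> (\<Union>c\<in>D. \<Union>N. A c N)" using c(1) A_I[OF x(1), of N c] c(2) by blast
    qed
  qed
qed

section \<open>Uniqueness of representing functions and density of test functions\<close>

lemma representation_unique:
  fixes T :: "'a functional"
  assumes g: "represents g T" and h: "represents h T"
  shows "AE x in lebesgue. g x = h x"
proof -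
  have gl: "locally_integrable UNIV g" and hl: "locally_integrable UNIV h" using g h by (auto simp: represents_def)
  have [measurable]: "g \<in> borel_measurable lebesgue" "h \<in> borel_measurable lebesgue"
    using locally_integrable_UNIV(1) gl hl by auto
  have "AE x in lebesgue. x \<in> UNIV \<longrightarrow> norm (g x - h x) \<le> 0"
  proof (rule fundamental_lemma)
    have "integrable lebesgue (\<lambda>x. indicator K x *\<^sub>R (g x - h x))" if "compact K" for K
      using locally_integrable_UNIV(2)[OF gl that] locally_integrable_UNIV(2)[OF hl that]
      by (simp add: scaleR_diff_right)
    then show "locally_integrable UNIV (\<lambda>x. g x - h x)"
      unfolding locally_integrable_def set_integrable_def by (auto simp: lebesgue_on_UNIV_eq)
    fix \<psi> :: "'a \<Rightarrow> complex" assume \<psi>: "test_function UNIV \<psi>"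
    have "(LINT x|lebesgue. (g x - h x) * \<psi> x) = distribution_of g \<psi> - distribution_of h \<psi>"
      using locally_integrable_mult_test[OF gl \<psi>] locally_integrable_mult_test[OF hl \<psi>]
      by (simp add: distribution_of_def left_diff_distrib)
    also have "\<dots> = 0" using g h \<psi> by (simp add: represents_def)
    finally show "norm (LINT x|lebesgue. (g x - h x) * \<psi> x) \<le> 0 * (LINT x|lebesgue. norm (\<psi> x))" by simp
  qed auto
  then show ?thesis by simp
qed

text \<open>The function picked by \<open>SOME\<close> also represents \<open>T\<close>, so by
  uniqueness the choice matters only on a null set.\<close>

lemma distribution_modulus_eq:
  fixes T :: "'a functional"
  assumes g: "represents g T"
  shows "AE x in lebesgue. distribution_modulus T x = ennreal (norm (g x))"
proof -
  have "represents (SOME g. represents g T) T" by (rule someI[of "\<lambda>g. represents g T", OF g])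
  from representation_unique[OF this g] show ?thesis
    by (rule AE_mp) (use g in \<open>auto simp: distribution_modulus_def\<close>)
qed

text \<open>Test functions are dense: \<open>\<sigma>k k\<close> vanishes on the ball of radius
  \<open>k + 1\<close> and has derivatives bounded uniformly in \<open>k\<close>, so every seminorm
  of \<open>\<sigma>k k x * u x\<close> is of order \<open>1 / (k + 1)\<close>, since
  \<open>u\<close> has one more power of decay than the seminorm asks for.\<close>

lemma tempered_eq_on_schwartz:
  fixes T1 T2 :: "'a functional"
  assumes T: "tempered_distribution T1" "tempered_distribution T2"
    and eq: "\<And>\<psi>. test_function UNIV \<psi> \<Longrightarrow> T1 \<psi> = T2 \<psi>" and u: "schwartz u"
  shows "T1 u = T2 u"
proof -
  define \<sigma> where "\<sigma> x = 1 - \<rho> x" for x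
  have sb: "smooth_bounded \<sigma>"
    unfolding \<sigma>_def[abs_def] by (intro smooth_bounded_diff smooth_bounded_const schwartz_smooth_bounded test_function_schwartz[OF test_function])
  define c where "c k = 1 / real (Suc k)" for k
  have c: "0 < c k" "c k \<le> 1" for k by (auto simp: c_def)
  define \<sigma>k where "\<sigma>k k x = \<sigma> (c k *\<^sub>R x)" for k x
  have itk: "iter_deriv vs (\<sigma>k k) = (\<lambda>x. c k ^ length vs *\<^sub>R iter_deriv vs \<sigma> (c k *\<^sub>R x))" if "set vs \<subseteq> Basis" for k vs
    using iter_deriv_affine_comp[of \<sigma> vs "c k" 0] sb that by (simp add: smooth_bounded_def \<sigma>k_def[abs_def])
  have sk: "smooth (\<sigma>k k)" for k
    using smooth_affine_comp[of \<sigma> "c k" 0] sb by (simp add: smooth_bounded_def \<sigma>k_def[abs_def])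
  have bdk: "norm (iter_deriv vs (\<sigma>k k) x) \<le> A" if "set vs \<subseteq> Basis" "norm (iter_deriv vs \<sigma> (c k *\<^sub>R x)) \<le> A" for vs k x A
  proof -
    have "c k ^ length vs * norm (iter_deriv vs \<sigma> (c k *\<^sub>R x)) \<le> 1 * A"
      using c[of k] that by (intro mult_mono power_le_one) (auto simp: less_imp_le)
    then show ?thesis unfolding itk[OF that(1)] using c[of k] by simp
  qed
  have sbk: "smooth_bounded (\<sigma>k k)" for k
    unfolding smooth_bounded_def using sk sb bdk by (metis smooth_bounded_def)
  have wS: "schwartz (\<lambda>x. \<sigma>k k x * u x)" for k by (rule schwartz_mult[OF sbk u])
  have lim: "(\<lambda>k. T (\<lambda>x. \<sigma>k k x * u x)) \<longlonglongrightarrow> 0" if T: "tempered_distribution T" for T :: "'a functional"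
  proof -
    obtain N C where NC: "0 \<le> C" "\<And>u B. schwartz u \<Longrightarrow> schwartz_bound N u B \<Longrightarrow> norm (T u) \<le> C * B"
      using tempered_seminorm_bound[OF T] by metis
    obtain A where A: "0 \<le> A" "\<And>us x. set us \<subseteq> Basis \<Longrightarrow> length us \<le> N \<Longrightarrow> norm (iter_deriv us \<sigma> x) \<le> A"
      using smooth_bounded_uniform[OF sb] by metis
    obtain B where B: "0 \<le> B" "\<And>us x. set us \<subseteq> Basis \<Longrightarrow> length us \<le> N \<Longrightarrow> (1 + norm x) ^ Suc N * norm (iter_deriv us u x) \<le> B"
      using schwartz_uniform[OF u] by metis
    have bound: "norm (T (\<lambda>x. \<sigma>k k x * u x)) \<le> C * ((2 ^ N * (A * B)) * c k)" for k
    proof (rule NC(2)[OF wS], unfold schwartz_bound_def, intro allI impI)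
      fix vs :: "'a list" and x :: 'a assume vs: "set vs \<subseteq> Basis" "length vs \<le> N"
      have p: "0 < 1 + norm x" by (simp add: add_pos_nonneg)
      show "(1 + norm x) ^ N * norm (iter_deriv vs (\<lambda>x. \<sigma>k k x * u x) x) \<le> (2 ^ N * (A * B)) * c k"
      proof (cases "norm x < real (Suc k)")
        case True
        have "iter_deriv vs (\<lambda>x. \<sigma>k k x * u x) x = iter_deriv vs (\<lambda>_. 0) x"
        proof (rule iter_deriv_cong_open[of "ball 0 (real (Suc k))"])
          fix y assume "y \<in> ball (0::'a) (real (Suc k))"
          then have "norm (c k *\<^sub>R y) \<le> 1" using c[of k] by (simp add: c_def field_simps)
          then show "\<sigma>k k y * u y = 0" by (simp add: \<sigma>k_def \<sigma>_def eq_1)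
        qed (use True in auto)
        then show ?thesis using A B c[of k] by (simp add: iter_deriv_const_0)
      next
        case False
        have "norm (iter_deriv vs (\<lambda>x. \<sigma>k k x * u x) x) \<le> 2 ^ N * (A * (B / (1 + norm x) ^ Suc N))"
        proof (rule iter_deriv_mult_bound[OF sk schwartz_smooth[OF u] vs])
          fix us :: "'a list" assume us: "set us \<subseteq> Basis" "length us \<le> N"
          show "norm (iter_deriv us (\<sigma>k k) x) \<le> A" by (rule bdk[OF us(1) A(2)[OF us]])
          show "norm (iter_deriv us u x) \<le> B / (1 + norm x) ^ Suc N"
            using B(2)[OF us, of x] p by (simp add: pos_le_divide_eq mult.commute)
        qed
        then have "(1 + norm x) ^ N * norm (iter_deriv vs (\<lambda>x. \<sigma>k k x * u x) x) \<le> (1 + norm x) ^ N * (2 ^ N * (A * (B / (1 + norm x) ^ Suc N)))"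
          using p by (intro mult_left_mono) auto
        also have "\<dots> = (2 ^ N * (A * B)) * (1 / (1 + norm x))"
        proof -
          have "t ^ N * (2 ^ N * (A * (B / t ^ Suc N))) = (2 ^ N * (A * B)) * (1 / t)" if "0 < t" for t :: real
            using that by simp
          from this[OF p] show ?thesis .
        qed
        also have "\<dots> \<le> (2 ^ N * (A * B)) * c k"
          using False A(1) B(1) p unfolding c_def by (intro mult_left_mono divide_left_mono) auto
        finally show ?thesis .
      qed
    qed
    have "c \<longlonglongrightarrow> 0" unfolding c_def using LIMSEQ_inverse_real_of_nat by (simp add: inverse_eq_divide)
    then have lim0: "(\<lambda>k. C * ((2 ^ N * (A * B)) * c k)) \<longlonglongrightarrow> 0" by (intro tendsto_mult_right_zero)
    show ?thesis by (rule Lim_null_comparison[OF always_eventually lim0]) (use bound in blast)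
  qed
  have "T1 u - T2 u = T1 (\<lambda>x. \<sigma>k k x * u x) - T2 (\<lambda>x. \<sigma>k k x * u x)" for k
  proof -
    have t: "test_function UNIV (\<lambda>x. \<rho> (c k *\<^sub>R x) * u x)"
      using test_function_affine[OF test_function, of "c k" 0] c[of k]
      by (intro test_function_mult(2) schwartz_smooth[OF u]) auto
    have ueq: "u = (\<lambda>x. \<rho> (c k *\<^sub>R x) * u x + \<sigma>k k x * u x)"
      by (auto simp: \<sigma>k_def \<sigma>_def algebra_simps)
    have "T u = T (\<lambda>x. \<rho> (c k *\<^sub>R x) * u x) + T (\<lambda>x. \<sigma>k k x * u x)" if "tempered_distribution T" for T :: "'a functional"
      by (subst ueq, rule tempered_add[OF that test_function_schwartz[OF t] wS])
    from this[OF T(1)] this[OF T(2)] eq[OF t] show ?thesis by simp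
  qed
  then have "(\<lambda>k::nat. T1 u - T2 u) \<longlonglongrightarrow> 0 - 0"
    using tendsto_diff[OF lim[OF T(1)] lim[OF T(2)]] by simp
  then show ?thesis by (simp add: LIMSEQ_const_iff)
qed

end

section \<open>Approximate identities acting on tempered distributions\<close>

text \<open>The normalisation keeps the integral the same for all \<open>l > 0\<close>: as
  \<open>l\<close> grows, this is an approximate identity up to the factor given by the integral of
  \<open>k\<close>.\<close>

definition dilate :: "real \<Rightarrow> ('a::euclidean_space \<Rightarrow> complex) \<Rightarrow> 'a \<Rightarrow> complex" where
  "dilate l k z = of_real (l ^ DIM('a)) * k (l *\<^sub>R z)"

lemma iter_deriv_dilate:
  fixes k :: "'a::euclidean_space \<Rightarrow> complex"
  assumes k: "smooth k" and vs: "set vs \<subseteq> Basis"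
  shows "iter_deriv vs (dilate l k) x = of_real (l ^ (DIM('a) + length vs)) * iter_deriv vs k (l *\<^sub>R x)"
proof -
  have "smooth (\<lambda>x. k (l *\<^sub>R x))" using smooth_affine_comp[OF k, of l 0] by simp
  then have "iter_deriv vs (\<lambda>z. of_real (l ^ DIM('a)) * k (l *\<^sub>R z)) x
      = of_real (l ^ DIM('a)) * (l ^ length vs *\<^sub>R iter_deriv vs k (l *\<^sub>R x))"
    using iter_deriv_affine_comp[OF k vs, of l 0] by (simp add: iter_deriv_cmult[OF _ vs])
  then show ?thesis unfolding dilate_def[abs_def] by (simp add: scaleR_conv_of_real power_add mult.assoc)
qed

lemma smooth_bounded_dilate:
  assumes "smooth_bounded k" shows "smooth_bounded (dilate l k)"
  unfolding smooth_bounded_def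
proof (intro conjI allI impI)
  have sk: "smooth k" using assms by (simp add: smooth_bounded_def)
  show "smooth (dilate l k)"
    unfolding dilate_def[abs_def] using smooth_affine_comp[OF sk, of l 0] by (intro smooth_mult smooth_const) simp
  fix vs :: "'a list" assume vs: "set vs \<subseteq> Basis"
  obtain B where B: "\<And>x. norm (iter_deriv vs k x) \<le> B" using assms vs unfolding smooth_bounded_def by metis
  have "norm (iter_deriv vs (dilate l k) x) \<le> \<bar>l\<bar> ^ (DIM('a) + length vs) * B" for x
    unfolding iter_deriv_dilate[OF sk vs] norm_mult norm_of_real power_abs by (intro mult_left_mono B) simp
  then show "\<exists>B. \<forall>x. norm (iter_deriv vs (dilate l k) x) \<le> B" by blast
qed

lemma schwartz_dilate:
  assumes k: "schwartz k" and l: "1 \<le> l" shows "schwartz (dilate l k)"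
proof (rule schwartzI)
  show "smooth (dilate l k)"
    using smooth_bounded_dilate[OF schwartz_smooth_bounded[OF k]] by (simp add: smooth_bounded_def)
  fix M and vs :: "'a list" assume vs: "set vs \<subseteq> Basis"
  obtain C where C: "\<And>x. (1 + norm x) ^ M * norm (iter_deriv vs k x) \<le> C" using schwartzD[OF k vs] by metis
  have "(1 + norm x) ^ M * norm (iter_deriv vs (dilate l k) x) \<le> l ^ (DIM('a) + length vs) * C" for x
  proof -
    have "1 * norm x \<le> l * norm x" using l by (intro mult_right_mono) auto
    then have "(1 + norm x) ^ M * norm (iter_deriv vs k (l *\<^sub>R x)) \<le> (1 + norm (l *\<^sub>R x)) ^ M * norm (iter_deriv vs k (l *\<^sub>R x))"
      using l by (intro mult_right_mono power_mono) auto
    also have "\<dots> \<le> C" by (rule C)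
    finally show ?thesis unfolding iter_deriv_dilate[OF schwartz_smooth[OF k] vs] using l
      by (simp add: norm_mult norm_power mult.left_commute[of "(1 + norm x) ^ M"])
  qed
  then show "\<exists>C. \<forall>x. (1 + norm x) ^ M * norm (iter_deriv vs (dilate l k) x) \<le> C" by blast
qed

lemma peetre: "1 + norm x \<le> (1 + norm (x - y)) * (1 + norm (y::'a::real_normed_vector))"
proof -
  have "norm x \<le> norm (x - y) + norm y" using norm_triangle_ineq[of "x - y" y] by simp
  moreover have "1 + c \<le> (1 + a) * (1 + b)" if "c \<le> a + b" "0 \<le> a" "0 \<le> b" for a b c :: real
    using that mult_nonneg_nonneg[OF that(2,3)] by (simp only: distrib_left distrib_right mult_1 mult_1_right)
  ultimately show ?thesis by simp
qed

lemma norm_conv_le: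
  assumes "smooth_bounded k" "integrable lebesgue w" "\<And>y. w y \<noteq> 0 \<Longrightarrow> norm (k (x - y)) \<le> Q"
  shows "norm (conv k w x) \<le> Q * (LINT y|lebesgue. norm (w y))"
proof -
  have "norm (conv k w x) \<le> (LINT y|lebesgue. norm (w y * k (x - y)))"
    unfolding conv_def by (rule integral_norm_bound)
  also have "\<dots> \<le> (LINT y|lebesgue. Q * norm (w y))"
  proof (rule integral_mono)
    show "integrable lebesgue (\<lambda>y. norm (w y * k (x - y)))" by (rule integrable_norm[OF conv_integrable[OF assms(1,2)]])
    show "integrable lebesgue (\<lambda>y. Q * norm (w y))" using assms(2) by simp
    show "norm (w y * k (x - y)) \<le> Q * norm (w y)" for y
      using mult_right_mono[OF assms(3), of y "norm (w y)"] by (cases "w y = 0") (auto simp: norm_mult mult.commute)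
  qed
  finally show ?thesis by simp
qed

text \<open>Peetre's inequality moves the weight from \<open>x\<close> to \<open>x - y\<close>; the
  other factor is at most \<open>(1 + R) ^ N\<close> because \<open>y\<close> stays in the support
  of \<open>w\<close>.\<close>

lemma schwartz_conv:
  assumes k: "schwartz k" and w: "test_function UNIV w" shows "schwartz (conv k w)"
proof (rule schwartzI)
  have sb: "smooth_bounded k" by (rule schwartz_smooth_bounded[OF k])
  have wi: "integrable lebesgue w" by (rule test_function_integrable[OF w])
  obtain R where R: "0 < R" "\<And>x. R \<le> norm x \<Longrightarrow> w x = 0" using test_function_bounded_support[OF w] by metis
  show "smooth (conv k w)" by (rule smooth_conv[OF sb wi])
  fix N and vs :: "'a list" assume vs: "set vs \<subseteq> Basis"
  obtain C where C: "0 \<le> C" "\<And>x. (1 + norm x) ^ N * norm (iter_deriv vs k x) \<le> C" using schwartzD[OF k vs] by metis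
  have "(1 + norm x) ^ N * norm (iter_deriv vs (conv k w) x) \<le> (1 + R) ^ N * C * (LINT y|lebesgue. norm (w y))" for x
  proof -
    have p: "0 < (1 + norm x) ^ N" by (intro zero_less_power) (simp add: add_pos_nonneg)
    have "norm (conv (iter_deriv vs k) w x) \<le> ((1 + R) ^ N * C / (1 + norm x) ^ N) * (LINT y|lebesgue. norm (w y))"
    proof (rule norm_conv_le[OF smooth_bounded_iter_deriv[OF sb vs] wi])
      fix y assume "w y \<noteq> 0"
      then have y: "norm y \<le> R" using R(2)[of y] by force
      have "(1 + norm x) ^ N \<le> ((1 + norm (x - y)) * (1 + norm y)) ^ N" by (intro power_mono peetre) auto
      also have "\<dots> \<le> (1 + norm (x - y)) ^ N * (1 + R) ^ N"
        unfolding power_mult_distrib using y by (intro mult_left_mono power_mono) auto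
      finally have "(1 + norm x) ^ N * norm (iter_deriv vs k (x - y)) \<le> (1 + norm (x - y)) ^ N * (1 + R) ^ N * norm (iter_deriv vs k (x - y))"
        by (rule mult_right_mono) simp
      also have "\<dots> \<le> (1 + R) ^ N * C" using mult_left_mono[OF C(2)[of "x - y"], of "(1 + R) ^ N"] R(1) by (simp add: mult_ac)
      finally show "norm (iter_deriv vs k (x - y)) \<le> (1 + R) ^ N * C / (1 + norm x) ^ N"
        using p by (simp add: field_simps)
    qed
    then show ?thesis unfolding iter_deriv_conv[OF sb wi vs] using p by (simp add: field_simps)
  qed
  then show "\<exists>C. \<forall>x. (1 + norm x) ^ N * norm (iter_deriv vs (conv k w) x) \<le> C" by blast
qed

text \<open>The kernel of an approximate identity is rapidly decreasing away from the support of the test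
  function, so it does not matter that nothing is known about the growth of \<open>T\<close>.\<close>

lemma tempered_conv_far:
  fixes T :: "'a::euclidean_space functional" and x0 :: 'a
  assumes T: "tempered_distribution T" and k: "schwartz k" and \<sigma>: "smooth_bounded \<sigma>"
    and r: "0 < r" and \<sigma>0: "\<And>x. x \<in> ball x0 (2 * r) \<Longrightarrow> \<sigma> x = 0"
  obtains C where "0 \<le> C"
    "\<And>l \<psi>. 1 \<le> l \<Longrightarrow> test_function (ball x0 r) \<psi> \<Longrightarrow>
      norm (T (\<lambda>x. \<sigma> x * conv (dilate l k) \<psi> x)) \<le> C / l * (LINT y|lebesgue. norm (\<psi> y))"
proof -
  obtain N CT where NC: "0 \<le> CT" "\<And>u B. schwartz u \<Longrightarrow> schwartz_bound N u B \<Longrightarrow> norm (T u) \<le> CT * B"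
    using tempered_seminorm_bound[OF T] by metis
  define n where "n = DIM('a)"
  obtain A where A: "0 \<le> A" "\<And>us x. set us \<subseteq> Basis \<Longrightarrow> length us \<le> N \<Longrightarrow> norm (iter_deriv us \<sigma> x) \<le> A"
    using smooth_bounded_uniform[OF \<sigma>] by metis
  \<comment> \<open>The decay exponent is spent as follows: \<open>N\<close> for the weight in the
    seminorm, \<open>n + N\<close> for the powers of \<open>l\<close> produced by the dilation and
    at most \<open>N\<close> derivatives, and one more to gain the factor
    \<open>1 / l\<close>.\<close>
  obtain B where B: "0 \<le> B" "\<And>us x. set us \<subseteq> Basis \<Longrightarrow> length us \<le> N \<Longrightarrow>
      (1 + norm x) ^ (N + (n + N + 1)) * norm (iter_deriv us k x) \<le> B"
    using schwartz_uniform[OF k] by metis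
  define D where "D = 1 + norm x0 + r"
  have D: "1 \<le> D" using r by (simp add: D_def)
  define Q where "Q = D ^ N * B / r ^ (n + N + 1)"
  have Q: "0 \<le> Q" using D B r by (simp add: Q_def)
  have sbk: "smooth_bounded k" by (rule schwartz_smooth_bounded[OF k])
  have sk: "smooth k" using k by (rule schwartz_smooth)
  have s\<sigma>: "smooth \<sigma>" using \<sigma> by (simp add: smooth_bounded_def)
  show ?thesis
  proof (rule that[of "CT * (2 ^ N * A * Q)"])
    show "0 \<le> CT * (2 ^ N * A * Q)" using NC A Q by simp
    fix l :: real and \<psi> :: "'a \<Rightarrow> complex" assume l: "1 \<le> l" and \<psi>: "test_function (ball x0 r) \<psi>"
    have \<psi>i: "integrable lebesgue \<psi>" and \<psi>U: "test_function UNIV \<psi>"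
      using test_function_integrable[OF \<psi>] test_function_mono[OF \<psi>] by auto
    have \<psi>0: "y \<in> ball x0 r" if "\<psi> y \<noteq> 0" for y
      using that test_functionD[OF \<psi>] by (metis subsetD)
    define I where "I = (LINT y|lebesgue. norm (\<psi> y))"
    have I: "0 \<le> I" by (simp add: I_def)
    have sbd: "smooth_bounded (dilate l k)" by (rule smooth_bounded_dilate[OF sbk])
    have sd: "schwartz (dilate l k)" by (rule schwartz_dilate[OF k l])
    have sc: "schwartz (conv (dilate l k) \<psi>)" by (rule schwartz_conv[OF sd \<psi>U])
    have "norm (T (\<lambda>x. \<sigma> x * conv (dilate l k) \<psi> x)) \<le> CT * ((2 ^ N * A * Q) * (I / l))"
    proof (rule NC(2)[OF schwartz_mult[OF \<sigma> sc]], unfold schwartz_bound_def, intro allI impI)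
      fix vs :: "'a list" and x :: 'a assume vs: "set vs \<subseteq> Basis" "length vs \<le> N"
      have p: "0 < (1 + norm x) ^ N" by (intro zero_less_power) (simp add: add_pos_nonneg)
      show "(1 + norm x) ^ N * norm (iter_deriv vs (\<lambda>x. \<sigma> x * conv (dilate l k) \<psi> x) x) \<le> (2 ^ N * A * Q) * (I / l)"
      proof (cases "x \<in> ball x0 (2 * r)")
        case True
        have "iter_deriv vs (\<lambda>x. \<sigma> x * conv (dilate l k) \<psi> x) x = iter_deriv vs (\<lambda>_. 0) x"
          by (rule iter_deriv_cong_open[of "ball x0 (2 * r)"]) (use True \<sigma>0 in auto)
        then show ?thesis using A Q I l by (simp add: iter_deriv_const_0)
      next
        case False
        have "norm (iter_deriv vs (\<lambda>x. \<sigma> x * conv (dilate l k) \<psi> x) x) \<le> 2 ^ N * (A * (Q / l / (1 + norm x) ^ N * I))"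
        proof (rule iter_deriv_mult_bound[OF s\<sigma> schwartz_smooth[OF sc] vs A(2)])
          fix us :: "'a list" assume us: "set us \<subseteq> Basis" "length us \<le> N"
          show "norm (iter_deriv us (conv (dilate l k) \<psi>) x) \<le> Q / l / (1 + norm x) ^ N * I"
            unfolding iter_deriv_conv[OF sbd \<psi>i us(1)] I_def
          proof (rule norm_conv_le[OF smooth_bounded_iter_deriv[OF sbd us(1)] \<psi>i])
            fix y assume "\<psi> y \<noteq> 0"
            then have y: "dist x0 y < r" using \<psi>0 by auto
            define z where "z = norm (x - y)"
            define g where "g = norm (iter_deriv us k (l *\<^sub>R (x - y)))"
            \<comment> \<open>The support of \<open>\<psi>\<close> lies within \<open>r\<close> of
              \<open>x0\<close>, while \<open>\<sigma>\<close> vanishes within \<open>2 * r\<close>;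
              so the dilated kernel is only evaluated at distance at least \<open>r\<close> from its
              centre.\<close>
            have "2 * r \<le> dist x0 x" using False by simp
            then have zr: "r \<le> z" using y dist_triangle[of x0 x y] by (simp add: z_def dist_norm norm_minus_commute)
            have "norm y \<le> norm x0 + r" using y norm_triangle_ineq2[of y x0] by (simp add: dist_norm norm_minus_commute)
            then have "1 + norm x \<le> (1 + z) * D"
              using order_trans[OF peetre[of x y] mult_left_mono[of "1 + norm y" D "1 + norm (x - y)"]]
              by (simp add: z_def D_def)
            then have "(1 + norm x) ^ N \<le> (1 + z) ^ N * D ^ N"
              unfolding power_mult_distrib[symmetric] by (intro power_mono) auto
            then have "(1 + norm x) ^ N * (l * r) ^ (n + N + 1) \<le> ((1 + z) ^ N * D ^ N) * (l * r) ^ (n + N + 1)"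
              using l r by (intro mult_right_mono) auto
            also have "\<dots> \<le> ((1 + l * z) ^ N * D ^ N) * (1 + l * z) ^ (n + N + 1)"
            proof (intro mult_mono power_mono)
              have z0: "0 \<le> z" by (simp add: z_def)
              show "1 + z \<le> 1 + l * z" using mult_right_mono[OF l z0] by simp
              show "l * r \<le> 1 + l * z" using mult_left_mono[OF zr order_trans[OF zero_le_one l]] by linarith
            qed (use l r D in \<open>auto simp: z_def\<close>)
            finally have 1: "(1 + norm x) ^ N * (l * r) ^ (n + N + 1) \<le> D ^ N * (1 + l * z) ^ (N + (n + N + 1))"
              by (simp only: power_add mult_ac)
            have "(1 + l * z) ^ (N + (n + N + 1)) * g \<le> B"
              using B(2)[OF us, of "l *\<^sub>R (x - y)"] l by (simp add: z_def g_def)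
            then have "D ^ N * ((1 + l * z) ^ (N + (n + N + 1)) * g) \<le> D ^ N * B"
              using D by (intro mult_left_mono) auto
            moreover have "(1 + norm x) ^ N * (l * r) ^ (n + N + 1) * g \<le> D ^ N * (1 + l * z) ^ (N + (n + N + 1)) * g"
              by (rule mult_right_mono[OF 1]) (simp add: g_def)
            ultimately have 2: "(1 + norm x) ^ N * (l * r) ^ (n + N + 1) * g \<le> D ^ N * B"
              by (simp only: mult.assoc)
            have lp: "l ^ (n + length us) \<le> l ^ (n + N)" using l us(2) by (intro power_increasing) auto
            have "norm (iter_deriv us (dilate l k) (x - y)) = l ^ (n + length us) * g"
              unfolding iter_deriv_dilate[OF sk us(1)] g_def n_def using l by (simp add: norm_mult norm_power)
            also have "\<dots> \<le> l ^ (n + N) * g" using lp by (rule mult_right_mono) (simp add: g_def)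
            also have "\<dots> \<le> l ^ (n + N) * (D ^ N * B / ((1 + norm x) ^ N * (l * r) ^ (n + N + 1)))"
            proof (rule mult_left_mono)
              have "0 < (1 + norm x) ^ N * (l * r) ^ (n + N + 1)" using p l r by simp
              then show "g \<le> D ^ N * B / ((1 + norm x) ^ N * (l * r) ^ (n + N + 1))"
                using 2 by (simp only: pos_le_divide_eq mult.commute)
            qed (use l in simp)
            also have "\<dots> = Q / l / (1 + norm x) ^ N"
              unfolding Q_def using l r by (simp add: power_mult_distrib power_add)
            finally show "norm (iter_deriv us (dilate l k) (x - y)) \<le> Q / l / (1 + norm x) ^ N" .
          qed
        qed
        then have "(1 + norm x) ^ N * norm (iter_deriv vs (\<lambda>x. \<sigma> x * conv (dilate l k) \<psi> x) x)
            \<le> (1 + norm x) ^ N * (2 ^ N * (A * (Q / l / (1 + norm x) ^ N * I)))"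
          using p by (intro mult_left_mono) auto
        also have "\<dots> = (2 ^ N * A * Q) * (I / l)"
        proof -
          have "P * (2 ^ N * (A * (Q / l / P * I))) = (2 ^ N * A * Q) * (I / l)" if "0 < P" for P :: real
            using that by simp
          from this[OF p] show ?thesis .
        qed
        finally show ?thesis .
      qed
    qed
    then show "norm (T (\<lambda>x. \<sigma> x * conv (dilate l k) \<psi> x)) \<le> CT * (2 ^ N * A * Q) / l * (LINT y|lebesgue. norm (\<psi> y))"
      by (simp add: I_def)
  qed
qed

lemma schwartz_first_moment:
  fixes k :: "'a::euclidean_space \<Rightarrow> complex"
  assumes "schwartz k" shows "integrable lebesgue (\<lambda>v. norm v * norm (k v))"
proof -
  obtain C where C: "\<And>x. (1 + norm x) ^ (DIM('a) + 2) * norm (iter_deriv [] k x) \<le> C"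
    using schwartzD[OF assms, of "[]" "DIM('a) + 2"] by auto
  have "continuous_on UNIV (\<lambda>v. norm v * norm (k v))"
    by (intro continuous_intros smooth_continuous schwartz_smooth[OF assms])
  moreover have "(1 + norm x) ^ (DIM('a) + 1) * norm (norm x * norm (k x)) \<le> C" for x
  proof -
    have "norm x * ((1 + norm x) ^ (DIM('a) + 1) * norm (k x)) \<le> (1 + norm x) * ((1 + norm x) ^ (DIM('a) + 1) * norm (k x))"
      by (intro mult_right_mono) auto
    also have "\<dots> \<le> C" using C[of x] by (simp add: mult.assoc)
    finally show ?thesis by (simp add: mult_ac)
  qed
  ultimately show ?thesis by (intro integrable_decay(1) continuous_borel_measurable_lebesgue)
qed

lemma compact_support_uniformly_continuous:
  fixes H :: "'a::euclidean_space \<Rightarrow> complex"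
  assumes H: "continuous_on UNIV H" and K: "compact K" "\<And>x. x \<notin> K \<Longrightarrow> H x = 0" and e: "0 < e"
  obtains d where "0 < d" "\<And>x y. dist x y < d \<Longrightarrow> norm (H x - H y) < e"
proof -
  let ?K = "{x + y |x y. x \<in> K \<and> y \<in> cball 0 1}"
  have K': "compact ?K" by (rule compact_sums[OF K(1) compact_cball])
  have "\<exists>d>0. \<forall>x\<in>?K. \<forall>x'\<in>?K. dist x' x < d \<longrightarrow> dist (H x') (H x) < e"
    using compact_uniformly_continuous[OF continuous_on_subset[OF H subset_UNIV] K'] e
    unfolding uniformly_continuous_on_def by blast
  then obtain d where d: "0 < d" "\<And>x x'. x \<in> ?K \<Longrightarrow> x' \<in> ?K \<Longrightarrow> dist x' x < d \<Longrightarrow> dist (H x') (H x) < e"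
    by blast
  have near: "x' \<in> ?K" if "x \<in> K" "dist x x' < 1" for x x'
    unfolding mem_Collect_eq
    by (rule exI[of _ x], rule exI[of _ "x' - x"]) (use that in \<open>simp add: dist_norm norm_minus_commute\<close>)
  show ?thesis
  proof (rule that[of "min d 1"])
    fix x y :: 'a assume xy: "dist x y < min d 1"
    consider "x \<in> K" | "y \<in> K" | "x \<notin> K" "y \<notin> K" by blast
    then show "norm (H x - H y) < e"
    proof cases
      case 1
      then have "x \<in> ?K" "y \<in> ?K" using near[of x x] near[of x y] xy by auto
      then show ?thesis using d(2)[of y x] xy by (simp add: dist_norm)
    next
      case 2
      then have "x \<in> ?K" "y \<in> ?K" using near[of y x] near[of y y] xy by (auto simp: dist_commute)
      then show ?thesis using d(2)[of y x] xy by (simp add: dist_norm)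
    next
      case 3
      then show ?thesis using K(2) e by simp
    qed
  qed (use d in auto)
qed

text \<open>After the substitution \<open>x = y + v / l\<close> the increments of \<open>H\<close>
  are below \<open>e'\<close> as long as \<open>norm v < d * l\<close>. For larger \<open>v\<close>
  the trivial bound \<open>2 * M\<close> is at most \<open>2 * M / (d * l) * norm v\<close>, so the
  tail is absorbed by the first moment of \<open>k\<close>, with an explicit \<open>L\<close> that
  does not depend on \<open>y\<close>.\<close>

lemma approximate_identity_uniform:
  fixes H k :: "'a::euclidean_space \<Rightarrow> complex"
  assumes H: "continuous_on UNIV H" and K: "compact K" "\<And>x. x \<notin> K \<Longrightarrow> H x = 0"
    and k: "schwartz k" and e: "0 < e"
  obtains L where "1 \<le> L"
    "\<And>l y. L \<le> l \<Longrightarrow> norm ((LINT x|lebesgue. H x * dilate l k (x - y)) - (LINT x|lebesgue. k x) * H y) \<le> e"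
proof -
  have "bounded (H ` K)" by (intro compact_imp_bounded compact_continuous_image continuous_on_subset[OF H] K) auto
  then obtain M0 where M0: "\<And>x. x \<in> K \<Longrightarrow> norm (H x) \<le> M0" unfolding bounded_iff by auto
  define M where "M = \<bar>M0\<bar>"
  have M: "0 \<le> M" "norm (H x) \<le> M" for x
    using M0[of x] K(2)[of x] by (cases "x \<in> K"; auto simp: M_def)+
  have ki: "integrable lebesgue k" by (rule schwartz_integrable[OF k])
  define I where "I = (LINT x|lebesgue. norm (k x))"
  define J where "J = (LINT v|lebesgue. norm v * norm (k v))"
  have I: "0 \<le> I" and J: "0 \<le> J" by (auto simp: I_def J_def)
  define e' where "e' = e / (2 * (I + 1))"
  have e': "0 < e'" "e' * I \<le> e / 2"
  proof -
    show "0 < e'" using e I by (simp add: e'_def)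
    have "e' * I \<le> e' * (I + 1)" using \<open>0 < e'\<close> by (intro mult_left_mono) auto
    also have "\<dots> = e / 2"
    proof -
      have "e / (2 * t) * t = e / 2" if "0 < t" for t :: real using that by simp
      from this[of "I + 1"] I show ?thesis unfolding e'_def by simp
    qed
    finally show "e' * I \<le> e / 2" .
  qed
  obtain d where d: "0 < d" "\<And>x y. dist x y < d \<Longrightarrow> norm (H x - H y) < e'"
    using compact_support_uniformly_continuous[OF H K e'(1)] by metis
  show ?thesis
  proof (rule that[of "max 1 (4 * M * J / (d * e))"])
    fix l y assume L: "max 1 (4 * M * J / (d * e)) \<le> l"
    then have l: "1 \<le> l" "4 * M * J / (d * e) \<le> l" by auto
    have "(LINT x|lebesgue. H x * dilate l k (x - y)) = (LINT v|lebesgue. H (y + (1 / l) *\<^sub>R v) * k v)"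
    proof -
      have "(LINT x|lebesgue. H x * dilate l k (x - y)) =
         \<bar>1 / l\<bar> ^ DIM('a) *\<^sub>R (LINT v|lebesgue. H (y + (1 / l) *\<^sub>R v) * dilate l k (y + (1 / l) *\<^sub>R v - y))"
        using l by (intro integral_scaling(2)) simp
      also have "\<dots> = (LINT v|lebesgue. \<bar>1 / l\<bar> ^ DIM('a) *\<^sub>R (H (y + (1 / l) *\<^sub>R v) * dilate l k (y + (1 / l) *\<^sub>R v - y)))"
        by (rule integral_scaleR_right[symmetric])
      also have "\<dots> = (LINT v|lebesgue. H (y + (1 / l) *\<^sub>R v) * k v)"
        using l by (intro Bochner_Integration.integral_cong refl) (simp add: dilate_def scaleR_conv_of_real power_divide)
      finally show ?thesis .
    qed
    moreover have i1: "integrable lebesgue (\<lambda>v. k v * H (y + (1 / l) *\<^sub>R v))"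
      using M by (intro integrable_mult_bounded_continuous[OF ki, of _ M] continuous_on_compose2[OF H] continuous_intros) auto
    ultimately have "(LINT x|lebesgue. H x * dilate l k (x - y)) - (LINT x|lebesgue. k x) * H y
        = (LINT v|lebesgue. k v * H (y + (1 / l) *\<^sub>R v) - k v * H y)"
      using ki by (simp add: mult.commute)
    also have "norm \<dots> \<le> (LINT v|lebesgue. norm (k v * H (y + (1 / l) *\<^sub>R v) - k v * H y))"
      by (rule integral_norm_bound)
    also have "\<dots> \<le> (LINT v|lebesgue. e' * norm (k v) + 2 * M / (d * l) * (norm v * norm (k v)))"
    proof (rule integral_mono)
      show "integrable lebesgue (\<lambda>v. norm (k v * H (y + (1 / l) *\<^sub>R v) - k v * H y))" using i1 ki by simp
      show "integrable lebesgue (\<lambda>v. e' * norm (k v) + 2 * M / (d * l) * (norm v * norm (k v)))"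
        using ki schwartz_first_moment[OF k] by simp
      fix v
      have "norm (H (y + (1 / l) *\<^sub>R v) - H y) \<le> e' + 2 * M / (d * l) * norm v"
      proof (cases "norm v < d * l")
        case True
        then have "dist (y + (1 / l) *\<^sub>R v) y < d" using l by (simp add: dist_norm field_simps)
        from d(2)[OF this] have "norm (H (y + (1 / l) *\<^sub>R v) - H y) \<le> e'" by simp
        moreover have "0 \<le> 2 * M / (d * l) * norm v" using M d l by simp
        ultimately show ?thesis by linarith
      next
        case False
        have "norm (H (y + (1 / l) *\<^sub>R v) - H y) \<le> M + M"
          by (rule order_trans[OF norm_triangle_ineq4 add_mono[OF M(2) M(2)]])
        also have "\<dots> = 2 * M / (d * l) * (d * l)" using d l by simp
        also have "\<dots> \<le> 2 * M / (d * l) * norm v" using False M d l by (intro mult_left_mono) auto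
        finally show ?thesis using e' by simp
      qed
      from mult_left_mono[OF this, of "norm (k v)"]
      have "norm (k v * (H (y + (1 / l) *\<^sub>R v) - H y)) \<le> norm (k v) * (e' + 2 * M / (d * l) * norm v)"
        by (simp only: norm_mult norm_ge_zero)
      then show "norm (k v * H (y + (1 / l) *\<^sub>R v) - k v * H y) \<le> e' * norm (k v) + 2 * M / (d * l) * (norm v * norm (k v))"
        by (simp only: right_diff_distrib distrib_left mult_ac)
    qed
    also have "\<dots> = e' * I + 2 * M / (d * l) * J"
      using ki schwartz_first_moment[OF k] by (simp add: I_def J_def)
    also have "\<dots> \<le> e / 2 + e / 2"
    proof (rule add_mono[OF e'(2)])
      show "2 * M / (d * l) * J \<le> e / 2" using l d e by (simp add: field_simps)
    qed
    finally show "norm ((LINT x|lebesgue. H x * dilate l k (x - y)) - (LINT x|lebesgue. k x) * H y) \<le> e" by simp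
  qed auto
qed

context cutoff
begin

text \<open>A substitute for Fourier inversion: if the integral vanished for one symbol, then testing against
  dilated test functions would give \<open>\<integral> inv_fourier w = 0\<close> for all test functions \<open>w\<close>; for the translates
  of \<open>\<rho>\<close> this says that \<open>inv_fourier (inv_fourier \<rho>) = 0\<close>, which contradicts Plancherel.\<close>

lemma integral_inv_fourier_nonzero:
  fixes m :: "'a \<Rightarrow> complex"
  assumes m: "test_function UNIV m" and m0: "m 0 \<noteq> 0"
  shows "(LINT x|lebesgue. inv_fourier m x) \<noteq> 0"
proof
  assume zero: "(LINT x|lebesgue. inv_fourier m x) = 0"
  have mi: "integrable lebesgue m" by (rule test_function_integrable[OF m])
  have Km: "integrable lebesgue (inv_fourier m)" by (rule schwartz_integrable[OF schwartz_inv_fourier[OF m]])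
  have [measurable]: "inv_fourier m \<in> borel_measurable lebesgue" "m \<in> borel_measurable lebesgue"
    using Km mi by auto
  obtain M where M: "\<And>x. norm (m x) \<le> M" using test_function_bounded[OF m] by metis
  define d where "d k = 1 / real (Suc k)" for k
  have d: "0 < d k" for k by (simp add: d_def)
  have dlim: "d \<longlonglongrightarrow> 0" unfolding d_def using LIMSEQ_inverse_real_of_nat by (simp add: inverse_eq_divide)
  have w0: "(LINT x|lebesgue. inv_fourier w x) = 0" if w: "test_function UNIV w" for w :: "'a \<Rightarrow> complex"
  proof -
    have wi: "integrable lebesgue w" by (rule test_function_integrable[OF w])
    have wc: "continuous_on UNIV w" by (rule smooth_continuous[OF test_function_smooth[OF w]])
    have mc: "continuous_on UNIV m" by (rule smooth_continuous[OF test_function_smooth[OF m]])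
    have Kw: "integrable lebesgue (inv_fourier w)" by (rule schwartz_integrable[OF schwartz_inv_fourier[OF w]])
    obtain W where W: "\<And>x. norm (w x) \<le> W" using test_function_bounded[OF w] by metis
    have lim_at_0: "(\<lambda>k. f (d k *\<^sub>R x)) \<longlonglongrightarrow> f 0" if "continuous_on UNIV f" for f :: "'a \<Rightarrow> complex" and x
    proof -
      have "(\<lambda>k. d k *\<^sub>R x) \<longlonglongrightarrow> 0 *\<^sub>R x" by (intro tendsto_scaleR dlim tendsto_const)
      then show ?thesis using that continuous_on_tendsto_compose[OF that, of "\<lambda>k. d k *\<^sub>R x" 0] by simp
    qed
    have meas: "(\<lambda>x. f (d k *\<^sub>R x)) \<in> borel_measurable lebesgue" if "continuous_on UNIV f" for f :: "'a \<Rightarrow> complex" and k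
      by (intro continuous_borel_measurable_lebesgue continuous_on_compose2[OF that] continuous_intros) auto
    have 1: "(\<lambda>k. LINT x|lebesgue. inv_fourier m x * w (d k *\<^sub>R x)) \<longlonglongrightarrow> (LINT x|lebesgue. inv_fourier m x * w 0)"
    proof (rule integral_dominated_convergence[where w = "\<lambda>x. norm (inv_fourier m x) * W"])
      show "integrable lebesgue (\<lambda>x. norm (inv_fourier m x) * W)" using Km by simp
      show "AE x in lebesgue. (\<lambda>k. inv_fourier m x * w (d k *\<^sub>R x)) \<longlonglongrightarrow> inv_fourier m x * w 0"
        by (intro AE_I2 tendsto_mult tendsto_const lim_at_0 wc)
      show "AE x in lebesgue. norm (inv_fourier m x * w (d k *\<^sub>R x)) \<le> norm (inv_fourier m x) * W" for k
        unfolding norm_mult by (intro AE_I2 mult_left_mono W) auto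
      show "(\<lambda>x. inv_fourier m x * w (d k *\<^sub>R x)) \<in> borel_measurable lebesgue" for k
        using meas[OF wc, of k] by measurable
    qed measurable
    have 2: "(\<lambda>k. LINT x|lebesgue. inv_fourier w x * m (d k *\<^sub>R x)) \<longlonglongrightarrow> (LINT x|lebesgue. inv_fourier w x * m 0)"
    proof (rule integral_dominated_convergence[where w = "\<lambda>x. norm (inv_fourier w x) * M"])
      have [measurable]: "inv_fourier w \<in> borel_measurable lebesgue" using Kw by auto
      show "integrable lebesgue (\<lambda>x. norm (inv_fourier w x) * M)" using Kw by simp
      show "AE x in lebesgue. (\<lambda>k. inv_fourier w x * m (d k *\<^sub>R x)) \<longlonglongrightarrow> inv_fourier w x * m 0"
        by (intro AE_I2 tendsto_mult tendsto_const lim_at_0 mc)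
      show "AE x in lebesgue. norm (inv_fourier w x * m (d k *\<^sub>R x)) \<le> norm (inv_fourier w x) * M" for k
        unfolding norm_mult by (intro AE_I2 mult_left_mono M) auto
      show "(\<lambda>x. inv_fourier w x * m (d k *\<^sub>R x)) \<in> borel_measurable lebesgue" for k
        using meas[OF mc, of k] by measurable
      show "(\<lambda>x. inv_fourier w x * m 0) \<in> borel_measurable lebesgue" by measurable
    qed
    \<comment> \<open>Duality and the substitution \<open>x -> d k x\<close> exchange the roles of
      \<open>m\<close> and \<open>w\<close>. As \<open>d k\<close> tends to 0, the two sides
      converge to \<open>w 0\<close> times the integral of \<open>inv_fourier m\<close> and to
      \<open>m 0\<close> times the integral of \<open>inv_fourier w\<close>.\<close>
    have "(LINT x|lebesgue. inv_fourier m x * w (d k *\<^sub>R x)) = (LINT x|lebesgue. inv_fourier w x * m (d k *\<^sub>R x))" for k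
    proof -
      have dk: "d k \<noteq> 0" using d[of k] by simp
      have wki: "integrable lebesgue (\<lambda>x. w (d k *\<^sub>R x))"
        using integral_scaling(1)[OF dk, of w 0] wi by simp
      have "(LINT x|lebesgue. inv_fourier m x * w (d k *\<^sub>R x)) = (LINT x|lebesgue. m x * inv_fourier (\<lambda>x. w (d k *\<^sub>R x)) x)"
        by (rule fourier_duality[OF mi wki, symmetric])
      also have "\<dots> = \<bar>d k\<bar> ^ DIM('a) *\<^sub>R (LINT x|lebesgue. m (d k *\<^sub>R x) * inv_fourier (\<lambda>x. w (d k *\<^sub>R x)) (d k *\<^sub>R x))"
        using integral_scaling(2)[OF dk, of "\<lambda>x. m x * inv_fourier (\<lambda>x. w (d k *\<^sub>R x)) x" 0] by simp
      also have "\<dots> = (LINT x|lebesgue. \<bar>d k\<bar> ^ DIM('a) *\<^sub>R (m (d k *\<^sub>R x) * inv_fourier (\<lambda>x. w (d k *\<^sub>R x)) (d k *\<^sub>R x)))"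
        by (rule integral_scaleR_right[symmetric])
      also have "\<dots> = (LINT x|lebesgue. inv_fourier w x * m (d k *\<^sub>R x))"
        using inv_fourier_affine[OF dk, of w 0] dk
        by (intro Bochner_Integration.integral_cong refl) (simp add: scaleR_conv_of_real)
      finally show ?thesis .
    qed
    with LIMSEQ_unique[OF 1] 2 have "(LINT x|lebesgue. inv_fourier m x * w 0) = (LINT x|lebesgue. inv_fourier w x * m 0)"
      by simp
    then show ?thesis using zero m0 by simp
  qed
  define P where "P = inv_fourier \<rho>"
  have Psch: "schwartz P" unfolding P_def by (rule schwartz_inv_fourier[OF test_function])
  have Pi: "integrable lebesgue P" by (rule schwartz_integrable[OF Psch])
  have iP: "inv_fourier P y = 0" for y
  proof -
    have "test_function UNIV (\<lambda>x. \<rho> (- y + 1 *\<^sub>R x))"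
      using test_function_affine[OF test_function, of 1 "- y"] by (simp add: add.commute)
    from w0[OF this] have "(LINT x|lebesgue. inv_fourier (\<lambda>x. \<rho> (- y + 1 *\<^sub>R x)) x) = 0" .
    then show ?thesis
      unfolding inv_fourier_affine[OF one_neq_zero] inv_fourier_character[of P]
      by (simp add: P_def mult.commute)
  qed
  have ri: "integrable lebesgue (\<lambda>x. \<rho> (- x))"
    using integral_scaling(1)[of "-1" \<rho> 0] integrable by simp
  have cnjP: "inv_fourier (\<lambda>x. \<rho> (- x)) x = cnj (P x)" for x
  proof -
    have c\<rho>: "cnj (\<rho> y) = \<rho> y" for y using real[of y] by (metis complex_cnj_complex_of_real)
    have "inv_fourier (\<lambda>x. \<rho> (- x)) x = inv_fourier \<rho> (- x)" by (rule inv_fourier_reflect[symmetric])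
    also have "\<dots> = cnj (inv_fourier \<rho> x)"
      unfolding inv_fourier_character Bochner_Integration.integral_cnj[symmetric] complex_cnj_mult c\<rho> cnj_character inner_minus_left ..
    finally show ?thesis by (simp add: P_def)
  qed
  \<comment> \<open>Since \<open>\<rho>\<close> is real, the second factor on the left is
    \<open>cnj (P x)\<close>, while the right-hand side vanishes with \<open>inv_fourier P\<close>.
    So \<open>P\<close> vanishes identically, although \<open>P 0\<close> is the positive mass of
    \<open>\<rho>\<close>.\<close>
  have "(LINT x|lebesgue. P x * inv_fourier (\<lambda>x. \<rho> (- x)) x) = (LINT y|lebesgue. inv_fourier P y * \<rho> (- y))"
    by (rule fourier_duality[OF Pi ri])
  then have "(LINT x|lebesgue. P x * cnj (P x)) = 0" by (simp add: iP cnjP)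
  moreover have "(LINT x|lebesgue. P x * cnj (P x)) = of_real (LINT x|lebesgue. (norm (P x))\<^sup>2)"
    unfolding integral_complex_of_real[symmetric] complex_norm_square by simp
  ultimately have P0: "(LINT x|lebesgue. (norm (P x))\<^sup>2) = 0" by simp
  obtain B where B: "\<And>x. norm (P x) \<le> B"
    using schwartzD[OF Psch, of "[]" 0] by auto
  have Pc: "continuous_on UNIV P" by (rule smooth_continuous[OF schwartz_smooth[OF Psch]])
  have "integrable lebesgue (\<lambda>x. norm (P x * P x))"
    by (intro integrable_norm integrable_mult_bounded_continuous[OF Pi Pc B])
  then have "integrable lebesgue (\<lambda>x. (norm (P x))\<^sup>2)" by (simp add: norm_mult power2_eq_square)
  from integral_nonneg_eq_0_iff_AE[OF this] P0 have P_AE: "AE x in lebesgue. P x = 0" by simp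
  have oP: "open {x. P x \<noteq> 0}" by (intro open_Collect_neq Pc continuous_intros)
  then have "{x. P x \<noteq> 0} \<in> sets lebesgue" by simp
  from AE_iff_null_sets[OF this] P_AE have "negligible {x. P x \<noteq> 0}"
    unfolding negligible_iff_null_sets by simp
  with oP have "{x. P x \<noteq> 0} = {}" using open_not_negligible by blast
  moreover have "P 0 = of_real mass" by (simp add: P_def inv_fourier_character integral_eq_mass)
  ultimately show False using mass_pos by auto
qed

lemma integral_fourier_nonzero:
  fixes m :: "'a \<Rightarrow> complex"
  assumes m: "test_function UNIV m" and m0: "m 0 \<noteq> 0"
  shows "(LINT x|lebesgue. fourier m x) \<noteq> 0"
  using integral_inv_fourier_nonzero[OF assms] integral_scaling(2)[of "-1" "inv_fourier m" 0]
  by (simp add: fourier_inv_fourier)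

text \<open>The convolution is split by a cut-off \<open>\<theta>\<close> around \<open>x0\<close>.
  In the near part \<open>T\<close> is integration against \<open>H x = h x * \<theta> x\<close>,
  which is continuous with compact support, so Fubini moves the kernel onto \<open>H\<close>, where
  it acts as an approximate identity. The far part is \<open>tempered_conv_far\<close>. The radius
  \<open>r\<close> is chosen before \<open>e\<close>, so that one ball serves every
  accuracy.\<close>

lemma tempered_conv_local:
  fixes T :: "'a functional" and h k :: "'a \<Rightarrow> complex"
  assumes T: "tempered_distribution T" and h: "represents h T"
    and U: "open U" "continuous_on U h" and k: "schwartz k" and x0: "x0 \<in> U"
  obtains r where "0 < r" "ball x0 r \<subseteq> U"
    "\<And>e. 0 < e \<Longrightarrow> \<exists>L\<ge>1. \<forall>l\<ge>L. \<forall>\<psi>. test_function (ball x0 r) \<psi> \<longrightarrow>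
       norm (T (conv (dilate l k) \<psi>) - (LINT x|lebesgue. k x) * (LINT x|lebesgue. h x * \<psi> x))
         \<le> e * (LINT x|lebesgue. norm (\<psi> x))"
proof -
  obtain r' where r': "0 < r'" "cball x0 r' \<subseteq> U" using open_contains_cball U(1) x0 by metis
  \<comment> \<open>\<open>\<theta>\<close> is \<open>\<rho>\<close> scaled by \<open>2 * r\<close>
    about \<open>x0\<close>: it is 1 on the ball of radius \<open>2 * r\<close> and vanishes beyond
    \<open>2 * r * R = r'\<close>, that is outside a ball contained in \<open>U\<close>.\<close>
  define r where "r = r' / (2 * R)"
  have R0: "0 < R" using R_gt_1 by simp
  have r: "0 < r" "2 * r * R = r'" "2 * r \<le> r'"
  proof -
    show "0 < r" "2 * r * R = r'" using r' R0 by (simp_all add: r_def)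
    then show "2 * r \<le> r'" using mult_left_mono[of 1 R "2 * r"] R_gt_1 by simp
  qed
  have rU: "ball x0 r \<subseteq> U" by (rule subset_trans[OF _ r'(2)]) (use r(1,3) in auto)
  define \<theta> where "\<theta> x = \<rho> ((1 / (2 * r)) *\<^sub>R x + (- (1 / (2 * r)) *\<^sub>R x0))" for x
  have arg: "norm ((1 / (2 * r)) *\<^sub>R x + (- (1 / (2 * r)) *\<^sub>R x0)) = dist x0 x / (2 * r)" for x
  proof -
    have "(1 / (2 * r)) *\<^sub>R x + (- (1 / (2 * r)) *\<^sub>R x0) = (1 / (2 * r)) *\<^sub>R (x - x0)"
      by (simp add: scaleR_diff_right)
    then show ?thesis using r(1) by (simp only: norm_scaleR) (simp add: dist_norm norm_minus_commute)
  qed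
  have t\<theta>: "test_function UNIV \<theta>" unfolding \<theta>_def[abs_def] using r by (intro test_function_affine test_function) simp
  have \<theta>1: "\<theta> x = 1" if "x \<in> ball x0 (2 * r)" for x
    unfolding \<theta>_def using that r by (intro eq_1) (simp only: arg, simp)
  have \<theta>0: "\<theta> x = 0" if "x \<notin> ball x0 r'" for x
  proof -
    have "R \<le> dist x0 x / (2 * r)" using that r by (simp add: pos_le_divide_eq mult.commute)
    then show ?thesis unfolding \<theta>_def by (intro eq_0) (simp only: arg)
  qed
  define \<sigma> where "\<sigma> x = 1 - \<theta> x" for x
  have sb\<theta>: "smooth_bounded \<theta>" by (rule schwartz_smooth_bounded[OF test_function_schwartz[OF t\<theta>]])
  have sb\<sigma>: "smooth_bounded \<sigma>" unfolding \<sigma>_def[abs_def] by (rule smooth_bounded_diff[OF smooth_bounded_const sb\<theta>])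
  obtain C where C: "0 \<le> C" "\<And>l \<psi>. 1 \<le> l \<Longrightarrow> test_function (ball x0 r) \<psi> \<Longrightarrow>
      norm (T (\<lambda>x. \<sigma> x * conv (dilate l k) \<psi> x)) \<le> C / l * (LINT y|lebesgue. norm (\<psi> y))"
    using tempered_conv_far[OF T k sb\<sigma> r(1), of x0] \<theta>1 by (auto simp: \<sigma>_def)
  define H where "H x = h x * \<theta> x" for x
  have hl: "locally_integrable UNIV h" using h by (simp add: represents_def)
  have H0: "H x = 0" if "x \<notin> cball x0 r'" for x using \<theta>0[of x] that by (auto simp: H_def)
  have Hc: "continuous_on UNIV H"
  proof -
    have 1: "continuous_on U H"
      unfolding H_def[abs_def] by (intro continuous_on_mult U smooth_continuous test_function_smooth[OF t\<theta>])
    have 2: "continuous_on (- cball x0 r') H"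
      by (rule continuous_on_eq[OF continuous_on_const[of _ 0]]) (use H0 in auto)
    have "continuous_on (U \<union> - cball x0 r') H" using U(1) by (intro continuous_on_open_Un 1 2) auto
    moreover have "U \<union> - cball x0 r' = UNIV" using r'(2) by auto
    ultimately show ?thesis by simp
  qed
  have Hi: "integrable lebesgue H" by (rule integrable_compact_support[OF Hc compact_cball H0])
  show ?thesis
  proof (rule that[OF r(1) rU])
    fix e :: real assume e: "0 < e"
    obtain L where L: "1 \<le> L"
      "\<And>l y. L \<le> l \<Longrightarrow> norm ((LINT x|lebesgue. H x * dilate l k (x - y)) - (LINT x|lebesgue. k x) * H y) \<le> e / 2"
      using approximate_identity_uniform[OF Hc compact_cball H0 k, where e = "e / 2"] e by auto
    define L' where "L' = max L (2 * C / e)"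
    show "\<exists>L\<ge>1. \<forall>l\<ge>L. \<forall>\<psi>. test_function (ball x0 r) \<psi> \<longrightarrow>
       norm (T (conv (dilate l k) \<psi>) - (LINT x|lebesgue. k x) * (LINT x|lebesgue. h x * \<psi> x))
         \<le> e * (LINT x|lebesgue. norm (\<psi> x))"
    proof (intro exI[of _ L'] conjI allI impI)
      show "1 \<le> L'" using L(1) by (simp add: L'_def)
      fix l :: real and \<psi> :: "'a \<Rightarrow> complex"
      assume l: "L' \<le> l" and \<psi>: "test_function (ball x0 r) \<psi>"
      have l1: "1 \<le> l" "L \<le> l" "2 * C / e \<le> l" using l L(1) by (auto simp: L'_def)
      define \<kappa> where "\<kappa> = (LINT x|lebesgue. k x)"
      have \<psi>i: "integrable lebesgue \<psi>" and \<psi>U: "test_function UNIV \<psi>"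
        using test_function_integrable[OF \<psi>] test_function_mono[OF \<psi>] by auto
      have sbd: "smooth_bounded (dilate l k)" by (rule smooth_bounded_dilate[OF schwartz_smooth_bounded[OF k]])
      have scs: "smooth (conv (dilate l k) \<psi>)" by (rule smooth_conv[OF sbd \<psi>i])
      have tc: "test_function UNIV (\<lambda>x. \<theta> x * conv (dilate l k) \<psi> x)"
        by (rule test_function_mult(2)[OF t\<theta> scs])
      have sc: "schwartz (\<lambda>x. \<sigma> x * conv (dilate l k) \<psi> x)"
        by (rule schwartz_mult[OF sb\<sigma> schwartz_conv[OF schwartz_dilate[OF k l1(1)] \<psi>U]])
      have split: "conv (dilate l k) \<psi> = (\<lambda>x. \<theta> x * conv (dilate l k) \<psi> x + \<sigma> x * conv (dilate l k) \<psi> x)"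
        by (auto simp: \<sigma>_def algebra_simps)
      have Tsplit: "T (conv (dilate l k) \<psi>) = T (\<lambda>x. \<theta> x * conv (dilate l k) \<psi> x) + T (\<lambda>x. \<sigma> x * conv (dilate l k) \<psi> x)"
        by (subst split, rule tempered_add[OF T test_function_schwartz[OF tc] sc])
      obtain Bd where Bd: "\<And>x. norm (iter_deriv [] (dilate l k) x) \<le> Bd"
        using sbd unfolding smooth_bounded_def by (metis empty_set empty_subsetI)
      have dc: "continuous_on UNIV (dilate l k)" using sbd by (simp add: smooth_bounded_def smooth_continuous)
      have cm: "(\<lambda>p. dilate l k (fst p - snd p)) \<in> borel_measurable (borel :: ('a \<times> 'a) measure)"
        by (intro borel_measurable_continuous_onI continuous_on_compose2[OF dc] continuous_intros) auto
      have "T (\<lambda>x. \<theta> x * conv (dilate l k) \<psi> x) = (LINT x|lebesgue. h x * (\<theta> x * conv (dilate l k) \<psi> x))"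
        using h tc by (simp add: represents_def distribution_of_def)
      also have "\<dots> = (LINT x|lebesgue. LINT y|lebesgue. H x * \<psi> y * dilate l k (x - y))"
        unfolding conv_def H_def
        by (intro Bochner_Integration.integral_cong refl) (simp only: integral_mult_right_zero mult.assoc)
      also have "\<dots> = (LINT y|lebesgue. LINT x|lebesgue. H x * \<psi> y * dilate l k (x - y))"
        by (rule fubini_bounded(1)[OF Hi \<psi>i cm, of Bd]) (use Bd in simp)
      also have "\<dots> = (LINT y|lebesgue. \<psi> y * (LINT x|lebesgue. H x * dilate l k (x - y)))"
        by (intro Bochner_Integration.integral_cong refl) (simp only: integral_mult_right_zero[symmetric] mult_ac)
      finally have T1: "T (\<lambda>x. \<theta> x * conv (dilate l k) \<psi> x) = (LINT y|lebesgue. \<psi> y * (LINT x|lebesgue. H x * dilate l k (x - y)))" .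
      have i2: "integrable lebesgue (\<lambda>y. \<psi> y * (LINT x|lebesgue. H x * dilate l k (x - y)))"
      proof -
        have cm': "(\<lambda>p. dilate l k (snd p - fst p)) \<in> borel_measurable (borel :: ('a \<times> 'a) measure)"
          by (intro borel_measurable_continuous_onI continuous_on_compose2[OF dc] continuous_intros) auto
        have "integrable lebesgue (\<lambda>y. LINT x|lebesgue. \<psi> y * H x * dilate l k (x - y))"
          by (rule fubini_bounded(2)[OF \<psi>i Hi cm', of Bd]) (use Bd in simp)
        then show ?thesis by (simp only: integral_mult_right_zero mult.assoc)
      qed
      have h\<psi>: "h y * \<psi> y = \<psi> y * H y" for y
      proof (cases "y \<in> ball x0 r")
        case True
        then show ?thesis using \<theta>1[of y] r by (simp add: H_def)
      next
        case False
        then have "\<psi> y = 0" using test_functionD[OF \<psi>] by (metis subsetD)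
        then show ?thesis by simp
      qed
      have i3: "integrable lebesgue (\<lambda>y. \<psi> y * H y)"
        using locally_integrable_mult_test[OF hl \<psi>U] by (simp only: h\<psi>)
      have "T (\<lambda>x. \<theta> x * conv (dilate l k) \<psi> x) - \<kappa> * (LINT x|lebesgue. h x * \<psi> x) =
          (LINT y|lebesgue. \<psi> y * (LINT x|lebesgue. H x * dilate l k (x - y)) - \<kappa> * (\<psi> y * H y))"
        unfolding T1 h\<psi> using i2 i3 by simp
      also have "norm \<dots> \<le> (LINT y|lebesgue. norm (\<psi> y * (LINT x|lebesgue. H x * dilate l k (x - y)) - \<kappa> * (\<psi> y * H y)))"
        by (rule integral_norm_bound)
      also have "\<dots> \<le> (LINT y|lebesgue. e / 2 * norm (\<psi> y))"
      proof (rule integral_mono)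
        show "integrable lebesgue (\<lambda>y. norm (\<psi> y * (LINT x|lebesgue. H x * dilate l k (x - y)) - \<kappa> * (\<psi> y * H y)))"
          using i2 i3 by (intro integrable_norm Bochner_Integration.integrable_diff integrable_mult_right)
        show "integrable lebesgue (\<lambda>y. e / 2 * norm (\<psi> y))" using \<psi>i by simp
        fix y
        have "norm (\<psi> y * (LINT x|lebesgue. H x * dilate l k (x - y)) - \<kappa> * (\<psi> y * H y))
           = norm (\<psi> y) * norm ((LINT x|lebesgue. H x * dilate l k (x - y)) - \<kappa> * H y)"
          unfolding norm_mult[symmetric] by (simp only: right_diff_distrib mult.left_commute)
        also have "\<dots> \<le> norm (\<psi> y) * (e / 2)" unfolding \<kappa>_def by (intro mult_left_mono L(2) l1) simp
        finally show "norm (\<psi> y * (LINT x|lebesgue. H x * dilate l k (x - y)) - \<kappa> * (\<psi> y * H y)) \<le> e / 2 * norm (\<psi> y)"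
          by (simp only: mult.commute)
      qed
      also have "\<dots> = e / 2 * (LINT y|lebesgue. norm (\<psi> y))" by simp
      finally have near: "norm (T (\<lambda>x. \<theta> x * conv (dilate l k) \<psi> x) - \<kappa> * (LINT x|lebesgue. h x * \<psi> x)) \<le> e / 2 * (LINT y|lebesgue. norm (\<psi> y))" .
      have "norm (T (\<lambda>x. \<sigma> x * conv (dilate l k) \<psi> x)) \<le> C / l * (LINT y|lebesgue. norm (\<psi> y))"
        by (rule C(2)[OF l1(1) \<psi>])
      also have "\<dots> \<le> e / 2 * (LINT y|lebesgue. norm (\<psi> y))"
        using l1 e by (intro mult_right_mono) (auto simp: field_simps)
      finally have far: "norm (T (\<lambda>x. \<sigma> x * conv (dilate l k) \<psi> x)) \<le> e / 2 * (LINT y|lebesgue. norm (\<psi> y))" .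
      have "T (conv (dilate l k) \<psi>) - \<kappa> * (LINT x|lebesgue. h x * \<psi> x) =
         (T (\<lambda>x. \<theta> x * conv (dilate l k) \<psi> x) - \<kappa> * (LINT x|lebesgue. h x * \<psi> x)) + T (\<lambda>x. \<sigma> x * conv (dilate l k) \<psi> x)"
        unfolding Tsplit by simp
      from norm_triangle_le[OF add_mono[OF near far], folded this]
      show "norm (T (conv (dilate l k) \<psi>) - (LINT x|lebesgue. k x) * (LINT x|lebesgue. h x * \<psi> x)) \<le> e * (LINT x|lebesgue. norm (\<psi> x))"
        by (simp add: \<kappa>_def)
    qed
  qed
qed

text \<open>The functions \<open>G j\<close> are known only through their pairings. On a small ball
  the local estimate with \<open>e = 1 / (i + 1)\<close> and the fundamental lemma bound the
  difference from the limit almost everywhere for each large \<open>j\<close>. There are countably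
  many \<open>i\<close> and \<open>j\<close>, and by Lindelof countably many balls cover
  \<open>U\<close>, so the exceptional sets form a null set.\<close>

lemma tempered_conv_AE:
  fixes T :: "'a functional" and h k :: "'a \<Rightarrow> complex" and G :: "nat \<Rightarrow> 'a \<Rightarrow> complex"
  assumes T: "tempered_distribution T" and h: "represents h T"
    and U: "open U" "continuous_on U h" and k: "schwartz k"
    and l: "filterlim l at_top sequentially"
    and G: "\<And>j. locally_integrable UNIV (G j)"
    and GT: "\<And>j \<psi>. test_function UNIV \<psi> \<Longrightarrow> (LINT x|lebesgue. G j x * \<psi> x) = T (conv (dilate (l j) k) \<psi>)"
  shows "AE x in lebesgue. x \<in> U \<longrightarrow> (\<lambda>j. G j x) \<longlonglongrightarrow> (LINT x|lebesgue. k x) * h x"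
proof -
  define \<kappa> where "\<kappa> = (LINT x|lebesgue. k x)"
  have hl: "locally_integrable UNIV h" using h by (simp add: represents_def)
  have dl: "locally_integrable UNIV (\<lambda>x. G j x - \<kappa> * h x)" for j
  proof -
    have [measurable]: "G j \<in> borel_measurable lebesgue" "h \<in> borel_measurable lebesgue"
      using locally_integrable_UNIV(1) G hl by auto
    have "integrable lebesgue (\<lambda>x. indicator K x *\<^sub>R (G j x - \<kappa> * h x))" if "compact K" for K
    proof -
      have "(\<lambda>x. indicator K x *\<^sub>R (G j x - \<kappa> * h x)) = (\<lambda>x. indicator K x *\<^sub>R G j x - \<kappa> * (indicator K x *\<^sub>R h x))"
        by (auto simp: scaleR_diff_right)
      then show ?thesis
        using locally_integrable_UNIV(2)[OF G that] locally_integrable_UNIV(2)[OF hl that]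
        by (simp only:) (intro Bochner_Integration.integrable_diff integrable_mult_right)
    qed
    then show ?thesis
      unfolding locally_integrable_def set_integrable_def by (auto simp: lebesgue_on_UNIV_eq)
  qed
  have loc: "\<exists>r>0. AE x in lebesgue. x \<in> ball x0 r \<longrightarrow> (\<lambda>j. G j x) \<longlonglongrightarrow> \<kappa> * h x" if x0: "x0 \<in> U" for x0
  proof -
    have "\<exists>r>0. \<forall>e>0. \<exists>L\<ge>1. \<forall>l\<ge>L. \<forall>\<psi>. test_function (ball x0 r) \<psi> \<longrightarrow>
       norm (T (conv (dilate l k) \<psi>) - \<kappa> * (LINT x|lebesgue. h x * \<psi> x)) \<le> e * (LINT x|lebesgue. norm (\<psi> x))"
      unfolding \<kappa>_def by (rule tempered_conv_local[OF T h U k x0]) blast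
    then obtain r where r: "0 < r" "\<And>e. 0 < e \<Longrightarrow> \<exists>L\<ge>1. \<forall>l\<ge>L. \<forall>\<psi>. test_function (ball x0 r) \<psi> \<longrightarrow>
       norm (T (conv (dilate l k) \<psi>) - \<kappa> * (LINT x|lebesgue. h x * \<psi> x)) \<le> e * (LINT x|lebesgue. norm (\<psi> x))"
      by blast
    have "AE x in lebesgue. \<forall>i::nat. \<forall>\<^sub>F j in sequentially. x \<in> ball x0 r \<longrightarrow> norm (G j x - \<kappa> * h x) \<le> 1 / real (Suc i)"
      unfolding AE_all_countable
    proof
      fix i :: nat
      define e where "e = 1 / real (Suc i)"
      have e: "0 < e" by (simp add: e_def)
      obtain L where L: "\<forall>l\<ge>L. \<forall>\<psi>. test_function (ball x0 r) \<psi> \<longrightarrow>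
         norm (T (conv (dilate l k) \<psi>) - \<kappa> * (LINT x|lebesgue. h x * \<psi> x)) \<le> e * (LINT x|lebesgue. norm (\<psi> x))"
        using r(2)[OF e] by blast
      obtain J where J: "\<And>j. J \<le> j \<Longrightarrow> L \<le> l j"
        using l unfolding filterlim_at_top eventually_sequentially by blast
      have "AE x in lebesgue. \<forall>j. J \<le> j \<longrightarrow> x \<in> ball x0 r \<longrightarrow> norm (G j x - \<kappa> * h x) \<le> e"
        unfolding AE_all_countable
      proof (intro allI)
        fix j
        show "AE x in lebesgue. J \<le> j \<longrightarrow> x \<in> ball x0 r \<longrightarrow> norm (G j x - \<kappa> * h x) \<le> e"
        proof (cases "J \<le> j")
          case True
          have "AE x in lebesgue. x \<in> ball x0 r \<longrightarrow> norm (G j x - \<kappa> * h x) \<le> e"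
          proof (rule fundamental_lemma[OF dl open_ball less_imp_le[OF e]])
            fix \<psi> :: "'a \<Rightarrow> complex" assume \<psi>: "test_function (ball x0 r) \<psi>"
            have \<psi>U: "test_function UNIV \<psi>" using test_function_mono[OF \<psi>] by simp
            have "(LINT x|lebesgue. (G j x - \<kappa> * h x) * \<psi> x) = (LINT x|lebesgue. G j x * \<psi> x - \<kappa> * (h x * \<psi> x))"
              by (simp only: left_diff_distrib mult.assoc)
            also have "\<dots> = T (conv (dilate (l j) k) \<psi>) - \<kappa> * (LINT x|lebesgue. h x * \<psi> x)"
              using locally_integrable_mult_test[OF G \<psi>U, of j] locally_integrable_mult_test[OF hl \<psi>U] GT[OF \<psi>U, of j] by simp
            finally show "norm (LINT x|lebesgue. (G j x - \<kappa> * h x) * \<psi> x) \<le> e * (LINT x|lebesgue. norm (\<psi> x))"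
              using L J[OF True] \<psi> by simp
          qed
          then show ?thesis by simp
        qed simp
      qed
      then show "AE x in lebesgue. \<forall>\<^sub>F j in sequentially. x \<in> ball x0 r \<longrightarrow> norm (G j x - \<kappa> * h x) \<le> 1 / real (Suc i)"
        unfolding eventually_sequentially e_def[symmetric] by (rule AE_mp) (intro AE_I2 impI, blast)
    qed
    then have "AE x in lebesgue. x \<in> ball x0 r \<longrightarrow> (\<lambda>j. G j x) \<longlonglongrightarrow> \<kappa> * h x"
    proof (rule AE_mp, intro AE_I2 impI)
      fix x assume H: "\<forall>i::nat. \<forall>\<^sub>F j in sequentially. x \<in> ball x0 r \<longrightarrow> norm (G j x - \<kappa> * h x) \<le> 1 / real (Suc i)"
        and x: "x \<in> ball x0 r"
      show "(\<lambda>j. G j x) \<longlonglongrightarrow> \<kappa> * h x"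
      proof (rule tendstoI)
        fix e :: real assume "0 < e"
        then obtain i where "inverse (real (Suc i)) < e" using reals_Archimedean by blast
        then have i: "1 / real (Suc i) < e" by (simp add: inverse_eq_divide)
        show "\<forall>\<^sub>F j in sequentially. dist (G j x) (\<kappa> * h x) < e"
          using H[rule_format, of i] by eventually_elim (use x i in \<open>simp add: dist_norm\<close>)
      qed
    qed
    then show ?thesis using r(1) by blast
  qed
  then have "\<forall>x0\<in>U. \<exists>r. 0 < r \<and> (AE x in lebesgue. x \<in> ball x0 r \<longrightarrow> (\<lambda>j. G j x) \<longlonglongrightarrow> \<kappa> * h x)"
    by blast
  from bchoice[OF this] obtain r where
    r: "\<forall>x0\<in>U. 0 < r x0 \<and> (AE x in lebesgue. x \<in> ball x0 (r x0) \<longrightarrow> (\<lambda>j. G j x) \<longlonglongrightarrow> \<kappa> * h x)"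
    by blast
  obtain F where F: "F \<subseteq> (\<lambda>x0. ball x0 (r x0)) ` U" "countable F" "\<Union>F = (\<Union>x0\<in>U. ball x0 (r x0))"
    using Lindelof[of "(\<lambda>x0. ball x0 (r x0)) ` U"] by auto
  have "AE x in lebesgue. \<forall>S\<in>F. x \<in> S \<longrightarrow> (\<lambda>j. G j x) \<longlonglongrightarrow> \<kappa> * h x"
    unfolding AE_ball_countable[OF F(2)] using F(1) r by blast
  then show ?thesis unfolding \<kappa>_def[symmetric]
  proof (rule AE_mp, intro AE_I2 impI)
    fix x assume H: "\<forall>S\<in>F. x \<in> S \<longrightarrow> (\<lambda>j. G j x) \<longlonglongrightarrow> \<kappa> * h x" and x: "x \<in> U"
    have "x \<in> \<Union>F" unfolding F(3) using x r by (intro UN_I[of x]) auto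
    then show "(\<lambda>j. G j x) \<longlonglongrightarrow> \<kappa> * h x" using H by blast
  qed
qed

end

section \<open>Quasi-norms\<close>

lemma enn_powr_ennreal: "0 \<le> a \<Longrightarrow> enn_powr (ennreal a) r = ennreal (a powr r)"
  by (simp add: enn_powr_def)

lemma enn_powr_infinity [simp]: "enn_powr \<infinity> r = \<infinity>"
  by (simp add: enn_powr_def)

lemma enn_powr_top [simp]: "enn_powr top r = top"
  by (simp add: enn_powr_def)

lemma enn_powr_0 [simp]: "enn_powr 0 r = 0"
  by (simp add: enn_powr_def)

lemma enn_powr_mono: "0 \<le> r \<Longrightarrow> x \<le> y \<Longrightarrow> enn_powr x r \<le> enn_powr y r"
  by (cases x; cases y) (auto simp: enn_powr_ennreal top_unique intro!: ennreal_leI powr_mono2)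

lemma enn_powr_enn_powr: "enn_powr (enn_powr x r) t = enn_powr x (r * t)"
  by (cases x) (auto simp: enn_powr_ennreal powr_powr simp flip: infinity_ennreal_def)

lemma enn_powr_1 [simp]: "enn_powr x 1 = x"
  by (cases x) (auto simp: enn_powr_ennreal simp flip: infinity_ennreal_def)

lemma lq_norm_ge:
  assumes "0 < q" shows "a i \<le> lq_norm q a"
proof (cases "q = \<infinity>")
  case True
  then show ?thesis by (auto simp: lq_norm_def intro: SUP_upper)
next
  case False
  define q' where "q' = enn2real q"
  have q': "0 < q'" using assms False by (simp add: q'_def enn2real_positive_iff less_top)
  have "enn_powr (a i) q' \<le> (\<integral>\<^sup>+ i. enn_powr (a i) q' \<partial>count_space UNIV)"
    by (rule nn_integral_ge_point) simp
  then have "enn_powr (enn_powr (a i) q') (1 / q') \<le> enn_powr (\<integral>\<^sup>+ i. enn_powr (a i) q' \<partial>count_space UNIV) (1 / q')"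
    using q' by (intro enn_powr_mono) auto
  then show ?thesis using False q' by (simp add: lq_norm_def q'_def enn_powr_enn_powr)
qed

lemma Lp_norm_mono_AE:
  assumes "0 < p" "AE x in lebesgue. h x \<le> h' x" shows "Lp_norm p h \<le> Lp_norm p h'"
  unfolding Lp_norm_def
proof (intro enn_powr_mono nn_integral_mono_AE)
  show "AE x in lebesgue. enn_powr (h x) p \<le> enn_powr (h' x) p"
    using assms(2) by eventually_elim (use assms(1) in \<open>auto intro: enn_powr_mono\<close>)
qed (use assms in auto)

text \<open>By convention the modulus of a distribution that is not a function is infinite
  everywhere, so a finite bound on a block forces the block to be a function.\<close>

lemma Lp_norm_top:
  assumes "0 < p" shows "Lp_norm p (\<lambda>_::'a::euclidean_space. \<infinity>) = \<infinity>"
  using assms by (simp add: Lp_norm_def ennreal_top_mult emeasure_lborel_UNIV)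

lemma Lp_norm_le_iff:
  assumes "0 < p" "0 \<le> Y"
  shows "Lp_norm p h \<le> ennreal Y \<longleftrightarrow> (\<integral>\<^sup>+ x. enn_powr (h x) p \<partial>lebesgue) \<le> ennreal (Y powr p)"
proof
  let ?I = "\<integral>\<^sup>+ x. enn_powr (h x) p \<partial>lebesgue"
  assume "Lp_norm p h \<le> ennreal Y"
  then have "enn_powr (enn_powr ?I (1 / p)) p \<le> enn_powr (ennreal Y) p"
    using assms unfolding Lp_norm_def by (intro enn_powr_mono) auto
  then show "?I \<le> ennreal (Y powr p)" using assms by (simp add: enn_powr_enn_powr enn_powr_ennreal)
next
  let ?I = "\<integral>\<^sup>+ x. enn_powr (h x) p \<partial>lebesgue"
  assume "?I \<le> ennreal (Y powr p)"
  then have "enn_powr ?I (1 / p) \<le> enn_powr (ennreal (Y powr p)) (1 / p)" using assms by (intro enn_powr_mono) auto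
  then show "Lp_norm p h \<le> ennreal Y" using assms by (simp add: Lp_norm_def enn_powr_ennreal powr_powr)
qed

text \<open>The block of index 0 has weight 1 for every \<open>s\<close>, and its symbol is
  \<open>\<phi>\<close> itself; this is how the smoothness exponent drops out of the lower bound.
  The same holds for the lattice point 0 in the modulation space.\<close>

lemma besov_norm_ge:
  assumes "0 < q" shows "Lp_norm p (distribution_modulus (fourier_multiplier \<phi> T)) \<le> besov_norm \<phi> p q s T"
proof -
  have "dyadic_symbol \<phi> 0 = \<phi>" by (auto simp: dyadic_symbol_def)
  then show ?thesis
    using lq_norm_ge[OF assms, of "\<lambda>j. ennreal (2 powr (real j * s)) * Lp_norm p (distribution_modulus (dyadic_block \<phi> j T))" 0]
    by (simp add: besov_norm_def dyadic_block_def)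
qed

lemma triebel_lizorkin_norm_ge:
  assumes "0 < q" "0 < p"
  shows "Lp_norm p (distribution_modulus (fourier_multiplier \<phi> T)) \<le> triebel_lizorkin_norm \<phi> p q s T"
  unfolding triebel_lizorkin_norm_def
proof (intro Lp_norm_mono_AE assms AE_I2)
  fix x
  have "dyadic_symbol \<phi> 0 = \<phi>" by (auto simp: dyadic_symbol_def)
  then show "distribution_modulus (fourier_multiplier \<phi> T) x \<le>
      lq_norm q (\<lambda>j. ennreal (2 powr (real j * s)) * distribution_modulus (dyadic_block \<phi> j T) x)"
    using lq_norm_ge[OF assms(1), of "\<lambda>j. ennreal (2 powr (real j * s)) * distribution_modulus (dyadic_block \<phi> j T) x" 0]
    by (simp add: dyadic_block_def)
qed

lemma lattice_point_0 [simp]: "lattice_point 0 = 0"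
  by (simp add: lattice_point_def vec_eq_iff)

lemma modulation_norm_ge:
  assumes "0 < q"
  shows "Lp_norm p (distribution_modulus (fourier_multiplier (uniform_symbol \<eta> 0) T)) \<le> modulation_norm \<eta> p q s T"
  using lq_norm_ge[OF assms, of "\<lambda>k. ennreal (sqrt (1 + (norm (lattice_point k))\<^sup>2) powr s) *
       Lp_norm p (distribution_modulus (uniform_block \<eta> k T))" 0]
  by (simp add: modulation_norm_def uniform_block_def)

section \<open>Hausdorff operators\<close>

definition annulus :: "real \<Rightarrow> real \<Rightarrow> 'a::euclidean_space set" where
  "annulus a b = {y. a \<le> norm y \<and> norm y \<le> b}"

lemma compact_annulus: "compact (annulus a b :: 'a::euclidean_space set)"
proof -
  have "closed {y::'a. a \<le> norm y}" by (intro closed_Collect_le continuous_intros)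
  then have "compact (cball 0 b \<inter> {y::'a. a \<le> norm y})" by (rule compact_Int_closed[OF compact_cball])
  moreover have "annulus a b = cball 0 b \<inter> {y::'a. a \<le> norm y}" by (auto simp: annulus_def)
  ultimately show ?thesis by simp
qed

lemma annulus_subset: "0 < a \<Longrightarrow> annulus a b \<subseteq> - {0}"
  by (auto simp: annulus_def)

lemma compact_subset_annulus:
  assumes "compact K" "K \<subseteq> - {0::'a::euclidean_space}"
  obtains a b where "0 < a" "a < b" "K \<subseteq> annulus a b"
proof -
  have "open (- K)" "0 \<in> - K" using assms by (auto simp: compact_imp_closed open_Compl)
  then obtain a where a: "0 < a" "ball 0 a \<subseteq> - K" by (meson open_contains_ball)
  obtain b where b: "\<And>x. x \<in> K \<Longrightarrow> norm x \<le> b" using compact_imp_bounded[OF assms(1)] unfolding bounded_iff by auto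
  show ?thesis
  proof (rule that[of a "max b (a + 1)"])
    show "K \<subseteq> annulus a (max b (a + 1))"
    proof
      fix x assume x: "x \<in> K"
      then have "x \<notin> ball 0 a" using a(2) by blast
      then show "x \<in> annulus a (max b (a + 1))" using b[OF x] by (auto simp: annulus_def)
    qed
  qed (use a in auto)
qed

lemma punctured_integrable:
  assumes "locally_integrable (- {0}) \<Phi>" "0 < a"
  shows "integrable lebesgue (\<lambda>y. indicator (annulus a b) y *\<^sub>R \<Phi> y)"
  using assms compact_annulus[of a b] annulus_subset[OF assms(2)]
  unfolding locally_integrable_def set_integrable_def by blast

text \<open>If \<open>f (x / norm y)\<close> is nonzero, then \<open>norm y\<close> lies between
  \<open>norm x / b\<close> and \<open>norm x / a\<close>. So for \<open>x\<close> in a fixed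
  annulus \<open>\<Phi>\<close> may be replaced by its restriction to another annulus, which is
  integrable.\<close>

lemma hausdorff_integrand_cutoff:
  fixes \<Phi> f :: "'a::euclidean_space \<Rightarrow> complex"
  assumes f: "\<And>z. z \<notin> annulus a b \<Longrightarrow> f z = 0" and ab: "0 < a" "0 < b" and x: "0 < c" "x \<in> annulus c d"
  shows "\<Phi> y * f (x /\<^sub>R norm y) = (indicator (annulus (c / b) (d / a)) y *\<^sub>R \<Phi> y) * f (x /\<^sub>R norm y)"
proof (cases "x /\<^sub>R norm y \<in> annulus a b")
  case True
  then have "y \<noteq> 0" using ab by (auto simp: annulus_def)
  then have *: "a * norm y \<le> norm x" "norm x \<le> b * norm y" using True by (auto simp: annulus_def field_simps)
  then have "a * norm y \<le> d" "c \<le> b * norm y" using x by (auto simp: annulus_def)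
  then have "y \<in> annulus (c / b) (d / a)" using ab by (auto simp: annulus_def field_simps)
  then show ?thesis by simp
qed (simp add: f)

lemma measurable_dilated_point:
  fixes f :: "'a::euclidean_space \<Rightarrow> complex"
  assumes "continuous_on UNIV f"
  shows "(\<lambda>p. f (snd p /\<^sub>R norm (fst p))) \<in> borel_measurable (borel :: ('a \<times> 'a) measure)"
    "(\<lambda>y. f (x /\<^sub>R norm y)) \<in> borel_measurable lebesgue"
proof -
  have [measurable]: "f \<in> borel_measurable borel" by (rule borel_measurable_continuous_onI[OF assms])
  show "(\<lambda>p. f (snd p /\<^sub>R norm (fst p))) \<in> borel_measurable (borel :: ('a \<times> 'a) measure)"
    unfolding borel_prod[symmetric] by measurable
  have "(\<lambda>y. f (x /\<^sub>R norm y)) \<in> borel_measurable borel" by measurable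
  then show "(\<lambda>y. f (x /\<^sub>R norm y)) \<in> borel_measurable lebesgue" by (rule borel_measurable_lebesgue)
qed

text \<open>For \<open>x\<close> in an open annulus only an integrable piece of
  \<open>\<Phi>\<close> is involved, and dominated convergence applies. The convergence almost
  everywhere of the rescaled blocks rests on this continuity; the origin itself is a null
  set.\<close>

lemma continuous_hausdorff_op:
  fixes \<Phi> f :: "'a::euclidean_space \<Rightarrow> complex"
  assumes \<Phi>: "locally_integrable (- {0}) \<Phi>" and f: "test_function (- {0}) f"
  shows "continuous_on (- {0}) (hausdorff_op \<Phi> f)"
proof -
  obtain K where K: "compact K" "K \<subseteq> - {0}" "\<And>x. x \<notin> K \<Longrightarrow> f x = 0" using test_functionD[OF f] by metis
  obtain a b where ab: "0 < a" "a < b" "K \<subseteq> annulus a b" using compact_subset_annulus[OF K(1,2)] by metis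
  have f0: "\<And>z. z \<notin> annulus a b \<Longrightarrow> f z = 0" using K(3) ab(3) by blast
  have fc: "continuous_on UNIV f" by (rule smooth_continuous[OF test_function_smooth[OF f]])
  obtain M where M: "0 \<le> M" "\<And>x. norm (f x) \<le> M" using test_function_bounded[OF f] by metis
  have b0: "0 < b" using ab by simp
  have loc: "continuous_on {x. c < norm x \<and> norm x < d} (hausdorff_op \<Phi> f)" if c: "0 < c" for c d
    unfolding continuous_on_sequentially
  proof (intro allI ballI impI)
    fix X :: "nat \<Rightarrow> 'a" and x
    assume x: "x \<in> {x. c < norm x \<and> norm x < d}" and X: "(\<forall>n. X n \<in> {x. c < norm x \<and> norm x < d}) \<and> X \<longlonglongrightarrow> x"
    let ?\<Phi> = "\<lambda>y. indicator (annulus (c / b) (d / a)) y *\<^sub>R \<Phi> y"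
    have \<Phi>i: "integrable lebesgue ?\<Phi>" using c b0 by (intro punctured_integrable[OF \<Phi>]) simp
    have eq: "hausdorff_op \<Phi> f z = (LINT y|lebesgue. ?\<Phi> y * f (z /\<^sub>R norm y))" if "c < norm z \<and> norm z < d" for z
      unfolding hausdorff_op_def
      by (intro Bochner_Integration.integral_cong refl hausdorff_integrand_cutoff[where a = a and b = b] f0 ab b0 c) (use that in \<open>auto simp: annulus_def\<close>)
    have "(\<lambda>n. LINT y|lebesgue. ?\<Phi> y * f (X n /\<^sub>R norm y)) \<longlonglongrightarrow> (LINT y|lebesgue. ?\<Phi> y * f (x /\<^sub>R norm y))"
    proof (rule integral_dominated_convergence[where w = "\<lambda>y. norm (?\<Phi> y) * M"])
      show "(\<lambda>y. ?\<Phi> y * f (z /\<^sub>R norm y)) \<in> borel_measurable lebesgue" for z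
        using borel_measurable_integrable[OF \<Phi>i] measurable_dilated_point(2)[OF fc, of z] by (rule borel_measurable_times)
      then show "(\<lambda>y. ?\<Phi> y * f (X n /\<^sub>R norm y)) \<in> borel_measurable lebesgue" for n .
      show "integrable lebesgue (\<lambda>y. norm (?\<Phi> y) * M)" by (rule integrable_mult_left[OF integrable_norm[OF \<Phi>i]])
      show "AE y in lebesgue. (\<lambda>n. ?\<Phi> y * f (X n /\<^sub>R norm y)) \<longlonglongrightarrow> ?\<Phi> y * f (x /\<^sub>R norm y)"
        using X by (intro AE_I2 tendsto_mult tendsto_const continuous_on_tendsto_compose[OF fc] tendsto_scaleR) auto
      show "AE y in lebesgue. norm (?\<Phi> y * f (X n /\<^sub>R norm y)) \<le> norm (?\<Phi> y) * M" for n
        unfolding norm_mult by (intro AE_I2 mult_left_mono M) simp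
    qed
    then show "(hausdorff_op \<Phi> f \<circ> X) \<longlonglongrightarrow> hausdorff_op \<Phi> f x"
      unfolding comp_def using eq X x by simp
  qed
  have "isCont (hausdorff_op \<Phi> f) x" if "x \<noteq> 0" for x
  proof -
    let ?S = "{z::'a. norm x / 2 < norm z \<and> norm z < 2 * norm x}"
    have "open ?S" by (intro open_Collect_conj open_Collect_less continuous_intros)
    moreover have "continuous_on ?S (hausdorff_op \<Phi> f)" by (rule loc) (use that in simp)
    ultimately have "\<forall>z\<in>?S. isCont (hausdorff_op \<Phi> f) z" by (simp only: continuous_on_eq_continuous_at)
    moreover have "x \<in> ?S" using that by simp
    ultimately show ?thesis by blast
  qed
  then show ?thesis by (intro continuous_at_imp_continuous_on) auto
qed

lemma hausdorff_op_dilate: "hausdorff_op \<Phi> (\<lambda>x. f (c *\<^sub>R x)) x = hausdorff_op \<Phi> f (c *\<^sub>R x)"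
  by (simp add: hausdorff_op_def mult.commute)

lemma test_function_dilate:
  fixes f :: "'a::euclidean_space \<Rightarrow> complex"
  assumes "test_function (- {0}) f" "c \<noteq> 0"
  shows "test_function (- {0}) (\<lambda>x. f (c *\<^sub>R x))"
proof -
  obtain K where K: "compact K" "K \<subseteq> - {0}" "\<And>x. x \<notin> K \<Longrightarrow> f x = 0" using test_functionD[OF assms(1)] by metis
  have cK: "compact ((*\<^sub>R) (1 / c) ` K)" by (rule compact_scaling[OF K(1)])
  show ?thesis
  proof (rule test_functionI[OF _ compact_imp_closed[OF cK] compact_imp_bounded[OF cK]])
    show "smooth (\<lambda>x. f (c *\<^sub>R x))" using smooth_affine_comp[OF test_function_smooth[OF assms(1)], of c 0] by simp
    show "(*\<^sub>R) (1 / c) ` K \<subseteq> - {0}" using K(2) assms(2) by auto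
    fix x assume "x \<notin> (*\<^sub>R) (1 / c) ` K"
    then have "c *\<^sub>R x \<notin> K" using assms(2) by (auto simp: image_iff)
    then show "f (c *\<^sub>R x) = 0" by (rule K(3))
  qed
qed

section \<open>From boundedness in a scale of spaces to an \<open>L^p\<close> estimate for the
  image\<close>

lemma fourier_multiplier_eq_conv:
  assumes "test_function UNIV m" "test_function UNIV \<psi>"
  shows "fourier_multiplier m T \<psi> = T (conv (fourier m) \<psi>)"
proof -
  have "fourier (\<lambda>\<xi>. m \<xi> * inv_fourier \<psi> \<xi>) = conv (fourier m) \<psi>"
    using fourier_mult_inv_fourier[OF test_function_integrable[OF assms(1)] test_function_integrable[OF assms(2)]] by blast
  then show ?thesis by (simp add: fourier_multiplier_def inv_fourier_dist_def mult_dist_def fourier_dist_def)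
qed

context cutoff
begin

text \<open>The growth allowed in \<open>l j\<close> is that of an \<open>L^p\<close> quasi-norm
  under dilation, so after rescaling the blocks \<open>G j\<close> have integrals of
  \<open>p\<close>-th powers bounded independently of \<open>j\<close>. Each \<open>G j\<close>
  pairs with \<open>\<psi>\<close> as the single distribution \<open>T\<close> does with
  \<open>conv (dilate (l j) k) \<psi>\<close>, where \<open>T\<close> represents the image of the
  undilated \<open>f\<close>.\<close>

lemma hausdorff_bounded_imp_Lp:
  fixes \<Phi> f m :: "'a \<Rightarrow> complex" and N :: "'a functional \<Rightarrow> ennreal"
  assumes m: "test_function UNIV m" and p: "0 < p"
    and N: "\<And>T. Lp_norm p (distribution_modulus (fourier_multiplier m T)) \<le> N T"
    and C: "0 \<le> C" "\<And>f. test_function (- {0}) f \<Longrightarrow>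
      \<exists>T. represents (hausdorff_op \<Phi> f) T \<and> T \<in> qspace N \<and> N T \<le> ennreal C * N (distribution_of f)"
    and \<Phi>: "locally_integrable (- {0}) \<Phi>" and f: "test_function (- {0}) f"
    and l: "\<And>j. 1 \<le> l j" "filterlim l at_top sequentially"
    and B: "0 \<le> B" "\<And>j::nat. N (distribution_of (\<lambda>x. f ((1 / l j) *\<^sub>R x))) \<le> ennreal (B * l j powr (real DIM('a) / p))"
  shows "(\<integral>\<^sup>+x. ennreal (norm ((LINT z|lebesgue. fourier m z) * hausdorff_op \<Phi> f x) powr p) \<partial>lebesgue) \<le> ennreal ((C * B) powr p)"
proof -
  define h where "h = hausdorff_op \<Phi> f"
  define k where "k = fourier m"
  define n where "n = DIM('a)"
  have kS: "schwartz k" unfolding k_def by (rule schwartz_fourier[OF m])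
  have hc: "continuous_on (- {0}) h" unfolding h_def by (rule continuous_hausdorff_op[OF \<Phi> f])
  obtain T where T: "represents h T" "tempered_distribution T"
    using C(2)[OF f] unfolding h_def qspace_def by blast
  have hl: "locally_integrable UNIV h" using T(1) by (simp add: represents_def)
  have "\<exists>G. locally_integrable UNIV G \<and> (\<forall>\<psi>. test_function UNIV \<psi> \<longrightarrow> (LINT x|lebesgue. G x * \<psi> x) = T (conv (dilate (l j) k) \<psi>)) \<and>
      (\<integral>\<^sup>+x. ennreal (norm (G x) powr p) \<partial>lebesgue) \<le> ennreal ((C * B) powr p)" for j
  proof -
    define c where "c = l j"
    have c: "1 \<le> c" "0 < c" "c \<noteq> 0" using l(1)[of j] by (auto simp: c_def)
    have cn: "c ^ n \<noteq> 0" "0 < c ^ n" using c by auto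
    define fc where "fc x = f ((1 / c) *\<^sub>R x)" for x
    have tfc: "test_function (- {0}) fc" unfolding fc_def[abs_def] using c by (intro test_function_dilate[OF f]) simp
    obtain Tc where Tc: "represents (hausdorff_op \<Phi> fc) Tc" "tempered_distribution Tc" "N Tc \<le> ennreal C * N (distribution_of fc)"
      using C(2)[OF tfc] unfolding qspace_def by blast
    have hfc: "hausdorff_op \<Phi> fc x = h ((1 / c) *\<^sub>R x)" for x
      unfolding fc_def[abs_def] h_def by (rule hausdorff_op_dilate)
    define Y where "Y = C * (B * c powr (real n / p))"
    have Y: "0 \<le> Y" using C(1) B(1) by (simp add: Y_def)
    have "N (distribution_of fc) \<le> ennreal (B * c powr (real n / p))"
      using B(2)[of j] unfolding fc_def[abs_def] c_def n_def .
    then have "N Tc \<le> ennreal C * ennreal (B * c powr (real n / p))"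
      using Tc(3) by (meson mult_left_mono order_trans zero_le)
    also have "\<dots> = ennreal Y" unfolding Y_def using C(1) B(1) by (simp add: ennreal_mult)
    finally have LY: "Lp_norm p (distribution_modulus (fourier_multiplier m Tc)) \<le> ennreal Y"
      using N[of Tc] order_trans by blast
    have "\<exists>g. represents g (fourier_multiplier m Tc)"
    proof (rule ccontr)
      assume "\<not> ?thesis"
      then have "distribution_modulus (fourier_multiplier m Tc) = (\<lambda>_. \<infinity>)" by (auto simp: distribution_modulus_def)
      then show False using LY Lp_norm_top[OF p, where 'a = 'a] by (simp add: top_unique)
    qed
    then obtain g where g: "represents g (fourier_multiplier m Tc)" by blast
    have gl: "locally_integrable UNIV g" using g by (simp add: represents_def)
    have gm: "g \<in> borel_measurable lebesgue" by (rule locally_integrable_UNIV(1)[OF gl])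
    have "(\<integral>\<^sup>+ x. ennreal (norm (g x) powr p) \<partial>lebesgue) = (\<integral>\<^sup>+ x. enn_powr (distribution_modulus (fourier_multiplier m Tc) x) p \<partial>lebesgue)"
      using distribution_modulus_eq[OF g] by (intro nn_integral_cong_AE) (auto simp: enn_powr_ennreal)
    also have "\<dots> \<le> ennreal (Y powr p)" using LY Lp_norm_le_iff[OF p Y] by blast
    also have "Y powr p = (C * B) powr p * c ^ n"
      unfolding Y_def using C(1) B(1) p c by (simp add: powr_mult powr_powr powr_realpow mult_ac)
    finally have gp: "(\<integral>\<^sup>+ x. ennreal (norm (g x) powr p) \<partial>lebesgue) \<le> ennreal ((C * B) powr p * c ^ n)" .
    define G where "G x = g (c *\<^sub>R x)" for x
    have Gm: "G \<in> borel_measurable lebesgue"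
      using measurable_compose[OF lebesgue_scaling(2)[OF c(3), of 0] gm] by (simp add: G_def[abs_def])
    have "locally_integrable UNIV G"
    proof -
      have "integrable lebesgue (\<lambda>x. indicator K x *\<^sub>R G x)" if K: "compact K" for K
      proof -
        have "compact ((*\<^sub>R) c ` K)" by (rule compact_scaling[OF K])
        from locally_integrable_UNIV(2)[OF gl this]
        have "integrable lebesgue (\<lambda>x. indicator ((*\<^sub>R) c ` K) (0 + c *\<^sub>R x) *\<^sub>R g (0 + c *\<^sub>R x))"
          by (subst integral_scaling(1)[OF c(3)])
        moreover have "indicat_real ((*\<^sub>R) c ` K) (0 + c *\<^sub>R x) = indicator K x" for x
          using c(3) by (auto simp: indicator_def image_iff)
        ultimately show ?thesis by (simp add: G_def)
      qed
      then show ?thesis unfolding locally_integrable_def set_integrable_def using Gm by (auto simp: lebesgue_on_UNIV_eq)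
    qed
    moreover have "(\<integral>\<^sup>+x. ennreal (norm (G x) powr p) \<partial>lebesgue) \<le> ennreal ((C * B) powr p)"
    proof -
      have gpm: "(\<lambda>x. ennreal (norm (g x) powr p)) \<in> borel_measurable lebesgue" using gm by measurable
      have "ennreal (c ^ n) * (\<integral>\<^sup>+x. ennreal (norm (G x) powr p) \<partial>lebesgue) \<le> ennreal ((C * B) powr p * c ^ n)"
        using gp nn_integral_scaling[OF c(3) gpm, of 0] c by (simp add: G_def n_def)
      also have "\<dots> = ennreal (c ^ n) * ennreal ((C * B) powr p)" using c by (simp add: ennreal_mult mult.commute)
      finally show ?thesis using cn by (subst (asm) ennreal_mult_le_mult_iff) (auto simp: ennreal_eq_0_iff)
    qed
    moreover have "(LINT x|lebesgue. G x * \<psi> x) = T (conv (dilate c k) \<psi>)" if \<psi>: "test_function UNIV \<psi>" for \<psi>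
    proof -
      define \<psi>c where "\<psi>c x = \<psi> ((1 / c) *\<^sub>R x)" for x
      have t\<psi>c: "test_function UNIV \<psi>c"
        unfolding \<psi>c_def[abs_def] using test_function_affine[OF \<psi>, of "1 / c" 0] c by simp
      have "(LINT x|lebesgue. g x * \<psi>c x) = c ^ n *\<^sub>R (LINT x|lebesgue. G x * \<psi> x)"
        using integral_scaling(2)[OF c(3), of "\<lambda>x. g x * \<psi>c x" 0] c by (simp add: G_def \<psi>c_def n_def)
      moreover have "(LINT x|lebesgue. g x * \<psi>c x) = Tc (conv k \<psi>c)"
        using g t\<psi>c fourier_multiplier_eq_conv[OF m t\<psi>c, of Tc] by (simp add: represents_def distribution_of_def k_def)
      \<comment> \<open>\<open>Tc\<close> represents the dilated image, so on test functions it
        agrees with the rescaled \<open>T\<close>. The Schwartz function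
        \<open>conv k \<psi>c\<close> is in general not a test function; density extends the
        identity to it.\<close>
      moreover have "Tc (conv k \<psi>c) = of_real (c ^ n) * T (\<lambda>x. conv k \<psi>c (c *\<^sub>R x))"
      proof (rule tempered_eq_on_schwartz[OF Tc(2) tempered_scaling[OF T(2) c(1)] _ schwartz_conv[OF kS t\<psi>c]])
        fix u :: "'a \<Rightarrow> complex" assume u: "test_function UNIV u"
        have u': "test_function UNIV (\<lambda>x. u (c *\<^sub>R x))" using test_function_affine[OF u c(3), of 0] by simp
        have "Tc u = (LINT x|lebesgue. h ((1 / c) *\<^sub>R x) * u x)"
          using Tc(1) u by (simp add: represents_def distribution_of_def hfc)
        also have "\<dots> = c ^ n *\<^sub>R (LINT x|lebesgue. h x * u (c *\<^sub>R x))"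
          using integral_scaling(2)[OF c(3), of "\<lambda>x. h ((1 / c) *\<^sub>R x) * u x" 0] c by (simp add: n_def)
        also have "\<dots> = of_real (c ^ n) * T (\<lambda>x. u (c *\<^sub>R x))"
          using T(1) u' by (simp add: represents_def distribution_of_def scaleR_conv_of_real)
        finally show "Tc u = of_real (c ^ n) * T (\<lambda>x. u (c *\<^sub>R x))" .
      qed
      moreover have "conv k \<psi>c (c *\<^sub>R x) = conv (dilate c k) \<psi> x" for x
      proof -
        have "conv k \<psi>c (c *\<^sub>R x) = \<bar>c\<bar> ^ DIM('a) *\<^sub>R (LINT y|lebesgue. \<psi>c (0 + c *\<^sub>R y) * k (c *\<^sub>R x - (0 + c *\<^sub>R y)))"
          unfolding conv_def by (rule integral_scaling(2)[OF c(3)])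
        also have "\<dots> = (LINT y|lebesgue. \<bar>c\<bar> ^ DIM('a) *\<^sub>R (\<psi>c (0 + c *\<^sub>R y) * k (c *\<^sub>R x - (0 + c *\<^sub>R y))))"
          by (rule integral_scaleR_right[symmetric])
        also have "\<dots> = conv (dilate c k) \<psi> x"
          unfolding conv_def dilate_def using c
          by (intro Bochner_Integration.integral_cong refl) (simp add: \<psi>c_def scaleR_conv_of_real scaleR_diff_right)
        finally show ?thesis .
      qed
      ultimately show ?thesis using c(3) by (auto simp: scaleR_conv_of_real)
    qed
    ultimately show ?thesis unfolding c_def by blast
  qed
  then obtain G where G: "\<And>j. locally_integrable UNIV (G j)"
    "\<And>j \<psi>. test_function UNIV \<psi> \<Longrightarrow> (LINT x|lebesgue. G j x * \<psi> x) = T (conv (dilate (l j) k) \<psi>)"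
    "\<And>j. (\<integral>\<^sup>+x. ennreal (norm (G j x) powr p) \<partial>lebesgue) \<le> ennreal ((C * B) powr p)"
    by metis
  define \<kappa> where "\<kappa> = (LINT z|lebesgue. k z)"
  have lim: "AE x in lebesgue. x \<in> - {0} \<longrightarrow> (\<lambda>j. G j x) \<longlonglongrightarrow> \<kappa> * h x"
    unfolding \<kappa>_def by (rule tempered_conv_AE[OF T(2,1) _ hc kS l(2) G(1,2)]) auto
  have "AE x in lebesgue. x \<in> - {0::'a}" using AE_not_in[of "{0::'a}" lebesgue] by (simp add: negligible_iff_null_sets[symmetric])
  with lim have "AE x in lebesgue. ennreal (norm (\<kappa> * h x) powr p) = liminf (\<lambda>j. ennreal (norm (G j x) powr p))"
  proof eventually_elim
    case (elim x)
    then have "(\<lambda>j. G j x) \<longlonglongrightarrow> \<kappa> * h x" by simp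
    then have "(\<lambda>j. norm (G j x) powr p) \<longlonglongrightarrow> norm (\<kappa> * h x) powr p"
      using p by (intro tendsto_powr' tendsto_norm tendsto_const) auto
    then have "(\<lambda>j. ennreal (norm (G j x) powr p)) \<longlonglongrightarrow> ennreal (norm (\<kappa> * h x) powr p)" by (rule tendsto_ennrealI)
    then show ?case by (intro lim_imp_Liminf[symmetric]) auto
  qed
  then have "(\<integral>\<^sup>+x. ennreal (norm (\<kappa> * h x) powr p) \<partial>lebesgue) = (\<integral>\<^sup>+x. liminf (\<lambda>j. ennreal (norm (G j x) powr p)) \<partial>lebesgue)"
    by (rule nn_integral_cong_AE)
  also have "\<dots> \<le> liminf (\<lambda>j. \<integral>\<^sup>+x. ennreal (norm (G j x) powr p) \<partial>lebesgue)"
  proof (rule nn_integral_liminf)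
    show "(\<lambda>x. ennreal (norm (G j x) powr p)) \<in> borel_measurable lebesgue" for j
      using locally_integrable_UNIV(1)[OF G(1)[of j]] by measurable
  qed
  also have "\<dots> \<le> ennreal ((C * B) powr p)"
    by (rule order_trans[OF Liminf_mono[of _ "\<lambda>_. ennreal ((C * B) powr p)"]]) (use G(3) in \<open>auto simp: Liminf_const\<close>)
  finally show ?thesis unfolding \<kappa>_def k_def h_def .
qed

end

section \<open>Quasi-norms of translated and dilated test functions\<close>

lemma continuous_locally_integrable:
  fixes f :: "'a::euclidean_space \<Rightarrow> complex"
  assumes "continuous_on UNIV f" shows "locally_integrable UNIV f"
proof -
  have "integrable lebesgue (\<lambda>x. indicator K x *\<^sub>R f x)" if "compact K" for K
    using borel_integrable_compact[OF that continuous_on_subset[OF assms subset_UNIV]] by (simp add: integrable_completion)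
  then show ?thesis
    using continuous_borel_measurable_lebesgue[OF assms]
    by (auto simp: locally_integrable_def set_integrable_def lebesgue_on_UNIV_eq)
qed

text \<open>Fubini and the reflection \<open>fourier m (x - y) = inv_fourier m (y - x)\<close> move
  the kernel from the test function to \<open>G\<close>. Thus the blocks of a test function are
  explicit smooth functions that can be estimated pointwise.\<close>

lemma conv_represents_multiplier:
  fixes m G :: "'a::euclidean_space \<Rightarrow> complex"
  assumes m: "test_function UNIV m" and G: "test_function UNIV G"
  shows "represents (conv (inv_fourier m) G) (fourier_multiplier m (distribution_of G))"
  unfolding represents_def
proof (intro conjI allI impI)
  have Gi: "integrable lebesgue G" by (rule test_function_integrable[OF G])
  have "smooth (conv (inv_fourier m) G)"
    by (rule smooth_conv[OF schwartz_smooth_bounded[OF schwartz_inv_fourier[OF m]] Gi])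
  then show "locally_integrable UNIV (conv (inv_fourier m) G)"
    by (intro continuous_locally_integrable smooth_continuous)
  fix \<psi> :: "'a \<Rightarrow> complex" assume \<psi>: "test_function UNIV \<psi>"
  have \<psi>i: "integrable lebesgue \<psi>" by (rule test_function_integrable[OF \<psi>])
  have Fs: "schwartz (fourier m)" by (rule schwartz_fourier[OF m])
  have Fc: "continuous_on UNIV (fourier m)" by (intro smooth_continuous schwartz_smooth[OF Fs])
  obtain B where B: "\<And>x. norm (fourier m x) \<le> B"
    using schwartzD[OF Fs, of "[]" 0] by auto
  have "fourier_multiplier m (distribution_of G) \<psi> = (LINT x|lebesgue. LINT y|lebesgue. G x * \<psi> y * fourier m (x - y))"
    unfolding fourier_multiplier_eq_conv[OF m \<psi>] distribution_of_def conv_def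
    by (intro Bochner_Integration.integral_cong refl) (simp only: integral_mult_right_zero mult.assoc)
  also have "\<dots> = (LINT y|lebesgue. LINT x|lebesgue. G x * \<psi> y * fourier m (x - y))"
    by (rule fubini_bounded(1)[OF Gi \<psi>i, of _ B])
       (use B in \<open>auto intro!: borel_measurable_continuous_onI continuous_on_compose2[OF Fc] continuous_intros\<close>)
  also have "\<dots> = (LINT y|lebesgue. LINT x|lebesgue. \<psi> y * (G x * inv_fourier m (y - x)))"
    by (intro Bochner_Integration.integral_cong refl) (simp add: fourier_inv_fourier)
  also have "\<dots> = distribution_of (conv (inv_fourier m) G) \<psi>"
    unfolding distribution_of_def conv_def
    by (intro Bochner_Integration.integral_cong refl) (simp only: integral_mult_right_zero mult.commute)
  finally show "fourier_multiplier m (distribution_of G) \<psi> = distribution_of (conv (inv_fourier m) G) \<psi>" .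
qed

lemma schwartz_weighted_integrable:
  fixes k :: "'a::euclidean_space \<Rightarrow> complex"
  assumes "schwartz k" shows "integrable lebesgue (\<lambda>u. (1 + norm u) ^ N * norm (k u))"
proof -
  obtain C where C: "\<And>x. (1 + norm x) ^ (N + (DIM('a) + 1)) * norm (iter_deriv [] k x) \<le> C"
    using schwartzD[OF assms, of "[]" "N + (DIM('a) + 1)"] by auto
  have "continuous_on UNIV (\<lambda>u. (1 + norm u) ^ N * norm (k u))"
    by (intro continuous_intros smooth_continuous schwartz_smooth[OF assms])
  moreover have "(1 + norm x) ^ (DIM('a) + 1) * norm ((1 + norm x) ^ N * norm (k x)) \<le> C" for x
  proof -
    have "norm ((1 + norm x) ^ N * norm (k x)) = (1 + norm x) ^ N * norm (k x)" by simp
    moreover have "(1 + norm x) ^ (DIM('a) + 1) * ((1 + norm x) ^ N * norm (k x)) = (1 + norm x) ^ (N + (DIM('a) + 1)) * norm (k x)"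
      by (simp only: power_add mult_ac)
    ultimately show ?thesis using C[of x] by (simp only: iter_deriv.simps)
  qed
  ultimately show ?thesis by (intro integrable_decay(1) continuous_borel_measurable_lebesgue)
qed

text \<open>The common features of the dyadic and the uniform decomposition; \<open>\<omega>\<close>
  is \<open>2 powr j\<close> in the first and the bracket of \<open>k\<close> in the second. By
  \<open>weight_le\<close> block \<open>i\<close> lives at frequencies of size at least about
  \<open>\<omega> i\<close>, \<open>kernel\<close> gives decay in space uniformly in
  \<open>i\<close>, and \<open>weight_summable\<close> lets sufficient decay in
  \<open>\<omega> i\<close> control an \<open>lq_norm\<close> with any exponent
  \<open>q > 0\<close>.\<close>

locale symbol_family = cutoff \<rho> R for \<rho> :: "'a::euclidean_space \<Rightarrow> complex" and R :: real +
  fixes m :: "'i \<Rightarrow> 'a \<Rightarrow> complex" and \<omega> :: "'i \<Rightarrow> real" and B D :: real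
  assumes symbol: "test_function UNIV (m i)"
    and kernel: "\<exists>C. \<forall>i. (LINT u|lebesgue. (1 + norm u) ^ N * norm (inv_fourier (m i) u)) \<le> C"
    and symbol_le: "norm (m i \<xi>) \<le> B"
    and weight_ge_1: "1 \<le> \<omega> i"
    and weight_le: "m i \<xi> \<noteq> 0 \<Longrightarrow> \<omega> i \<le> D * (1 + norm \<xi>)"
    and weight_summable: "\<exists>L. (\<integral>\<^sup>+i. ennreal (\<omega> i powr (- L)) \<partial>count_space UNIV) < \<infinity>"
    and countable_index: "countable (UNIV :: 'i set)"
begin

text \<open>With \<open>\<xi> = - v / \<mu>\<close> the block is bounded by the integral of
  \<open>m i (- v / \<mu>)\<close> times \<open>inv_fourier g v\<close>, in modulus. Where the
  symbol is nonzero, \<open>\<omega> i\<close> is at most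
  \<open>\<bar>D\<bar> * (1 + norm v)\<close> because \<open>\<mu> \<ge> 1\<close>, so the rapid
  decay of \<open>inv_fourier g\<close> pays for any power of \<open>\<omega> i\<close>. The
  translation \<open>z\<close> only contributes a factor of modulus 1.\<close>

lemma block_decay_frequency:
  fixes g :: "'a \<Rightarrow> complex"
  assumes g: "test_function UNIV g"
  obtains C where "0 \<le> C" "\<And>i \<mu> z x. 1 \<le> \<mu> \<Longrightarrow>
    \<omega> i ^ M * norm (conv (inv_fourier (m i)) (\<lambda>x. g ((1 / \<mu>) *\<^sub>R x + z)) x) \<le> C"
proof -
  define n where "n = DIM('a)"
  obtain C where C: "0 \<le> C" "\<And>v. (1 + norm v) ^ (M + (n + 1)) * norm (iter_deriv [] (inv_fourier g) v) \<le> C"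
    using schwartzD[OF schwartz_inv_fourier[OF g], of "[]" "M + (n + 1)"] by auto
  define I where "I = (LINT x|lebesgue. 1 / (1 + norm (x::'a)) ^ (DIM('a) + 1))"
  have I0: "0 \<le> I" unfolding I_def by (intro integral_nonneg_AE AE_I2) (simp add: add_nonneg_nonneg)
  have B0: "0 \<le> B" using symbol_le order_trans[OF norm_ge_zero] by blast
  show ?thesis
  proof (rule that[of "(B * \<bar>D\<bar> ^ M * C) * I"])
    show "0 \<le> (B * \<bar>D\<bar> ^ M * C) * I" using I0 B0 C by simp
    fix i and \<mu> :: real and z x :: 'a assume \<mu>: "1 \<le> \<mu>"
    define G where "G x = g ((1 / \<mu>) *\<^sub>R x + z)" for x
    have tG: "test_function UNIV G" unfolding G_def[abs_def] using \<mu> by (intro test_function_affine[OF g]) simp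
    have Gi: "integrable lebesgue G" by (rule test_function_integrable[OF tG])
    have mi: "integrable lebesgue (m i)" by (rule test_function_integrable[OF symbol])
    have mc: "continuous_on UNIV (m i)" by (intro smooth_continuous test_function_smooth[OF symbol])
    have gc: "continuous_on UNIV (inv_fourier g)"
      by (intro smooth_continuous schwartz_smooth schwartz_inv_fourier g)
    have Ghat: "norm (fourier G \<xi>) = \<mu> ^ n * norm (inv_fourier g (- \<mu> *\<^sub>R \<xi>))" for \<xi>
    proof -
      have "G = (\<lambda>x. g (z + (1 / \<mu>) *\<^sub>R x))" by (simp add: G_def[abs_def] add.commute)
      then show ?thesis
        using inv_fourier_affine[of "1 / \<mu>" g z "- \<xi>"] \<mu>
        by (simp add: fourier_inv_fourier norm_mult norm_power n_def norm_divide power_one_over)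
    qed
    define F where "F v = m i ((- (1 / \<mu>)) *\<^sub>R v) * inv_fourier g v" for v
    have Fb: "(1 + norm v) ^ (DIM('a) + 1) * norm ((\<omega> i ^ M) * norm (F v)) \<le> B * \<bar>D\<bar> ^ M * C" for v
    proof (cases "m i ((- (1 / \<mu>)) *\<^sub>R v) = 0")
      case True
      then show ?thesis using B0 C by (simp add: F_def)
    next
      case False
      have "\<omega> i \<le> D * (1 + norm ((- (1 / \<mu>)) *\<^sub>R v))" by (rule weight_le[OF False])
      also have "\<dots> \<le> \<bar>D\<bar> * (1 + norm ((- (1 / \<mu>)) *\<^sub>R v))" by (intro mult_right_mono) auto
      also have "\<dots> \<le> \<bar>D\<bar> * (1 + norm v)"
      proof -
        have "norm v / \<mu> \<le> norm v / 1" using \<mu> by (intro divide_left_mono) auto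
        then show ?thesis using \<mu> by (intro mult_left_mono) auto
      qed
      finally have "\<omega> i ^ M \<le> \<bar>D\<bar> ^ M * (1 + norm v) ^ M"
        unfolding power_mult_distrib[symmetric] using weight_ge_1[of i] by (intro power_mono) auto
      then have "\<omega> i ^ M * norm (F v) \<le> (\<bar>D\<bar> ^ M * (1 + norm v) ^ M) * (B * norm (inv_fourier g v))"
        unfolding F_def norm_mult using symbol_le B0 weight_ge_1[of i] by (intro mult_mono) auto
      then have "(1 + norm v) ^ (n + 1) * (\<omega> i ^ M * norm (F v)) \<le> (1 + norm v) ^ (n + 1) * ((\<bar>D\<bar> ^ M * (1 + norm v) ^ M) * (B * norm (inv_fourier g v)))"
        by (intro mult_left_mono) auto
      also have "\<dots> = (B * \<bar>D\<bar> ^ M) * ((1 + norm v) ^ (M + (n + 1)) * norm (inv_fourier g v))"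
        by (simp only: power_add mult_ac)
      also have "\<dots> \<le> (B * \<bar>D\<bar> ^ M) * C" using B0 C(2)[of v] by (intro mult_left_mono) auto
      finally show ?thesis using weight_ge_1[of i] by (simp add: n_def abs_mult)
    qed
    have Fc: "continuous_on UNIV (\<lambda>v. (\<omega> i ^ M) * norm (F v))"
      unfolding F_def by (intro continuous_intros gc continuous_on_compose2[OF mc]) auto
    have "\<omega> i ^ M * norm (conv (inv_fourier (m i)) G x) = \<omega> i ^ M * norm (inv_fourier (\<lambda>\<xi>. m i \<xi> * fourier G \<xi>) x)"
      by (simp only: inv_fourier_mult_fourier[OF mi Gi])
    also have "\<dots> \<le> \<omega> i ^ M * (LINT \<xi>|lebesgue. norm (m i \<xi> * fourier G \<xi>))"
      using weight_ge_1[of i] by (intro mult_left_mono norm_inv_fourier_le) auto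
    also have "(LINT \<xi>|lebesgue. norm (m i \<xi> * fourier G \<xi>)) =
        \<bar>- (1 / \<mu>)\<bar> ^ n *\<^sub>R (LINT v|lebesgue. norm (m i (0 + (- (1 / \<mu>)) *\<^sub>R v) * fourier G (0 + (- (1 / \<mu>)) *\<^sub>R v)))"
      unfolding n_def using \<mu> by (intro integral_scaling(2)) simp
    also have "\<dots> = (LINT v|lebesgue. \<bar>- (1 / \<mu>)\<bar> ^ n *\<^sub>R norm (m i (0 + (- (1 / \<mu>)) *\<^sub>R v) * fourier G (0 + (- (1 / \<mu>)) *\<^sub>R v)))"
      by (rule integral_scaleR_right[symmetric])
    also have "\<dots> = (LINT v|lebesgue. norm (F v))"
      using \<mu> by (intro Bochner_Integration.integral_cong refl) (simp add: norm_mult Ghat F_def power_divide)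
    also have "\<omega> i ^ M * \<dots> = (LINT v|lebesgue. norm ((\<omega> i ^ M) * norm (F v)))"
      using weight_ge_1[of i] by (simp add: abs_mult)
    also have "\<dots> \<le> (B * \<bar>D\<bar> ^ M * C) * I"
      unfolding I_def by (rule integrable_decay(2)[OF continuous_borel_measurable_lebesgue[OF Fc] Fb])
    finally show "\<omega> i ^ M * norm (conv (inv_fourier (m i)) (\<lambda>x. g ((1 / \<mu>) *\<^sub>R x + z)) x) \<le> (B * \<bar>D\<bar> ^ M * C) * I"
      unfolding G_def .
  qed
qed

text \<open>Since \<open>\<mu> \<ge> 1\<close>, the points \<open>x / \<mu> + z\<close> and
  \<open>y / \<mu> + z\<close> are no farther apart than \<open>x\<close> and \<open>y\<close>;
  Peetre's inequality then moves the weight onto the kernel, whose weighted norms are uniform in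
  \<open>i\<close>.\<close>

lemma block_decay_space:
  fixes g :: "'a \<Rightarrow> complex"
  assumes g: "test_function UNIV g"
  obtains C where "0 \<le> C" "\<And>i \<mu> z x. 1 \<le> \<mu> \<Longrightarrow>
    (1 + norm ((1 / \<mu>) *\<^sub>R x + z)) ^ N * norm (conv (inv_fourier (m i)) (\<lambda>x. g ((1 / \<mu>) *\<^sub>R x + z)) x) \<le> C"
proof -
  obtain r where r: "0 < r" "\<And>x. r \<le> norm x \<Longrightarrow> g x = 0" using test_function_bounded_support[OF g] by metis
  obtain W where W: "0 \<le> W" "\<And>x. norm (g x) \<le> W" using test_function_bounded[OF g] by metis
  obtain K where K: "\<And>i. (LINT u|lebesgue. (1 + norm u) ^ N * norm (inv_fourier (m i) u)) \<le> K"
    using kernel[of N] by blast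
  show ?thesis
  proof (rule that[of "(1 + r) ^ N * W * \<bar>K\<bar>"])
    show "0 \<le> (1 + r) ^ N * W * \<bar>K\<bar>" using r W by simp
    fix i and \<mu> :: real and z x :: 'a assume \<mu>: "1 \<le> \<mu>"
    define G where "G x = g ((1 / \<mu>) *\<^sub>R x + z)" for x
    define k where "k = inv_fourier (m i)"
    have kS: "schwartz k" unfolding k_def by (rule schwartz_inv_fourier[OF symbol])
    have tG: "test_function UNIV G" unfolding G_def[abs_def] using \<mu> by (intro test_function_affine[OF g]) simp
    have Gi: "integrable lebesgue G" by (rule test_function_integrable[OF tG])
    define X where "X = (1 + norm ((1 / \<mu>) *\<^sub>R x + z)) ^ N"
    have X0: "0 \<le> X" by (simp add: X_def)
    have wi: "integrable lebesgue (\<lambda>u. (1 + norm u) ^ N * norm (k u))" by (rule schwartz_weighted_integrable[OF kS])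
    have wi': "integrable lebesgue (\<lambda>y. (1 + norm (x - y)) ^ N * norm (k (x - y)))"
      using integral_scaling(1)[of "-1" "\<lambda>u. (1 + norm u) ^ N * norm (k u)" x] wi by simp
    have weq: "(LINT y|lebesgue. (1 + norm (x - y)) ^ N * norm (k (x - y))) = (LINT u|lebesgue. (1 + norm u) ^ N * norm (k u))"
      using integral_scaling(2)[of "-1" "\<lambda>u. (1 + norm u) ^ N * norm (k u)" x] by simp
    have pt: "X * norm (G y * k (x - y)) \<le> ((1 + r) ^ N * W) * ((1 + norm (x - y)) ^ N * norm (k (x - y)))" for y
    proof (cases "r \<le> norm ((1 / \<mu>) *\<^sub>R y + z)")
      case True
      then have "G y = 0" by (simp add: G_def r(2))
      then show ?thesis using r W by simp
    next
      case False
      have "1 + norm ((1 / \<mu>) *\<^sub>R x + z) \<le> (1 + norm (((1 / \<mu>) *\<^sub>R x + z) - ((1 / \<mu>) *\<^sub>R y + z))) * (1 + norm ((1 / \<mu>) *\<^sub>R y + z))"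
        by (rule peetre)
      also have "\<dots> \<le> (1 + norm (x - y)) * (1 + r)"
      proof (rule mult_mono)
        have "((1 / \<mu>) *\<^sub>R x + z) - ((1 / \<mu>) *\<^sub>R y + z) = (1 / \<mu>) *\<^sub>R (x - y)" by (simp add: scaleR_diff_right)
        moreover have "norm (x - y) / \<mu> \<le> norm (x - y) / 1" using \<mu> by (intro divide_left_mono) auto
        ultimately show "1 + norm (((1 / \<mu>) *\<^sub>R x + z) - ((1 / \<mu>) *\<^sub>R y + z)) \<le> 1 + norm (x - y)" using \<mu> by simp
      qed (use False in auto)
      finally have "X \<le> (1 + norm (x - y)) ^ N * (1 + r) ^ N"
        unfolding X_def power_mult_distrib[symmetric] by (intro power_mono) auto
      then have "X * (norm (G y) * norm (k (x - y))) \<le> ((1 + norm (x - y)) ^ N * (1 + r) ^ N) * (W * norm (k (x - y)))"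
        using W r by (intro mult_mono) (auto simp: G_def)
      then show ?thesis by (simp only: norm_mult mult_ac)
    qed
    have gki: "integrable lebesgue (\<lambda>y. norm (G y * k (x - y)))"
      by (rule integrable_norm[OF conv_integrable[OF schwartz_smooth_bounded[OF kS] Gi]])
    have "X * norm (conv k G x) \<le> X * (LINT y|lebesgue. norm (G y * k (x - y)))"
      unfolding conv_def by (intro mult_left_mono integral_norm_bound X0)
    also have "\<dots> = (LINT y|lebesgue. X * norm (G y * k (x - y)))" by (rule integral_mult_right_zero[symmetric])
    also have "\<dots> \<le> (LINT y|lebesgue. ((1 + r) ^ N * W) * ((1 + norm (x - y)) ^ N * norm (k (x - y))))"
      by (rule integral_mono[OF integrable_mult_right[OF gki] integrable_mult_right[OF wi'] pt])
    also have "\<dots> = ((1 + r) ^ N * W) * (LINT u|lebesgue. (1 + norm u) ^ N * norm (k u))"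
      unfolding weq[symmetric] by (rule integral_mult_right_zero)
    also have "\<dots> \<le> ((1 + r) ^ N * W) * \<bar>K\<bar>"
      using K[of i] r W unfolding k_def by (intro mult_left_mono) auto
    finally show "(1 + norm ((1 / \<mu>) *\<^sub>R x + z)) ^ N * norm (conv (inv_fourier (m i)) (\<lambda>x. g ((1 / \<mu>) *\<^sub>R x + z)) x) \<le> (1 + r) ^ N * W * \<bar>K\<bar>"
      unfolding X_def k_def G_def .
  qed
qed

text \<open>Both decays hold at the same time by taking a geometric mean: each is used with twice
  the exponent, the two are multiplied, and the square root restores \<open>M\<close> and
  \<open>N\<close>.\<close>

lemma block_decay:
  fixes g :: "'a \<Rightarrow> complex"
  assumes g: "test_function UNIV g"
  obtains C where "0 \<le> C" "\<And>i \<mu> z x. 1 \<le> \<mu> \<Longrightarrow>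
    norm (conv (inv_fourier (m i)) (\<lambda>x. g ((1 / \<mu>) *\<^sub>R x + z)) x) \<le> C / \<omega> i ^ M / (1 + norm ((1 / \<mu>) *\<^sub>R x + z)) ^ N"
proof -
  obtain C1 where C1: "0 \<le> C1" "\<And>i \<mu> z x. 1 \<le> \<mu> \<Longrightarrow>
    \<omega> i ^ (M + M) * norm (conv (inv_fourier (m i)) (\<lambda>x. g ((1 / \<mu>) *\<^sub>R x + z)) x) \<le> C1"
    by (rule block_decay_frequency[OF g, of "M + M"]) blast
  obtain C2 where C2: "0 \<le> C2" "\<And>i \<mu> z x. 1 \<le> \<mu> \<Longrightarrow>
    (1 + norm ((1 / \<mu>) *\<^sub>R x + z)) ^ (N + N) * norm (conv (inv_fourier (m i)) (\<lambda>x. g ((1 / \<mu>) *\<^sub>R x + z)) x) \<le> C2"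
    by (rule block_decay_space[OF g, of "N + N"]) blast
  show ?thesis
  proof (rule that[of "sqrt (C1 * C2)"])
    show "0 \<le> sqrt (C1 * C2)" using C1 C2 by simp
    fix i and \<mu> :: real and z x :: 'a assume \<mu>: "1 \<le> \<mu>"
    define b where "b = norm (conv (inv_fourier (m i)) (\<lambda>x. g ((1 / \<mu>) *\<^sub>R x + z)) x)"
    define P where "P = \<omega> i ^ M"
    define Q where "Q = (1 + norm ((1 / \<mu>) *\<^sub>R x + z)) ^ N"
    have P: "0 < P" unfolding P_def using weight_ge_1[of i] by (intro zero_less_power) simp
    have Q: "0 < Q" unfolding Q_def by (intro zero_less_power) (simp add: add_pos_nonneg)
    have b: "0 \<le> b" by (simp add: b_def)
    have "(P * P * b) * (Q * Q * b) \<le> C1 * C2"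
      using C1(2)[OF \<mu>, of i z x] C2(2)[OF \<mu>, of x z i] C1(1) b P Q
      unfolding b_def P_def Q_def power_add[symmetric] by (intro mult_mono) auto
    then have "(b * P * Q)\<^sup>2 \<le> C1 * C2" by (simp add: power2_eq_square mult_ac)
    then have "b * P * Q \<le> sqrt (C1 * C2)" using real_le_rsqrt by blast
    then show "norm (conv (inv_fourier (m i)) (\<lambda>x. g ((1 / \<mu>) *\<^sub>R x + z)) x) \<le> sqrt (C1 * C2) / \<omega> i ^ M / (1 + norm ((1 / \<mu>) *\<^sub>R x + z)) ^ N"
      unfolding b_def[symmetric] P_def[symmetric] Q_def[symmetric] using P Q by (simp add: pos_le_divide_eq mult_ac)
  qed
qed

section \<open>From pointwise bounds on the blocks to the quasi-norms\<close>

lemma lq_norm_weights: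
  fixes s :: real
  assumes q: "0 < q"
  obtains M :: nat and S where "0 \<le> S"
    "\<And>K a. 0 \<le> K \<Longrightarrow> (\<And>i. a i \<le> ennreal (K / \<omega> i ^ M)) \<Longrightarrow>
       lq_norm q (\<lambda>i. ennreal (\<omega> i powr s) * a i) \<le> ennreal (K * S)"
proof -
  have le: "ennreal (\<omega> i powr s) * a i \<le> ennreal (K * \<omega> i powr (s - real M))"
    if "0 \<le> K" "\<And>i. a i \<le> ennreal (K / \<omega> i ^ M)" for K a i and M :: nat
  proof -
    have w: "0 < \<omega> i" using weight_ge_1[of i] by simp
    have "ennreal (\<omega> i powr s) * a i \<le> ennreal (\<omega> i powr s) * ennreal (K / \<omega> i ^ M)"
      by (intro mult_left_mono that) simp
    also have "\<dots> = ennreal (K * \<omega> i powr (s - real M))"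
      using w that(1) by (simp add: ennreal_mult[symmetric] powr_diff powr_realpow mult_ac)
    finally show ?thesis .
  qed
  show ?thesis
  proof (cases "q = \<infinity>")
    case True
    obtain M :: nat where M: "s \<le> real M" using real_arch_simple by blast
    show ?thesis
    proof (rule that[of 1 M])
      fix K and a :: "'i \<Rightarrow> ennreal" assume K: "0 \<le> K" "\<And>i. a i \<le> ennreal (K / \<omega> i ^ M)"
      have "ennreal (\<omega> i powr s) * a i \<le> ennreal (K * 1)" for i
      proof (rule order_trans[OF le[OF K]])
        have "\<omega> i powr (s - real M) \<le> \<omega> i powr 0" using M weight_ge_1[of i] by (intro powr_mono) auto
        then show "ennreal (K * \<omega> i powr (s - real M)) \<le> ennreal (K * 1)"
          using K(1) weight_ge_1[of i] by (intro ennreal_leI mult_left_mono) auto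
      qed
      then show "lq_norm q (\<lambda>i. ennreal (\<omega> i powr s) * a i) \<le> ennreal (K * 1)"
        unfolding lq_norm_def using True by (auto intro: SUP_least)
    qed simp
  next
    case False
    define q' where "q' = enn2real q"
    have q': "0 < q'" using q False by (simp add: q'_def enn2real_positive_iff less_top)
    obtain L where L: "(\<integral>\<^sup>+i. ennreal (\<omega> i powr (- L)) \<partial>count_space UNIV) < \<infinity>" using weight_summable by blast
    define Z where "Z = enn2real (\<integral>\<^sup>+i. ennreal (\<omega> i powr (- L)) \<partial>count_space UNIV)"
    have Z: "(\<integral>\<^sup>+i. ennreal (\<omega> i powr (- L)) \<partial>count_space UNIV) = ennreal Z" "0 \<le> Z" using L by (auto simp: Z_def less_top)
    \<comment> \<open>This \<open>M\<close> gives \<open>(s - M) * q' \<le> - L\<close>, so the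
      \<open>q'\<close>-th powers of the weighted terms are dominated by the summable
      family.\<close>
    obtain M :: nat where M: "s + L / q' \<le> real M" using real_arch_simple by blast
    show ?thesis
    proof (rule that[of "Z powr (1 / q')" M])
      fix K and a :: "'i \<Rightarrow> ennreal" assume K: "0 \<le> K" "\<And>i. a i \<le> ennreal (K / \<omega> i ^ M)"
      have "enn_powr (ennreal (\<omega> i powr s) * a i) q' \<le> ennreal (K powr q') * ennreal (\<omega> i powr (- L))" for i
      proof -
        have w: "1 \<le> \<omega> i" by (rule weight_ge_1)
        have "enn_powr (ennreal (\<omega> i powr s) * a i) q' \<le> enn_powr (ennreal (K * \<omega> i powr (s - real M))) q'"
          using q' by (intro enn_powr_mono le[OF K]) auto
        also have "\<dots> = ennreal (K powr q' * \<omega> i powr ((s - real M) * q'))"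
          using K(1) by (simp add: enn_powr_ennreal powr_mult powr_powr)
        also have "\<dots> \<le> ennreal (K powr q' * \<omega> i powr (- L))"
        proof (intro ennreal_leI mult_left_mono powr_mono w)
          have "L / q' \<le> real M - s" using M by simp
          then have "L \<le> (real M - s) * q'" using q' by (simp only: pos_divide_le_eq)
          then show "(s - real M) * q' \<le> - L" by (simp add: algebra_simps)
        qed simp
        also have "\<dots> = ennreal (K powr q') * ennreal (\<omega> i powr (- L))" by (simp add: ennreal_mult)
        finally show ?thesis .
      qed
      then have "(\<integral>\<^sup>+i. enn_powr (ennreal (\<omega> i powr s) * a i) q' \<partial>count_space UNIV)
         \<le> (\<integral>\<^sup>+i. ennreal (K powr q') * ennreal (\<omega> i powr (- L)) \<partial>count_space UNIV)"
        by (intro nn_integral_mono)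
      also have "\<dots> = ennreal (K powr q' * Z)" using Z by (simp add: nn_integral_cmult ennreal_mult)
      finally have "enn_powr (\<integral>\<^sup>+i. enn_powr (ennreal (\<omega> i powr s) * a i) q' \<partial>count_space UNIV) (1 / q') \<le> enn_powr (ennreal (K powr q' * Z)) (1 / q')"
        using q' by (intro enn_powr_mono) auto
      also have "\<dots> = ennreal (K * Z powr (1 / q'))"
        using K(1) Z q' by (simp add: enn_powr_ennreal powr_mult powr_powr)
      finally show "lq_norm q (\<lambda>i. ennreal (\<omega> i powr s) * a i) \<le> ennreal (K * Z powr (1 / q'))"
        using False by (simp add: lq_norm_def q'_def)
    qed simp
  qed
qed

text \<open>The condition on \<open>N\<close> makes the \<open>p\<close>-th power of the decay
  integrable. Undoing the substitution \<open>z + x / \<mu>\<close> costs \<open>\<mu>\<close> to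
  the power of the dimension, which the \<open>p\<close>-th root turns into the stated exponent, and
  the translation costs nothing.\<close>

lemma Lp_norm_decay:
  assumes p: "0 < p" and N: "real (DIM('a) + 1) \<le> real N * p"
  obtains I where "0 \<le> I" "\<And>K \<mu> h and z::'a. 0 \<le> K \<Longrightarrow> 1 \<le> \<mu> \<Longrightarrow>
     (AE x in lebesgue. h x \<le> ennreal (K / (1 + norm ((1 / \<mu>) *\<^sub>R x + z)) ^ N)) \<Longrightarrow>
     Lp_norm p h \<le> ennreal (K * I * \<mu> powr (real DIM('a) / p))"
proof -
  define J where "J = enn2real (\<integral>\<^sup>+x. ennreal (1 / (1 + norm (x::'a)) ^ (DIM('a) + 1)) \<partial>lebesgue)"
  have J: "(\<integral>\<^sup>+x. ennreal (1 / (1 + norm (x::'a)) ^ (DIM('a) + 1)) \<partial>lebesgue) = ennreal J" "0 \<le> J"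
    using nn_integral_decay_finite[where 'a = 'a] by (auto simp: J_def less_top)
  show ?thesis
  proof (rule that[of "J powr (1 / p)"])
    fix K \<mu> :: real and h and z :: 'a
    assume K: "0 \<le> K" and \<mu>: "1 \<le> \<mu>"
      and h: "AE x in lebesgue. h x \<le> ennreal (K / (1 + norm ((1 / \<mu>) *\<^sub>R x + z)) ^ N)"
    define w where "w x = ennreal (1 / (1 + norm (x::'a)) ^ (DIM('a) + 1))" for x
    have one: "1 + norm x \<noteq> 0" for x :: 'a using norm_ge_zero[of x] by linarith
    have wm: "w \<in> borel_measurable lebesgue"
      unfolding w_def[abs_def] using one
      by (intro measurable_compose[OF _ measurable_ennreal] continuous_borel_measurable_lebesgue continuous_intros) auto
    have "(\<integral>\<^sup>+x. enn_powr (h x) p \<partial>lebesgue) \<le> (\<integral>\<^sup>+x. ennreal (K powr p) * w (z + (1 / \<mu>) *\<^sub>R x) \<partial>lebesgue)"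
    proof (rule nn_integral_mono_AE, use h in eventually_elim)
      case (elim x)
      define t where "t = 1 + norm (z + (1 / \<mu>) *\<^sub>R x)"
      have t: "1 \<le> t" by (simp add: t_def)
      have "enn_powr (h x) p \<le> enn_powr (ennreal (K / t ^ N)) p"
        using p elim by (intro enn_powr_mono) (auto simp: t_def add.commute)
      also have "\<dots> = ennreal (K powr p / (t powr (real N * p)))"
        using K t by (simp add: enn_powr_ennreal powr_divide powr_powr flip: powr_realpow)
      also have "\<dots> \<le> ennreal (K powr p * (1 / t ^ (DIM('a) + 1)))"
      proof -
        have "t powr real (DIM('a) + 1) \<le> t powr (real N * p)" using t N by (intro powr_mono) auto
        then have "K powr p / t powr (real N * p) \<le> K powr p / t powr real (DIM('a) + 1)"
          using t by (intro divide_left_mono mult_pos_pos) auto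
        also have "\<dots> = K powr p * (1 / t ^ (DIM('a) + 1))" using t by (subst powr_realpow) auto
        finally show ?thesis by (rule ennreal_leI)
      qed
      also have "\<dots> = ennreal (K powr p) * w (z + (1 / \<mu>) *\<^sub>R x)"
        using t by (simp add: w_def t_def ennreal_mult[symmetric])
      finally show ?case .
    qed
    also have "\<dots> = ennreal (K powr p) * (\<integral>\<^sup>+x. w (z + (1 / \<mu>) *\<^sub>R x) \<partial>lebesgue)"
      using measurable_compose[OF lebesgue_scaling(2)[of "1 / \<mu>" z] wm] \<mu> by (intro nn_integral_cmult) simp
    also have "(\<integral>\<^sup>+x. w (z + (1 / \<mu>) *\<^sub>R x) \<partial>lebesgue) = ennreal (\<mu> ^ DIM('a) * J)"
    proof -
      have w0: "w (z + (1 / \<mu>) *\<^sub>R (- \<mu> *\<^sub>R z + \<mu> *\<^sub>R x)) = w x" for x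
      proof -
        have "z + (1 / \<mu>) *\<^sub>R (- \<mu> *\<^sub>R z + \<mu> *\<^sub>R x) = x" using \<mu> by (simp add: scaleR_add_right scaleR_diff_right)
        then show ?thesis by (simp only:)
      qed
      have wm': "(\<lambda>x. w (z + (1 / \<mu>) *\<^sub>R x)) \<in> borel_measurable lebesgue"
        using measurable_compose[OF lebesgue_scaling(2)[of "1 / \<mu>" z] wm] \<mu> by simp
      have "(\<integral>\<^sup>+x. w (z + (1 / \<mu>) *\<^sub>R x) \<partial>lebesgue) = ennreal (\<bar>\<mu>\<bar> ^ DIM('a)) * (\<integral>\<^sup>+x. w (z + (1 / \<mu>) *\<^sub>R (- \<mu> *\<^sub>R z + \<mu> *\<^sub>R x)) \<partial>lebesgue)"
        using \<mu> by (intro nn_integral_scaling wm') simp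
      also have "\<dots> = ennreal (\<mu> ^ DIM('a)) * ennreal J"
        using J(1) \<mu> unfolding w0 by (simp only: w_def[abs_def]) simp
      finally show ?thesis using \<mu> J by (simp add: ennreal_mult)
    qed
    also have "ennreal (K powr p) * ennreal (\<mu> ^ DIM('a) * J) = ennreal ((K * J powr (1 / p) * \<mu> powr (real DIM('a) / p)) powr p)"
      using K \<mu> J p by (simp add: ennreal_mult[symmetric] powr_mult powr_powr powr_realpow mult_ac)
    finally show "Lp_norm p h \<le> ennreal (K * J powr (1 / p) * \<mu> powr (real DIM('a) / p))"
      by (subst Lp_norm_le_iff[OF p]) (use K J in auto)
  qed simp
qed

text \<open>The pointwise bound on the blocks is a product of decay in \<open>\<omega> i\<close> and
  decay in \<open>x\<close>, so the \<open>lq_norm\<close> and the \<open>Lp_norm\<close> can be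
  taken in either order: one order covers Besov and modulation spaces, the other Triebel-Lizorkin
  spaces.\<close>

lemma family_norm_bound:
  fixes s :: real and g :: "'a \<Rightarrow> complex"
  assumes q: "0 < q" and p: "0 < p" and g: "test_function UNIV g"
  obtains A where "0 \<le> A"
    "\<And>\<mu> z. 1 \<le> \<mu> \<Longrightarrow> lq_norm q (\<lambda>i. ennreal (\<omega> i powr s) * Lp_norm p (distribution_modulus
        (fourier_multiplier (m i) (distribution_of (\<lambda>x. g ((1 / \<mu>) *\<^sub>R x + z)))))) \<le> ennreal (A * \<mu> powr (real DIM('a) / p))"
    "\<And>\<mu> z. 1 \<le> \<mu> \<Longrightarrow> Lp_norm p (\<lambda>x. lq_norm q (\<lambda>i. ennreal (\<omega> i powr s) * distribution_modulus
        (fourier_multiplier (m i) (distribution_of (\<lambda>x. g ((1 / \<mu>) *\<^sub>R x + z)))) x)) \<le> ennreal (A * \<mu> powr (real DIM('a) / p))"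
proof -
  obtain N :: nat where "real (DIM('a) + 1) / p \<le> real N" using real_arch_simple by blast
  then have N: "real (DIM('a) + 1) \<le> real N * p" using p by (simp only: pos_divide_le_eq)
  obtain I where I: "0 \<le> I" "\<And>K \<mu> h and z::'a. 0 \<le> K \<Longrightarrow> 1 \<le> \<mu> \<Longrightarrow>
     (AE x in lebesgue. h x \<le> ennreal (K / (1 + norm ((1 / \<mu>) *\<^sub>R x + z)) ^ N)) \<Longrightarrow>
     Lp_norm p h \<le> ennreal (K * I * \<mu> powr (real DIM('a) / p))"
    by (rule Lp_norm_decay[OF p N]) blast
  obtain M :: nat and S where S: "0 \<le> S"
    "\<And>K a. 0 \<le> K \<Longrightarrow> (\<And>i. a i \<le> ennreal (K / \<omega> i ^ M)) \<Longrightarrow>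
       lq_norm q (\<lambda>i. ennreal (\<omega> i powr s) * a i) \<le> ennreal (K * S)"
    by (rule lq_norm_weights[OF q, of s]) blast
  obtain C where C: "0 \<le> C" "\<And>i \<mu> z x. 1 \<le> \<mu> \<Longrightarrow>
    norm (conv (inv_fourier (m i)) (\<lambda>x. g ((1 / \<mu>) *\<^sub>R x + z)) x) \<le> C / \<omega> i ^ M / (1 + norm ((1 / \<mu>) *\<^sub>R x + z)) ^ N"
    by (rule block_decay[OF g, of M N]) blast
  have mod: "AE x in lebesgue. distribution_modulus (fourier_multiplier (m i) (distribution_of (\<lambda>x. g ((1 / \<mu>) *\<^sub>R x + z)))) x
      \<le> ennreal (C / \<omega> i ^ M / (1 + norm ((1 / \<mu>) *\<^sub>R x + z)) ^ N)" if \<mu>: "1 \<le> \<mu>" for i \<mu> z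
  proof -
    have "test_function UNIV (\<lambda>x. g ((1 / \<mu>) *\<^sub>R x + z))" using \<mu> by (intro test_function_affine[OF g]) simp
    from distribution_modulus_eq[OF conv_represents_multiplier[OF symbol[of i] this]] show ?thesis
      by eventually_elim (use C(2)[OF \<mu>] in \<open>simp add: ennreal_leI\<close>)
  qed
  show ?thesis
  proof (rule that[of "C * I * S"])
    show "0 \<le> C * I * S" using C I S by simp
    fix \<mu> :: real and z :: 'a assume \<mu>: "1 \<le> \<mu>"
    define T where "T = distribution_of (\<lambda>x. g ((1 / \<mu>) *\<^sub>R x + z))"
    define E where "E = \<mu> powr (real DIM('a) / p)"
    have E: "0 \<le> E" by (simp add: E_def)
    have w0: "0 \<le> C / \<omega> i ^ M" for i using C(1) weight_ge_1[of i] by simp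
    have "lq_norm q (\<lambda>i. ennreal (\<omega> i powr s) * Lp_norm p (distribution_modulus (fourier_multiplier (m i) T))) \<le> ennreal ((C * I * E) * S)"
    proof (rule S(2))
      show "0 \<le> C * I * E" using C I E by simp
      show "Lp_norm p (distribution_modulus (fourier_multiplier (m i) T)) \<le> ennreal ((C * I * E) / \<omega> i ^ M)" for i
        using I(2)[OF w0 \<mu> mod[OF \<mu>], of i z] unfolding T_def E_def by (simp add: mult_ac)
    qed
    then show "lq_norm q (\<lambda>i. ennreal (\<omega> i powr s) * Lp_norm p (distribution_modulus (fourier_multiplier (m i) T))) \<le> ennreal (C * I * S * E)"
      by (simp add: mult_ac)
    have "AE x in lebesgue. \<forall>i. distribution_modulus (fourier_multiplier (m i) T) x \<le> ennreal (C / \<omega> i ^ M / (1 + norm ((1 / \<mu>) *\<^sub>R x + z)) ^ N)"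
      using AE_ball_countable[OF countable_index, of "\<lambda>x i. distribution_modulus (fourier_multiplier (m i) T) x \<le> ennreal (C / \<omega> i ^ M / (1 + norm ((1 / \<mu>) *\<^sub>R x + z)) ^ N)" lebesgue]
        mod[OF \<mu>, of _ z] unfolding T_def by simp
    then have "AE x in lebesgue. lq_norm q (\<lambda>i. ennreal (\<omega> i powr s) * distribution_modulus (fourier_multiplier (m i) T) x) \<le> ennreal ((C * S) / (1 + norm ((1 / \<mu>) *\<^sub>R x + z)) ^ N)"
    proof eventually_elim
      case (elim x)
      define t where "t = (1 + norm ((1 / \<mu>) *\<^sub>R x + z)) ^ N"
      have t: "0 \<le> t" by (simp add: t_def)
      have "lq_norm q (\<lambda>i. ennreal (\<omega> i powr s) * distribution_modulus (fourier_multiplier (m i) T) x) \<le> ennreal ((C / t) * S)"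
        by (rule S(2)) (use elim C t in \<open>auto simp: t_def field_simps\<close>)
      then show ?case unfolding t_def by simp
    qed
    from I(2)[OF _ \<mu> this] show "Lp_norm p (\<lambda>x. lq_norm q (\<lambda>i. ennreal (\<omega> i powr s) * distribution_modulus (fourier_multiplier (m i) T) x)) \<le> ennreal (C * I * S * E)"
      using C S unfolding E_def by (simp add: mult_ac)
  qed
qed

end

section \<open>Vanishing of bounded Hausdorff operators\<close>

context cutoff
begin

text \<open>\<open>\<rho>\<close> rescaled to width \<open>\<epsilon>\<close> about
  \<open>e\<close>, written with an affine argument so that its dilates are literally of the form
  \<open>\<rho> (x / \<mu> + z)\<close> in the norm bounds, with \<open>\<mu>\<close> the product of
  the dilation and \<open>\<epsilon>\<close>.\<close>

definition bump :: "'a \<Rightarrow> real \<Rightarrow> 'a \<Rightarrow> complex" where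
  "bump e \<epsilon> x = \<rho> ((1 / \<epsilon>) *\<^sub>R x + (- (1 / \<epsilon>) *\<^sub>R e))"

lemma bump_eq_0:
  assumes "0 < \<epsilon>" "\<epsilon> * R \<le> norm (x - e)" shows "bump e \<epsilon> x = 0"
proof -
  have "(1 / \<epsilon>) *\<^sub>R x + (- (1 / \<epsilon>) *\<^sub>R e) = (1 / \<epsilon>) *\<^sub>R (x - e)" by (simp add: scaleR_diff_right)
  moreover have "R \<le> norm ((1 / \<epsilon>) *\<^sub>R (x - e))" using assms unfolding norm_scaleR by (simp add: field_simps)
  ultimately show ?thesis unfolding bump_def by (simp only: eq_0)
qed

lemma bump_support:
  assumes "0 < \<epsilon>" "\<epsilon> * R \<le> norm e / 2" "x \<notin> annulus (norm e / 2) (2 * norm e)"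
  shows "bump e \<epsilon> x = 0"
proof (rule bump_eq_0[OF assms(1)])
  show "\<epsilon> * R \<le> norm (x - e)"
  proof (rule ccontr)
    assume "\<not> \<epsilon> * R \<le> norm (x - e)"
    then have "norm (x - e) < norm e / 2" using assms(2) by simp
    moreover have "norm x \<le> norm (x - e) + norm e" "norm e \<le> norm (x - e) + norm x"
      using norm_triangle_ineq[of "x - e" e] norm_triangle_ineq4[of x "x - e"] by auto
    ultimately have "x \<in> annulus (norm e / 2) (2 * norm e)" by (simp add: annulus_def)
    then show False using assms(3) by simp
  qed
qed

lemma test_function_bump:
  assumes "0 < \<epsilon>" "\<epsilon> * R \<le> norm e / 2" "e \<noteq> 0"
  shows "test_function (- {0}) (bump e \<epsilon>)"
proof (rule test_functionI)
  show "smooth (bump e \<epsilon>)" unfolding bump_def[abs_def] by (rule smooth_affine_comp[OF smooth])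
  show "closed (annulus (norm e / 2) (2 * norm e))" "bounded (annulus (norm e / 2) (2 * norm e))"
    by (auto intro: compact_imp_closed compact_imp_bounded compact_annulus)
  show "annulus (norm e / 2) (2 * norm e) \<subseteq> - {0}" using assms(3) by (intro annulus_subset) simp
qed (rule bump_support[OF assms(1,2)])

lemma continuous_bump: "continuous_on UNIV (bump e \<epsilon>)"
  unfolding bump_def[abs_def] by (intro smooth_continuous smooth_affine_comp smooth)

lemma norm_bump_le_1: "norm (bump e \<epsilon> x) \<le> 1"
  unfolding bump_def by (rule norm_le_1)

context
  fixes \<Phi> :: "'a \<Rightarrow> complex" and e :: 'a and \<epsilon> :: "nat \<Rightarrow> real" and a b :: real
  assumes \<Phi>: "locally_integrable (- {0}) \<Phi>" and e: "e \<noteq> 0"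
    and \<epsilon>: "\<And>k. 0 < \<epsilon> k" "\<And>k. \<epsilon> k * R \<le> norm e / 2" "\<epsilon> \<longlonglongrightarrow> 0"
    and ab: "0 < a" "a < b"
begin

text \<open>The annulus is the one given by \<open>hausdorff_integrand_cutoff\<close> for
  \<open>x\<close> in \<open>annulus a b\<close> and a function supported in
  \<open>annulus (norm e / 2) (2 * norm e)\<close>, where all the bumps in question live. It is
  independent of the width of the bump.\<close>

abbreviation (input) "\<Phi>' \<equiv> (\<lambda>y. indicator (annulus (a / (2 * norm e)) (b / (norm e / 2))) y *\<^sub>R \<Phi> y)"

lemma integrable_cut: "integrable lebesgue \<Phi>'"
  using ab e by (intro punctured_integrable[OF \<Phi>]) simp

lemma hausdorff_op_bump:
  assumes "x \<in> annulus a b"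
  shows "hausdorff_op \<Phi> (bump e (\<epsilon> k)) x = (LINT y|lebesgue. \<Phi>' y * bump e (\<epsilon> k) (x /\<^sub>R norm y))"
  unfolding hausdorff_op_def
  by (intro Bochner_Integration.integral_cong refl hausdorff_integrand_cutoff bump_support \<epsilon> ab assms) (use e in auto)

text \<open>For fixed \<open>x\<close>, the function \<open>y \<mapsto> bump e \<epsilon> (x / |y|)\<close> lives on a spherical shell which
  shrinks to a null set; a compactness argument makes this uniform in \<open>x\<close>.\<close>

lemma hausdorff_op_bump_uniformly_small:
  assumes d: "0 < d"
  shows "\<exists>K. \<forall>k\<ge>K. \<forall>x\<in>annulus a b. norm (hausdorff_op \<Phi> (bump e (\<epsilon> k)) x) \<le> d"
proof (rule ccontr)
  assume "\<not> ?thesis"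
  then have "\<forall>K. \<exists>k x. K \<le> k \<and> x \<in> annulus a b \<and> d < norm (hausdorff_op \<Phi> (bump e (\<epsilon> k)) x)"
    by (simp add: not_le) blast
  then obtain k x where kx: "\<And>K. K \<le> k K" "\<And>K. x K \<in> annulus a b"
    "\<And>K. d < norm (hausdorff_op \<Phi> (bump e (\<epsilon> (k K))) (x K))" by metis
  have "\<forall>n. x n \<in> annulus a b" using kx(2) by blast
  with compact_annulus obtain l r where l: "l \<in> annulus a b" and r: "strict_mono r" "(x \<circ> r) \<longlonglongrightarrow> l"
    unfolding compact_def by metis
  have krlim: "(\<lambda>j. \<epsilon> (k (r j))) \<longlonglongrightarrow> 0"
  proof (rule filterlim_compose[OF \<epsilon>(3)])
    show "filterlim (\<lambda>j. k (r j)) sequentially sequentially"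
    proof (rule filterlim_at_top_mono[OF filterlim_ident])
      show "\<forall>\<^sub>F j in sequentially. j \<le> k (r j)"
        using kx(1) seq_suble[OF r(1)] by (intro always_eventually allI) (meson order_trans)
    qed
  qed
  have "(\<lambda>j. LINT y|lebesgue. \<Phi>' y * bump e (\<epsilon> (k (r j))) (x (r j) /\<^sub>R norm y)) \<longlonglongrightarrow> (LINT y::'a|lebesgue. 0)"
  proof (rule integral_dominated_convergence[where w = "\<lambda>y. norm (\<Phi>' y)"])
    show "(\<lambda>y. \<Phi>' y * bump e (\<epsilon> (k (r j))) (x (r j) /\<^sub>R norm y)) \<in> borel_measurable lebesgue" for j
      using borel_measurable_integrable[OF integrable_cut] measurable_dilated_point(2)[OF continuous_bump, of _ _ "x (r j)"]
      by (rule borel_measurable_times)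
    show "integrable lebesgue (\<lambda>y. norm (\<Phi>' y))" by (rule integrable_norm[OF integrable_cut])
    show "AE y in lebesgue. norm (\<Phi>' y * bump e (\<epsilon> (k (r j))) (x (r j) /\<^sub>R norm y)) \<le> norm (\<Phi>' y)" for j
      unfolding norm_mult by (intro AE_I2 mult_right_le_one_le norm_bump_le_1) auto
    \<comment> \<open>The limit \<open>l\<close> of the bad points determines the exceptional set:
      if \<open>norm y\<close> differs from \<open>norm l / norm e\<close>, then
      \<open>l / norm y\<close> is not \<open>e\<close>, and the shrinking bumps eventually vanish
      at the points where they are evaluated.\<close>
    have "sphere (0::'a) (norm l / norm e) \<in> null_sets lebesgue"
      using negligible_sphere negligible_iff_null_sets by blast
    then have "AE y in lebesgue. y \<notin> sphere (0::'a) (norm l / norm e)" by (rule AE_not_in)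
    then show "AE y in lebesgue. (\<lambda>j. \<Phi>' y * bump e (\<epsilon> (k (r j))) (x (r j) /\<^sub>R norm y)) \<longlonglongrightarrow> 0"
    proof eventually_elim
      case (elim y)
      have ne: "l /\<^sub>R norm y - e \<noteq> 0"
      proof
        assume "l /\<^sub>R norm y - e = 0"
        then have eq: "e = l /\<^sub>R norm y" by simp
        then have "y \<noteq> 0" using e by auto
        then have "norm l / norm e = norm y" using eq e by (auto simp: field_simps)
        then show False using elim by simp
      qed
      have "(\<lambda>j. norm (x (r j) /\<^sub>R norm y - e)) \<longlonglongrightarrow> norm (l /\<^sub>R norm y - e)"
        using r(2) unfolding comp_def by (intro tendsto_intros)
      moreover have "(\<lambda>j. \<epsilon> (k (r j)) * R) \<longlonglongrightarrow> 0 * R" by (intro tendsto_intros krlim)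
      ultimately have "(\<lambda>j. norm (x (r j) /\<^sub>R norm y - e) - \<epsilon> (k (r j)) * R) \<longlonglongrightarrow> norm (l /\<^sub>R norm y - e) - 0 * R"
        by (rule tendsto_diff)
      then have "\<forall>\<^sub>F j in sequentially. 0 < norm (x (r j) /\<^sub>R norm y - e) - \<epsilon> (k (r j)) * R"
        by (rule order_tendstoD(1)) (use ne in simp)
      then have "\<forall>\<^sub>F j in sequentially. \<Phi>' y * bump e (\<epsilon> (k (r j))) (x (r j) /\<^sub>R norm y) = 0"
        by eventually_elim (simp add: bump_eq_0[OF \<epsilon>(1)])
      then show ?case by (rule tendsto_eventually)
    qed
  qed simp
  then have "(\<lambda>j. norm (hausdorff_op \<Phi> (bump e (\<epsilon> (k (r j)))) (x (r j)))) \<longlonglongrightarrow> 0"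
    using hausdorff_op_bump[OF kx(2)] tendsto_norm_zero by simp
  then have "\<forall>\<^sub>F j in sequentially. norm (hausdorff_op \<Phi> (bump e (\<epsilon> (k (r j)))) (x (r j))) < d"
    by (rule order_tendstoD(2)) (rule d)
  then have "\<forall>\<^sub>F j in sequentially. False" by eventually_elim (use kx(3) in \<open>meson less_asym\<close>)
  then show False by simp
qed

context
  fixes \<psi> :: "'a \<Rightarrow> complex"
  assumes \<psi>: "continuous_on UNIV \<psi>" "\<And>x. x \<notin> annulus a b \<Longrightarrow> \<psi> x = 0"
begin

lemma psi_bounded: obtains W where "0 \<le> W" "\<And>x. norm (\<psi> x) \<le> W"
proof -
  have "bounded (\<psi> ` annulus a b)"
    by (intro compact_imp_bounded compact_continuous_image continuous_on_subset[OF \<psi>(1)] compact_annulus) auto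
  then obtain W where "\<And>x. x \<in> annulus a b \<Longrightarrow> norm (\<psi> x) \<le> W" unfolding bounded_iff by auto
  then have "norm (\<psi> x) \<le> \<bar>W\<bar>" for x using \<psi>(2)[of x] by (cases "x \<in> annulus a b") force+
  then show ?thesis using that[of "\<bar>W\<bar>"] by simp
qed

lemma integrable_psi: "integrable lebesgue \<psi>"
  by (rule integrable_compact_support[OF \<psi>(1) compact_annulus \<psi>(2)])

text \<open>For fixed \<open>y\<close> the substitution
  \<open>x = norm y * (e + \<epsilon> k * w)\<close> turns the dilated bump into
  \<open>\<rho> w\<close>. The Jacobian splits into a power of \<open>\<epsilon> k\<close>, which is
  pulled out, and a power of \<open>norm y\<close>, which stays with \<open>\<Phi>\<close>.\<close>

lemma pairing_fubini:
  "integrable lebesgue (\<lambda>x. hausdorff_op \<Phi> (bump e (\<epsilon> k)) x * \<psi> x)"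
  "(LINT x|lebesgue. hausdorff_op \<Phi> (bump e (\<epsilon> k)) x * \<psi> x) =
     of_real (\<epsilon> k ^ DIM('a)) * (LINT y|lebesgue. (norm y ^ DIM('a) *\<^sub>R \<Phi>' y) *
        (LINT w|lebesgue. \<rho> w * \<psi> (norm y *\<^sub>R e + (norm y * \<epsilon> k) *\<^sub>R w)))"
  "integrable lebesgue (\<lambda>y. (norm y ^ DIM('a) *\<^sub>R \<Phi>' y) *
        (LINT w|lebesgue. \<rho> w * \<psi> (norm y *\<^sub>R e + (norm y * \<epsilon> k) *\<^sub>R w)))"
proof -
  let ?c = "\<lambda>y x. bump e (\<epsilon> k) (x /\<^sub>R norm y)"
  have cm: "(\<lambda>p. ?c (fst p) (snd p)) \<in> borel_measurable (borel :: ('a \<times> 'a) measure)"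
    by (rule measurable_dilated_point(1)[OF continuous_bump])
  have "((\<lambda>p. (snd p, fst p)) :: 'a \<times> 'a \<Rightarrow> 'a \<times> 'a) \<in> borel_measurable borel"
    by (intro borel_measurable_continuous_onI continuous_intros)
  from measurable_compose[OF this cm] have cm': "(\<lambda>p. ?c (snd p) (fst p)) \<in> borel_measurable (borel :: ('a \<times> 'a) measure)"
    by simp
  have eq: "hausdorff_op \<Phi> (bump e (\<epsilon> k)) x * \<psi> x = (LINT y|lebesgue. \<psi> x * \<Phi>' y * ?c y x)" for x
  proof (cases "x \<in> annulus a b")
    case True
    then show ?thesis unfolding hausdorff_op_bump[OF True] by (simp only: mult.assoc integral_mult_right_zero mult.commute[of _ "\<psi> x"])
  qed (simp add: \<psi>(2))
  show "integrable lebesgue (\<lambda>x. hausdorff_op \<Phi> (bump e (\<epsilon> k)) x * \<psi> x)"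
    unfolding eq by (rule fubini_bounded(2)[OF integrable_psi integrable_cut cm' norm_bump_le_1])
  have inner: "(LINT x|lebesgue. \<Phi>' y * \<psi> x * ?c y x) = of_real (\<epsilon> k ^ DIM('a)) * ((norm y ^ DIM('a) *\<^sub>R \<Phi>' y) *
        (LINT w|lebesgue. \<rho> w * \<psi> (norm y *\<^sub>R e + (norm y * \<epsilon> k) *\<^sub>R w)))" for y
  proof (cases "y = 0")
    case True
    then have "y \<notin> annulus (a / (2 * norm e)) (b / (norm e / 2))" using ab e by (simp add: annulus_def not_le)
    then show ?thesis by simp
  next
    case False
    have nz: "norm y * \<epsilon> k \<noteq> 0" "0 < norm y * \<epsilon> k" using False \<epsilon>(1)[of k] by auto
    have arg: "?c y (norm y *\<^sub>R e + (norm y * \<epsilon> k) *\<^sub>R w) = \<rho> w" for w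
    proof -
      have "(1 / \<epsilon> k) *\<^sub>R ((norm y *\<^sub>R e + (norm y * \<epsilon> k) *\<^sub>R w) /\<^sub>R norm y) + (- (1 / \<epsilon> k) *\<^sub>R e) = w"
        using False \<epsilon>(1)[of k] by (simp add: scaleR_add_right field_simps)
      then show ?thesis unfolding bump_def by (simp only:)
    qed
    have "(LINT x|lebesgue. \<psi> x * ?c y x) = \<bar>norm y * \<epsilon> k\<bar> ^ DIM('a) *\<^sub>R
        (LINT w|lebesgue. \<psi> (norm y *\<^sub>R e + (norm y * \<epsilon> k) *\<^sub>R w) * ?c y (norm y *\<^sub>R e + (norm y * \<epsilon> k) *\<^sub>R w))"
      by (rule integral_scaling(2)[OF nz(1)])
    also have "\<dots> = of_real (norm y ^ DIM('a) * \<epsilon> k ^ DIM('a)) * (LINT w|lebesgue. \<rho> w * \<psi> (norm y *\<^sub>R e + (norm y * \<epsilon> k) *\<^sub>R w))"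
      unfolding arg using nz(2) by (simp only: abs_of_pos power_mult_distrib scaleR_conv_of_real mult.commute[of "\<rho> _"])
    finally show ?thesis
      by (simp add: mult.assoc scaleR_conv_of_real)
  qed
  have "(LINT x|lebesgue. hausdorff_op \<Phi> (bump e (\<epsilon> k)) x * \<psi> x) = (LINT x|lebesgue. LINT y|lebesgue. \<psi> x * \<Phi>' y * ?c y x)"
    by (simp only: eq)
  also have "\<dots> = (LINT y|lebesgue. LINT x|lebesgue. \<psi> x * \<Phi>' y * ?c y x)"
    by (rule fubini_bounded(1)[OF integrable_psi integrable_cut cm' norm_bump_le_1])
  also have "\<dots> = (LINT y|lebesgue. LINT x|lebesgue. \<Phi>' y * \<psi> x * ?c y x)" by (simp only: mult.commute[of "\<psi> _" "\<Phi>' _"])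
  also have "\<dots> = of_real (\<epsilon> k ^ DIM('a)) * (LINT y|lebesgue. (norm y ^ DIM('a) *\<^sub>R \<Phi>' y) *
        (LINT w|lebesgue. \<rho> w * \<psi> (norm y *\<^sub>R e + (norm y * \<epsilon> k) *\<^sub>R w)))"
    unfolding inner by (rule integral_mult_right_zero)
  finally show "(LINT x|lebesgue. hausdorff_op \<Phi> (bump e (\<epsilon> k)) x * \<psi> x) =
     of_real (\<epsilon> k ^ DIM('a)) * (LINT y|lebesgue. (norm y ^ DIM('a) *\<^sub>R \<Phi>' y) *
        (LINT w|lebesgue. \<rho> w * \<psi> (norm y *\<^sub>R e + (norm y * \<epsilon> k) *\<^sub>R w)))" .
  have "integrable lebesgue (\<lambda>y. LINT x|lebesgue. \<Phi>' y * \<psi> x * ?c y x)"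
    by (rule fubini_bounded(2)[OF integrable_cut integrable_psi cm norm_bump_le_1])
  then have "integrable lebesgue (\<lambda>y. of_real (1 / \<epsilon> k ^ DIM('a)) * (of_real (\<epsilon> k ^ DIM('a)) * ((norm y ^ DIM('a) *\<^sub>R \<Phi>' y) *
        (LINT w|lebesgue. \<rho> w * \<psi> (norm y *\<^sub>R e + (norm y * \<epsilon> k) *\<^sub>R w)))))"
    unfolding inner by (rule integrable_mult_right)
  moreover have "of_real (1 / \<epsilon> k ^ DIM('a)) * (of_real (\<epsilon> k ^ DIM('a)) * z) = z" for z :: complex
    using \<epsilon>(1)[of k] by simp
  ultimately show "integrable lebesgue (\<lambda>y. (norm y ^ DIM('a) *\<^sub>R \<Phi>' y) *
        (LINT w|lebesgue. \<rho> w * \<psi> (norm y *\<^sub>R e + (norm y * \<epsilon> k) *\<^sub>R w)))" by (simp only:)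
qed

text \<open>As \<open>\<epsilon> k\<close> tends to 0 the inner integral tends to
  \<open>mass\<close> times the value of \<open>\<psi>\<close> on the ray through \<open>e\<close>.
  So the pairing of the image with \<open>\<psi>\<close>, divided by the Jacobian power of
  \<open>\<epsilon> k\<close>, has a limit given by \<open>\<Phi>\<close> alone.\<close>

lemma pairing_limit:
  "(\<lambda>k. LINT y|lebesgue. (norm y ^ DIM('a) *\<^sub>R \<Phi>' y) * (LINT w|lebesgue. \<rho> w * \<psi> (norm y *\<^sub>R e + (norm y * \<epsilon> k) *\<^sub>R w)))
     \<longlonglongrightarrow> (LINT y|lebesgue. (norm y ^ DIM('a) *\<^sub>R \<Phi>' y) * (of_real mass * \<psi> (norm y *\<^sub>R e)))"
proof -
  obtain W where W: "0 \<le> W" "\<And>x. norm (\<psi> x) \<le> W" using psi_bounded by metis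
  define V where "V = (LINT w|lebesgue. norm (\<rho> w) * W)"
  have \<psi>c: "continuous_on UNIV (\<lambda>w. \<psi> (u + c *\<^sub>R w))" for u c
    by (intro continuous_on_compose2[OF \<psi>(1)] continuous_intros) auto
  have \<psi>i: "integrable lebesgue (\<lambda>w. \<rho> w * \<psi> (u + c *\<^sub>R w))" for u c
    by (rule integrable_mult_bounded_continuous[OF integrable \<psi>c W(2)])
  have bd: "norm (LINT w|lebesgue. \<rho> w * \<psi> (u + c *\<^sub>R w)) \<le> V" for u c
  proof -
    have "norm (LINT w|lebesgue. \<rho> w * \<psi> (u + c *\<^sub>R w)) \<le> (LINT w|lebesgue. norm (\<rho> w * \<psi> (u + c *\<^sub>R w)))"
      by (rule integral_norm_bound)
    also have "\<dots> \<le> V" unfolding V_def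
      by (rule integral_mono[OF integrable_norm[OF \<psi>i] integrable_mult_left[OF integrable_norm[OF integrable]]])
         (simp add: norm_mult W mult_left_mono)
    finally show ?thesis .
  qed
  have inner: "(\<lambda>k. LINT w|lebesgue. \<rho> w * \<psi> (norm y *\<^sub>R e + (norm y * \<epsilon> k) *\<^sub>R w)) \<longlonglongrightarrow> of_real mass * \<psi> (norm y *\<^sub>R e)" for y
  proof -
    have "(\<lambda>k. LINT w|lebesgue. \<rho> w * \<psi> (norm y *\<^sub>R e + (norm y * \<epsilon> k) *\<^sub>R w)) \<longlonglongrightarrow> (LINT w|lebesgue. \<rho> w * \<psi> (norm y *\<^sub>R e))"
    proof (rule integral_dominated_convergence[where w = "\<lambda>w. norm (\<rho> w) * W"])
      show "(\<lambda>w. \<rho> w * \<psi> (norm y *\<^sub>R e + (norm y * \<epsilon> k) *\<^sub>R w)) \<in> borel_measurable lebesgue" for k by (rule borel_measurable_integrable[OF \<psi>i])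
      show "(\<lambda>w. \<rho> w * \<psi> (norm y *\<^sub>R e)) \<in> borel_measurable lebesgue" using integrable by auto
      show "integrable lebesgue (\<lambda>w. norm (\<rho> w) * W)" using integrable by simp
      show "AE w in lebesgue. norm (\<rho> w * \<psi> (norm y *\<^sub>R e + (norm y * \<epsilon> k) *\<^sub>R w)) \<le> norm (\<rho> w) * W" for k
        by (intro AE_I2) (simp add: norm_mult W mult_left_mono)
      show "AE w in lebesgue. (\<lambda>k. \<rho> w * \<psi> (norm y *\<^sub>R e + (norm y * \<epsilon> k) *\<^sub>R w)) \<longlonglongrightarrow> \<rho> w * \<psi> (norm y *\<^sub>R e)"
      proof (intro AE_I2 tendsto_mult tendsto_const continuous_on_tendsto_compose[OF \<psi>(1)])
        fix w
        have "(\<lambda>k. norm y *\<^sub>R e + (norm y * \<epsilon> k) *\<^sub>R w) \<longlonglongrightarrow> norm y *\<^sub>R e + (norm y * 0) *\<^sub>R w"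
          by (intro tendsto_intros \<epsilon>(3))
        then show "(\<lambda>k. norm y *\<^sub>R e + (norm y * \<epsilon> k) *\<^sub>R w) \<longlonglongrightarrow> norm y *\<^sub>R e" by simp
      qed auto
    qed
    then show ?thesis by (simp add: integral_eq_mass)
  qed
  have cutm: "\<Phi>' \<in> borel_measurable lebesgue" by (rule borel_measurable_integrable[OF integrable_cut])
  have nm: "(\<lambda>y::'a. norm y ^ DIM('a)) \<in> borel_measurable lebesgue"
    by (intro continuous_borel_measurable_lebesgue continuous_intros)
  have ncutm: "(\<lambda>y. norm y ^ DIM('a) *\<^sub>R \<Phi>' y) \<in> borel_measurable lebesgue"
    by (rule borel_measurable_scaleR[OF nm cutm])
  define b' where "b' = b / (norm e / 2)"
  have b': "0 \<le> b'" using ab by (simp add: b'_def)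
  have ncut: "norm (norm y ^ DIM('a) *\<^sub>R \<Phi>' y) \<le> norm (\<Phi>' y) * b' ^ DIM('a)" for y
  proof (cases "y \<in> annulus (a / (2 * norm e)) (b / (norm e / 2))")
    case True
    then have "norm y ^ DIM('a) \<le> b' ^ DIM('a)" by (intro power_mono) (auto simp: annulus_def b'_def)
    moreover have "norm (norm y ^ DIM('a) *\<^sub>R \<Phi>' y) = norm y ^ DIM('a) * norm (\<Phi>' y)"
      by (subst norm_scaleR) (simp only: abs_of_nonneg zero_le_power norm_ge_zero)
    ultimately show ?thesis by (simp only: mult.commute[of "norm (\<Phi>' y)"] mult_right_mono norm_ge_zero)
  qed simp
  show ?thesis
  proof (rule integral_dominated_convergence[where w = "\<lambda>y. norm (\<Phi>' y) * b' ^ DIM('a) * V"])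
    show "integrable lebesgue (\<lambda>y. norm (\<Phi>' y) * b' ^ DIM('a) * V)"
      by (intro integrable_mult_left integrable_norm integrable_cut)
    show "(\<lambda>y. (norm y ^ DIM('a) *\<^sub>R \<Phi>' y) * (LINT w|lebesgue. \<rho> w * \<psi> (norm y *\<^sub>R e + (norm y * \<epsilon> k) *\<^sub>R w))) \<in> borel_measurable lebesgue" for k
      by (rule borel_measurable_integrable[OF pairing_fubini(3)])
    have "continuous_on UNIV (\<lambda>y::'a. of_real mass * \<psi> (norm y *\<^sub>R e))"
      by (intro continuous_intros continuous_on_compose2[OF \<psi>(1)]) auto
    from borel_measurable_times[OF ncutm continuous_borel_measurable_lebesgue[OF this]]
    show "(\<lambda>y. (norm y ^ DIM('a) *\<^sub>R \<Phi>' y) * (of_real mass * \<psi> (norm y *\<^sub>R e))) \<in> borel_measurable lebesgue" .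
    show "AE y in lebesgue. (\<lambda>k. (norm y ^ DIM('a) *\<^sub>R \<Phi>' y) * (LINT w|lebesgue. \<rho> w * \<psi> (norm y *\<^sub>R e + (norm y * \<epsilon> k) *\<^sub>R w)))
       \<longlonglongrightarrow> (norm y ^ DIM('a) *\<^sub>R \<Phi>' y) * (of_real mass * \<psi> (norm y *\<^sub>R e))"
      by (intro AE_I2 tendsto_mult tendsto_const inner)
    show "AE y in lebesgue. norm ((norm y ^ DIM('a) *\<^sub>R \<Phi>' y) * (LINT w|lebesgue. \<rho> w * \<psi> (norm y *\<^sub>R e + (norm y * \<epsilon> k) *\<^sub>R w)))
       \<le> norm (\<Phi>' y) * b' ^ DIM('a) * V" for k
      unfolding norm_mult by (intro AE_I2 mult_mono ncut bd) (use b' in auto)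
  qed
qed

text \<open>The assumed bound and the pairing carry the same power of \<open>\<epsilon> k\<close>,
  which cancels; what remains is \<open>d powr (1 - p) * Q\<close>, where \<open>d\<close> bounds
  the image on \<open>annulus a b\<close> and becomes arbitrarily small by
  \<open>hausdorff_op_bump_uniformly_small\<close>.\<close>

lemma pairing_zero:
  assumes p: "0 < p" "p < 1" and \<kappa>: "\<kappa> \<noteq> 0" and C: "0 \<le> C"
    and Lp: "\<And>k. (\<integral>\<^sup>+x. ennreal (norm (\<kappa> * hausdorff_op \<Phi> (bump e (\<epsilon> k)) x) powr p) \<partial>lebesgue) \<le> ennreal (C * \<epsilon> k ^ DIM('a))"
  shows "(LINT y|lebesgue. (norm y ^ DIM('a) *\<^sub>R \<Phi>' y) * \<psi> (norm y *\<^sub>R e)) = 0"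
proof -
  obtain W where W: "0 \<le> W" "\<And>x. norm (\<psi> x) \<le> W" using psi_bounded by metis
  let ?H = "\<lambda>k. hausdorff_op \<Phi> (bump e (\<epsilon> k))"
  let ?I = "\<lambda>k. LINT y|lebesgue. (norm y ^ DIM('a) *\<^sub>R \<Phi>' y) * (LINT w|lebesgue. \<rho> w * \<psi> (norm y *\<^sub>R e + (norm y * \<epsilon> k) *\<^sub>R w))"
  define Q where "Q = W * norm \<kappa> powr (- p) * C"
  have Q: "0 \<le> Q" using W C by (simp add: Q_def)
  have small: "norm (?I k) \<le> d powr (1 - p) * Q"
    if d: "0 < d" "\<And>x. x \<in> annulus a b \<Longrightarrow> norm (?H k x) \<le> d" for d k
  proof -
    have Hm: "?H k \<in> borel_measurable lebesgue"
    proof (rule borel_measurable_lebesgue, rule borel_measurable_continuous_countable_exceptions[of "{0}"])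
      show "continuous_on (- {0}) (?H k)" by (rule continuous_hausdorff_op[OF \<Phi> test_function_bump[OF \<epsilon>(1,2) e]])
    qed simp
    have pt: "norm (?H k x * \<psi> x) \<le> (d powr (1 - p) * (W * norm \<kappa> powr (- p))) * norm (\<kappa> * ?H k x) powr p" for x
    proof (cases "x \<in> annulus a b \<and> ?H k x \<noteq> 0")
      case True
      define t where "t = norm (?H k x)"
      have t: "0 < t" "t \<le> d" using True d(2) by (auto simp: t_def)
      \<comment> \<open>This is where \<open>p < 1\<close> enters: the exponent \<open>1 - p\<close>
        is positive, so the uniform smallness of the image survives as the factor
        \<open>d powr (1 - p)\<close>.\<close>
      have "t = t powr (1 - p) * t powr p" using t by (simp flip: powr_add)
      also have "\<dots> \<le> d powr (1 - p) * t powr p" using t p by (intro mult_right_mono powr_mono2) auto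
      also have "t powr p = norm \<kappa> powr (- p) * norm (\<kappa> * ?H k x) powr p"
        using \<kappa> t by (simp add: norm_mult powr_mult t_def powr_minus)
      finally have "t * norm (\<psi> x) \<le> (d powr (1 - p) * (norm \<kappa> powr (- p) * norm (\<kappa> * ?H k x) powr p)) * W"
        using W by (intro mult_mono) auto
      then show ?thesis by (simp add: norm_mult t_def mult_ac)
    next
      case False
      then have "?H k x * \<psi> x = 0" using \<psi>(2)[of x] by auto
      moreover have "0 \<le> (d powr (1 - p) * (W * norm \<kappa> powr (- p))) * norm (\<kappa> * ?H k x) powr p" using W by simp
      ultimately show ?thesis by (simp only: norm_zero)
    qed
    let ?D = "d powr (1 - p) * (W * norm \<kappa> powr (- p))"
    have D: "0 \<le> ?D" using W by simp
    have "ennreal (norm (LINT x|lebesgue. ?H k x * \<psi> x)) \<le> (\<integral>\<^sup>+x. norm (?H k x * \<psi> x) \<partial>lebesgue)"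
      by (rule integral_norm_bound_ennreal[OF pairing_fubini(1)])
    also have "\<dots> \<le> (\<integral>\<^sup>+x. ennreal ?D * ennreal (norm (\<kappa> * ?H k x) powr p) \<partial>lebesgue)"
      using pt D by (intro nn_integral_mono) (simp add: ennreal_mult[symmetric] ennreal_leI)
    also have "\<dots> = ennreal ?D * (\<integral>\<^sup>+x. ennreal (norm (\<kappa> * ?H k x) powr p) \<partial>lebesgue)"
      using Hm by (intro nn_integral_cmult) measurable
    also have "\<dots> \<le> ennreal ?D * ennreal (C * \<epsilon> k ^ DIM('a))" by (intro mult_left_mono Lp) simp
    also have "\<dots> = ennreal (?D * (C * \<epsilon> k ^ DIM('a)))"
      using D C \<epsilon>(1)[of k] by (simp add: ennreal_mult[symmetric] less_imp_le)
    finally have "norm (LINT x|lebesgue. ?H k x * \<psi> x) \<le> ?D * (C * \<epsilon> k ^ DIM('a))"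
      using D C \<epsilon>(1)[of k] by (subst (asm) ennreal_le_iff) (auto simp: less_imp_le)
    then have "\<epsilon> k ^ DIM('a) * norm (?I k) \<le> \<epsilon> k ^ DIM('a) * (d powr (1 - p) * Q)"
      unfolding pairing_fubini(2) norm_mult norm_of_real Q_def using \<epsilon>(1)[of k] by (simp add: mult_ac)
    then show ?thesis using \<epsilon>(1)[of k] by (simp only: mult_le_cancel_left_pos zero_less_power)
  qed
  have lim0: "?I \<longlonglongrightarrow> 0"
  proof (rule LIMSEQ_I)
    fix r :: real assume r: "0 < r"
    \<comment> \<open>Chosen so that \<open>d powr (1 - p)\<close> is at most
      \<open>r / (Q + 1)\<close>. The denominator \<open>Q + 1\<close> covers \<open>Q = 0\<close>
      and makes the final inequality strict.\<close>
    define d where "d = (r / (Q + 1)) powr (1 / (1 - p)) / 2"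
    have d: "0 < d" using r Q by (simp add: d_def)
    have "d powr (1 - p) * Q < r"
    proof -
      have "d powr (1 - p) \<le> ((r / (Q + 1)) powr (1 / (1 - p))) powr (1 - p)"
        using p d by (intro powr_mono2) (auto simp: d_def)
      also have "\<dots> = r / (Q + 1)" using p r Q by (simp add: powr_powr)
      finally have "d powr (1 - p) * Q \<le> r / (Q + 1) * Q" using Q by (intro mult_right_mono)
      also have "\<dots> < r" using r Q by (simp add: field_simps)
      finally show ?thesis .
    qed
    moreover obtain K where "\<forall>k\<ge>K. \<forall>x\<in>annulus a b. norm (?H k x) \<le> d"
      using hausdorff_op_bump_uniformly_small[OF d] by blast
    ultimately show "\<exists>K. \<forall>k\<ge>K. norm (?I k - 0) < r"
      using small[OF d] by (intro exI[of _ K] allI impI) force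
  qed
  have "(LINT y|lebesgue. (norm y ^ DIM('a) *\<^sub>R \<Phi>' y) * (of_real mass * \<psi> (norm y *\<^sub>R e))) = 0"
    by (rule LIMSEQ_unique[OF pairing_limit lim0])
  then have "of_real mass * (LINT y|lebesgue. (norm y ^ DIM('a) *\<^sub>R \<Phi>' y) * \<psi> (norm y *\<^sub>R e)) = 0"
    by (simp only: integral_mult_right_zero[symmetric] mult.left_commute)
  then show ?thesis using mass_pos by simp
qed

end

end

text \<open>To evaluate the operator at \<open>x\<close>, the bumps are centred at
  \<open>e = x\<close>, and \<open>\<psi>\<close> is built from \<open>f\<close> in such a way that
  the vanishing pairing is \<open>hausdorff_op \<Phi> f x\<close> itself. Thus \<open>\<Phi>\<close>
  need not be averaged over spheres explicitly.\<close>

lemma hausdorff_bounded_imp_zero: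
  fixes \<Phi> m :: "'a \<Rightarrow> complex" and N :: "'a functional \<Rightarrow> ennreal"
  assumes \<Phi>: "locally_integrable (- {0}) \<Phi>" and p: "0 < p" "p < 1"
    and m: "test_function UNIV m" "m 0 \<noteq> 0"
    and lower: "\<And>T. Lp_norm p (distribution_modulus (fourier_multiplier m T)) \<le> N T"
    and A: "0 \<le> A" and upper: "\<And>\<mu> z. 1 \<le> \<mu> \<Longrightarrow>
       N (distribution_of (\<lambda>x. \<rho> ((1 / \<mu>) *\<^sub>R x + z))) \<le> ennreal (A * \<mu> powr (real DIM('a) / p))"
    and bdd: "hausdorff_bounded \<Phi> N"
  shows "hausdorff_zero \<Phi>"
  unfolding hausdorff_zero_def
proof (intro allI impI)
  fix f :: "'a \<Rightarrow> complex" and x :: 'a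
  assume f: "test_function (- {0}) f"
  obtain K where K: "compact K" "K \<subseteq> - {0}" "\<And>x. x \<notin> K \<Longrightarrow> f x = 0" using test_functionD[OF f] by metis
  show "hausdorff_op \<Phi> f x = 0"
  proof (cases "x = 0")
    case True
    have "f 0 = 0" using K(2,3) by blast
    then show ?thesis using True by (simp add: hausdorff_op_def)
  next
    case False
    obtain \<alpha> \<beta> where \<alpha>\<beta>: "0 < \<alpha>" "\<alpha> < \<beta>" "K \<subseteq> annulus \<alpha> \<beta>" using compact_subset_annulus[OF K(1,2)] by metis
    have f0: "f z = 0" if "z \<notin> annulus \<alpha> \<beta>" for z using K(3) \<alpha>\<beta>(3) that by blast
    define t where "t = norm x"
    have t: "0 < t" using False by (simp add: t_def)
    \<comment> \<open>Inversion in the sphere of radius \<open>t\<close> exchanges the radii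
      \<open>\<alpha>\<close>, \<open>\<beta>\<close> with \<open>t^2 / \<alpha>\<close>,
      \<open>t^2 / \<beta>\<close>, so these are the radii of the annulus carrying
      \<open>\<psi>\<close>.\<close>
    define a where "a = t\<^sup>2 / \<beta>"
    define b where "b = t\<^sup>2 / \<alpha>"
    have ab: "0 < a" "a < b" using t \<alpha>\<beta> by (auto simp: a_def b_def intro!: divide_strict_left_mono)
    \<comment> \<open>\<open>f\<close> composed with the inversion in the sphere through
      \<open>x\<close>. At \<open>z\<close> equal to \<open>norm y\<close> times \<open>x\<close>
      the argument of \<open>f\<close> becomes \<open>x / norm y\<close>, and the factor
      \<open>t / norm z\<close> is \<open>1 / norm y\<close>, which cancels the Jacobian power of
      \<open>norm y\<close> in the pairing.\<close>
    define \<psi> where "\<psi> z = of_real ((t / norm z) ^ DIM('a)) * f ((t\<^sup>2 / (norm z)\<^sup>2) *\<^sub>R z)" for z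
    have \<psi>0: "\<psi> z = 0" if "z \<notin> annulus a b" for z
    proof (cases "z = 0")
      case True
      then show ?thesis using K(2,3) by (auto simp: \<psi>_def)
    next
      case z: False
      have nz: "norm ((t\<^sup>2 / (norm z)\<^sup>2) *\<^sub>R z) = t\<^sup>2 / norm z" using z by (simp add: power2_eq_square)
      have "(t\<^sup>2 / (norm z)\<^sup>2) *\<^sub>R z \<notin> annulus \<alpha> \<beta>"
        using that z \<alpha>\<beta> t unfolding annulus_def mem_Collect_eq nz a_def b_def by (auto simp: field_simps)
      then show ?thesis by (simp add: \<psi>_def f0)
    qed
    have \<psi>c: "continuous_on UNIV \<psi>"
    proof -
      have fc: "continuous_on UNIV f" by (rule smooth_continuous[OF test_function_smooth[OF f]])
      have 1: "continuous_on (- {0}) \<psi>"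
        unfolding \<psi>_def[abs_def] by (intro continuous_intros continuous_on_compose2[OF fc]) auto
      have 2: "continuous_on (ball 0 a) \<psi>"
        by (rule continuous_on_eq[OF continuous_on_const[of _ 0]]) (use \<psi>0 in \<open>auto simp: annulus_def\<close>)
      have "continuous_on (- {0} \<union> ball 0 a) \<psi>" by (intro continuous_on_open_Un 1 2) auto
      moreover have "- {0} \<union> ball (0::'a) a = UNIV" using ab by auto
      ultimately show ?thesis by simp
    qed
    \<comment> \<open>The first width already satisfies \<open>\<epsilon> 0 * R = t / 2\<close>,
      which keeps all bumps at distance at least \<open>t / 2\<close> from the origin.\<close>
    define \<epsilon> where "\<epsilon> k = (t / (2 * R)) * (1 / real (Suc k))" for k
    have R0: "0 < R" using R_gt_1 by simp
    have \<epsilon>: "\<epsilon> k > 0" "\<epsilon> k * R \<le> norm x / 2" "\<epsilon> \<longlonglongrightarrow> 0" for k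
    proof -
      show "\<epsilon> k > 0" using t R0 by (simp add: \<epsilon>_def)
      have "\<epsilon> k * R = (t / 2) * (1 / real (Suc k))" using R0 by (simp add: \<epsilon>_def)
      also have "\<dots> \<le> (t / 2) * 1" using t by (intro mult_left_mono) auto
      finally show "\<epsilon> k * R \<le> norm x / 2" by (simp add: t_def)
      have "(\<lambda>k. 1 / real (Suc k)) \<longlonglongrightarrow> 0" using LIMSEQ_inverse_real_of_nat by (simp add: inverse_eq_divide)
      then show "\<epsilon> \<longlonglongrightarrow> 0" unfolding \<epsilon>_def by (rule tendsto_mult_right_zero)
    qed
    obtain C0 where C0: "\<And>f. test_function (- {0}) f \<Longrightarrow>
        \<exists>T. represents (hausdorff_op \<Phi> f) T \<and> T \<in> qspace N \<and> N T \<le> ennreal C0 * N (distribution_of f)"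
      using bdd unfolding hausdorff_bounded_def by blast
    \<comment> \<open>\<open>ennreal\<close> sends negative reals to 0, so replacing a negative
      constant by 0 changes nothing.\<close>
    define C where "C = max C0 0"
    have C: "0 \<le> C" "ennreal C = ennreal C0" by (auto simp: C_def max_def ennreal_neg)
    define \<kappa> where "\<kappa> = (LINT z|lebesgue. fourier m z)"
    have \<kappa>: "\<kappa> \<noteq> 0" unfolding \<kappa>_def by (rule integral_fourier_nonzero[OF m])
    have Lp: "(\<integral>\<^sup>+y. ennreal (norm (\<kappa> * hausdorff_op \<Phi> (bump x (\<epsilon> k)) y) powr p) \<partial>lebesgue) \<le> ennreal ((C * A) powr p * \<epsilon> k ^ DIM('a))" for k
    proof -
      \<comment> \<open>The dilations start at \<open>1 / \<epsilon> k\<close> or later, because the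
        dilated bump has width \<open>\<mu> = l j * \<epsilon> k\<close> and the norm bound requires
        \<open>\<mu> \<ge> 1\<close>. Its growth in \<open>\<mu>\<close> then splits into a power of
        \<open>l j\<close> and a power of \<open>\<epsilon> k\<close>.\<close>
      define l where "l j = real j + max 1 (1 / \<epsilon> k)" for j :: nat
      have l: "1 \<le> l j" "1 / \<epsilon> k \<le> l j" for j by (auto simp: l_def)
      have llim: "filterlim l at_top sequentially"
        unfolding l_def by (rule filterlim_at_top_mono[OF filterlim_real_sequentially]) auto
      have nb: "N (distribution_of (\<lambda>y. bump x (\<epsilon> k) ((1 / l j) *\<^sub>R y))) \<le> ennreal ((A * \<epsilon> k powr (real DIM('a) / p)) * l j powr (real DIM('a) / p))" for j
      proof -
        have "1 \<le> l j * \<epsilon> k" using l(2)[of j] \<epsilon>(1)[of k] by (simp add: field_simps)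
        from upper[OF this, of "- (1 / \<epsilon> k) *\<^sub>R x"] show ?thesis
          using l(1)[of j] \<epsilon>(1)[of k] by (simp add: bump_def powr_mult mult_ac)
      qed
      have "(\<integral>\<^sup>+y. ennreal (norm (\<kappa> * hausdorff_op \<Phi> (bump x (\<epsilon> k)) y) powr p) \<partial>lebesgue) \<le> ennreal ((C * (A * \<epsilon> k powr (real DIM('a) / p))) powr p)"
        unfolding \<kappa>_def
      proof (rule hausdorff_bounded_imp_Lp[where l = l and N = N])
        show "test_function (- {0}) (bump x (\<epsilon> k))" by (rule test_function_bump[OF \<epsilon>(1,2) False])
      qed (use m p lower C C0 \<Phi> l llim A nb in \<open>auto\<close>)
      also have "(C * (A * \<epsilon> k powr (real DIM('a) / p))) powr p = (C * A) powr p * \<epsilon> k ^ DIM('a)"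
        using C(1) A \<epsilon>(1)[of k] p by (simp add: powr_mult powr_powr powr_realpow)
      finally show ?thesis .
    qed
    have zero: "(LINT y|lebesgue. (norm y ^ DIM('a) *\<^sub>R (indicator (annulus (a / (2 * norm x)) (b / (norm x / 2))) y *\<^sub>R \<Phi> y)) * \<psi> (norm y *\<^sub>R x)) = 0"
      by (rule pairing_zero[OF \<Phi> False \<epsilon> ab \<psi>c \<psi>0 p \<kappa> _ Lp]) (assumption, rule powr_ge_zero)
    have "\<Phi> y * f (x /\<^sub>R norm y) = (norm y ^ DIM('a) *\<^sub>R (indicator (annulus (a / (2 * norm x)) (b / (norm x / 2))) y *\<^sub>R \<Phi> y)) * \<psi> (norm y *\<^sub>R x)" for y
    proof (cases "y = 0")
      case True
      have "f 0 = 0" using K(2,3) by blast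
      then show ?thesis using True by (simp add: \<psi>_def)
    next
      case y: False
      have arg: "(t\<^sup>2 / (norm (norm y *\<^sub>R x))\<^sup>2) *\<^sub>R (norm y *\<^sub>R x) = x /\<^sub>R norm y"
        using y t by (simp add: t_def power2_eq_square divide_simps)
      have \<psi>y: "of_real (norm y ^ DIM('a)) * \<psi> (norm y *\<^sub>R x) = f (x /\<^sub>R norm y)"
        unfolding \<psi>_def arg using y t by (simp add: t_def power_divide)
      show ?thesis
      proof (cases "f (x /\<^sub>R norm y) = 0")
        case True
        then have "\<psi> (norm y *\<^sub>R x) = 0" using \<psi>y y by simp
        then show ?thesis using True by simp
      next
        case f: False
        then have "x /\<^sub>R norm y \<in> annulus \<alpha> \<beta>" using f0 by blast
        then have "\<alpha> \<le> t / norm y" "t / norm y \<le> \<beta>" by (auto simp: annulus_def t_def field_simps)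
        then have "t / \<beta> \<le> norm y" "norm y \<le> t / \<alpha>" using y \<alpha>\<beta> by (auto simp: field_simps)
        moreover have "a / (2 * norm x) \<le> t / \<beta>" "t / \<alpha> \<le> b / (norm x / 2)"
          using t \<alpha>\<beta> by (auto simp: a_def b_def t_def power2_eq_square field_simps)
        ultimately have "y \<in> annulus (a / (2 * norm x)) (b / (norm x / 2))" by (simp add: annulus_def)
        then show ?thesis unfolding \<psi>y[symmetric] by (simp add: scaleR_conv_of_real)
      qed
    qed
    then show ?thesis using zero by (simp only: hausdorff_op_def)
  qed
qed

section \<open>The converse implication: the zero operator\<close>

lemma distribution_modulus_zero:
  "AE x::'a in lebesgue. distribution_modulus (\<lambda>_. 0) x = 0"
proof -
  have "represents (\<lambda>_::'a. 0) (\<lambda>_. 0)"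
    unfolding represents_def by (auto simp: distribution_of_def intro: integrable_locally_integrable)
  from distribution_modulus_eq[OF this] show ?thesis by simp
qed

end

lemma Lp_norm_zero: "AE x in lebesgue. h x = 0 \<Longrightarrow> Lp_norm p h = 0"
proof -
  assume "AE x in lebesgue. h x = 0"
  then have "AE x in lebesgue. enn_powr (h x) p = 0" by eventually_elim simp
  then have "(\<integral>\<^sup>+ x. enn_powr (h x) p \<partial>lebesgue) = (\<integral>\<^sup>+ x. 0 \<partial>(lebesgue :: 'a measure))" by (rule nn_integral_cong_AE)
  then show ?thesis by (simp add: Lp_norm_def)
qed

lemma lq_norm_zero: "lq_norm q (\<lambda>_. 0) = 0"
  by (simp add: lq_norm_def)

lemma fourier_multiplier_zero: "fourier_multiplier m (\<lambda>_. 0) = (\<lambda>_. 0)"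
  by (simp add: fourier_multiplier_def inv_fourier_dist_def mult_dist_def fourier_dist_def)

lemma hausdorff_zero_imp_bounded:
  assumes "hausdorff_zero \<Phi>" "N (\<lambda>_. 0) = 0" shows "hausdorff_bounded \<Phi> N"
  unfolding hausdorff_bounded_def
proof (intro exI[of _ 0] allI impI)
  fix f :: "'a \<Rightarrow> complex" assume "test_function (- {0}) f"
  then have h: "hausdorff_op \<Phi> f = (\<lambda>_. 0)" using assms(1) by (auto simp: hausdorff_zero_def)
  have "represents (\<lambda>_::'a. 0) (\<lambda>_. 0)"
    unfolding represents_def by (auto simp: distribution_of_def intro: integrable_locally_integrable)
  then show "\<exists>T. represents (hausdorff_op \<Phi> f) T \<and> T \<in> qspace N \<and> N T \<le> ennreal 0 * N (distribution_of f)"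
    unfolding h qspace_def using assms(2) by (intro exI[of _ "\<lambda>_. 0"]) (simp add: tempered_distribution_def)
qed

section \<open>Dyadic and uniform decompositions\<close>

text \<open>The transform of \<open>a (c \<xi>)\<close> is an L1-normalised dilate of
  \<open>inv_fourier a\<close>, spread towards the origin or outwards only by
  \<open>u -> c u\<close>; with \<open>c \<le> 1\<close> the substitution shrinks the weight. Used
  with \<open>c = 2 powr - j\<close>, this bounds all dyadic kernels by those of two fixed
  symbols.\<close>

lemma inv_fourier_dilate_weighted_le:
  fixes a :: "'a::euclidean_space \<Rightarrow> complex"
  assumes a: "test_function UNIV a" and c: "0 < c" "c \<le> 1"
  shows "(LINT u|lebesgue. (1 + norm u) ^ N * norm (inv_fourier (\<lambda>\<xi>. a (c *\<^sub>R \<xi>)) u))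
    \<le> (LINT u|lebesgue. (1 + norm u) ^ N * norm (inv_fourier a u))"
proof -
  have ac: "test_function UNIV (\<lambda>\<xi>. a (c *\<^sub>R \<xi>))" using test_function_affine[OF a, of c 0] c by simp
  have eq: "inv_fourier (\<lambda>\<xi>. a (c *\<^sub>R \<xi>)) (c *\<^sub>R u) = of_real (1 / c ^ DIM('a)) * inv_fourier a u" for u
    using inv_fourier_affine[of c a 0 "c *\<^sub>R u"] c by simp
  have i1: "integrable lebesgue (\<lambda>u. (1 + norm u) ^ N * norm (inv_fourier a u))"
    by (rule schwartz_weighted_integrable[OF schwartz_inv_fourier[OF a]])
  have i2: "integrable lebesgue (\<lambda>u. (1 + norm (c *\<^sub>R u)) ^ N * norm (inv_fourier (\<lambda>\<xi>. a (c *\<^sub>R \<xi>)) (c *\<^sub>R u)))"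
    using integral_scaling(1)[of c "\<lambda>u. (1 + norm u) ^ N * norm (inv_fourier (\<lambda>\<xi>. a (c *\<^sub>R \<xi>)) u)" 0] c
      schwartz_weighted_integrable[OF schwartz_inv_fourier[OF ac], of N] by simp
  have "(LINT u|lebesgue. (1 + norm u) ^ N * norm (inv_fourier (\<lambda>\<xi>. a (c *\<^sub>R \<xi>)) u))
     = \<bar>c\<bar> ^ DIM('a) *\<^sub>R (LINT u|lebesgue. (1 + norm (c *\<^sub>R u)) ^ N * norm (inv_fourier (\<lambda>\<xi>. a (c *\<^sub>R \<xi>)) (c *\<^sub>R u)))"
    using integral_scaling(2)[of c "\<lambda>u. (1 + norm u) ^ N * norm (inv_fourier (\<lambda>\<xi>. a (c *\<^sub>R \<xi>)) u)" 0] c by simp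
  also have "\<dots> = (LINT u|lebesgue. \<bar>c\<bar> ^ DIM('a) *\<^sub>R ((1 + norm (c *\<^sub>R u)) ^ N * norm (inv_fourier (\<lambda>\<xi>. a (c *\<^sub>R \<xi>)) (c *\<^sub>R u))))"
    by (rule integral_scaleR_right[symmetric])
  also have "\<dots> \<le> (LINT u|lebesgue. (1 + norm u) ^ N * norm (inv_fourier a u))"
  proof (rule integral_mono[OF integrable_scaleR_right[OF i2] i1])
    fix u :: 'a
    have "c * norm u \<le> 1 * norm u" using c by (intro mult_right_mono) auto
    then have "(1 + norm (c *\<^sub>R u)) ^ N \<le> (1 + norm u) ^ N" using c by (intro power_mono) auto
    then have "(1 + norm (c *\<^sub>R u)) ^ N * norm (inv_fourier a u) \<le> (1 + norm u) ^ N * norm (inv_fourier a u)"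
      by (rule mult_right_mono) simp
    then show "\<bar>c\<bar> ^ DIM('a) *\<^sub>R ((1 + norm (c *\<^sub>R u)) ^ N * norm (inv_fourier (\<lambda>\<xi>. a (c *\<^sub>R \<xi>)) (c *\<^sub>R u))) \<le> (1 + norm u) ^ N * norm (inv_fourier a u)"
      unfolding eq using c by (simp add: norm_mult norm_divide norm_power)
  qed
  finally show ?thesis .
qed

lemma dyadic_bump_test_function:
  assumes "dyadic_bump \<phi>" shows "test_function UNIV \<phi>"
proof (rule test_functionI)
  show "smooth \<phi>" using assms by (simp add: dyadic_bump_def)
  show "bounded (closure {\<xi>. \<phi> \<xi> \<noteq> 0})"
    by (rule bounded_subset[OF bounded_cball[of 0 "3/2"]]) (use assms in \<open>force simp: dyadic_bump_def\<close>)
  show "\<phi> x = 0" if "x \<notin> closure {\<xi>. \<phi> \<xi> \<noteq> 0}" for x using that closure_subset[of "{\<xi>. \<phi> \<xi> \<noteq> 0}"] by auto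
qed auto

lemma dyadic_symbol_family:
  fixes \<phi> \<rho> :: "'a::euclidean_space \<Rightarrow> complex"
  assumes \<phi>: "dyadic_bump \<phi>" and \<rho>: "cutoff \<rho> R"
  obtains B D where "symbol_family \<rho> R (dyadic_symbol \<phi>) (\<lambda>j. 2 powr real j) B D"
proof -
  have t\<phi>: "test_function UNIV \<phi>" by (rule dyadic_bump_test_function[OF \<phi>])
  have \<phi>1: "\<phi> \<xi> = 1" if "norm \<xi> \<le> 4/3" for \<xi> using \<phi> that by (simp add: dyadic_bump_def)
  define a where "a \<xi> = \<phi> \<xi> - \<phi> (2 *\<^sub>R \<xi>)" for \<xi>
  have ta: "test_function UNIV a"
  proof -
    obtain r where r: "0 < r" "\<And>x. r \<le> norm x \<Longrightarrow> \<phi> x = 0" using test_function_bounded_support[OF t\<phi>] by metis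
    show ?thesis
    proof (rule test_functionI[of _ "cball 0 r"])
      show "smooth a" unfolding a_def[abs_def]
        using smooth_affine_comp[OF test_function_smooth[OF t\<phi>], of 2 0] test_function_smooth[OF t\<phi>]
        by (intro smooth_diff) auto
      show "a x = 0" if "x \<notin> cball 0 r" for x
      proof -
        have "r \<le> norm x" "r \<le> norm (2 *\<^sub>R x)" using that r(1) by auto
        then show ?thesis unfolding a_def using r(2) by simp
      qed
    qed auto
  qed
  have sym: "dyadic_symbol \<phi> j = (\<lambda>\<xi>. a ((2 powr - real j) *\<^sub>R \<xi>))" if "j \<noteq> 0" for j
    using that by (auto simp: dyadic_symbol_def a_def)
  have sym0: "dyadic_symbol \<phi> 0 = \<phi>" by (auto simp: dyadic_symbol_def)
  obtain B1 where B1: "\<And>\<xi>. norm (\<phi> \<xi>) \<le> B1" using test_function_bounded[OF t\<phi>] by metis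
  obtain B2 where B2: "\<And>\<xi>. norm (a \<xi>) \<le> B2" using test_function_bounded[OF ta] by metis
  have "symbol_family \<rho> R (dyadic_symbol \<phi>) (\<lambda>j. 2 powr real j) (max B1 B2) (3/2)"
  proof (rule symbol_family.intro[OF \<rho> symbol_family_axioms.intro])
    show "test_function UNIV (dyadic_symbol \<phi> j)" for j
    proof (cases "j = 0")
      case False
      then show ?thesis unfolding sym[OF False] using test_function_affine[OF ta, of "2 powr - real j" 0] by simp
    qed (simp add: sym0 t\<phi>)
    show "\<exists>C. \<forall>j. (LINT u|lebesgue. (1 + norm u) ^ N * norm (inv_fourier (dyadic_symbol \<phi> j) u)) \<le> C" for N
    proof (intro exI allI)
      let ?I = "\<lambda>a. LINT u|lebesgue. (1 + norm u) ^ N * norm (inv_fourier a (u::'a))"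
      fix j
      show "?I (dyadic_symbol \<phi> j) \<le> max (?I \<phi>) (?I a)"
      proof (cases "j = 0")
        case False
        have "2 powr - real j \<le> 2 powr 0" by (rule powr_mono) auto
        then have "?I (dyadic_symbol \<phi> j) \<le> ?I a"
          unfolding sym[OF False] by (intro inv_fourier_dilate_weighted_le[OF ta]) auto
        then show ?thesis by simp
      qed (simp add: sym0)
    qed
    show "norm (dyadic_symbol \<phi> j \<xi>) \<le> max B1 B2" for j \<xi>
      using B1[of \<xi>] B2[of "(2 powr - real j) *\<^sub>R \<xi>"] by (cases "j = 0") (auto simp: sym0 sym le_max_iff_disj)
    show "1 \<le> 2 powr real j" for j by (rule ge_one_powr_ge_zero) auto
    show "2 powr real j \<le> 3/2 * (1 + norm \<xi>)" if nz: "dyadic_symbol \<phi> j \<xi> \<noteq> 0" for j \<xi>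
    proof (cases "j = 0")
      case False
      \<comment> \<open>If twice the rescaled frequency had norm at most \<open>4/3\<close>, both
        terms of \<open>a\<close> would be 1 and cancel. Hence \<open>2 powr j\<close> is below
        \<open>3/2 * norm \<xi>\<close> on the support, which is the origin of the constant
        \<open>3/2\<close>.\<close>
      have "4/3 < norm (2 *\<^sub>R ((2 powr - real j) *\<^sub>R \<xi>))"
      proof (rule ccontr)
        assume n: "\<not> ?thesis"
        have "norm v \<le> norm (2 *\<^sub>R v)" for v :: 'a by simp
        with n have "norm (2 *\<^sub>R ((2 powr - real j) *\<^sub>R \<xi>)) \<le> 4/3" "norm ((2 powr - real j) *\<^sub>R \<xi>) \<le> 4/3"
          by (meson not_less order_trans)+
        then have "a ((2 powr - real j) *\<^sub>R \<xi>) = 0" by (simp add: a_def \<phi>1)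
        then show False using nz sym[OF False] by simp
      qed
      then have "4/3 < 2 * (inverse (2 powr real j) * norm \<xi>)"
        by (simp only: norm_scaleR powr_minus abs_numeral abs_inverse abs_of_nonneg[OF powr_ge_zero])
      moreover have "X \<le> 3/2 * (1 + v)" if "0 < X" "4/3 < 2 * (inverse X * v)" for X v :: real
        using that by (simp add: field_simps)
      ultimately show ?thesis by simp
    qed (use norm_ge_zero[of \<xi>] in simp)
    show "\<exists>L. (\<integral>\<^sup>+j. ennreal ((2 powr real j) powr - L) \<partial>count_space UNIV) < \<infinity>"
    proof
      have "(\<integral>\<^sup>+j. ennreal ((2 powr real j) powr - 1) \<partial>count_space UNIV) = (\<Sum>j. ennreal ((1/2) ^ j))"
        unfolding nn_integral_count_space_nat
        by (intro suminf_cong arg_cong[of _ _ ennreal]) (simp add: powr_minus powr_realpow power_one_over inverse_eq_divide)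
      also have "\<dots> = ennreal (\<Sum>j. (1/2) ^ j)" by (intro suminf_ennreal2) (auto simp: summable_geometric)
      also have "\<dots> < \<infinity>" by simp
      finally show "(\<integral>\<^sup>+j. ennreal ((2 powr real j) powr - 1) \<partial>count_space UNIV) < \<infinity>" .
    qed
  qed simp
  then show ?thesis using that by blast
qed

section \<open>The uniform decomposition: symbols, translations and lattice sums\<close>

lemma infnorm_cart_le:
  fixes x :: "real ^ 'n"
  assumes "\<And>i. \<bar>x $ i\<bar> \<le> c" shows "infnorm x \<le> c"
  unfolding infnorm_cart by (rule cSup_least) (use assms in auto)

lemma lattice_point_add: "lattice_point (k + l) = lattice_point k + lattice_point l"
  by (simp add: lattice_point_def vec_eq_iff)

lemma norm_le_card_infnorm: "norm (x :: real ^ 'n) \<le> real CARD('n) * infnorm x"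
proof -
  have "norm x \<le> (\<Sum>i\<in>UNIV. \<bar>x $ i\<bar>)" by (rule norm_le_l1_cart)
  also have "\<dots> \<le> (\<Sum>i\<in>(UNIV::'n set). infnorm x)" by (intro sum_mono component_le_infnorm_cart)
  finally show ?thesis by simp
qed

lemma finite_lattice_cube: "finite {l :: int ^ 'n. \<forall>i. l $ i \<in> {-2..2}}"
proof (rule finite_imageD)
  show "finite (vec_nth ` {l :: int ^ 'n. \<forall>i. l $ i \<in> {-2..2}})"
    by (rule finite_subset[OF _ finite_PiE[of UNIV "\<lambda>_. {-2..2}"]]) (auto simp: PiE_def)
  show "inj_on vec_nth {l :: int ^ 'n. \<forall>i. l $ i \<in> {-2..2}}"
    by (auto simp: inj_on_def vec_eq_iff)
qed

context
  fixes \<eta> :: "real ^ 'n \<Rightarrow> real"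
  assumes \<eta>: "uniform_bump \<eta>"
begin

lemma eta_nonneg: "0 \<le> \<eta> \<xi>" and eta_le_1: "\<eta> \<xi> \<le> 1"
  and eta_eq_1: "infnorm \<xi> \<le> 1/2 \<Longrightarrow> \<eta> \<xi> = 1" and eta_eq_0: "3/4 \<le> infnorm \<xi> \<Longrightarrow> \<eta> \<xi> = 0"
  and smooth_eta: "smooth \<eta>"
  using \<eta> by (auto simp: uniform_bump_def)

lemma smooth_eta_complex: "smooth (\<lambda>\<xi>. complex_of_real (\<eta> (c *\<^sub>R \<xi> + z)))"
  by (rule smooth_bounded_linear_comp[OF bounded_linear_of_real smooth_affine_comp[OF smooth_eta]])

text \<open>The dilation by 2 is needed because \<open>\<eta>\<close> is 1 only up to
  \<open>infnorm\<close> equal to \<open>1/2\<close>. The radius comes from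
  \<open>norm x \<le> CARD('n) * infnorm x\<close>: beyond it, \<open>infnorm x\<close> is at least
  2.\<close>

lemma cutoff_eta: "cutoff (\<lambda>x. complex_of_real (\<eta> ((1/2) *\<^sub>R x))) (2 * real CARD('n))"
proof
  show "smooth (\<lambda>x. complex_of_real (\<eta> ((1/2) *\<^sub>R x)))" using smooth_eta_complex[of "1/2" 0] by simp
  fix x :: "real ^ 'n"
  show "complex_of_real (\<eta> ((1/2) *\<^sub>R x)) = 1" if "norm x \<le> 1"
  proof -
    have "infnorm ((1/2) *\<^sub>R x) \<le> norm ((1/2) *\<^sub>R x)" by (rule infnorm_le_norm)
    then show ?thesis using that by (simp add: eta_eq_1)
  qed
  show "complex_of_real (\<eta> ((1/2) *\<^sub>R x)) = 0" if "2 * real CARD('n) \<le> norm x"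
  proof -
    have "2 * real CARD('n) \<le> real CARD('n) * infnorm x" using norm_le_card_infnorm[of x] that by linarith
    then have "2 \<le> infnorm x" by (simp add: mult.commute)
    then have "3/4 \<le> infnorm ((1/2) *\<^sub>R x)" by (simp add: infnorm_mul)
    then show ?thesis by (simp add: eta_eq_0)
  qed
qed (auto simp: eta_nonneg eta_le_1)

text \<open>The denominator is invariant under lattice translations. So all symbols are translates
  of one, and their kernels differ from a single one by factors of modulus 1.\<close>

lemma uniform_symbol_shift: "uniform_symbol \<eta> k \<xi> = uniform_symbol \<eta> 0 (\<xi> - lattice_point k)"
proof -
  have "bij_betw (\<lambda>l. k + l) UNIV (UNIV :: (int ^ 'n) set)"
    by (rule bij_betw_byWitness[of _ "\<lambda>l. l - k"]) auto
  from infsum_reindex_bij_betw[OF this, of "\<lambda>l. \<eta> (\<xi> - lattice_point l)"]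
  have "(\<Sum>\<^sub>\<infinity>l. \<eta> (\<xi> - lattice_point l)) = (\<Sum>\<^sub>\<infinity>l. \<eta> (\<xi> - lattice_point k - lattice_point l))"
    by (simp add: lattice_point_add diff_diff_eq)
  then show ?thesis by (simp add: uniform_symbol_def)
qed

text \<open>On the support of \<open>\<eta>\<close> the infinite sum in the denominator is a finite sum.  The summand
  \<open>1 - \<eta> (\<xi> / 2)\<close> vanishes there and keeps the denominator away from zero everywhere.\<close>

lemma uniform_symbol_0:
  obtains d :: "real ^ 'n \<Rightarrow> complex" where "smooth d" "\<And>\<xi>. d \<xi> \<noteq> 0"
    "uniform_symbol \<eta> 0 = (\<lambda>\<xi>. of_real (\<eta> \<xi>) * inverse (d \<xi>))"
proof -
  \<comment> \<open>The cube serves two purposes: it contains every \<open>l\<close> for which the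
    bump at \<open>l\<close> meets the support of \<open>\<eta>\<close>, and it contains the
    rounding of each \<open>\<xi>\<close> with \<open>infnorm \<xi> \<le> 3/2\<close>, which
    supplies a summand equal to 1.\<close>
  define L where "L = {l :: int ^ 'n. \<forall>i. l $ i \<in> {-2..2}}"
  have L: "finite L" unfolding L_def by (rule finite_lattice_cube)
  define d where "d \<xi> = (\<Sum>l\<in>L. \<eta> (\<xi> - lattice_point l)) + (1 - \<eta> ((1/2) *\<^sub>R \<xi>))" for \<xi>
  have dpos: "1 \<le> d \<xi>" for \<xi>
  proof (cases "infnorm \<xi> \<le> 3/2")
    case True
    define l :: "int ^ 'n" where "l = (\<chi> i. round (\<xi> $ i))"
    have "l \<in> L"
    proof -
      have "round (\<xi> $ i) \<in> {-2..2}" for i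
      proof -
        have "\<bar>\<xi> $ i\<bar> \<le> 3/2" using component_le_infnorm_cart[of \<xi> i] True by linarith
        moreover have "\<bar>of_int (round (\<xi> $ i)) - \<xi> $ i\<bar> \<le> 1/2" by (rule of_int_round_abs_le)
        ultimately have "\<bar>real_of_int (round (\<xi> $ i))\<bar> \<le> 2" by linarith
        then show ?thesis by (simp add: abs_le_iff)
      qed
      then show ?thesis by (simp add: L_def l_def)
    qed
    have "infnorm (\<xi> - lattice_point l) \<le> 1/2"
    proof (rule infnorm_cart_le)
      show "\<bar>(\<xi> - lattice_point l) $ i\<bar> \<le> 1/2" for i
        using of_int_round_abs_le[of "\<xi> $ i"] by (simp add: lattice_point_def l_def abs_minus_commute)
    qed
    then have "1 \<le> (\<Sum>l\<in>L. \<eta> (\<xi> - lattice_point l))"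
      using member_le_sum[OF \<open>l \<in> L\<close>, of "\<lambda>l. \<eta> (\<xi> - lattice_point l)"] L eta_nonneg by (simp add: eta_eq_1)
    then show ?thesis unfolding d_def using eta_le_1[of "(1/2) *\<^sub>R \<xi>"] by linarith
  next
    case False
    then have "3/4 \<le> infnorm ((1/2) *\<^sub>R \<xi>)" by (simp add: infnorm_mul)
    then have "\<eta> ((1/2) *\<^sub>R \<xi>) = 0" by (rule eta_eq_0)
    moreover have "0 \<le> (\<Sum>l\<in>L. \<eta> (\<xi> - lattice_point l))" by (intro sum_nonneg eta_nonneg)
    ultimately show ?thesis by (simp add: d_def)
  qed
  show ?thesis
  proof (rule that[of "\<lambda>\<xi>. complex_of_real (d \<xi>)"])
    have "smooth (\<lambda>\<xi>. (\<Sum>l\<in>L. complex_of_real (\<eta> (1 *\<^sub>R \<xi> + (- lattice_point l)))) + (1 - complex_of_real (\<eta> ((1/2) *\<^sub>R \<xi> + 0))))"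
      by (intro smooth_add smooth_sum smooth_diff smooth_const smooth_eta_complex)
    then show "smooth (\<lambda>\<xi>. complex_of_real (d \<xi>))" by (simp add: d_def)
    show "complex_of_real (d \<xi>) \<noteq> 0" for \<xi> using dpos[of \<xi>] by (simp only: of_real_eq_0_iff)
    show "uniform_symbol \<eta> 0 = (\<lambda>\<xi>. complex_of_real (\<eta> \<xi>) * inverse (complex_of_real (d \<xi>)))"
    proof
      fix \<xi>
      show "uniform_symbol \<eta> 0 \<xi> = complex_of_real (\<eta> \<xi>) * inverse (complex_of_real (d \<xi>))"
      proof (cases "3/4 \<le> infnorm \<xi>")
        case True
        then show ?thesis by (simp add: uniform_symbol_def eta_eq_0)
      next
        case False
        have out: "\<eta> (\<xi> - lattice_point l) = 0" if "l \<notin> L" for l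
        proof (rule eta_eq_0, rule ccontr)
          assume n: "\<not> 3/4 \<le> infnorm (\<xi> - lattice_point l)"
          have "l $ i \<in> {-2..2}" for i
          proof -
            have "\<bar>\<xi> $ i - of_int (l $ i)\<bar> < 3/4"
              using component_le_infnorm_cart[of "\<xi> - lattice_point l" i] n by (simp add: lattice_point_def)
            moreover have "\<bar>\<xi> $ i\<bar> < 3/4" using component_le_infnorm_cart[of \<xi> i] False by linarith
            ultimately have "\<bar>real_of_int (l $ i)\<bar> \<le> 2" by linarith
            then show ?thesis by (simp add: abs_le_iff)
          qed
          then show False using that by (simp add: L_def)
        qed
        have "(\<Sum>\<^sub>\<infinity>l. \<eta> (\<xi> - lattice_point l)) = (\<Sum>\<^sub>\<infinity>l\<in>L. \<eta> (\<xi> - lattice_point l))"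
          by (rule infsum_cong_neutral) (use out in auto)
        also have "\<dots> = (\<Sum>l\<in>L. \<eta> (\<xi> - lattice_point l))" using L by (rule infsum_finite)
        finally have "(\<Sum>\<^sub>\<infinity>l. \<eta> (\<xi> - lattice_point l)) = (\<Sum>l\<in>L. \<eta> (\<xi> - lattice_point l))" .
        moreover have "\<eta> ((1/2) *\<^sub>R \<xi>) = 1" using False by (intro eta_eq_1) (simp add: infnorm_mul)
        ultimately have "(\<Sum>\<^sub>\<infinity>l. \<eta> (\<xi> - lattice_point l)) = d \<xi>"
          by (simp only: d_def diff_self add_0_right)
        then show ?thesis
          by (simp only: uniform_symbol_def lattice_point_0 diff_zero divide_inverse of_real_mult of_real_inverse)
      qed
    qed
  qed
qed

lemma uniform_symbol_0_test_function: "test_function UNIV (uniform_symbol \<eta> 0)"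
  and uniform_symbol_0_nonzero: "uniform_symbol \<eta> 0 0 \<noteq> 0"
proof -
  obtain d :: "real ^ 'n \<Rightarrow> complex" where d: "smooth d" "\<And>\<xi>. d \<xi> \<noteq> 0"
    "uniform_symbol \<eta> 0 = (\<lambda>\<xi>. of_real (\<eta> \<xi>) * inverse (d \<xi>))" by (rule uniform_symbol_0) blast
  show "uniform_symbol \<eta> 0 0 \<noteq> 0" unfolding d(3) using d(2) eta_eq_1[of 0] by (simp add: infnorm_0)
  show "test_function UNIV (uniform_symbol \<eta> 0)"
  proof (rule test_functionI[of _ "cball 0 (real CARD('n))"])
    show "smooth (uniform_symbol \<eta> 0)"
      unfolding d(3) using smooth_eta_complex[of 1 0] by (intro smooth_mult smooth_inverse d) simp
    show "uniform_symbol \<eta> 0 x = 0" if "x \<notin> cball 0 (real CARD('n))" for x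
    proof -
      have "1 \<le> infnorm x"
      proof (rule ccontr)
        assume "\<not> 1 \<le> infnorm x"
        then have "real CARD('n) * infnorm x < real CARD('n) * 1" by (intro mult_strict_left_mono) auto
        moreover have "real CARD('n) < norm x" using that by simp
        ultimately show False using norm_le_card_infnorm[of x] by linarith
      qed
      then have "3/4 \<le> infnorm x" by simp
      then show ?thesis by (simp add: uniform_symbol_def eta_eq_0)
    qed
  qed auto
qed

text \<open>The sum is compared with an integral over the disjoint unit cubes \<open>Q k\<close>: a
  point \<open>y\<close> of \<open>Q k\<close> has \<open>k\<close> as its vector of integer parts,
  and there \<open>1 + norm y\<close> is at most \<open>2 * (1 + n)\<close> times the bracket of
  \<open>k\<close>, which explains the constant \<open>c\<close>.\<close>

lemma lattice_weight_summable:
  "(\<integral>\<^sup>+k. ennreal (sqrt (1 + (norm (lattice_point k :: real ^ 'n))\<^sup>2) powr - real (CARD('n) + 1)) \<partial>count_space UNIV) < \<infinity>"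
proof -
  define n where "n = CARD('n)"
  define Q where "Q k = box (lattice_point k) (lattice_point k + (1::real^'n))" for k
  define c where "c = ((2 * (1 + real n)) ^ (n + 1))"
  have c0: "0 \<le> c" by (simp add: c_def)
  have em: "emeasure lebesgue (Q k) = 1" for k
  proof -
    have "emeasure lborel (Q k) = (\<Prod>b\<in>Basis. ((lattice_point k + 1) - lattice_point k) \<bullet> b)"
      unfolding Q_def by (rule emeasure_lborel_box) (auto simp: inner_add_left Basis_vec_def inner_axis)
    also have "(\<Prod>b\<in>Basis. ((lattice_point k + 1) - lattice_point k) \<bullet> b) = 1"
      by (rule prod.neutral) (auto simp: Basis_vec_def inner_axis)
    finally have "emeasure lborel (Q k) = 1" by simp
    moreover have "Q k \<in> sets lborel" by (simp add: Q_def)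
    ultimately show ?thesis by simp
  qed
  have inQ: "k $ i = \<lfloor>y $ i\<rfloor>" if "y \<in> Q k" for y k i
    using that unfolding Q_def mem_box_cart lattice_point_def
    by (auto intro!: floor_unique[symmetric] simp: less_imp_le dest: spec[of _ i])
  have le: "ennreal (sqrt (1 + (norm (lattice_point k :: real ^ 'n))\<^sup>2) powr - real (n + 1)) \<le> ennreal c * ennreal (1 / (1 + norm y) ^ (n + 1))"
    if y: "y \<in> Q k" for y k
  proof -
    define t where "t = norm (lattice_point k :: real ^ 'n)"
    have t: "0 \<le> t" by (simp add: t_def)
    have "norm (y - lattice_point k) \<le> (\<Sum>i\<in>UNIV. \<bar>(y - lattice_point k) $ i\<bar>)" by (rule norm_le_l1_cart)
    also have "\<dots> \<le> (\<Sum>i\<in>(UNIV::'n set). 1)"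
    proof (rule sum_mono)
      fix i
      show "\<bar>(y - lattice_point k) $ i\<bar> \<le> 1"
        using y unfolding Q_def mem_box_cart by (auto simp: abs_le_iff dest: spec[of _ i])
    qed
    also have "\<dots> = real n" by (simp add: n_def)
    finally have "norm y \<le> t + real n" using norm_triangle_ineq2[of y "lattice_point k"] by (simp add: t_def)
    moreover have "1 + t \<le> 2 * sqrt (1 + t\<^sup>2)"
    proof -
      have "1 \<le> sqrt (1 + t\<^sup>2)" "t \<le> sqrt (1 + t\<^sup>2)" by (auto intro: real_le_rsqrt)
      then show ?thesis by linarith
    qed
    ultimately have "1 + norm y \<le> (1 + real n) * (2 * sqrt (1 + t\<^sup>2))"
    proof -
      assume a: "norm y \<le> t + real n" "1 + t \<le> 2 * sqrt (1 + t\<^sup>2)"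
      have "0 \<le> t * real n" using t by simp
      then have "1 + norm y \<le> (1 + real n) * (1 + t)" using a(1) by (simp add: algebra_simps)
      also have "\<dots> \<le> (1 + real n) * (2 * sqrt (1 + t\<^sup>2))" using a by (intro mult_left_mono) auto
      finally show ?thesis .
    qed
    then have "(1 + norm y) ^ (n + 1) \<le> ((1 + real n) * (2 * sqrt (1 + t\<^sup>2))) ^ (n + 1)" by (intro power_mono) auto
    also have "\<dots> = c * sqrt (1 + t\<^sup>2) ^ (n + 1)" unfolding c_def power_mult_distrib[symmetric] by (simp only: mult_ac)
    finally have le: "(1 + norm y) ^ (n + 1) \<le> c * sqrt (1 + t\<^sup>2) ^ (n + 1)" .
    have p1: "0 < (1 + norm y) ^ (n + 1)" by (intro zero_less_power) (simp add: add_pos_nonneg)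
    have s0: "0 < sqrt (1 + t\<^sup>2)" by (simp add: add_pos_nonneg)
    have p2: "0 < sqrt (1 + t\<^sup>2) ^ (n + 1)" by (intro zero_less_power s0)
    have "sqrt (1 + t\<^sup>2) powr - real (n + 1) = 1 / sqrt (1 + t\<^sup>2) ^ (n + 1)"
      using s0 by (simp only: powr_minus powr_realpow inverse_eq_divide)
    also have "\<dots> \<le> c / (1 + norm y) ^ (n + 1)"
      using le p1 p2 by (simp only: divide_le_eq pos_divide_le_eq pos_le_divide_eq frac_le_eq) (simp add: field_simps)
    finally show ?thesis using c0 p1 unfolding t_def by (simp add: ennreal_mult[symmetric] ennreal_leI)
  qed
  have Qm: "Q k \<in> sets lebesgue" for k by (simp add: Q_def)
  define w where "w y = ennreal c * ennreal (1 / (1 + norm (y::real^'n)) ^ (n + 1))" for y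
  have wm: "w \<in> borel_measurable lebesgue"
  proof -
    have one: "1 + norm x \<noteq> 0" for x :: "real ^ 'n" using norm_ge_zero[of x] by linarith
    have "(\<lambda>y::real^'n. 1 / (1 + norm y) ^ (n + 1)) \<in> borel_measurable lebesgue"
      using one by (intro continuous_borel_measurable_lebesgue continuous_intros) auto
    then show ?thesis unfolding w_def[abs_def] by measurable
  qed
  have "ennreal (sqrt (1 + (norm (lattice_point k :: real ^ 'n))\<^sup>2) powr - real (n + 1)) \<le> (\<integral>\<^sup>+y. w y * indicator (Q k) y \<partial>lebesgue)" for k
  proof -
    let ?u = "ennreal (sqrt (1 + (norm (lattice_point k :: real ^ 'n))\<^sup>2) powr - real (n + 1))"
    have "?u = (\<integral>\<^sup>+y. ?u * indicator (Q k) y \<partial>lebesgue)"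
      using em[of k] by (simp add: nn_integral_cmult_indicator Qm)
    also have "\<dots> \<le> (\<integral>\<^sup>+y. w y * indicator (Q k) y \<partial>lebesgue)"
      by (intro nn_integral_mono) (use le in \<open>auto simp: w_def indicator_def\<close>)
    finally show ?thesis .
  qed
  then have "(\<integral>\<^sup>+k. ennreal (sqrt (1 + (norm (lattice_point k :: real ^ 'n))\<^sup>2) powr - real (n + 1)) \<partial>count_space UNIV)
     \<le> (\<integral>\<^sup>+k. (\<integral>\<^sup>+y. w y * indicator (Q k) y \<partial>lebesgue) \<partial>count_space UNIV)"
    by (intro nn_integral_mono)
  also have "\<dots> = (\<integral>\<^sup>+y. (\<integral>\<^sup>+k. w y * indicator (Q k) y \<partial>count_space UNIV) \<partial>lebesgue)"
    by (rule nn_integral_count_space_nn_integral[symmetric])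
       (auto intro!: borel_measurable_times_ennreal wm borel_measurable_indicator Qm)
  also have "\<dots> \<le> (\<integral>\<^sup>+y. w y \<partial>lebesgue)"
  proof (rule nn_integral_mono)
    fix y :: "real ^ 'n"
    define k0 :: "int ^ 'n" where "k0 = (\<chi> i. \<lfloor>y $ i\<rfloor>)"
    have "indicator (Q k) y \<le> (indicator {k0} k :: ennreal)" for k
      using inQ[of y k] by (auto simp: indicator_def k0_def vec_eq_iff)
    then have "(\<integral>\<^sup>+k. w y * indicator (Q k) y \<partial>count_space UNIV) \<le> (\<integral>\<^sup>+k. w y * indicator {k0} k \<partial>count_space UNIV)"
      by (intro nn_integral_mono mult_left_mono) auto
    also have "\<dots> = w y" by (simp add: nn_integral_cmult_indicator)
    finally show "(\<integral>\<^sup>+k. w y * indicator (Q k) y \<partial>count_space UNIV) \<le> w y" .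
  qed
  also have "\<dots> = ennreal c * (\<integral>\<^sup>+y. ennreal (1 / (1 + norm (y::real^'n)) ^ (n + 1)) \<partial>lebesgue)"
  proof -
    have one: "1 + norm x \<noteq> 0" for x :: "real ^ 'n" using norm_ge_zero[of x] by linarith
    have "(\<lambda>y::real^'n. ennreal (1 / (1 + norm y) ^ (n + 1))) \<in> borel_measurable lebesgue"
      using one by (intro measurable_compose[OF _ measurable_ennreal] continuous_borel_measurable_lebesgue continuous_intros) auto
    then show ?thesis unfolding w_def by (rule nn_integral_cmult)
  qed
  also have "\<dots> < \<infinity>"
    using nn_integral_decay_finite[where 'a = "real ^ 'n"] by (simp add: n_def ennreal_mult_less_top)
  finally show ?thesis unfolding n_def .
qed

lemma uniform_symbol_family:
  assumes \<rho>: "cutoff \<rho> R"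
  obtains B D where "symbol_family \<rho> R (uniform_symbol \<eta>) (\<lambda>k. sqrt (1 + (norm (lattice_point k))\<^sup>2)) B D"
proof -
  let ?\<sigma> = "uniform_symbol \<eta> 0"
  have t: "test_function UNIV ?\<sigma>" by (rule uniform_symbol_0_test_function)
  have sh: "uniform_symbol \<eta> k = (\<lambda>\<xi>. ?\<sigma> (- lattice_point k + 1 *\<^sub>R \<xi>))" for k
    by (rule ext) (simp add: uniform_symbol_shift[of k])
  obtain B where B: "\<And>\<xi>. norm (?\<sigma> \<xi>) \<le> B" using test_function_bounded[OF t] by metis
  \<comment> \<open>On the support of the symbol, \<open>\<xi>\<close> is within
    \<open>infnorm\<close> distance 1 of the lattice point, hence within norm distance
    \<open>CARD('n)\<close>; this yields the constant \<open>1 + CARD('n)\<close>.\<close>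
  have "symbol_family \<rho> R (uniform_symbol \<eta>) (\<lambda>k. sqrt (1 + (norm (lattice_point k))\<^sup>2)) B (1 + real CARD('n))"
  proof (rule symbol_family.intro[OF \<rho> symbol_family_axioms.intro])
    show "test_function UNIV (uniform_symbol \<eta> k)" for k
      unfolding sh[of k] using test_function_affine[OF t, of 1 "- lattice_point k"] by (simp add: add.commute)
    show "\<exists>C. \<forall>k. (LINT u|lebesgue. (1 + norm u) ^ N * norm (inv_fourier (uniform_symbol \<eta> k) u)) \<le> C" for N
    proof (intro exI allI)
      fix k
      have "norm (inv_fourier (uniform_symbol \<eta> k) u) = norm (inv_fourier ?\<sigma> u)" for u
        unfolding sh[of k] inv_fourier_affine[OF one_neq_zero] by (simp add: norm_mult)
      then show "(LINT u|lebesgue. (1 + norm u) ^ N * norm (inv_fourier (uniform_symbol \<eta> k) u)) \<le> (LINT u|lebesgue. (1 + norm u) ^ N * norm (inv_fourier ?\<sigma> u))"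
        by simp
    qed
    show "norm (uniform_symbol \<eta> k \<xi>) \<le> B" for k \<xi> unfolding uniform_symbol_shift[of k] by (rule B)
    show "1 \<le> sqrt (1 + (norm (lattice_point k))\<^sup>2)" for k :: "int ^ 'n" by simp
    show "sqrt (1 + (norm (lattice_point k))\<^sup>2) \<le> (1 + real CARD('n)) * (1 + norm \<xi>)"
      if nz: "uniform_symbol \<eta> k \<xi> \<noteq> 0" for k \<xi>
    proof -
      have "\<eta> (\<xi> - lattice_point k) \<noteq> 0" using nz by (auto simp: uniform_symbol_def)
      then have inf1: "infnorm (\<xi> - lattice_point k) \<le> 1" using eta_eq_0[of "\<xi> - lattice_point k"] by force
      have "norm (\<xi> - lattice_point k) \<le> real CARD('n) * infnorm (\<xi> - lattice_point k)" by (rule norm_le_card_infnorm)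
      also have "\<dots> \<le> real CARD('n) * 1" using inf1 by (intro mult_left_mono) auto
      finally have "norm (lattice_point k) \<le> norm \<xi> + real CARD('n)"
        using norm_triangle_ineq2[of "lattice_point k" \<xi>] by (simp add: norm_minus_commute)
      moreover have "sqrt (1 + (norm (lattice_point k))\<^sup>2) \<le> 1 + norm (lattice_point k :: real ^ 'n)"
        by (rule real_le_lsqrt) (auto simp: power2_eq_square algebra_simps)
      moreover have "0 \<le> real CARD('n) * norm \<xi>" by simp
      ultimately show ?thesis by (simp only: distrib_left distrib_right mult_1 mult_1_right)
    qed
    show "\<exists>L. (\<integral>\<^sup>+k. ennreal (sqrt (1 + (norm (lattice_point k :: real ^ 'n))\<^sup>2) powr - L) \<partial>count_space UNIV) < \<infinity>"
      using lattice_weight_summable by blast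
  qed simp
  then show ?thesis using that by blast
qed

end

theorem corollary3p4:
  fixes \<Phi> :: "real ^ 'n \<Rightarrow> complex"
    and \<phi> :: "real ^ 'n \<Rightarrow> complex"
    and \<eta> :: "real ^ 'n \<Rightarrow> real"
    and p s :: real
    and q :: ennreal
  assumes "locally_integrable (- {0}) \<Phi>"
    and "0 < q"
    and "0 < p" and "p < 1"
    and "dyadic_bump \<phi>"
    and "uniform_bump \<eta>"
  shows "(hausdorff_bounded \<Phi> (triebel_lizorkin_norm \<phi> p q s) \<longleftrightarrow> hausdorff_zero \<Phi>) \<and>
         (hausdorff_bounded \<Phi> (besov_norm \<phi> p q s) \<longleftrightarrow> hausdorff_zero \<Phi>) \<and>
         (hausdorff_bounded \<Phi> (modulation_norm \<eta> p q s) \<longleftrightarrow> hausdorff_zero \<Phi>)"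
proof -
  note \<Phi> = assms(1) and q = assms(2) and p = assms(3,4) and \<phi> = assms(5) and \<eta> = assms(6)
  \<comment> \<open>One function plays two parts: it is the auxiliary cut-off of the general lemmas
    and the profile of the concentrating bumps, for all three spaces alike.\<close>
  let ?\<rho> = "\<lambda>x. complex_of_real (\<eta> ((1/2) *\<^sub>R x))" and ?R = "2 * real CARD('n)"
  interpret cutoff ?\<rho> ?R by (rule cutoff_eta[OF \<eta>])
  obtain B D where "symbol_family ?\<rho> ?R (dyadic_symbol \<phi>) (\<lambda>j. 2 powr real j) B D"
    by (rule dyadic_symbol_family[OF \<phi> cutoff_axioms])
  then interpret dyadic: symbol_family ?\<rho> ?R "dyadic_symbol \<phi>" "\<lambda>j. 2 powr real j" B D .
  obtain B' D' where "symbol_family ?\<rho> ?R (uniform_symbol \<eta>) (\<lambda>k. sqrt (1 + (norm (lattice_point k))\<^sup>2)) B' D'"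
    by (rule uniform_symbol_family[OF \<eta> cutoff_axioms])
  then interpret uniform: symbol_family ?\<rho> ?R "uniform_symbol \<eta>" "\<lambda>k. sqrt (1 + (norm (lattice_point k))\<^sup>2)" B' D' .
  have t\<phi>: "test_function UNIV \<phi>" "\<phi> 0 \<noteq> 0"
    using dyadic_bump_test_function[OF \<phi>] \<phi> by (auto simp: dyadic_bump_def)
  note t\<sigma> = uniform_symbol_0_test_function[OF \<eta>] uniform_symbol_0_nonzero[OF \<eta>]
  \<comment> \<open>The locale weights are raised to the power \<open>s\<close>; for
    \<open>\<omega> j = 2 powr j\<close> this identity matches them with the weights in the
    definitions of the norms.\<close>
  have weight: "(2 powr real j) powr s = 2 powr (real j * s)" for j by (simp add: powr_powr)
  obtain A where A: "0 \<le> A"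
    "\<And>\<mu> z. 1 \<le> \<mu> \<Longrightarrow> besov_norm \<phi> p q s (distribution_of (\<lambda>x. ?\<rho> ((1 / \<mu>) *\<^sub>R x + z))) \<le> ennreal (A * \<mu> powr (real DIM(real ^ 'n) / p))"
    "\<And>\<mu> z. 1 \<le> \<mu> \<Longrightarrow> triebel_lizorkin_norm \<phi> p q s (distribution_of (\<lambda>x. ?\<rho> ((1 / \<mu>) *\<^sub>R x + z))) \<le> ennreal (A * \<mu> powr (real DIM(real ^ 'n) / p))"
    unfolding besov_norm_def triebel_lizorkin_norm_def dyadic_block_def weight[symmetric]
    by (rule dyadic.family_norm_bound[OF q p(1) test_function, of s]) blast
  obtain A' where A': "0 \<le> A'"
    "\<And>\<mu> z. 1 \<le> \<mu> \<Longrightarrow> modulation_norm \<eta> p q s (distribution_of (\<lambda>x. ?\<rho> ((1 / \<mu>) *\<^sub>R x + z))) \<le> ennreal (A' * \<mu> powr (real DIM(real ^ 'n) / p))"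
    unfolding modulation_norm_def uniform_block_def
    by (rule uniform.family_norm_bound[OF q p(1) test_function, of s]) blast
  have zero: "besov_norm \<phi> p q s (\<lambda>_. 0) = 0" "modulation_norm \<eta> p q s (\<lambda>_. 0) = 0"
    using distribution_modulus_zero
    by (simp_all add: besov_norm_def modulation_norm_def dyadic_block_def uniform_block_def
        fourier_multiplier_zero Lp_norm_zero lq_norm_zero)
  have zero_F: "triebel_lizorkin_norm \<phi> p q s (\<lambda>_. 0) = 0"
    unfolding triebel_lizorkin_norm_def dyadic_block_def fourier_multiplier_zero
  proof (rule Lp_norm_zero)
    show "AE x in lebesgue. lq_norm q (\<lambda>j. ennreal (2 powr (real j * s)) * distribution_modulus (\<lambda>_. 0) (x :: real ^ 'n)) = 0"
      using distribution_modulus_zero by eventually_elim (simp add: lq_norm_zero)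
  qed
  show ?thesis
    using hausdorff_bounded_imp_zero[OF \<Phi> p t\<phi> triebel_lizorkin_norm_ge[OF q p(1)] A(1) A(3)]
      hausdorff_bounded_imp_zero[OF \<Phi> p t\<phi> besov_norm_ge[OF q] A(1) A(2)]
      hausdorff_bounded_imp_zero[OF \<Phi> p t\<sigma> modulation_norm_ge[OF q] A']
      hausdorff_zero_imp_bounded[where N = "triebel_lizorkin_norm \<phi> p q s", OF _ zero_F] hausdorff_zero_imp_bounded[where N = "besov_norm \<phi> p q s", OF _ zero(1)]
      hausdorff_zero_imp_bounded[where N = "modulation_norm \<eta> p q s", OF _ zero(2)] by blast
qed

end
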